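(* Let $m\ge 2$ and let $n<2m$. Let $\{V_j:1\le j\le n\}$ be a family of one-dimensional linear subspaces of $\mathbb R^m$ lying in general position. Then $\{V_j\}$ has the uniform power decay property. Moreover, for every $d\in\mathbb N$, every $c>0$ and every compactly supported $\eta\in C^1(\mathbb R^m)$ there exist $C<\infty$ and $\varepsilon>0$ such that $$|\Lambda_\lambda(f_1,\dots,f_n)|\le C(1+|\lambda|)^{-\varepsilon}\prod_{j=1}^n\|f_j\|_{L^2}$$ for all $\lambda\in\mathbb R$, all $f_j\in L^2(V_j)$ (where $V_j\cong\mathbb R^1$), and all real-valued polynomials $P$ on $\mathbb R^m$ of degree $\le d$ whose norm relative to $\{V_j\}$ is $\ge c$.
   Context: $\pi_j$ denotes the orthogonal projection of $\mathbb R^m$ onto $V_j$. For $\lambda\in\mathbb R$, a real-valued polynomial $P$ on $\mathbb R^m$, a compactly supported $\eta\in C^1(\mathbb R^m)$ and functions $f_j:V_j\to\mathbb C$, define $$\Lambda_\lambda(f_1,\dots,f_n)=\int_{\mathbb R^m}e^{i\lambda P(x)}\prod_{j=1}^n f_j(\pi_j(x))\,\eta(x)\,dx .$$ General position: a collection of $\kappa$-dimensional subspaces of $\mathbb R^m$ is in general position if any subcollection of cardinality $k\ge1$ spans a subspace of dimension $\min(k\kappa,m)$ (here $\kappa=1$). Relative norm: for each $d$ fix a norm $\|\cdot\|_{\mathcal P_d}$ on the finite-dimensional space $\mathcal P_d$ of polynomials on $\mathbb R^m$ of degree $\le d$. The norm of $P\in\mathcal P_d$ relative to $\{V_j\}$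 is $\inf\|P-\sum_j p_j\circ\pi_j\|_{\mathcal P_d}$, the infimum over all real-valued polynomials $p_j:V_j\to\mathbb R$ of degree $\le d$. If $n=0$ (empty collection) the infimum is instead over $\|P-a\|_{\mathcal P_d}$ with $a\in\mathbb R$ constant. Uniform power decay property of $\{V_j\}$: for every $d\in\mathbb N$, $c>0$ and compact $K\subset\mathbb R^m$ there exist $\varepsilon>0$ and $C<\infty$ such that $|\Lambda_\lambda(f_1,\dots,f_n)|\le C\|\eta\|_{C^1}(1+|\lambda|)^{-\varepsilon}\prod_j\|f_j\|_{L^\infty}$ for all $\lambda\in\mathbb R$, all $f_j\in L^\infty(V_j)$, all $\eta\in C^1(\mathbb R^m)$ supported in $K$, and all real-valued polynomials $P$ of degree $\le d$ whose norm relative to $\{V_j\}$ is $\ge c$. *)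

theory Defs
  imports "HOL-Analysis.Analysis" "HOL-Probability.Essential_Supremum"
begin

section \<open>Polynomials and the relative norm\<close>

definition polys_le :: "nat \<Rightarrow> (real ^ 'm \<Rightarrow> real) set" where
  "polys_le d = {P. \<exists>a :: ('m \<Rightarrow> nat) \<Rightarrow> real.
     P = (\<lambda>x. \<Sum>\<alpha> | (\<Sum>i\<in>UNIV. \<alpha> i) \<le> d. a \<alpha> * (\<Prod>i\<in>UNIV. (x $ i) ^ \<alpha> i))}"

lemma finite_multi_indices: "finite {\<alpha> :: 'm::finite \<Rightarrow> nat. (\<Sum>i\<in>UNIV. \<alpha> i) \<le> d}"
proof (rule finite_subset)
  show "{\<alpha> :: 'm \<Rightarrow> nat. (\<Sum>i\<in>UNIV. \<alpha> i) \<le> d} \<subseteq> (\<Pi>\<^sub>E i\<in>UNIV. {..d})"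
  proof
    fix \<alpha> :: "'m \<Rightarrow> nat" assume "\<alpha> \<in> {\<alpha>. (\<Sum>i\<in>UNIV. \<alpha> i) \<le> d}"
    then have "\<alpha> i \<le> d" for i
      using member_le_sum[of i UNIV \<alpha>] by force
    then show "\<alpha> \<in> (\<Pi>\<^sub>E i\<in>UNIV. {..d})" by auto
  qed
  show "finite (\<Pi>\<^sub>E i\<in>(UNIV :: 'm set). {..d})" by (intro finite_PiE) auto
qed

definition norm_on :: "('a \<Rightarrow> real) set \<Rightarrow> (('a \<Rightarrow> real) \<Rightarrow> real) \<Rightarrow> bool" where
  "norm_on S N \<longleftrightarrow>
     (\<forall>p\<in>S. 0 \<le> N p) \<and>
     (\<forall>p\<in>S. N p = 0 \<longleftrightarrow> p = (\<lambda>_. 0)) \<and>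
     (\<forall>p\<in>S. \<forall>a. N (\<lambda>x. a * p x) = \<bar>a\<bar> * N p) \<and>
     (\<forall>p\<in>S. \<forall>q\<in>S. N (\<lambda>x. p x + q x) \<le> N p + N q)"

definition orth_proj :: "'a::euclidean_space set \<Rightarrow> 'a \<Rightarrow> 'a" where
  "orth_proj V x = (THE y. y \<in> V \<and> (\<forall>v\<in>V. orthogonal (x - y) v))"

text \<open>A collection \<open>V\<^sub>1, \<dots>, V\<^sub>n\<close> is a function \<open>V\<close> on \<open>{1..n}\<close>. A polynomial on \<open>V\<^sub>j\<close> is
  the restriction to \<open>V\<^sub>j\<close> of a polynomial on the ambient space of the same degree bound; only
  these restrictions enter below, as \<open>p j\<close> is composed with the projection onto \<open>V j\<close>.
  The function \<open>nrm d\<close> is the norm fixed on the polynomials of degree at most \<open>d\<close>.\<close>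

definition relative_norm ::
  "(nat \<Rightarrow> (real ^ 'm \<Rightarrow> real) \<Rightarrow> real) \<Rightarrow> nat \<Rightarrow> nat \<Rightarrow> (nat \<Rightarrow> (real ^ 'm) set)
     \<Rightarrow> (real ^ 'm \<Rightarrow> real) \<Rightarrow> real" where
  "relative_norm nrm d n V P =
     (if n = 0 then INF a. nrm d (\<lambda>x. P x - a)
      else INF p \<in> {p. \<forall>j\<in>{1..n}. p j \<in> polys_le d}.
             nrm d (\<lambda>x. P x - (\<Sum>j=1..n. p j (orth_proj (V j) x))))"

definition general_position :: "nat \<Rightarrow> nat \<Rightarrow> (nat \<Rightarrow> 'a::euclidean_space set) \<Rightarrow> bool" where
  "general_position k n V \<longleftrightarrow>
     (\<forall>j\<in>{1..n}. subspace (V j) \<and> dim (V j) = k) \<and>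
     (\<forall>J. J \<subseteq> {1..n} \<and> J \<noteq> {} \<longrightarrow>
        dim (span (\<Union>j\<in>J. V j)) = min (card J * k) DIM('a))"

section \<open>Function spaces\<close>

text \<open>Lebesgue measure on a linear subspace \<open>V\<close>, transported from the coordinates of an
  orthonormal basis of \<open>V\<close> (compare the definition of \<open>lborel\<close>). It is realised as a complete measure on the
  ambient space carried by \<open>V\<close>: the complement of \<open>V\<close> is a null set, so measurability, integrals
  and essential suprema of functions on the ambient space only depend on their restriction
  to \<open>V\<close>. The measure does not depend on the basis chosen.\<close>

definition orthonormal_basis :: "'a::euclidean_space set \<Rightarrow> 'a set \<Rightarrow> bool" where
  "orthonormal_basis V B \<longleftrightarrow>
     B \<subseteq> V \<and> pairwise orthogonal B \<and> (\<forall>b\<in>B. norm b = 1) \<and> span B = V"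

definition subspace_lebesgue :: "'a::euclidean_space set \<Rightarrow> 'a measure" where
  "subspace_lebesgue V =
     (let B = (SOME B. orthonormal_basis V B)
      in completion (distr (\<Pi>\<^sub>M b\<in>B. lborel) borel (\<lambda>c. \<Sum>b\<in>B. c b *\<^sub>R b)))"

definition Linf_norm :: "'a::euclidean_space set \<Rightarrow> ('a \<Rightarrow> complex) \<Rightarrow> real" where
  "Linf_norm V f = real_of_ereal (esssup (subspace_lebesgue V) (\<lambda>x. ereal (norm (f x))))"

definition Linf_on :: "'a::euclidean_space set \<Rightarrow> ('a \<Rightarrow> complex) set" where
  "Linf_on V = {f \<in> borel_measurable (subspace_lebesgue V).
     esssup (subspace_lebesgue V) (\<lambda>x. ereal (norm (f x))) < \<infinity>}"

definition L2_norm_on :: "'a::euclidean_space set \<Rightarrow> ('a \<Rightarrow> complex) \<Rightarrow> real" where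
  "L2_norm_on V f = sqrt (LINT x|subspace_lebesgue V. (norm (f x))\<^sup>2)"

definition L2_on :: "'a::euclidean_space set \<Rightarrow> ('a \<Rightarrow> complex) set" where
  "L2_on V = {f \<in> borel_measurable (subspace_lebesgue V).
     integrable (subspace_lebesgue V) (\<lambda>x. (norm (f x))\<^sup>2)}"

definition supp :: "('a::topological_space \<Rightarrow> complex) \<Rightarrow> 'a set" where
  "supp \<eta> = closure {x. \<eta> x \<noteq> 0}"

definition is_C1 :: "('a::euclidean_space \<Rightarrow> complex) \<Rightarrow> bool" where
  "is_C1 \<eta> \<longleftrightarrow> (\<exists>D :: 'a \<Rightarrow> 'a \<Rightarrow>\<^sub>L complex.
     (\<forall>x. (\<eta> has_derivative blinfun_apply (D x)) (at x)) \<and> continuous_on UNIV D)"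

definition C1_norm :: "('a::euclidean_space \<Rightarrow> complex) \<Rightarrow> real" where
  "C1_norm \<eta> = (SUP x. norm (\<eta> x)) + (SUP x. onorm (frechet_derivative \<eta> (at x)))"

section \<open>The oscillatory form and uniform power decay\<close>

definition Lambda_integrand ::
  "nat \<Rightarrow> (nat \<Rightarrow> 'a::euclidean_space set) \<Rightarrow> ('a \<Rightarrow> real) \<Rightarrow> ('a \<Rightarrow> complex)
     \<Rightarrow> real \<Rightarrow> (nat \<Rightarrow> 'a \<Rightarrow> complex) \<Rightarrow> 'a \<Rightarrow> complex" where
  "Lambda_integrand n V P \<eta> l f x =
     exp (\<i> * complex_of_real (l * P x)) * (\<Prod>j=1..n. f j (orth_proj (V j) x)) * \<eta> x"

definition Lambda ::
  "nat \<Rightarrow> (nat \<Rightarrow> 'a::euclidean_space set) \<Rightarrow> ('a \<Rightarrow> real) \<Rightarrow> ('a \<Rightarrow> complex)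
     \<Rightarrow> real \<Rightarrow> (nat \<Rightarrow> 'a \<Rightarrow> complex) \<Rightarrow> complex" where
  "Lambda n V P \<eta> l f = (LINT x|lebesgue. Lambda_integrand n V P \<eta> l f x)"

definition uniform_power_decay ::
  "(nat \<Rightarrow> (real ^ 'm \<Rightarrow> real) \<Rightarrow> real) \<Rightarrow> nat \<Rightarrow> (nat \<Rightarrow> (real ^ 'm) set) \<Rightarrow> bool" where
  "uniform_power_decay nrm n V \<longleftrightarrow>
     (\<forall>d c K. 0 < c \<and> compact K \<longrightarrow>
       (\<exists>\<epsilon>>0. \<exists>C. \<forall>l f \<eta> P.
          (\<forall>j\<in>{1..n}. f j \<in> Linf_on (V j)) \<and> is_C1 \<eta> \<and> supp \<eta> \<subseteq> K \<and>
          P \<in> polys_le d \<and> c \<le> relative_norm nrm d n V P \<longrightarrow>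
          norm (Lambda n V P \<eta> l f)
            \<le> C * C1_norm \<eta> * (1 + \<bar>l\<bar>) powr (- \<epsilon>) * (\<Prod>j=1..n. Linf_norm (V j) (f j))))"

end

theory Submission
  imports Defs "HOL-Computational_Algebra.Fundamental_Theorem_Algebra" "HOL-Probability.Characteristic_Functions"
begin

text \<open>Let \<open>u\<^sub>j\<close> be a unit vector spanning \<open>V\<^sub>j\<close>; the proof is by induction on the number of directions.
  For linearly independent directions, integration along a dual basis shows that the form decays in
  finitely many linear functionals of \<open>P\<close> whose common kernel consists of the degenerate polynomials
  \<open>\<Sum>\<^sub>j p\<^sub>j(u\<^sub>j \<bullet> x)\<close>.

  With more than \<open>m\<close> directions, single out one of them, \<open>u\<^sub>n\<close>, split the others into a set \<open>A\<close> of size \<open>m - 1\<close> and a rest \<open>B\<close>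
  for which \<open>B \<union> {n}\<close> is still independent (this is where fewer than \<open>2m\<close> directions are needed), and let \<open>v\<close> be
  orthogonal to all \<open>u\<^sub>j\<close> with \<open>j \<in> A\<close>. Van der Corput differencing along \<open>v\<close> removes the functions in \<open>A\<close> and gives decay in a quantity \<open>X\<close>
  measuring how far the derivative of \<open>P\<close> along \<open>v\<close> is from being degenerate for \<open>B \<union> {n}\<close>. If \<open>X\<close> is small,
  then \<open>P = E + h + \<Sum>\<^sub>j p\<^sub>j(u\<^sub>j \<bullet> x)\<close>, the sum being over \<open>B \<union> {n}\<close>, with \<open>h\<close> constant along \<open>v\<close> and \<open>E\<close> of Lipschitz constant \<open>O(X)\<close>.
  The \<open>n\<close>-th function may be replaced by the conjugate of the function that represents the form by duality.
  Its local Fourier coefficients, twisted by \<open>p\<^sub>n\<close>, are again forms whose \<open>n\<close>-th function is a polynomial phase, so they are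
  small by the induction hypothesis for \<open>A \<union> B\<close>; two differencing steps and Plancherel's inequality then bound the form.

  For square integrable functions one truncates at a small power of \<open>1 + \<bar>\<lambda>\<bar>\<close>. As there are fewer than \<open>2m\<close> functions, the discarded
  part is dominated by products of squares of at most \<open>m\<close> of them, which are integrable by independence.\<close>

text \<open>The obstacle is that an arbitrary bounded function of \<open>u n \<bullet> x\<close>
  need not have small Fourier coefficients, so differencing alone cannot defeat it. The form is
  linear in that function, hence an integral against a dual function that depends only on the other
  data. Cauchy-Schwarz bounds it by the form at the conjugate of this dual function, and there the
  Fourier coefficients are forms whose n-th function is explicit and can be moved into the phase.

  Since \<open>A\<close> has m - 1 elements, general position forces \<open>u j \<bullet> v\<close>
  to be nonzero for all other \<open>j\<close>; this permits integration along \<open>v\<close> of a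
  degenerate derivative.

  One bound decays in X. The other decays in the distance N from \<open>P\<close> to the degenerate
  polynomials but loses a factor 1 + X. Balancing the two costs only part of the exponent.

  Uniformity in \<open>P\<close> comes from linear algebra: if the vanishing of finitely many
  functionals forces a polynomial into a class, every polynomial splits into a member of the class
  and a combination of fixed polynomials with the functionals as coefficients. The factor \<lambda>
  is kept inside the phase until the end.\<close>

abbreviation borel_fun :: "('a::topological_space \<Rightarrow> 'b::topological_space) \<Rightarrow> bool" where
  "borel_fun f \<equiv> f \<in> borel_measurable borel"

abbreviation line_invariant :: "'a::real_vector \<Rightarrow> ('a \<Rightarrow> 'b) \<Rightarrow> bool" where
  "line_invariant v h \<equiv> \<forall>x t. h (x + t *\<^sub>R v) = h x"

abbreviation lipschitz_on_ball :: "real \<Rightarrow> real \<Rightarrow> ('a::real_normed_vector \<Rightarrow> real) \<Rightarrow> bool" where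
  "lipschitz_on_ball R L E \<equiv> \<forall>x\<in>cball 0 R. \<forall>y\<in>cball 0 R. \<bar>E x - E y\<bar> \<le> L * norm (x - y)"

section \<open>Linear spaces of functions and functionals on them\<close>

definition fsub :: "('a \<Rightarrow> real) set \<Rightarrow> bool" where
  "fsub S \<longleftrightarrow> (\<lambda>_. 0) \<in> S \<and> (\<forall>p\<in>S. \<forall>q\<in>S. (\<lambda>x. p x + q x) \<in> S) \<and>
     (\<forall>p\<in>S. \<forall>a. (\<lambda>x. a * p x) \<in> S)"

text \<open>Linearity is asked on \<open>S\<close> only, so that evaluations, derivatives and
  differences of polynomials all qualify without a convention for other functions.\<close>

definition flin :: "('a \<Rightarrow> real) set \<Rightarrow> (('a \<Rightarrow> real) \<Rightarrow> real) \<Rightarrow> bool" where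
  "flin S \<phi> \<longleftrightarrow> (\<forall>p\<in>S. \<forall>q\<in>S. \<phi> (\<lambda>x. p x + q x) = \<phi> p + \<phi> q) \<and>
     (\<forall>p\<in>S. \<forall>a. \<phi> (\<lambda>x. a * p x) = a * \<phi> p)"

lemma fsub_zero: "fsub S \<Longrightarrow> (\<lambda>_. 0) \<in> S"
  and fsub_add: "fsub S \<Longrightarrow> p \<in> S \<Longrightarrow> q \<in> S \<Longrightarrow> (\<lambda>x. p x + q x) \<in> S"
  and fsub_scale: "fsub S \<Longrightarrow> p \<in> S \<Longrightarrow> (\<lambda>x. a * p x) \<in> S"
  by (simp_all add: fsub_def)

lemma flin_add: "flin S \<phi> \<Longrightarrow> p \<in> S \<Longrightarrow> q \<in> S \<Longrightarrow> \<phi> (\<lambda>x. p x + q x) = \<phi> p + \<phi> q"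
  and flin_scale: "flin S \<phi> \<Longrightarrow> p \<in> S \<Longrightarrow> \<phi> (\<lambda>x. a * p x) = a * \<phi> p"
  by (simp_all add: flin_def)

lemma fsub_diff: "fsub S \<Longrightarrow> p \<in> S \<Longrightarrow> q \<in> S \<Longrightarrow> (\<lambda>x. p x - a * q x) \<in> S"
proof -
  assume S: "fsub S" and p: "p \<in> S" and q: "q \<in> S"
  from fsub_add[OF S p fsub_scale[OF S q, of "- a"]] show ?thesis by simp
qed

lemma fsub_sum: "fsub S \<Longrightarrow> (\<And>i. i \<in> I \<Longrightarrow> p i \<in> S) \<Longrightarrow> (\<lambda>x. \<Sum>i\<in>I. a i * p i x) \<in> S"
proof (induction I rule: infinite_finite_induct)
  case (insert i I)
  then have "(\<lambda>x. a i * p i x + (\<Sum>i\<in>I. a i * p i x)) \<in> S"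
    by (intro fsub_add fsub_scale) auto
  then show ?case using insert.hyps by simp
qed (auto simp: fsub_def)

lemma flin_diff:
  assumes "fsub S" "flin S \<phi>" "p \<in> S" "q \<in> S"
  shows "\<phi> (\<lambda>x. p x - a * q x) = \<phi> p - a * \<phi> q"
proof -
  from flin_add[OF assms(2,3) fsub_scale[OF assms(1,4)], of "- a"] flin_scale[OF assms(2,4), of "- a"]
  show ?thesis by simp
qed

text \<open>Kernel inclusion made quantitative: the induction removes one functional at a time and
  continues on its kernel. The functions \<open>e i\<close> do not depend on \<open>p\<close>, so
  the values \<open>\<phi> i p\<close> measure how far \<open>p\<close> is from \<open>W\<close>.
  With evaluations as functionals and only the zero function in \<open>W\<close> this is
  interpolation; with \<open>W\<close> a class of degenerate phases it gives an explicit error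
  term.\<close>

lemma functional_splitting:
  assumes "finite I" "fsub S" "\<And>i. i \<in> I \<Longrightarrow> flin S (\<phi> i)"
    and "\<And>p. p \<in> S \<Longrightarrow> (\<And>i. i \<in> I \<Longrightarrow> \<phi> i p = 0) \<Longrightarrow> p \<in> W"
  shows "\<exists>e. (\<forall>i\<in>I. e i \<in> S) \<and> (\<forall>p\<in>S. (\<lambda>x. p x - (\<Sum>i\<in>I. \<phi> i p * e i x)) \<in> W)"
  using assms
proof (induction I arbitrary: S rule: finite_induct)
  case empty
  then show ?case by auto
next
  case (insert k I)
  define S' where "S' = {p \<in> S. \<phi> k p = 0}"
  have linS: "flin S (\<phi> i)" if "i \<in> insert k I" for i using insert.prems that by blast
  have zero: "\<phi> k (\<lambda>_. 0) = 0"
  proof -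
    from flin_scale[OF linS[of k] fsub_zero[OF insert.prems(1)], of 0] show ?thesis by simp
  qed
  have S': "fsub S'"
    using insert.prems(1) linS[of k] zero unfolding S'_def fsub_def flin_def by auto
  have "\<exists>e. (\<forall>i\<in>I. e i \<in> S') \<and> (\<forall>p\<in>S'. (\<lambda>x. p x - (\<Sum>i\<in>I. \<phi> i p * e i x)) \<in> W)"
  proof (rule insert.IH[OF S'])
    show "flin S' (\<phi> i)" if "i \<in> I" for i using linS[of i] that unfolding flin_def S'_def by auto
    show "p \<in> W" if "p \<in> S'" "\<And>i. i \<in> I \<Longrightarrow> \<phi> i p = 0" for p
      using that insert.prems(3)[of p] unfolding S'_def by auto
  qed
  then obtain e where e: "\<And>i. i \<in> I \<Longrightarrow> e i \<in> S'"
    "\<And>p. p \<in> S' \<Longrightarrow> (\<lambda>x. p x - (\<Sum>i\<in>I. \<phi> i p * e i x)) \<in> W" by blast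
  show ?case
  proof (cases "\<forall>p\<in>S. \<phi> k p = 0")
    case True
    \<comment> \<open>If \<open>\<phi> k\<close> vanishes on all of \<open>S\<close>, its kernel is
      \<open>S\<close> and its coefficient is always zero, so the zero function serves as
      \<open>e k\<close>.\<close>
    then have SS: "S' = S" by (auto simp: S'_def)
    have z0: "(\<lambda>_. 0) \<in> S" using insert.prems(1) by (simp add: fsub_def)
    show ?thesis
    proof (intro exI[of _ "e(k := (\<lambda>_. 0))"] conjI ballI)
      fix i assume "i \<in> insert k I"
      then show "(e(k := (\<lambda>_. 0))) i \<in> S" using e(1) z0 SS by auto
    next
      fix p assume p: "p \<in> S"
      have "(\<lambda>x. p x - (\<Sum>i\<in>insert k I. \<phi> i p * (e(k := (\<lambda>_. 0))) i x)) =
        (\<lambda>x. p x - (\<Sum>i\<in>I. \<phi> i p * e i x))"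
      proof
        fix x
        have "(\<Sum>i\<in>I. \<phi> i p * (e(k := (\<lambda>_. 0))) i x) = (\<Sum>i\<in>I. \<phi> i p * e i x)"
          using insert.hyps by (intro sum.cong) auto
        then show "p x - (\<Sum>i\<in>insert k I. \<phi> i p * (e(k := (\<lambda>_. 0))) i x) = p x - (\<Sum>i\<in>I. \<phi> i p * e i x)"
          using insert.hyps by simp
      qed
      then show "(\<lambda>x. p x - (\<Sum>i\<in>insert k I. \<phi> i p * (e(k := (\<lambda>_. 0))) i x)) \<in> W"
        using e(2)[of p] p SS by simp
    qed
  next
    case False
    then obtain b0 where b0: "b0 \<in> S" "\<phi> k b0 \<noteq> 0" by blast
    define b where "b = (\<lambda>x. (1 / \<phi> k b0) * b0 x)"
    have bS: "b \<in> S" using b0 insert.prems(1) unfolding b_def by (intro fsub_scale)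
    have "\<phi> k b = (1 / \<phi> k b0) * \<phi> k b0" using b0 linS[of k] unfolding b_def by (intro flin_scale) auto
    then have b1: "\<phi> k b = 1" using b0 by simp
    \<comment> \<open>Expanding \<open>p - \<phi> k p * b\<close> over \<open>I\<close> produces the
      coefficients \<open>\<phi> i p - \<phi> k p * \<phi> i b\<close>. The part carrying the factor
      \<open>\<phi> k p\<close> is collected here together with \<open>b\<close>.\<close>
    define ek where "ek = (\<lambda>x. b x - (\<Sum>i\<in>I. \<phi> i b * e i x))"
    have eS: "e i \<in> S" if "i \<in> I" for i using e(1)[OF that] by (simp add: S'_def)
    have ekS: "ek \<in> S"
    proof -
      have "(\<lambda>x. \<Sum>i\<in>I. \<phi> i b * e i x) \<in> S" by (rule fsub_sum[OF insert.prems(1) eS])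
      from fsub_diff[OF insert.prems(1) bS this, of 1] show ?thesis by (simp add: ek_def)
    qed
    show ?thesis
    proof (intro exI[of _ "e(k := ek)"] conjI ballI)
      fix i assume "i \<in> insert k I"
      then show "(e(k := ek)) i \<in> S" using eS ekS by auto
    next
      fix p assume p: "p \<in> S"
      define p' where "p' = (\<lambda>x. p x - \<phi> k p * b x)"
      have p'S: "p' \<in> S" unfolding p'_def by (rule fsub_diff[OF insert.prems(1) p bS])
      have \<phi>p': "\<phi> i p' = \<phi> i p - \<phi> k p * \<phi> i b" if "i \<in> insert k I" for i
        unfolding p'_def by (rule flin_diff[OF insert.prems(1) linS[OF that] p bS])
      have "p' \<in> S'" using p'S \<phi>p'[of k] b1 by (simp add: S'_def)
      from e(2)[OF this] have *: "(\<lambda>x. p' x - (\<Sum>i\<in>I. \<phi> i p' * e i x)) \<in> W" .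
      have "p' x - (\<Sum>i\<in>I. \<phi> i p' * e i x) =
         p x - (\<Sum>i\<in>insert k I. \<phi> i p * (e(k := ek)) i x)" for x
      proof -
        have "(\<Sum>i\<in>I. \<phi> i p * (e(k := ek)) i x) = (\<Sum>i\<in>I. \<phi> i p * e i x)"
          using insert.hyps by (intro sum.cong) auto
        moreover have "(\<Sum>i\<in>I. \<phi> i p' * e i x) = (\<Sum>i\<in>I. \<phi> i p * e i x) - \<phi> k p * (\<Sum>i\<in>I. \<phi> i b * e i x)"
          by (simp add: \<phi>p' algebra_simps sum_subtractf sum_distrib_left)
        ultimately show ?thesis using insert.hyps by (simp add: p'_def ek_def algebra_simps)
      qed
      then show "(\<lambda>x. p x - (\<Sum>i\<in>insert k I. \<phi> i p * (e(k := ek)) i x)) \<in> W"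
        using * by simp
    qed
  qed
qed

subsection \<open>Polynomials\<close>

abbreviation mono_fun :: "('m::finite \<Rightarrow> nat) \<Rightarrow> real ^ 'm \<Rightarrow> real" where
  "mono_fun \<alpha> x \<equiv> (\<Prod>i\<in>UNIV. (x $ i) ^ \<alpha> i)"

lemma fsub_polys_le: "fsub (polys_le d :: (real ^ 'm::finite \<Rightarrow> real) set)"
  unfolding fsub_def
proof (intro conjI ballI allI)
  show "(\<lambda>_. 0) \<in> (polys_le d :: (real ^ 'm \<Rightarrow> real) set)"
    unfolding polys_le_def by (auto intro!: exI[of _ "\<lambda>_. 0"])
next
  fix p q :: "real ^ 'm \<Rightarrow> real" assume "p \<in> polys_le d" "q \<in> polys_le d"
  then obtain a b where
    "p = (\<lambda>x. \<Sum>\<alpha> | (\<Sum>i\<in>UNIV. \<alpha> i) \<le> d. a \<alpha> * mono_fun \<alpha> x)"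
    "q = (\<lambda>x. \<Sum>\<alpha> | (\<Sum>i\<in>UNIV. \<alpha> i) \<le> d. b \<alpha> * mono_fun \<alpha> x)"
    unfolding polys_le_def by blast
  then have "(\<lambda>x. p x + q x) = (\<lambda>x. \<Sum>\<alpha> | (\<Sum>i\<in>UNIV. \<alpha> i) \<le> d. (a \<alpha> + b \<alpha>) * mono_fun \<alpha> x)"
    by (simp add: sum.distrib algebra_simps)
  then show "(\<lambda>x. p x + q x) \<in> polys_le d" unfolding polys_le_def by (intro CollectI exI)
next
  fix p :: "real ^ 'm \<Rightarrow> real" and c :: real assume "p \<in> polys_le d"
  then obtain a where
    "p = (\<lambda>x. \<Sum>\<alpha> | (\<Sum>i\<in>UNIV. \<alpha> i) \<le> d. a \<alpha> * mono_fun \<alpha> x)"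
    unfolding polys_le_def by blast
  then have "(\<lambda>x. c * p x) = (\<lambda>x. \<Sum>\<alpha> | (\<Sum>i\<in>UNIV. \<alpha> i) \<le> d. (c * a \<alpha>) * mono_fun \<alpha> x)"
    by (simp add: sum_distrib_left algebra_simps)
  then show "(\<lambda>x. c * p x) \<in> polys_le d" unfolding polys_le_def by (intro CollectI exI)
qed

lemmas polys_le_sum = fsub_sum[OF fsub_polys_le]
lemmas polys_le_diff' = fsub_diff[OF fsub_polys_le]

lemma polys_le_add: "p \<in> polys_le d \<Longrightarrow> q \<in> polys_le d \<Longrightarrow> (\<lambda>x. p x + q x) \<in> polys_le d"
  and polys_le_scale: "p \<in> polys_le d \<Longrightarrow> (\<lambda>x. a * p x) \<in> polys_le d"
  for p q :: "real ^ 'm::finite \<Rightarrow> real"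
  using fsub_polys_le[of d, where 'm='m] by (auto simp: fsub_def)

lemma polys_le_zero: "(\<lambda>x. 0) \<in> (polys_le d :: (real ^ 'm::finite \<Rightarrow> real) set)"
  by (rule fsub_zero[OF fsub_polys_le])

lemma polys_le_diff: "p \<in> polys_le d \<Longrightarrow> q \<in> polys_le d \<Longrightarrow> (\<lambda>x. p x - q x) \<in> polys_le d"
  for p q :: "real ^ 'm::finite \<Rightarrow> real"
  using polys_le_diff'[of p d q 1] by simp

lemma polys_le_sum1: "(\<And>i. i \<in> I \<Longrightarrow> p i \<in> polys_le d) \<Longrightarrow> (\<lambda>x. \<Sum>i\<in>I. p i x) \<in> polys_le d"
  for p :: "'b \<Rightarrow> real ^ 'm::finite \<Rightarrow> real"
  using polys_le_sum[of I p d "\<lambda>_. 1"] by simp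

lemma polys_le_mono_fun:
  assumes "(\<Sum>i\<in>UNIV. \<alpha> i) \<le> d"
  shows "mono_fun \<alpha> \<in> polys_le d"
proof -
  have "mono_fun \<alpha> = (\<lambda>x. \<Sum>\<beta> | (\<Sum>i\<in>UNIV. \<beta> i) \<le> d. (if \<beta> = \<alpha> then 1 else 0) * mono_fun \<beta> x)"
  proof
    fix x :: "real ^ 'a"
    have "(\<Sum>\<beta> | (\<Sum>i\<in>UNIV. \<beta> i) \<le> d. (if \<beta> = \<alpha> then 1 else 0) * mono_fun \<beta> x) =
      (\<Sum>\<beta> | (\<Sum>i\<in>UNIV. \<beta> i) \<le> d. (if \<beta> = \<alpha> then mono_fun \<beta> x else 0))"
      by (intro sum.cong) auto
    also have "\<dots> = mono_fun \<alpha> x" using assms by (simp add: sum.delta finite_multi_indices)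
    finally show "mono_fun \<alpha> x = (\<Sum>\<beta> | (\<Sum>i\<in>UNIV. \<beta> i) \<le> d. (if \<beta> = \<alpha> then 1 else 0) * mono_fun \<beta> x)" by simp
  qed
  then show ?thesis unfolding polys_le_def by (intro CollectI exI)
qed

text \<open>Polynomials form the span of the monomials, so a property closed under linear
  combinations has to be checked on monomials only.\<close>

lemma polys_le_subset:
  assumes X: "fsub X" and mono: "\<And>\<alpha>. (\<Sum>i\<in>UNIV. \<alpha> i) \<le> d \<Longrightarrow> mono_fun \<alpha> \<in> X"
  shows "(polys_le d :: (real ^ 'm::finite \<Rightarrow> real) set) \<subseteq> X"
proof
  fix p :: "real ^ 'm \<Rightarrow> real" assume "p \<in> polys_le d"
  then obtain a where
    "p = (\<lambda>x. \<Sum>\<alpha> | (\<Sum>i\<in>UNIV. \<alpha> i) \<le> d. a \<alpha> * mono_fun \<alpha> x)"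
    unfolding polys_le_def by blast
  then show "p \<in> X" using fsub_sum[OF X, of "{\<alpha>. (\<Sum>i\<in>UNIV. \<alpha> i) \<le> d}" mono_fun a] mono by simp
qed

lemma polys_le_mono: "d \<le> e \<Longrightarrow> (polys_le d :: (real ^ 'm::finite \<Rightarrow> real) set) \<subseteq> polys_le e"
  by (intro polys_le_subset fsub_polys_le polys_le_mono_fun) auto

lemma polys_le_const: "(\<lambda>x. c) \<in> (polys_le d :: (real ^ 'm::finite \<Rightarrow> real) set)"
  using polys_le_scale[OF polys_le_mono_fun[of "\<lambda>_. 0" d], of c] by simp

lemma polys_le_coord: "(\<lambda>x. x $ i) \<in> (polys_le (Suc d) :: (real ^ 'm::finite \<Rightarrow> real) set)"
proof -
  have "(\<Sum>j\<in>UNIV. if j = i then 1 else 0) \<le> Suc d" by simp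
  from polys_le_mono_fun[OF this] show ?thesis by (simp add: if_distrib[of "\<lambda>n. _ ^ n"] prod.delta cong: if_cong)
qed

lemma polys_le_times:
  fixes p q :: "real ^ 'm::finite \<Rightarrow> real"
  assumes "p \<in> polys_le d" "q \<in> polys_le e"
  shows "(\<lambda>x. p x * q x) \<in> polys_le (d + e)"
proof -
  have mm: "(\<lambda>x. mono_fun \<alpha> x * mono_fun \<beta> x) \<in> (polys_le (d + e) :: (real ^ 'm \<Rightarrow> real) set)"
    if "(\<Sum>i\<in>UNIV. \<alpha> i) \<le> d" "(\<Sum>i\<in>UNIV. \<beta> i) \<le> e" for \<alpha> \<beta>
  proof -
    have "(\<Sum>i\<in>UNIV. \<alpha> i + \<beta> i) \<le> d + e" using that by (simp add: sum.distrib)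
    from polys_le_mono_fun[OF this] show ?thesis by (simp add: power_add prod.distrib)
  qed
  let ?X = "{q :: real ^ 'm \<Rightarrow> real. \<forall>\<alpha>. (\<Sum>i\<in>UNIV. \<alpha> i) \<le> d \<longrightarrow> (\<lambda>x. mono_fun \<alpha> x * q x) \<in> polys_le (d + e)}"
  have "fsub ?X" unfolding fsub_def
  proof (intro conjI ballI allI CollectI impI)
    fix a and q1 q2 :: "real ^ 'm \<Rightarrow> real" and \<alpha> :: "'m \<Rightarrow> nat"
    assume q: "q1 \<in> ?X" and \<alpha>: "(\<Sum>i\<in>UNIV. \<alpha> i) \<le> d"
    from polys_le_scale[of "\<lambda>x. mono_fun \<alpha> x * q1 x" "d + e" a] q \<alpha>
    show "(\<lambda>x. mono_fun \<alpha> x * (a * q1 x)) \<in> polys_le (d + e)" by (simp add: mult.left_commute)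
    assume "q2 \<in> ?X"
    then show "(\<lambda>x. mono_fun \<alpha> x * (q1 x + q2 x)) \<in> polys_le (d + e)"
      using polys_le_add[of "\<lambda>x. mono_fun \<alpha> x * q1 x" "d + e" "\<lambda>x. mono_fun \<alpha> x * q2 x"] q \<alpha>
      by (simp add: distrib_left)
  qed (use polys_le_zero in auto)
  then have "polys_le e \<subseteq> ?X" by (rule polys_le_subset) (use mm in auto)
  then have q: "q \<in> ?X" using assms by blast
  let ?Y = "{p :: real ^ 'm \<Rightarrow> real. (\<lambda>x. p x * q x) \<in> polys_le (d + e)}"
  have "fsub ?Y" unfolding fsub_def
  proof (intro conjI ballI allI CollectI impI)
    fix a and p1 p2 :: "real ^ 'm \<Rightarrow> real"
    assume p: "p1 \<in> ?Y"
    from polys_le_scale[of "\<lambda>x. p1 x * q x" "d + e" a] p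
    show "(\<lambda>x. (a * p1 x) * q x) \<in> polys_le (d + e)" by (simp add: mult.assoc)
    assume "p2 \<in> ?Y"
    then show "(\<lambda>x. (p1 x + p2 x) * q x) \<in> polys_le (d + e)"
      using polys_le_add[of "\<lambda>x. p1 x * q x" "d + e" "\<lambda>x. p2 x * q x"] p
      by (simp add: distrib_right)
  qed (use polys_le_zero in auto)
  then have "polys_le d \<subseteq> ?Y" by (rule polys_le_subset) (use q in auto)
  then show ?thesis using assms by blast
qed

text \<open>A nonconstant monomial contains a coordinate that can be split off. This is the
  induction scheme on the degree for translates, differences, restrictions to lines and curves, and
  Lipschitz bounds; it avoids further work with multi-indices.\<close>

lemma polys_le_Suc_cases:
  fixes P :: "real ^ 'm::finite \<Rightarrow> real"
  assumes "P \<in> polys_le (Suc d)"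
  shows "\<exists>c Q. (\<forall>i. Q i \<in> polys_le d) \<and> P = (\<lambda>x. c + (\<Sum>i\<in>UNIV. x $ i * Q i x))"
proof -
  let ?X = "{P. \<exists>c Q. (\<forall>i. Q i \<in> polys_le d) \<and> P = (\<lambda>x::real ^ 'm. c + (\<Sum>i\<in>UNIV. x $ i * Q i x))}"
  have "fsub ?X" unfolding fsub_def
  proof (intro conjI ballI allI)
    show "(\<lambda>_. 0) \<in> ?X" using polys_le_zero by (auto intro!: exI[of _ 0] exI[of _ "\<lambda>_ _. 0"])
  next
    fix p q assume "p \<in> ?X" "q \<in> ?X"
    then obtain c Q c' Q' where "\<forall>i. Q i \<in> polys_le d" "p = (\<lambda>x::real ^ 'm. c + (\<Sum>i\<in>UNIV. x $ i * Q i x))"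
      "\<forall>i. Q' i \<in> polys_le d" "q = (\<lambda>x::real ^ 'm. c' + (\<Sum>i\<in>UNIV. x $ i * Q' i x))" by blast
    then show "(\<lambda>x. p x + q x) \<in> ?X"
      by (intro CollectI exI[of _ "c + c'"] exI[of _ "\<lambda>i x. Q i x + Q' i x"])
        (auto simp: polys_le_add sum.distrib algebra_simps)
  next
    fix p a assume "p \<in> ?X"
    then obtain c Q where "\<forall>i. Q i \<in> polys_le d" "p = (\<lambda>x::real ^ 'm. c + (\<Sum>i\<in>UNIV. x $ i * Q i x))"
       by blast
    then show "(\<lambda>x. a * p x) \<in> ?X"
      by (intro CollectI exI[of _ "a * c"] exI[of _ "\<lambda>i x. a * Q i x"])
        (auto simp: polys_le_scale sum_distrib_left algebra_simps)
  qed
  moreover have "mono_fun \<alpha> \<in> ?X" if \<alpha>: "(\<Sum>i\<in>UNIV. \<alpha> i) \<le> Suc d" for \<alpha> :: "'m \<Rightarrow> nat"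
  proof (cases "\<forall>i. \<alpha> i = 0")
    case True
    then show ?thesis using polys_le_zero by (auto intro!: exI[of _ 1] exI[of _ "\<lambda>_ _. 0"])
  next
    case False
    then obtain k where k: "\<alpha> k > 0" by auto
    define \<beta> where "\<beta> = \<alpha>(k := \<alpha> k - 1)"
    have s: "(\<Sum>i\<in>UNIV. f i) = f k + (\<Sum>i\<in>UNIV-{k}. f i)" for f :: "'m \<Rightarrow> nat"
      by (simp add: sum.remove)
    have "(\<Sum>i\<in>UNIV-{k}. \<beta> i) = (\<Sum>i\<in>UNIV-{k}. \<alpha> i)" by (intro sum.cong) (auto simp: \<beta>_def)
    then have "(\<Sum>i\<in>UNIV. \<beta> i) \<le> d" using \<alpha> k s[of \<alpha>] s[of \<beta>] by (simp add: \<beta>_def)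
    then have \<beta>: "mono_fun \<beta> \<in> polys_le d" by (rule polys_le_mono_fun)
    have e: "mono_fun \<alpha> x = x $ k * mono_fun \<beta> x" for x :: "real ^ 'm"
    proof -
      have "(\<Prod>i\<in>UNIV-{k}. x $ i ^ \<beta> i) = (\<Prod>i\<in>UNIV-{k}. x $ i ^ \<alpha> i)" by (intro prod.cong) (auto simp: \<beta>_def)
      moreover have "x $ k ^ \<alpha> k = x $ k * x $ k ^ \<beta> k" using k by (cases "\<alpha> k") (auto simp: \<beta>_def)
      ultimately show ?thesis by (simp add: prod.remove[of UNIV k])
    qed
    have "(\<Sum>i\<in>UNIV. x $ i * (if i = k then mono_fun \<beta> else (\<lambda>_. 0)) x) = mono_fun \<alpha> x" for x :: "real ^ 'm"
    proof -
      have "(\<Sum>i\<in>UNIV. x $ i * (if i = k then mono_fun \<beta> else (\<lambda>_. 0)) x) =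
        (\<Sum>i\<in>UNIV. if i = k then x $ i * mono_fun \<beta> x else 0)" by (intro sum.cong) auto
      then show ?thesis by (simp add: e)
    qed
    then show ?thesis using \<beta> polys_le_zero
      by (intro CollectI exI[of _ 0] exI[of _ "\<lambda>i. if i = k then mono_fun \<beta> else (\<lambda>_. 0)"]) auto
  qed
  ultimately have "polys_le (Suc d) \<subseteq> ?X" by (rule polys_le_subset)
  then show ?thesis using assms by blast
qed

lemma polys_le_0: "P \<in> polys_le 0 \<Longrightarrow> \<exists>c. P = (\<lambda>x. c)" for P :: "real ^ 'm::finite \<Rightarrow> real"
proof -
  have "{\<alpha> :: 'm \<Rightarrow> nat. (\<Sum>i\<in>UNIV. \<alpha> i) \<le> 0} = {\<lambda>_. 0}" by auto
  then show "P \<in> polys_le 0 \<Longrightarrow> \<exists>c. P = (\<lambda>x. c)" unfolding polys_le_def by auto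
qed

lemma polys_le_coord_times:
  assumes "Q \<in> polys_le d"
  shows "(\<lambda>x. x $ i * Q x) \<in> (polys_le (Suc d) :: (real ^ 'm::finite \<Rightarrow> real) set)"
  using polys_le_times[OF polys_le_coord[of i 0] assms] by simp

lemma polys_le_translate:
  fixes P :: "real ^ 'm::finite \<Rightarrow> real"
  shows "P \<in> polys_le d \<Longrightarrow> (\<lambda>x. P (x + h)) \<in> polys_le d"
proof (induction d arbitrary: P)
  case 0
  then show ?case using polys_le_0[of P] by (auto intro: polys_le_const)
next
  case (Suc d)
  from polys_le_Suc_cases[OF Suc.prems] obtain c Q where
    Q: "\<And>i. Q i \<in> polys_le d" and P: "P = (\<lambda>x. c + (\<Sum>i\<in>UNIV. x $ i * Q i x))" by blast
  have t: "(\<lambda>x. Q i (x + h)) \<in> polys_le d" for i by (rule Suc.IH[OF Q])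
  have "(\<lambda>x. x $ i * Q i (x + h) + h $ i * Q i (x + h)) \<in> polys_le (Suc d)" for i
  proof -
    have "(\<lambda>x. h $ i * Q i (x + h)) \<in> polys_le (Suc d)"
      using polys_le_scale[OF t] polys_le_mono[of d "Suc d"] by auto
    from polys_le_add[OF polys_le_coord_times[OF t] this] show ?thesis .
  qed
  then have "(\<lambda>x. c + (\<Sum>i\<in>UNIV. x $ i * Q i (x + h) + h $ i * Q i (x + h))) \<in> polys_le (Suc d)"
    by (intro polys_le_add[OF polys_le_const] polys_le_sum1) blast
  then show ?case by (simp add: P distrib_right)
qed

lemma polys_le_difference:
  fixes P :: "real ^ 'm::finite \<Rightarrow> real"
  shows "P \<in> polys_le d \<Longrightarrow> (\<lambda>x. P (x + h) - P x) \<in> polys_le (d - 1)"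
proof (induction d arbitrary: P)
  case 0
  then show ?case using polys_le_0[of P] by (auto intro: polys_le_const)
next
  case (Suc d)
  from polys_le_Suc_cases[OF Suc.prems] obtain c Q where
    Q: "\<And>i. Q i \<in> polys_le d" and P: "P = (\<lambda>x. c + (\<Sum>i\<in>UNIV. x $ i * Q i x))" by blast
  have t: "(\<lambda>x. Q i (x + h)) \<in> polys_le d" for i by (rule polys_le_translate[OF Q])
  \<comment> \<open>The difference of a product is the coordinate times a difference plus the step
    times a translate. In the first term the drop in degree compensates the coordinate; constant
    \<open>Q i\<close> are treated apart because \<open>d - 1\<close> is truncated at 0.\<close>
  have D: "(\<lambda>x. x $ i * (Q i (x + h) - Q i x)) \<in> polys_le d" for i
  proof (cases d)
    case 0
    with Q[of i] polys_le_0[of "Q i"] obtain c where "Q i = (\<lambda>x. c)" by auto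
    then show ?thesis by (simp add: polys_le_zero)
  next
    case d: (Suc e)
    from polys_le_coord_times[OF Suc.IH[OF Q[of i]], of i] show ?thesis by (simp add: d)
  qed
  have "(\<lambda>x. \<Sum>i\<in>UNIV. x $ i * (Q i (x + h) - Q i x) + h $ i * Q i (x + h)) \<in> polys_le d"
    by (intro polys_le_sum1 polys_le_add D polys_le_scale t)
  then show ?case
    by (simp add: P algebra_simps sum_subtractf sum.distrib)
qed

lemma polys_le_inner: "(\<lambda>x. u \<bullet> x) \<in> (polys_le (Suc d) :: (real ^ 'm::finite \<Rightarrow> real) set)"
  unfolding inner_vec_def using polys_le_sum[of UNIV "\<lambda>i x. x $ i" "Suc d" "\<lambda>i. u $ i", OF polys_le_coord]
  by (simp add: inner_real_def)

lemma polys_le_poly_inner: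
  fixes u :: "real ^ 'm::finite"
  assumes "degree p \<le> d"
  shows "(\<lambda>x. poly p (u \<bullet> x)) \<in> polys_le d"
proof -
  have pw: "(\<lambda>x. (u \<bullet> x) ^ k) \<in> polys_le k" for k
  proof (induction k)
    case (Suc k)
    from polys_le_times[OF polys_le_inner[of u 0] Suc] show ?case by simp
  qed (use polys_le_const in auto)
  have "(\<lambda>x. \<Sum>k\<le>degree p. coeff p k * (u \<bullet> x) ^ k) \<in> polys_le d"
  proof (rule polys_le_sum)
    fix k assume "k \<in> {..degree p}"
    then have "k \<le> d" using assms by simp
    then show "(\<lambda>x. (u \<bullet> x) ^ k) \<in> polys_le d" using pw polys_le_mono by blast
  qed
  then show ?thesis by (simp add: poly_altdef)
qed

lemma polys_le_on_line:
  fixes P :: "real ^ 'm::finite \<Rightarrow> real"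
  shows "P \<in> polys_le d \<Longrightarrow> \<exists>p. degree p \<le> d \<and> (\<forall>t. P (x + t *\<^sub>R v) = poly p t)"
proof (induction d arbitrary: P)
  case 0
  then show ?case using polys_le_0[of P] by (metis degree_pCons_0 le0 poly_const_conv)
next
  case (Suc d)
  from polys_le_Suc_cases[OF Suc.prems] obtain c Q where
    Q: "\<And>i. Q i \<in> polys_le d" and P: "P = (\<lambda>x. c + (\<Sum>i\<in>UNIV. x $ i * Q i x))" by blast
  from Suc.IH[OF Q] obtain p where p: "\<And>i. degree (p i) \<le> d" "\<And>i t. Q i (x + t *\<^sub>R v) = poly (p i) t"
    by metis
  show ?case
  proof (intro exI[of _ "[:c:] + (\<Sum>i\<in>UNIV. [:x $ i, v $ i:] * p i)"] conjI allI)
    have "degree ([:x $ i, v $ i:] * p i) \<le> Suc d" for i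
      using degree_mult_le[of "[:x $ i, v $ i:]" "p i"] p(1)[of i] degree_pCons_le[of "x $ i" "[:v $ i:]"]
      by (simp split: if_splits)
    then show "degree ([:c:] + (\<Sum>i\<in>UNIV. [:x $ i, v $ i:] * p i)) \<le> Suc d"
      by (intro degree_add_le degree_sum_le) auto
    show "P (x + t *\<^sub>R v) = poly ([:c:] + (\<Sum>i\<in>UNIV. [:x $ i, v $ i:] * p i)) t" for t
      by (simp add: P p(2) poly_sum algebra_simps)
  qed
qed

lemma polys_le_continuous: "P \<in> polys_le d \<Longrightarrow> continuous_on UNIV P" for P :: "real ^ 'm::finite \<Rightarrow> real"
  unfolding polys_le_def by (auto intro!: continuous_intros)

section \<open>Restriction to a curve on which distinct monomials stay distinct\<close>

lemma exists_injective_weights_on: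
  assumes "finite I"
  shows "\<exists>w :: 'i \<Rightarrow> nat. \<forall>\<alpha> \<beta>. (\<forall>i\<in>I. \<alpha> i \<le> d \<and> \<beta> i \<le> d) \<and>
    (\<Sum>i\<in>I. \<alpha> i * w i) = (\<Sum>i\<in>I. \<beta> i * w i) \<longrightarrow> (\<forall>i\<in>I. \<alpha> i = \<beta> i)"
  using assms
proof (induction I rule: finite_induct)
  case (insert k I)
  then obtain w :: "'i \<Rightarrow> nat" where w: "\<forall>\<alpha> \<beta>. (\<forall>i\<in>I. \<alpha> i \<le> d \<and> \<beta> i \<le> d) \<and>
    (\<Sum>i\<in>I. \<alpha> i * w i) = (\<Sum>i\<in>I. \<beta> i * w i) \<longrightarrow> (\<forall>i\<in>I. \<alpha> i = \<beta> i)" by (elim exE)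
  \<comment> \<open>Exponents at most \<open>d\<close> are digits in base \<open>d + 1\<close>. The
    new index takes the last digit and the earlier ones are shifted, so the weighted sum determines
    all of them.\<close>
  define w' where "w' = (\<lambda>i. if i = k then 1 else Suc d * w i)"
  have s: "(\<Sum>i\<in>insert k I. \<alpha> i * w' i) = \<alpha> k + Suc d * (\<Sum>i\<in>I. \<alpha> i * w i)" for \<alpha>
  proof -
    have "(\<Sum>i\<in>I. \<alpha> i * w' i) = (\<Sum>i\<in>I. Suc d * (\<alpha> i * w i))"
      using insert.hyps by (intro sum.cong) (auto simp: w'_def algebra_simps)
    then show ?thesis using insert.hyps by (simp add: w'_def sum_distrib_left)
  qed
  show ?case
  proof (intro exI[of _ w'] allI impI, elim conjE)
    fix \<alpha> \<beta> :: "'i \<Rightarrow> nat"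
    assume b: "\<forall>i\<in>insert k I. \<alpha> i \<le> d \<and> \<beta> i \<le> d"
      and e: "(\<Sum>i\<in>insert k I. \<alpha> i * w' i) = (\<Sum>i\<in>insert k I. \<beta> i * w' i)"
    have e': "\<alpha> k + Suc d * (\<Sum>i\<in>I. \<alpha> i * w i) = \<beta> k + Suc d * (\<Sum>i\<in>I. \<beta> i * w i)"
      using e unfolding s .
    have lt: "\<alpha> k < Suc d" "\<beta> k < Suc d" using b by (simp_all add: le_imp_less_Suc)
    have m: "(\<alpha> k + Suc d * a) mod Suc d = \<alpha> k" "(\<beta> k + Suc d * a) mod Suc d = \<beta> k"
      "(\<alpha> k + Suc d * a) div Suc d = a" "(\<beta> k + Suc d * a) div Suc d = a" for a
      using lt by (simp_all only: mod_mult_self2 mod_less div_mult_self2 div_less Suc_not_Zero not_False_eq_True add_0_right)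
    have "\<alpha> k = \<beta> k" using arg_cong[OF e', of "\<lambda>n. n mod Suc d"] by (simp only: m)
    moreover have "(\<Sum>i\<in>I. \<alpha> i * w i) = (\<Sum>i\<in>I. \<beta> i * w i)"
      using arg_cong[OF e', of "\<lambda>n. n div Suc d"] by (simp only: m)
    then have "\<forall>i\<in>I. \<alpha> i = \<beta> i" using spec[OF spec[OF w, of \<alpha>], of \<beta>] b by blast
    ultimately show "\<forall>i\<in>insert k I. \<alpha> i = \<beta> i" by simp
  qed
qed auto

definition unit_cube :: "(real ^ 'm::finite) set" where
  "unit_cube = cbox (\<chi> i. - 1) (\<chi> i. 1)"

text \<open>With suitably lacunary weights a polynomial on the space restricts to a one-variable polynomial on this curve
  without any cancellation between monomials.\<close>

definition power_curve :: "('m::finite \<Rightarrow> nat) \<Rightarrow> real \<Rightarrow> real ^ 'm" where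
  "power_curve w s = (\<chi> i. s ^ w i)"

abbreviation polys_on_curve :: "nat \<Rightarrow> nat \<Rightarrow> ('m::finite \<Rightarrow> nat) \<Rightarrow> bool" where
  "polys_on_curve d D w \<equiv> \<forall>P\<in>polys_le d. \<forall>x. \<exists>p. degree p \<le> D \<and> (\<forall>t. P (x + power_curve w t) = poly p t)"

lemma power_curve_in_unit_cube: "\<bar>s\<bar> \<le> 1 \<Longrightarrow> power_curve w s \<in> unit_cube"
proof -
  assume "\<bar>s\<bar> \<le> 1"
  then have "\<bar>s ^ w i\<bar> \<le> 1" for i by (simp add: power_abs power_le_one)
  then show ?thesis by (auto simp: unit_cube_def power_curve_def mem_box_cart abs_le_iff minus_le_iff)
qed

lemma continuous_power_curve: "continuous_on UNIV (power_curve w)"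
  unfolding power_curve_def by (intro continuous_on_vec_lambda continuous_intros)

lemma polys_le_on_curve:
  fixes P :: "real ^ 'm::finite \<Rightarrow> real"
  assumes W: "\<And>i. w i \<le> W"
  shows "P \<in> polys_le d \<Longrightarrow> \<exists>p. degree p \<le> d * W \<and> (\<forall>t. P (x + power_curve w t) = poly p t)"
proof (induction d arbitrary: P)
  case 0
  then show ?case using polys_le_0[of P] by (metis degree_pCons_0 le0 poly_const_conv)
next
  case (Suc d)
  from polys_le_Suc_cases[OF Suc.prems] obtain c Q where
    Q: "\<And>i. Q i \<in> polys_le d" and P: "P = (\<lambda>x. c + (\<Sum>i\<in>UNIV. x $ i * Q i x))" by blast
  from Suc.IH[OF Q] obtain p where
    p: "\<And>i. degree (p i) \<le> d * W" "\<And>i t. Q i (x + power_curve w t) = poly (p i) t"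
    by metis
  show ?case
  proof (intro exI[of _ "[:c:] + (\<Sum>i\<in>UNIV. ([:x $ i:] + monom 1 (w i)) * p i)"] conjI allI)
    have "degree (([:x $ i:] + monom 1 (w i)) * p i) \<le> Suc d * W" for i
    proof -
      have "degree ([:x $ i:] + monom 1 (w i)) \<le> W"
        using W[of i] degree_monom_le[of 1 "w i"] by (intro degree_add_le) (auto intro: order_trans)
      then show ?thesis
        using degree_mult_le[of "[:x $ i:] + monom 1 (w i)" "p i"] p(1)[of i] by simp
    qed
    then show "degree ([:c:] + (\<Sum>i\<in>UNIV. ([:x $ i:] + monom 1 (w i)) * p i)) \<le> Suc d * W"
      by (intro degree_add_le degree_sum_le) auto
    show "P (x + power_curve w t) = poly ([:c:] + (\<Sum>i\<in>UNIV. ([:x $ i:] + monom 1 (w i)) * p i)) t" for t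
      unfolding P p(2) by (simp add: poly_sum poly_monom power_curve_def)
  qed
qed

text \<open>The weights send different monomials to different powers of the parameter, so every
  coefficient of \<open>P\<close> is also a coefficient of the one-variable polynomial
  \<open>q\<close>, which vanishes identically.\<close>

lemma polys_le_eq_0_if_curve:
  fixes P :: "real ^ 'm::finite \<Rightarrow> real"
  assumes w: "\<And>\<alpha> \<beta> :: 'm \<Rightarrow> nat. (\<forall>i. \<alpha> i \<le> d \<and> \<beta> i \<le> d) \<Longrightarrow>
      (\<Sum>i\<in>UNIV. \<alpha> i * w i) = (\<Sum>i\<in>UNIV. \<beta> i * w i) \<Longrightarrow> \<alpha> = \<beta>"
    and P: "P \<in> polys_le d" and zero: "\<And>t. P (power_curve w t) = 0"
  shows "P = (\<lambda>_. 0)"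
proof -
  let ?A = "{\<alpha> :: 'm \<Rightarrow> nat. (\<Sum>i\<in>UNIV. \<alpha> i) \<le> d}"
  let ?e = "\<lambda>\<alpha>. \<Sum>i\<in>UNIV. \<alpha> i * w i"
  obtain a where a: "P = (\<lambda>x. \<Sum>\<alpha>\<in>?A. a \<alpha> * mono_fun \<alpha> x)"
    using P unfolding polys_le_def by blast
  have fin: "finite ?A" by (rule finite_multi_indices)
  have bd: "\<alpha> i \<le> d" if "\<alpha> \<in> ?A" for \<alpha> i
    using that member_le_sum[of i UNIV \<alpha>] by force
  define q where "q = (\<Sum>\<alpha>\<in>?A. monom (a \<alpha>) (?e \<alpha>))"
  have "poly q t = P (power_curve w t)" for t
  proof -
    have "mono_fun \<alpha> (power_curve w t) = t ^ ?e \<alpha>" for \<alpha>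
      by (simp add: power_curve_def power_sum mult.commute flip: power_mult)
    then show ?thesis by (simp add: q_def a poly_sum poly_monom)
  qed
  then have "poly q = poly 0" using zero by auto
  then have q0: "q = 0" by (simp add: poly_eq_poly_eq_iff)
  have "a \<beta> = 0" if \<beta>: "\<beta> \<in> ?A" for \<beta>
  proof -
    have e: "?e \<alpha> = ?e \<beta> \<longleftrightarrow> \<alpha> = \<beta>" if "\<alpha> \<in> ?A" for \<alpha>
      using w[of \<alpha> \<beta>] bd[OF that] bd[OF \<beta>] by blast
    have "coeff q (?e \<beta>) = (\<Sum>\<alpha>\<in>?A. if \<alpha> = \<beta> then a \<alpha> else 0)"
      unfolding q_def coeff_sum coeff_monom
      by (intro sum.cong if_cong refl e)
    also have "\<dots> = a \<beta>" using fin \<beta> by simp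
    finally show ?thesis using q0 by simp
  qed
  then show ?thesis by (simp add: a)
qed

text \<open>Restrictions to the curve have degree at most \<open>D\<close>, so \<open>D + 1\<close>
  parameters decide whether a polynomial vanishes on the curve, and the curve decides whether it
  vanishes everywhere.\<close>

lemma exists_unisolvent_curve:
  "\<exists>(w :: 'm::finite \<Rightarrow> nat) D N. finite N \<and> N \<subseteq> {-1..1} \<and>
    (polys_on_curve d D w) \<and>
    (\<forall>P\<in>polys_le d. (\<forall>s\<in>N. P (power_curve w s) = 0) \<longrightarrow> P = (\<lambda>_. 0))"
proof -
  obtain w :: "'m \<Rightarrow> nat" where w: "\<And>\<alpha> \<beta> :: 'm \<Rightarrow> nat. (\<forall>i. \<alpha> i \<le> d \<and> \<beta> i \<le> d) \<Longrightarrow>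
      (\<Sum>i\<in>UNIV. \<alpha> i * w i) = (\<Sum>i\<in>UNIV. \<beta> i * w i) \<Longrightarrow> \<alpha> = \<beta>"
  proof -
    from exists_injective_weights_on[OF finite[of "UNIV :: 'm set"], of d] obtain w :: "'m \<Rightarrow> nat"
      where "\<And>\<alpha> \<beta> :: 'm \<Rightarrow> nat. (\<forall>i. \<alpha> i \<le> d \<and> \<beta> i \<le> d) \<Longrightarrow>
      (\<Sum>i\<in>UNIV. \<alpha> i * w i) = (\<Sum>i\<in>UNIV. \<beta> i * w i) \<Longrightarrow> \<forall>i. \<alpha> i = \<beta> i" unfolding ball_UNIV by blast
    then have "\<And>\<alpha> \<beta> :: 'm \<Rightarrow> nat. (\<forall>i. \<alpha> i \<le> d \<and> \<beta> i \<le> d) \<Longrightarrow>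
      (\<Sum>i\<in>UNIV. \<alpha> i * w i) = (\<Sum>i\<in>UNIV. \<beta> i * w i) \<Longrightarrow> \<alpha> = \<beta>" by (intro ext) blast
    then show thesis by (rule that)
  qed
  define W where "W = Max (range w)"
  have W: "w i \<le> W" for i by (simp add: W_def)
  define D where "D = d * W"
  define N where "N = (\<lambda>k. real k / real (Suc D)) ` {..D}"
  have fN: "finite N" by (simp add: N_def)
  have "inj_on (\<lambda>k. real k / real (Suc D)) {..D}" by (auto simp: inj_on_def)
  then have cN: "card N = Suc D" by (simp add: N_def card_image)
  have D: "\<exists>p. degree p \<le> D \<and> (\<forall>t. P (x + power_curve w t) = poly p t)" if "P \<in> polys_le d" for P x
    unfolding D_def by (rule polys_le_on_curve[OF W that])
  have "P = (\<lambda>_. 0)" if P: "P \<in> polys_le d" and z: "\<And>s. s \<in> N \<Longrightarrow> P (power_curve w s) = 0" for P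
  proof -
    from D[OF P, of 0] obtain p where p: "degree p \<le> D" "\<And>t. P (power_curve w t) = poly p t" by auto
    have "p = 0"
    proof (rule ccontr)
      assume "p \<noteq> 0"
      then have "card {x. poly p x = 0} \<le> degree p" "finite {x. poly p x = 0}"
        by (auto simp: card_poly_roots_bound poly_roots_finite)
      moreover have "N \<subseteq> {x. poly p x = 0}" using z p(2) by auto
      ultimately have "card N \<le> degree p" by (meson card_mono order_trans)
      then show False using cN p(1) by simp
    qed
    then show ?thesis using polys_le_eq_0_if_curve[OF w P] p(2) by simp
  qed
  moreover have "N \<subseteq> {-1..1}"
  proof
    fix s assume "s \<in> N"
    then obtain k where "k \<le> D" "s = real k / real (Suc D)" by (auto simp: N_def)
    then have "0 \<le> s" "s \<le> 1" by simp_all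
    then show "s \<in> {-1..1}" by simp
  qed
  ultimately show ?thesis using fN D
    by (intro exI[of _ w] exI[of _ D] exI[of _ N] conjI ballI allI impI) auto
qed

section \<open>The supremum over the unit cube, compared with values along translated curves\<close>

definition pnorm :: "(real ^ 'm::finite \<Rightarrow> real) \<Rightarrow> real" where
  "pnorm P = (SUP x\<in>unit_cube. \<bar>P x\<bar>)"

lemma zero_in_unit_cube: "0 \<in> unit_cube"
  by (simp add: unit_cube_def mem_box_cart)

lemma pnorm_upper:
  assumes "P \<in> polys_le d" "x \<in> unit_cube"
  shows "\<bar>P x\<bar> \<le> pnorm P"
proof -
  have "compact ((\<lambda>x. \<bar>P x\<bar>) ` unit_cube)" unfolding unit_cube_def
    by (intro compact_continuous_image continuous_intros compact_cbox
        continuous_on_subset[OF polys_le_continuous[OF assms(1)]]) auto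
  then have "bdd_above ((\<lambda>x. \<bar>P x\<bar>) ` unit_cube)" by (simp add: bounded_imp_bdd_above compact_imp_bounded)
  then show ?thesis unfolding pnorm_def using assms(2) by (rule cSUP_upper2) auto
qed

lemma pnorm_nonneg: "P \<in> polys_le d \<Longrightarrow> 0 \<le> pnorm P"
  using pnorm_upper[OF _ zero_in_unit_cube] by (meson abs_ge_zero order_trans)

lemma pnorm_least: "(\<And>x. x \<in> unit_cube \<Longrightarrow> \<bar>P x\<bar> \<le> c) \<Longrightarrow> pnorm P \<le> c"
  unfolding pnorm_def using zero_in_unit_cube by (intro cSUP_least) auto

text \<open>\<open>functional_splitting\<close> for the evaluations at the nodes, with
  \<open>W\<close> consisting of the zero function: Lagrange interpolation from points of the
  curve.\<close>

lemma exists_interpolation: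
  "\<exists>(w :: 'm::finite \<Rightarrow> nat) D N e. finite N \<and> N \<subseteq> {-1..1} \<and>
    (polys_on_curve d D w) \<and>
    (\<forall>s\<in>N. e s \<in> polys_le d) \<and>
    (\<forall>P\<in>polys_le d. \<forall>x. P x = (\<Sum>s\<in>N. P (power_curve w s) * e s x))"
proof -
  from exists_unisolvent_curve[where 'm = 'm, of d]
  obtain w :: "'m \<Rightarrow> nat" and D N where N: "finite N" "N \<subseteq> {-1..1}"
    "polys_on_curve d D w"
    and z: "\<forall>P\<in>polys_le d. (\<forall>s\<in>N. P (power_curve w s) = 0) \<longrightarrow> P = (\<lambda>_. 0)"
    by (elim exE conjE) (rule that)
  have "\<exists>e. (\<forall>s\<in>N. e s \<in> polys_le d) \<and> (\<forall>P\<in>polys_le d.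
     (\<lambda>x. P x - (\<Sum>s\<in>N. P (power_curve w s) * e s x)) \<in> {\<lambda>_. 0})"
    by (rule functional_splitting[where \<phi> = "\<lambda>s P. P (power_curve w s)", OF N(1) fsub_polys_le])
      (use z in \<open>auto simp: flin_def\<close>)
  then obtain e where e: "\<forall>s\<in>N. e s \<in> polys_le d" "\<And>P. P\<in>polys_le d \<Longrightarrow>
    (\<lambda>x. P x - (\<Sum>s\<in>N. P (power_curve w s) * e s x)) = (\<lambda>_. 0)" by auto
  have "P x = (\<Sum>s\<in>N. P (power_curve w s) * e s x)" if "P \<in> polys_le d" for P x
    using fun_cong[OF e(2)[OF that], of x] by simp
  with N e(1) show ?thesis
    by (intro exI[of _ w] exI[of _ D] exI[of _ N] exI[of _ e] conjI ballI allI) auto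
qed

lemma polys_le_bounded_on:
  assumes "P \<in> polys_le d"
  shows "\<exists>C\<ge>0. \<forall>x\<in>cball (0 :: real ^ 'm::finite) R. \<bar>P x\<bar> \<le> C"
proof -
  have "compact (P ` cball 0 R)"
    by (intro compact_continuous_image continuous_on_subset[OF polys_le_continuous[OF assms]]) auto
  then obtain C where "\<forall>x\<in>P ` cball 0 R. norm x \<le> C" using compact_imp_bounded bounded_iff by blast
  then show ?thesis by (intro exI[of _ "max C 0"]) auto
qed

text \<open>Interpolating the translate of \<open>P\<close> by \<open>x\<close> expresses
  \<open>P y\<close> through values on the curve attached to \<open>x\<close>. The basis polynomials
  are evaluated at \<open>y - x\<close>, so they are bounded uniformly, and one of the values must
  be comparable to \<open>P y\<close>. The freedom in the base point \<open>x\<close> is what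
  permits averaging over translated curves later.\<close>

lemma polys_le_interpolation_bound:
  "\<exists>(w :: 'm::finite \<Rightarrow> nat) D.
    (polys_on_curve d D w) \<and>
    (\<forall>R. \<exists>C>0. \<forall>P\<in>polys_le d. \<forall>x\<in>cball 0 R. \<forall>y\<in>cball 0 R. \<exists>s\<in>{-1..1}.
       \<bar>P y\<bar> \<le> C * \<bar>P (x + power_curve w s)\<bar>)"
proof -
  from exists_interpolation[where 'm = 'm, of d]
  obtain w :: "'m \<Rightarrow> nat" and D N e where N: "finite N" "N \<subseteq> {-1..1}"
    "polys_on_curve d D w"
    and e0: "\<forall>s\<in>N. e s \<in> polys_le d"
    and i0: "\<forall>P\<in>polys_le d. \<forall>x. P x = (\<Sum>s\<in>N. P (power_curve w s) * e s x)"
    by (elim exE conjE) (rule that)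
  note e = bspec[OF e0] and i = spec[OF bspec[OF i0]]
  have "\<exists>C>0. \<forall>P\<in>polys_le d. \<forall>x\<in>cball 0 R. \<forall>y\<in>cball 0 R. \<exists>s\<in>{-1..1}.
       \<bar>P y\<bar> \<le> C * \<bar>P (x + power_curve w s)\<bar>" for R
  proof -
    have "\<exists>C\<ge>0. \<forall>x\<in>cball 0 (2 * R). \<bar>e s x\<bar> \<le> C" if "s \<in> N" for s
      by (rule polys_le_bounded_on[OF e[OF that]])
    then obtain c where c: "\<And>s. s \<in> N \<Longrightarrow> c s \<ge> 0"
      "\<And>s x. s \<in> N \<Longrightarrow> x \<in> cball 0 (2 * R) \<Longrightarrow> \<bar>e s x\<bar> \<le> c s" by metis
    \<comment> \<open>The summand 1 makes the contradiction strict: if all values on the curve were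
      below \<open>\<bar>P y\<bar> / C\<close>, interpolation would give at most
      \<open>(C - 1) / C\<close> times \<open>\<bar>P y\<bar>\<close>.\<close>
    define C where "C = 1 + sum c N"
    have C: "C > 0" using c(1) by (simp add: C_def add_pos_nonneg sum_nonneg)
    show ?thesis
    proof (intro exI[of _ C] conjI ballI C)
      fix P :: "real ^ 'm \<Rightarrow> real" and x y :: "real ^ 'm"
      assume P: "P \<in> polys_le d" and x: "x \<in> cball 0 R" and y: "y \<in> cball 0 R"
      have yx: "y - x \<in> cball 0 (2 * R)" using x y norm_triangle_ineq4[of y x] by simp
      show "\<exists>s\<in>{-1..1}. \<bar>P y\<bar> \<le> C * \<bar>P (x + power_curve w s)\<bar>"
      proof (rule ccontr)
        assume a: "\<not> ?thesis"
        let ?b = "\<bar>P y\<bar> / C"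
        have b: "\<bar>P (x + power_curve w s)\<bar> < ?b" if "s \<in> {-1..1}" for s
          using a that C by (auto simp: field_simps not_le)
        have b0: "0 \<le> ?b" using C by simp
        have "P y = (\<Sum>s\<in>N. P (power_curve w s + x) * e s (y - x))"
          using i[OF polys_le_translate[OF P, of x], of "y - x"] by simp
        then have "\<bar>P y\<bar> \<le> (\<Sum>s\<in>N. \<bar>P (power_curve w s + x)\<bar> * \<bar>e s (y - x)\<bar>)"
          by (simp only: abs_mult[symmetric]) (rule sum_abs)
        also have "\<dots> \<le> (\<Sum>s\<in>N. ?b * c s)"
        proof (intro sum_mono mult_mono b0)
          fix s assume s: "s \<in> N"
          show "\<bar>P (power_curve w s + x)\<bar> \<le> ?b" using b[of s] s N(2) by (auto simp: add.commute)
          show "\<bar>e s (y - x)\<bar> \<le> c s" using c(2)[OF s yx] .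
        qed auto
        also have "\<dots> = ?b * (C - 1)" by (simp add: C_def sum_distrib_left)
        also have "\<dots> = \<bar>P y\<bar> - ?b" using C by (simp add: field_simps)
        finally have "?b \<le> 0" by simp
        then show False using b[of 0] by simp
      qed
    qed
  qed
  with N(3) show ?thesis by (intro exI[of _ w] exI[of _ D] conjI allI) auto
qed

lemma pnorm_bound:
  "\<exists>C>0. \<forall>P\<in>polys_le d. \<forall>y\<in>cball (0 :: real ^ 'm::finite) R. \<bar>P y\<bar> \<le> C * pnorm P"
proof -
  from polys_le_interpolation_bound[where 'm = 'm, of d]
  obtain w :: "'m \<Rightarrow> nat" where
    *: "\<forall>R. \<exists>C>0. \<forall>P\<in>polys_le d. \<forall>x\<in>cball 0 R. \<forall>y\<in>cball 0 R. \<exists>s\<in>{-1..1}.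
       \<bar>P y\<bar> \<le> C * \<bar>P (x + power_curve w s)\<bar>"
    by (elim exE conjE) (rule that)
  from spec[OF *, of "\<bar>R\<bar>"] obtain C where C1: "C > 0"
    and C2: "\<forall>P\<in>polys_le d. \<forall>x\<in>cball 0 \<bar>R\<bar>. \<forall>y\<in>cball 0 \<bar>R\<bar>. \<exists>s\<in>{-1..1}.
       \<bar>P y\<bar> \<le> C * \<bar>P (x + power_curve w s)\<bar>" by (elim exE conjE) (rule that)
  note C = C1 C2[rule_format]
  show ?thesis
  proof (intro exI[of _ C] conjI ballI C(1))
    fix P :: "real ^ 'm \<Rightarrow> real" and y :: "real ^ 'm"
    assume P: "P \<in> polys_le d" and y: "y \<in> cball 0 R"
    have "\<exists>s\<in>{-1..1}. \<bar>P y\<bar> \<le> C * \<bar>P (0 + power_curve w s)\<bar>"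
      by (rule C(2)[OF P]) (use y in auto)
    then obtain s where s: "s\<in>{-1..1}" "\<bar>P y\<bar> \<le> C * \<bar>P (power_curve w s)\<bar>" by auto
    have "power_curve w s \<in> unit_cube" using s(1) by (intro power_curve_in_unit_cube) auto
    then have "C * \<bar>P (power_curve w s)\<bar> \<le> C * pnorm P"
      using C(1) pnorm_upper[OF P] by (intro mult_left_mono) auto
    with s(2) show "\<bar>P y\<bar> \<le> C * pnorm P" by linarith
  qed
qed

text \<open>The supremum over the cube is attained at some \<open>y\<close>; the interpolation bound
  is applied to this \<open>y\<close> and an arbitrary base point. The radius is enlarged so that
  the ball contains the cube.\<close>

lemma pnorm_curve_bound:
  "\<exists>(w :: 'm::finite \<Rightarrow> nat) D.
    (polys_on_curve d D w) \<and>
    (\<forall>R. \<exists>C>0. \<forall>P\<in>polys_le d. \<forall>x\<in>cball 0 R. \<exists>s\<in>{-1..1}. pnorm P \<le> C * \<bar>P (x + power_curve w s)\<bar>)"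
proof -
  from polys_le_interpolation_bound[where 'm = 'm, of d]
  obtain w :: "'m \<Rightarrow> nat" and D where w:
    "polys_on_curve d D w"
    and *: "\<forall>R. \<exists>C>0. \<forall>P\<in>polys_le d. \<forall>x\<in>cball 0 R. \<forall>y\<in>cball 0 R. \<exists>s\<in>{-1..1}.
       \<bar>P y\<bar> \<le> C * \<bar>P (x + power_curve w s)\<bar>"
    by (elim exE conjE) (rule that)
  have "bounded (unit_cube :: (real ^ 'm) set)" unfolding unit_cube_def by (rule bounded_cbox)
  from bounded_subset_ballD[OF this, of 0] obtain r where "(unit_cube :: (real ^ 'm) set) \<subseteq> ball 0 r"
    by (elim exE conjE) (rule that)
  then have r: "(unit_cube :: (real ^ 'm) set) \<subseteq> cball 0 r" using ball_subset_cball order_trans by metis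
  have "\<exists>C>0. \<forall>P\<in>polys_le d. \<forall>x\<in>cball 0 R. \<exists>s\<in>{-1..1}. pnorm P \<le> C * \<bar>P (x + power_curve w s)\<bar>" for R
  proof -
    from spec[OF *, of "max r R"] obtain C where C1: "C > 0"
      and C2: "\<forall>P\<in>polys_le d. \<forall>x\<in>cball 0 (max r R). \<forall>y\<in>cball 0 (max r R). \<exists>s\<in>{-1..1}.
       \<bar>P y\<bar> \<le> C * \<bar>P (x + power_curve w s)\<bar>" by (elim exE conjE) (rule that)
    note C = C1 C2[rule_format]
    show ?thesis
    proof (intro exI[of _ C] conjI ballI C(1))
      fix P :: "real ^ 'm \<Rightarrow> real" and x :: "real ^ 'm"
      assume P: "P \<in> polys_le d" and x: "x \<in> cball 0 R"
      have "compact (unit_cube :: (real ^ 'm) set)" unfolding unit_cube_def by (rule compact_cbox)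
      then obtain y where y: "y \<in> unit_cube" "\<And>z. z \<in> unit_cube \<Longrightarrow> \<bar>P z\<bar> \<le> \<bar>P y\<bar>"
        using continuous_attains_sup[of unit_cube "\<lambda>x. \<bar>P x\<bar>"] zero_in_unit_cube
          continuous_on_rabs[OF continuous_on_subset[OF polys_le_continuous[OF P], of unit_cube]] by blast
      have "pnorm P \<le> \<bar>P y\<bar>" by (rule pnorm_least[OF y(2)])
      moreover have "\<exists>s\<in>{-1..1}. \<bar>P y\<bar> \<le> C * \<bar>P (x + power_curve w s)\<bar>"
        by (rule C(2)[OF P]) (use x y r in auto)
      ultimately show "\<exists>s\<in>{-1..1}. pnorm P \<le> C * \<bar>P (x + power_curve w s)\<bar>" by force
    qed
  qed
  with w show ?thesis by (intro exI[of _ w] exI[of _ D] conjI allI) auto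
qed

subsection \<open>Directional derivatives\<close>

lemma pderiv_sum: "pderiv (\<Sum>i\<in>I. p i) = (\<Sum>i\<in>I. pderiv (p i))"
  by (induction I rule: infinite_finite_induct) (simp_all add: pderiv_add)

text \<open>Interpolate at the \<open>d + 1\<close> nodes and differentiate the basis polynomials at
  0; these derivatives are the coefficients \<open>c k\<close>.\<close>

lemma numerical_differentiation:
  "\<exists>c. \<forall>p :: real poly. degree p \<le> d \<longrightarrow> poly (pderiv p) 0 = (\<Sum>k\<le>d. c k * poly p (real k / real (Suc d)))"
proof -
  let ?S = "{f. \<exists>p :: real poly. degree p \<le> d \<and> f = poly p}"
  let ?t = "\<lambda>k. real k / real (Suc d)"
  have S: "fsub ?S" unfolding fsub_def
  proof (intro conjI ballI allI)
    show "(\<lambda>_. 0) \<in> ?S" by (auto intro!: exI[of _ 0])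
  next
    fix f g assume "f \<in> ?S" "g \<in> ?S"
    then obtain p q where "degree p \<le> d" "f = poly p" "degree q \<le> d" "g = poly q" by blast
    then show "(\<lambda>x. f x + g x) \<in> ?S" by (auto intro!: exI[of _ "p + q"] degree_add_le)
  next
    fix f and a :: real assume "f \<in> ?S"
    then obtain p where "degree p \<le> d" "f = poly p" by blast
    then show "(\<lambda>x. a * f x) \<in> ?S"
      by (auto intro!: exI[of _ "smult a p"] order_trans[OF degree_smult_le])
  qed
  have z: "f \<in> {\<lambda>_. 0}" if fS: "f \<in> ?S" and 0: "\<And>k. k \<in> {..d} \<Longrightarrow> f (?t k) = 0" for f
  proof -
    obtain p where p: "degree p \<le> d" "f = poly p" using fS by blast
    have "inj_on ?t {..d}" by (auto simp: inj_on_def)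
    then have c: "card (?t ` {..d}) = Suc d" by (simp add: card_image)
    have "p = 0"
    proof (rule ccontr)
      assume "p \<noteq> 0"
      then have "card {x. poly p x = 0} \<le> degree p" "finite {x. poly p x = 0}"
        by (auto simp: card_poly_roots_bound poly_roots_finite)
      moreover have "?t ` {..d} \<subseteq> {x. poly p x = 0}" using 0 p(2) by auto
      ultimately have "card (?t ` {..d}) \<le> degree p" by (meson card_mono order_trans)
      then show False using c p(1) by simp
    qed
    then show ?thesis using p by auto
  qed
  have "\<exists>e. (\<forall>k\<in>{..d}. e k \<in> ?S) \<and> (\<forall>f\<in>?S.
     (\<lambda>x. f x - (\<Sum>k\<in>{..d}. f (?t k) * e k x)) \<in> {\<lambda>_. 0})"
    by (rule functional_splitting[where \<phi> = "\<lambda>k f. f (?t k)", OF _ S _ z]) (auto simp: flin_def)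
  then obtain e where e: "\<forall>k\<in>{..d}. e k \<in> ?S" "\<And>f. f \<in> ?S \<Longrightarrow>
     (\<lambda>x. f x - (\<Sum>k\<in>{..d}. f (?t k) * e k x)) = (\<lambda>_. 0)" by auto
  have "\<forall>k. \<exists>q. k \<le> d \<longrightarrow> e k = poly q" using e(1) by auto
  from choice[OF this] obtain q where q: "\<And>k. k \<le> d \<Longrightarrow> e k = poly (q k)" by blast
  show ?thesis
  proof (intro exI[of _ "\<lambda>k. poly (pderiv (q k)) 0"] allI impI)
    fix p :: "real poly" assume "degree p \<le> d"
    then have pS: "poly p \<in> ?S" by blast
    have "poly p = poly (\<Sum>k\<le>d. smult (poly p (?t k)) (q k))"
    proof
      fix x
      show "poly p x = poly (\<Sum>k\<le>d. smult (poly p (?t k)) (q k)) x"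
        using fun_cong[OF e(2)[OF pS], of x] q by (simp add: poly_sum)
    qed
    then have "p = (\<Sum>k\<le>d. smult (poly p (?t k)) (q k))" by (simp add: poly_eq_poly_eq_iff)
    then have "pderiv p = pderiv (\<Sum>k\<le>d. smult (poly p (?t k)) (q k))" by simp
    then have "pderiv p = (\<Sum>k\<le>d. smult (poly p (?t k)) (pderiv (q k)))"
      unfolding pderiv_sum pderiv_smult .
    then show "poly (pderiv p) 0 = (\<Sum>k\<le>d. poly (pderiv (q k)) 0 * poly p (?t k))"
      by (simp add: poly_sum mult.commute)
  qed
qed

definition ddir :: "real ^ 'm::finite \<Rightarrow> (real ^ 'm \<Rightarrow> real) \<Rightarrow> real ^ 'm \<Rightarrow> real" where
  "ddir v P x = deriv (\<lambda>t. P (x + t *\<^sub>R v)) 0"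

lemma ddir_has_derivative:
  assumes "P \<in> polys_le d"
  shows "((\<lambda>t. P (x + t *\<^sub>R v)) has_real_derivative ddir v P (x + t *\<^sub>R v)) (at t)"
proof -
  from polys_le_on_line[OF assms] obtain p where p: "\<And>t. P (x + t *\<^sub>R v) = poly p t" by metis
  have "P (x + t *\<^sub>R v + s *\<^sub>R v) = poly p (t + s)" for s
    using p[of "t + s"] by (simp add: algebra_simps)
  moreover have "((\<lambda>s. poly p (t + s)) has_real_derivative poly (pderiv p) (t + 0)) (at 0)"
    using DERIV_shift[of "poly p" "poly (pderiv p) (t + 0)" 0 t] poly_DERIV[of p "t + 0"] by (simp add: add.commute)
  ultimately have "ddir v P (x + t *\<^sub>R v) = poly (pderiv p) t" unfolding ddir_def
    by (simp add: DERIV_imp_deriv)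
  then show ?thesis using poly_DERIV[of p t] by (simp add: p)
qed

text \<open>A derivative of a polynomial is a fixed combination of translates, so it inherits their
  properties and no calculus in several variables is involved. The coefficients sum to zero, as the
  polynomial 1 shows. Hence the combination can be rewritten with differences, which lower the
  degree and which are what differencing along a direction controls.\<close>

lemma ddir_formula:
  "\<exists>c :: nat \<Rightarrow> real. (\<Sum>k\<le>d. c k) = 0 \<and> (\<forall>P\<in>polys_le d. \<forall>(x :: real ^ 'm::finite) v.
    ddir v P x = (\<Sum>k\<le>d. c k * P (x + (real k / real (Suc d)) *\<^sub>R v)))"
proof -
  obtain c where c: "\<And>p :: real poly. degree p \<le> d \<Longrightarrow>
    poly (pderiv p) 0 = (\<Sum>k\<le>d. c k * poly p (real k / real (Suc d)))"
    using numerical_differentiation by blast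
  have "(\<Sum>k\<le>d. c k) = 0" using c[of 1] by simp
  moreover have "ddir v P x = (\<Sum>k\<le>d. c k * P (x + (real k / real (Suc d)) *\<^sub>R v))"
    if P: "P \<in> polys_le d" for P and x v :: "real ^ 'm"
  proof -
    from polys_le_on_line[OF P] obtain p where p: "degree p \<le> d" "\<And>t. P (x + t *\<^sub>R v) = poly p t" by metis
    have "ddir v P x = poly (pderiv p) 0" unfolding ddir_def p(2)
      by (rule DERIV_imp_deriv) (rule poly_DERIV)
    then show ?thesis by (simp add: c[OF p(1)] p(2))
  qed
  ultimately show ?thesis by blast
qed

lemma ddir_polys_le:
  fixes P :: "real ^ 'm::finite \<Rightarrow> real"
  assumes "P \<in> polys_le d"
  shows "ddir v P \<in> polys_le (d - 1)"
proof -
  obtain c :: "nat \<Rightarrow> real" where c0: "(\<Sum>k\<le>d. c k) = 0"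
    and c: "\<And>x. ddir v P x = (\<Sum>k\<le>d. c k * P (x + (real k / real (Suc d)) *\<^sub>R v))"
    using ddir_formula[of d, where 'm='m] assms by blast
  have "ddir v P = (\<lambda>x. \<Sum>k\<le>d. c k * (P (x + (real k / real (Suc d)) *\<^sub>R v) - P x))"
  proof
    fix x
    have "(\<Sum>k\<le>d. c k * (P (x + (real k / real (Suc d)) *\<^sub>R v) - P x)) =
      (\<Sum>k\<le>d. c k * P (x + (real k / real (Suc d)) *\<^sub>R v)) - (\<Sum>k\<le>d. c k) * P x"
      by (simp only: right_diff_distrib sum_subtractf sum_distrib_right)
    then show "ddir v P x = (\<Sum>k\<le>d. c k * (P (x + (real k / real (Suc d)) *\<^sub>R v) - P x))"
      using c0 c by simp
  qed
  moreover have "(\<lambda>x. \<Sum>k\<le>d. c k * (P (x + (real k / real (Suc d)) *\<^sub>R v) - P x)) \<in> polys_le (d - 1)"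
    by (intro polys_le_sum polys_le_difference assms)
  ultimately show ?thesis by simp
qed

lemma ddir_polys_le': "P \<in> polys_le d \<Longrightarrow> ddir v P \<in> polys_le d"
  using ddir_polys_le[of P d v] polys_le_mono[of "d - 1" d] by auto

lemma ddir_add: "P \<in> polys_le d \<Longrightarrow> Q \<in> polys_le d \<Longrightarrow> ddir v (\<lambda>x. P x + Q x) x = ddir v P x + ddir v Q x"
  and ddir_scale: "P \<in> polys_le d \<Longrightarrow> ddir v (\<lambda>x. a * P x) x = a * ddir v P x"
proof -
  have D: "((\<lambda>t. P (x + t *\<^sub>R v)) has_real_derivative ddir v P x) (at 0)" if "P \<in> polys_le d" for P
    using ddir_has_derivative[OF that, of x v 0] by simp
  show "ddir v (\<lambda>x. P x + Q x) x = ddir v P x + ddir v Q x" if "P \<in> polys_le d" "Q \<in> polys_le d"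
    by (subst ddir_def, rule DERIV_imp_deriv) (intro DERIV_add D that)
  show "ddir v (\<lambda>x. a * P x) x = a * ddir v P x" if "P \<in> polys_le d"
    by (subst ddir_def, rule DERIV_imp_deriv) (intro DERIV_cmult D that)
qed

lemma ddir_zero_invariant:
  assumes "P \<in> polys_le d" "\<And>x. ddir v P x = 0"
  shows "P (x + t *\<^sub>R v) = P x"
proof -
  have "\<forall>s. ((\<lambda>t. P (x + t *\<^sub>R v)) has_real_derivative 0) (at s)"
    using ddir_has_derivative[OF assms(1), of x v] assms(2) by simp
  from DERIV_isconst_all[OF this, of t 0] show ?thesis by simp
qed

subsection \<open>Sublevel sets of one-variable polynomials\<close>

lemma complex_poly_factorization:
  fixes q :: "complex poly"
  shows "\<exists>c rs. length rs = degree q \<and> (\<forall>z. poly q z = c * (\<Prod>r\<leftarrow>rs. z - r))"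
proof (induction "degree q" arbitrary: q)
  case 0
  then obtain c where "q = [:c:]" by (metis degree_eq_zeroE)
  then show ?case by (intro exI[of _ c] exI[of _ "[]"]) auto
next
  case (Suc n)
  then have "\<not> constant (poly q)" by (simp add: constant_degree)
  then obtain r where "poly q r = 0" using fundamental_theorem_of_algebra by blast
  then obtain q' where q': "q = [:- r, 1:] * q'" by (auto simp: poly_eq_0_iff_dvd)
  then have "q' \<noteq> 0" using Suc by auto
  then have "degree q = 1 + degree q'" unfolding q' by (subst degree_mult_eq) auto
  then have "n = degree q'" using Suc.hyps(2) by simp
  from Suc.hyps(1)[OF this] obtain c rs where "length rs = degree q'"
    "\<forall>z. poly q' z = c * (\<Prod>r\<leftarrow>rs. z - r)" by blast
  then show ?case using \<open>degree q = 1 + degree q'\<close>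
    by (intro exI[of _ c] exI[of _ "r # rs"]) (auto simp: q' algebra_simps)
qed

text \<open>\<open>rs\<close> lists the complex roots, and the inequality is proved factor by
  factor. A root of modulus at most 2 is at distance at most 4 from \<open>s'\<close>; for a larger
  root the distances from \<open>s\<close> and from \<open>s'\<close> are comparable with the same
  constant 4. This is why distances from \<open>s\<close> may be truncated at 1.\<close>

lemma poly_lower_bound:
  fixes p :: "real poly"
  shows "\<exists>rs :: complex list. length rs = degree p \<and> (\<forall>s s'. \<bar>s\<bar> \<le> 1 \<longrightarrow> \<bar>s'\<bar> \<le> 1 \<longrightarrow>
    \<bar>poly p s'\<bar> * (\<Prod>r\<leftarrow>rs. min 1 (norm (of_real s - r))) \<le> 4 ^ degree p * \<bar>poly p s\<bar>)"
proof -
  define q where "q = map_poly complex_of_real p"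
  have dq: "degree q = degree p" by (simp add: q_def degree_map_poly)
  have pq: "norm (poly q (of_real s)) = \<bar>poly p s\<bar>" for s
  proof -
    have "poly q (of_real s) = of_real (poly p s)" unfolding q_def
      by (induction p) (simp_all add: map_poly_pCons)
    then show ?thesis by simp
  qed
  obtain c rs where rs: "length rs = degree q" "\<And>z. poly q z = c * (\<Prod>r\<leftarrow>rs. z - r)"
    using complex_poly_factorization by metis
  have key: "norm (of_real s' - r) * min 1 (norm (of_real s - r)) \<le> 4 * norm (of_real s - r)"
    if "\<bar>s\<bar> \<le> 1" "\<bar>s'\<bar> \<le> 1" for s s' :: real and r :: complex
  proof -
    have a: "norm (of_real s' - r) \<le> 1 + norm r"
      using norm_triangle_ineq4[of "of_real s'" r] that by simp
    have b: "norm r - 1 \<le> norm (of_real s - r)"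
      using norm_triangle_ineq2[of r "of_real s"] that by (simp add: norm_minus_commute)
    show ?thesis
    proof (cases "norm r \<le> 2")
      case True
      then have "norm (of_real s' - r) \<le> 4" using a by simp
      then show ?thesis by (intro mult_mono) auto
    next
      case False
      then have "1 + norm r \<le> 4 * norm (of_real s - r)" using b by simp
      then have "norm (of_real s' - r) \<le> 4 * norm (of_real s - r)" using a by simp
      then show ?thesis using mult_mono[of "norm (of_real s' - r)" "4 * norm (of_real s - r)" "min 1 (norm (of_real s - r))" 1]
        by simp
    qed
  qed
  have "(\<Prod>r\<leftarrow>rs. norm (of_real s' - r)) * (\<Prod>r\<leftarrow>rs. min 1 (norm (of_real s - r))) \<le>
     4 ^ length rs * (\<Prod>r\<leftarrow>rs. norm (of_real s - r))" if s: "\<bar>s\<bar> \<le> 1" "\<bar>s'\<bar> \<le> 1" for s s' :: real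
  proof (induction rs)
    case (Cons r rs)
    have "(norm (of_real s' - r) * min 1 (norm (of_real s - r))) * ((\<Prod>r\<leftarrow>rs. norm (of_real s' - r)) * (\<Prod>r\<leftarrow>rs. min 1 (norm (of_real s - r))))
      \<le> (4 * norm (of_real s - r)) * (4 ^ length rs * (\<Prod>r\<leftarrow>rs. norm (of_real s - r)))"
      by (intro mult_mono key s Cons.IH mult_nonneg_nonneg prod_list_nonneg) auto
    then show ?case by (simp add: mult_ac)
  qed auto
  moreover have n: "norm (c * (\<Prod>r\<leftarrow>rs. z - r)) = norm c * (\<Prod>r\<leftarrow>rs. norm (z - r))" for z
    by (induction rs) (auto simp: norm_mult)
  ultimately have "norm c * ((\<Prod>r\<leftarrow>rs. norm (of_real s' - r)) * (\<Prod>r\<leftarrow>rs. min 1 (norm (of_real s - r)))) \<le>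
     norm c * (4 ^ length rs * (\<Prod>r\<leftarrow>rs. norm (of_real s - r)))" if "\<bar>s\<bar> \<le> 1" "\<bar>s'\<bar> \<le> 1" for s s' :: real
    using that by (intro mult_left_mono) auto
  then have "\<forall>s s'. \<bar>s\<bar> \<le> 1 \<longrightarrow> \<bar>s'\<bar> \<le> 1 \<longrightarrow>
    \<bar>poly p s'\<bar> * (\<Prod>r\<leftarrow>rs. min 1 (norm (of_real s - r))) \<le> 4 ^ degree p * \<bar>poly p s\<bar>"
    unfolding pq[symmetric] rs(2) n using rs(1) dq by (simp add: mult_ac)
  then show ?thesis using rs(1) dq by metis
qed

text \<open>A sublevel set estimate in which the size of \<open>p\<close> is measured by its value
  at an arbitrary point \<open>t\<close>. Away from intervals of radius \<open>h\<close> about the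
  real parts of the roots, with \<open>h \<le> 1\<close>, the product of the root distances is at
  least \<open>h\<close> to the degree, and \<open>poly_lower_bound\<close> makes
  \<open>\<bar>poly p s\<bar>\<close> at least the square root of
  \<open>\<bar>poly p t\<bar>\<close>.\<close>

lemma sublevel_integral_bound:
  fixes \<epsilon> :: real
  assumes \<epsilon>: "\<epsilon> > 0"
  shows "\<exists>C>0. \<exists>\<delta>>0. \<forall>p :: real poly. degree p \<le> D \<longrightarrow> (\<forall>t\<in>{-1..1}.
    (LBINT s. indicator {-1..1} s * (1 + \<bar>poly p s\<bar>) powr - \<epsilon>) \<le> C * (1 + \<bar>poly p t\<bar>) powr - \<delta>)"
proof -
  define E where "E = real (Suc D)"
  define \<delta> where "\<delta> = min (1 / (2 * E)) (\<epsilon> / 2)"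
  have E: "E > 0" "E \<ge> 1" by (auto simp: E_def)
  have \<delta>: "\<delta> > 0" "\<delta> \<le> 1 / (2 * E)" "\<delta> \<le> \<epsilon> / 2" using E \<epsilon> by (auto simp: \<delta>_def)
  define C where "C = 2 powr \<delta> * (8 * E + 10)"
  have meas [measurable]: "borel_fun (\<lambda>s. poly p s)" for p :: "real poly"
    by (intro borel_measurable_continuous_onI continuous_intros)
  have le1: "(1 + \<bar>a\<bar>) powr - \<epsilon> \<le> 1" for a :: real
    using \<epsilon> powr_mono2'[of "-\<epsilon>" 1 "1 + \<bar>a\<bar>"] by simp
  have int: "integrable lborel (\<lambda>s. indicator {-1..1} s * (1 + \<bar>poly p s\<bar>) powr - \<epsilon>)" for p :: "real poly"
  proof (rule Bochner_Integration.integrable_bound)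
    show "integrable lborel (indicator {-1..1::real} :: real \<Rightarrow> real)" by (simp add: integrable_indicator_iff)
    show "AE s in lborel. norm (indicator {-1..1} s * (1 + \<bar>poly p s\<bar>) powr - \<epsilon>) \<le> norm (indicator {-1..1} s :: real)"
      using le1 by (intro AE_I2) (auto simp: indicator_def)
  qed measurable
  have Cpos: "C > 0" using E by (auto simp: C_def intro!: mult_pos_pos add_pos_pos)
  show ?thesis
  proof (rule exI[of _ C], rule conjI[OF Cpos], rule exI[of _ \<delta>], rule conjI[OF \<delta>(1)], intro allI impI ballI)
    fix p :: "real poly" and t :: real assume deg: "degree p \<le> D" and t: "t \<in> {-1..1}"
    define B where "B = \<bar>poly p t\<bar>"
    have B0: "B \<ge> 0" by (simp add: B_def)
    show "(LBINT s. indicator {-1..1} s * (1 + \<bar>poly p s\<bar>) powr - \<epsilon>) \<le> C * (1 + \<bar>poly p t\<bar>) powr - \<delta>"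
    proof (cases "B \<ge> 1")
      case False
      have "(LBINT s. indicator {-1..1} s * (1 + \<bar>poly p s\<bar>) powr - \<epsilon>) \<le> (LBINT s. indicator {-1..1::real} s)"
        using le1 by (intro integral_mono int) (auto simp: integrable_indicator_iff split: split_indicator)
      also have "\<dots> = 2" by simp
      also have "2 \<le> C * 2 powr - \<delta>" using E by (simp add: C_def powr_minus field_simps)
      also have "\<dots> \<le> C * (1 + \<bar>poly p t\<bar>) powr - \<delta>"
        using False B0 \<delta> Cpos by (intro mult_left_mono powr_mono2') (auto simp: B_def)
      finally show ?thesis .
    next
      case B: True
      obtain rs :: "complex list" where rs: "length rs = degree p"
        "\<And>s s'. \<bar>s\<bar> \<le> 1 \<Longrightarrow> \<bar>s'\<bar> \<le> 1 \<Longrightarrow>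
          \<bar>poly p s'\<bar> * (\<Prod>r\<leftarrow>rs. min 1 (norm (of_real s - r))) \<le> 4 ^ degree p * \<bar>poly p s\<bar>"
        using poly_lower_bound[of p] by blast
      \<comment> \<open>The factor 4 absorbs \<open>4 ^ degree p\<close>. As
        \<open>degree p < E\<close>, the power of \<open>B\<close> contained in
        \<open>h ^ degree p\<close> is at least \<open>B powr - (1/2)\<close>, which leaves a square
        root of \<open>B\<close>.\<close>
      define h where "h = 4 * B powr - (1 / (2 * E))"
      have h: "h > 0" using B by (simp add: h_def)
      let ?I = "\<lambda>r. {Re r - h..Re r + h}"
      have int1: "integrable lborel (indicator {-1..1::real} :: real \<Rightarrow> real)"
        by (simp add: integrable_indicator_iff)
      have intI: "integrable lborel (indicator (?I r) :: real \<Rightarrow> real)" for r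
        using emeasure_bounded_finite[of "?I r"] by (simp add: integrable_indicator_iff)
      \<comment> \<open>The left side never exceeds 1. The added \<open>h\<close> takes care of
        \<open>h > 1\<close>, where the root intervals say nothing; otherwise a small value of
        \<open>poly p s\<close> puts \<open>s\<close> into one of the intervals.\<close>
      have pt: "indicator {-1..1} s * (1 + \<bar>poly p s\<bar>) powr - \<epsilon> \<le>
        indicator {-1..1} s * (B powr - (\<epsilon> / 2) + h) + (\<Sum>r\<leftarrow>rs. indicator (?I r) s)" for s
      proof (cases "s \<in> {-1..1} \<and> h \<le> 1 \<and> \<bar>poly p s\<bar> < B powr (1/2)")
        case True
        have "\<exists>r\<in>set rs. norm (of_real s - r) < h"
        proof (rule ccontr)
          assume "\<not> ?thesis"
          then have ge: "h \<le> min 1 (norm (of_real s - r))" if "r \<in> set rs" for r using that True by auto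
          have "h ^ length rs \<le> (\<Prod>r\<leftarrow>rs. min 1 (norm (of_real s - r)))"
            using ge
          proof (induction rs)
            case (Cons r rs)
            have "h \<le> min 1 (norm (of_real s - r))" by (rule Cons.prems) simp
            moreover have "h ^ length rs \<le> (\<Prod>r\<leftarrow>rs. min 1 (norm (of_real s - r)))"
              by (rule Cons.IH) (rule Cons.prems, simp)
            ultimately show ?case using h by (simp del: min.bounded_iff) (intro mult_mono, auto)
          qed auto
          moreover have "B powr - (1/2) * 4 ^ length rs \<le> h ^ length rs"
          proof -
            have "h ^ length rs = 4 ^ length rs * B powr (- (1 / (2 * E)) * real (length rs))"
              using B by (simp add: h_def power_mult_distrib powr_powr flip: powr_realpow)
            moreover have "B powr - (1/2) \<le> B powr (- (1 / (2 * E)) * real (length rs))"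
              using B E rs(1) deg by (intro powr_mono) (auto simp: field_simps E_def)
            ultimately show ?thesis by (simp add: mult.commute)
          qed
          ultimately have "B powr - (1/2) * 4 ^ length rs \<le> (\<Prod>r\<leftarrow>rs. min 1 (norm (of_real s - r)))" by linarith
          then have "B * (B powr - (1/2) * 4 ^ length rs) \<le> B * (\<Prod>r\<leftarrow>rs. min 1 (norm (of_real s - r)))"
            using B0 by (rule mult_left_mono)
          also have "\<dots> \<le> 4 ^ length rs * \<bar>poly p s\<bar>" using rs(2)[of s t] rs(1) t True by (auto simp: B_def abs_le_iff)
          finally have "B * B powr - (1/2) \<le> \<bar>poly p s\<bar>" by (simp add: mult_ac)
          moreover have "B * B powr - (1/2) = B powr (1/2)"
            using B powr_add[of B 1 "-(1/2)"] by simp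
          ultimately show False using True by linarith
        qed
        then obtain r where r: "r \<in> set rs" "norm (of_real s - r) < h" by blast
        have "s \<in> ?I r" using r(2) abs_Re_le_cmod[of "of_real s - r"] by auto
        then have one: "indicator (?I r) s = (1 :: real)" by simp
        obtain xs ys where "rs = xs @ r # ys" using split_list[OF r(1)] by (elim exE) (rule that)
        then have "(\<Sum>r\<leftarrow>rs. indicator (?I r) s :: real) =
          (\<Sum>r\<leftarrow>xs. indicator (?I r) s) + (1 + (\<Sum>r\<leftarrow>ys. indicator (?I r) s))" using one by simp
        moreover have "0 \<le> (\<Sum>r\<leftarrow>zs. indicator (?I r) s :: real)" for zs by (rule sum_list_nonneg) auto
        ultimately have "1 \<le> (\<Sum>r\<leftarrow>rs. indicator (?I r) s :: real)" by (smt (verit))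
        moreover have "indicator {-1..1} s * (1 + \<bar>poly p s\<bar>) powr - \<epsilon> \<le> 1" using le1[of "poly p s"] by (auto simp: indicator_def)
        moreover have "0 \<le> indicator {-1..1} s * (B powr - (\<epsilon> / 2) + h)" using h by (simp add: indicator_def)
        ultimately show ?thesis by linarith
      next
        case False
        have nn: "0 \<le> (\<Sum>r\<leftarrow>rs. indicator (?I r) s :: real)" by (intro sum_list_nonneg) auto
        have "(1 + \<bar>poly p s\<bar>) powr - \<epsilon> \<le> B powr - (\<epsilon> / 2) + h" if s: "s \<in> {-1..1}"
        proof (cases "h \<le> 1")
          case True
          then have "B powr (1/2) \<le> 1 + \<bar>poly p s\<bar>" using False s by auto
          then have "(1 + \<bar>poly p s\<bar>) powr - \<epsilon> \<le> (B powr (1/2)) powr - \<epsilon>"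
            using B \<epsilon> by (intro powr_mono2') auto
          also have "\<dots> = B powr - (\<epsilon> / 2)" by (simp add: powr_powr)
          finally show ?thesis using h by simp
        next
          case False
          have "0 \<le> B powr - (\<epsilon> / 2)" by simp
          then show ?thesis using le1[of "poly p s"] False by linarith
        qed
        then show ?thesis using nn by (auto simp: indicator_def)
      qed
      have "(LBINT s. indicator {-1..1} s * (1 + \<bar>poly p s\<bar>) powr - \<epsilon>) \<le>
        (LBINT s. indicator {-1..1} s * (B powr - (\<epsilon> / 2) + h) + (\<Sum>r\<leftarrow>rs. indicator (?I r) s))"
      proof (rule integral_mono[OF int _ pt])
        show "integrable lborel (\<lambda>s. indicator {-1..1::real} s * (B powr - (\<epsilon> / 2) + h) + (\<Sum>r\<leftarrow>rs. indicator (?I r) s))"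
        proof (rule Bochner_Integration.integrable_add)
          show "integrable lborel (\<lambda>s. \<Sum>r\<leftarrow>rs. indicator (?I r) s :: real)"
            by (induction rs) (auto intro!: Bochner_Integration.integrable_add intI)
          show "integrable lborel (\<lambda>s. indicator {-1..1::real} s * (B powr - (\<epsilon> / 2) + h))"
            by (rule Bochner_Integration.integrable_mult_left[OF int1])
        qed
      qed
      also have "\<dots> = 2 * (B powr - (\<epsilon> / 2) + h) + real (length rs) * (2 * h)"
      proof -
        have "integrable lborel (\<lambda>s. \<Sum>r\<leftarrow>rs. indicator (?I r) s :: real) \<and>
           (LBINT s. (\<Sum>r\<leftarrow>rs. indicator (?I r) s :: real)) = real (length rs) * (2 * h)"
        proof (induction rs)
          case (Cons r rs)
          then show ?case using h
            by (auto intro!: Bochner_Integration.integrable_add intI simp: intI algebra_simps)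
        qed auto
        moreover have "integrable lborel (\<lambda>s. indicator {-1..1::real} s * (B powr - (\<epsilon> / 2) + h))"
            by (rule Bochner_Integration.integrable_mult_left[OF int1])
        ultimately show ?thesis by (subst Bochner_Integration.integral_add) simp_all
      qed
      also have "\<dots> \<le> 2 * B powr - (\<epsilon> / 2) + 2 * E * h"
      proof -
        have "real (length rs) * (2 * h) \<le> (E - 1) * (2 * h)"
          using h rs(1) deg by (intro mult_right_mono) (auto simp: E_def)
        then show ?thesis by (simp add: algebra_simps)
      qed
      also have "\<dots> \<le> 2 * B powr - \<delta> + 2 * E * (4 * B powr - \<delta>)"
        unfolding h_def using B E \<delta> by (intro add_mono mult_left_mono powr_mono) auto
      also have "\<dots> = (8 * E + 2) * B powr - \<delta>" by (simp add: algebra_simps)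
      also have "\<dots> \<le> (8 * E + 10) * ((1 + B) / 2) powr - \<delta>"
        using B \<delta> E by (intro mult_mono powr_mono2') auto
      also have "((1 + B) / 2) powr - \<delta> = 2 powr \<delta> * (1 + B) powr - \<delta>"
        using B by (simp add: powr_divide powr_minus field_simps)
      finally show ?thesis by (simp add: C_def B_def mult_ac)
    qed
  qed
qed

subsection \<open>Bounded functions with bounded support\<close>

text \<open>Enough for integrability and for Fubini with bounded kernels. The bound and the radius
  are carried explicitly because all later estimates must be uniform in the functions.\<close>

definition bdd_supp :: "real \<Rightarrow> real \<Rightarrow> ('a::euclidean_space \<Rightarrow> 'b::{banach, second_countable_topology}) \<Rightarrow> bool" where
  "bdd_supp M R f \<longleftrightarrow> f \<in> borel_measurable borel \<and> (\<forall>x. norm (f x) \<le> M) \<and> (\<forall>x. R < norm x \<longrightarrow> f x = 0)"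

lemma bdd_suppD:
  assumes "bdd_supp M R f"
  shows "borel_fun f" "norm (f x) \<le> M" "R < norm x \<Longrightarrow> f x = 0" "0 \<le> M"
  using assms order_trans[OF norm_ge_zero[of "f x"], of M] unfolding bdd_supp_def by auto

lemma bdd_supp_le_indicator:
  assumes "bdd_supp M R f"
  shows "norm (f x) \<le> M * indicator (cball 0 R) x"
  using bdd_suppD(2,3)[OF assms, of x] by (auto split: split_indicator)

lemma integrable_cball_indicator: "integrable lborel (\<lambda>x. c * indicator (cball (0 :: 'a::euclidean_space) R) x :: real)"
  using emeasure_bounded_finite[OF bounded_cball[of "0 :: 'a" R]] by (simp add: integrable_indicator_iff)

lemma bdd_supp_integrable: "bdd_supp M R f \<Longrightarrow> integrable lborel f"
proof (rule Bochner_Integration.integrable_bound)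
  assume f: "bdd_supp M R f"
  show "integrable lborel (\<lambda>x. M * indicator (cball (0 :: 'a) R) x :: real)" by (rule integrable_cball_indicator)
  show "f \<in> borel_measurable lborel" using bdd_suppD(1)[OF f] by simp
  show "AE x in lborel. norm (f x) \<le> norm (M * indicator (cball (0 :: 'a) R) x :: real)"
    using bdd_supp_le_indicator[OF f] bdd_suppD(4)[OF f] by (intro AE_I2) (auto simp: abs_mult)
qed

lemma bdd_supp_integral_le:
  fixes f :: "'a::euclidean_space \<Rightarrow> 'b::{banach, second_countable_topology}"
  assumes "bdd_supp M R f"
  shows "norm (LBINT x. f x) \<le> M * measure lborel (cball (0 :: 'a) R)"
proof -
  have "norm (LBINT x. f x) \<le> (LBINT x. norm (f x))" by (rule integral_norm_bound)
  also have "\<dots> \<le> (LBINT x. M * indicator (cball (0 :: 'a) R) x)"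
    by (intro integral_mono integrable_cball_indicator bdd_supp_le_indicator[OF assms]
        integrable_norm bdd_supp_integrable[OF assms])
  finally show ?thesis by simp
qed

lemma lborel_integral_translate:
  fixes f :: "'a::euclidean_space \<Rightarrow> 'b::{banach, second_countable_topology}"
  assumes "borel_fun f"
  shows "(LBINT x. f (x + c)) = (LBINT x. f x)"
proof -
  have "(LBINT x. f x) = (\<integral>x. f x \<partial>distr lborel borel ((+) c))" by (simp add: lborel_distr_plus)
  also have "\<dots> = (LBINT x. f (c + x))" using assms by (subst integral_distr) auto
  finally show ?thesis by (simp add: add.commute)
qed

lemma bdd_supp_Fubini:
  fixes g :: "'a::euclidean_space \<times> 'b::euclidean_space \<Rightarrow> 'c::{banach, second_countable_topology}"
  assumes "bdd_supp M R g"
  shows "(LBINT x. (LBINT y. g (x, y))) = (LBINT y. (LBINT x. g (x, y)))"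
    and "integrable lborel (\<lambda>x. \<integral>y. g (x, y) \<partial>lborel)"
    and "integrable lborel (\<lambda>y. \<integral>x. g (x, y) \<partial>lborel)"
proof -
  have i: "integrable (lborel \<Otimes>\<^sub>M lborel) (case_prod (\<lambda>x y. g (x, y)))"
    using bdd_supp_integrable[OF assms] by (simp add: lborel_prod)
  show "(LBINT x. (LBINT y. g (x, y))) = (LBINT y. (LBINT x. g (x, y)))"
    using lborel_pair.Fubini_integral[OF i] by simp
  show "integrable lborel (\<lambda>x. \<integral>y. g (x, y) \<partial>lborel)" by (rule lborel_pair.integrable_fst[OF i])
  show "integrable lborel (\<lambda>y. \<integral>x. g (x, y) \<partial>lborel)" by (rule lborel_pair.integrable_snd[OF i])
qed

text \<open>Each translate of \<open>f\<close> has the same integral, and Fubini exchanges the two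
  integrations. The averaging arguments below use this with \<open>\<gamma>\<close> a segment or the
  power curve.\<close>

lemma bdd_supp_averaging:
  fixes f :: "'a::euclidean_space \<Rightarrow> 'b::{banach, second_countable_topology}"
  assumes f: "bdd_supp M R f" and k: "bdd_supp K S k"
    and \<gamma>: "borel_fun \<gamma>" "\<And>s :: real. \<bar>s\<bar> \<le> S \<Longrightarrow> norm (\<gamma> s) \<le> G"
  shows "(LBINT x. (LBINT s. k s *\<^sub>R f (x + \<gamma> s))) = (LBINT s. k s) *\<^sub>R (LBINT x. f x)"
    and "integrable lborel (\<lambda>x. \<integral>s. k s *\<^sub>R f (x + \<gamma> s) \<partial>lborel)"
proof -
  note [measurable] = bdd_suppD(1)[OF f] bdd_suppD(1)[OF k] \<gamma>(1)
  define g where "g = (\<lambda>p :: 'a \<times> real. k (snd p) *\<^sub>R f (fst p + \<gamma> (snd p)))"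
  have "(\<lambda>p. k (snd p) *\<^sub>R f (fst p + \<gamma> (snd p))) \<in> borel_measurable ((borel :: 'a measure) \<Otimes>\<^sub>M (borel :: real measure))"
    by measurable
  then have gm: "borel_fun g" by (simp add: g_def borel_prod)
  have "bdd_supp (K * M) (R + G + S) g" unfolding bdd_supp_def
  proof (intro conjI allI impI gm)
    fix p :: "'a \<times> real"
    show "norm (g p) \<le> K * M" unfolding g_def norm_scaleR
      using bdd_suppD(2,4)[OF f] bdd_suppD(2,4)[OF k] by (intro mult_mono) auto
    assume p: "R + G + S < norm p"
    show "g p = 0"
    proof (rule ccontr)
      assume "g p \<noteq> 0"
      then have "k (snd p) \<noteq> 0" "f (fst p + \<gamma> (snd p)) \<noteq> 0" by (auto simp: g_def)
      then have 1: "\<bar>snd p\<bar> \<le> S" "norm (fst p + \<gamma> (snd p)) \<le> R"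
        using bdd_suppD(3)[OF k, of "snd p"] bdd_suppD(3)[OF f, of "fst p + \<gamma> (snd p)"] by force+
      have "norm p \<le> norm (fst p) + norm (snd p)" using norm_Pair_le[of "fst p" "snd p"] by simp
      moreover have "norm (fst p) \<le> norm (fst p + \<gamma> (snd p)) + norm (\<gamma> (snd p))"
        using norm_triangle_ineq4[of "fst p + \<gamma> (snd p)" "\<gamma> (snd p)"] by simp
      ultimately show False using 1 \<gamma>(2)[OF 1(1)] p by simp
    qed
  qed
  note F = bdd_supp_Fubini[OF this]
  show "integrable lborel (\<lambda>x. \<integral>s. k s *\<^sub>R f (x + \<gamma> s) \<partial>lborel)" using F(2) by (simp add: g_def)
  have "(LBINT x. (LBINT s. k s *\<^sub>R f (x + \<gamma> s))) = (LBINT s. (LBINT x. k s *\<^sub>R f (x + \<gamma> s)))"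
    using F(1) by (simp add: g_def)
  also have "\<dots> = (LBINT s. k s *\<^sub>R (LBINT x. f x))"
    using lborel_integral_translate[OF bdd_suppD(1)[OF f]] by (simp add: integral_scaleR_right)
  also have "\<dots> = (LBINT s. k s) *\<^sub>R (LBINT x. f x)"
    using bdd_supp_integrable[OF k] by (rule integral_scaleR_left)
  finally show "(LBINT x. (LBINT s. k s *\<^sub>R f (x + \<gamma> s))) = (LBINT s. k s) *\<^sub>R (LBINT x. f x)" .
qed

lemma bdd_supp_indicator: "bdd_supp 1 (max \<bar>a\<bar> \<bar>b\<bar>) (indicator {a..b::real} :: real \<Rightarrow> real)"
  by (auto simp: bdd_supp_def indicator_def)

text \<open>Averaging over translates of the power curve reduces the integral over the ball to
  one-variable sublevel integrals, one for each base point. On every such curve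
  \<open>\<bar>Q\<bar>\<close> reaches a fixed fraction of \<open>pnorm Q\<close>, which supplies
  the point \<open>t\<close> for the one-variable estimate.\<close>

lemma negative_power_integral_bound:
  assumes \<epsilon>: "\<epsilon> > 0"
  shows "\<exists>C>0. \<exists>\<delta>>0. \<forall>Q \<in> polys_le d.
    (LBINT x. indicator (cball (0 :: real ^ 'm::finite) R) x * (1 + \<bar>Q x\<bar>) powr - \<epsilon>) \<le> C * (1 + pnorm Q) powr - \<delta>"
proof -
  obtain w :: "'m \<Rightarrow> nat" and D where
    w1: "polys_on_curve d D w" and
    w2: "\<forall>R. \<exists>C>0. \<forall>P\<in>polys_le d. \<forall>x\<in>cball 0 R. \<exists>s\<in>{-1..1}. pnorm P \<le> C * \<bar>P (x + power_curve w s)\<bar>"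
    using pnorm_curve_bound[where 'm = 'm, of d] by (elim exE conjE) (rule that)
  obtain G where G: "\<And>s. \<bar>s\<bar> \<le> 1 \<Longrightarrow> norm (power_curve w s) \<le> G"
  proof -
    have "compact (power_curve w ` {-1..1})"
      by (intro compact_continuous_image continuous_on_subset[OF continuous_power_curve]) auto
    then obtain G where "\<forall>x\<in>power_curve w ` {-1..1}. norm x \<le> G" using compact_imp_bounded bounded_iff by blast
    then show thesis by (intro that[of G]) (auto simp: abs_le_iff)
  qed
  have G0: "0 \<le> G" using order_trans[OF norm_ge_zero G[of 0]] by simp
  from spec[OF w2, of "R + G"] obtain C0 where C0: "C0 > 0"
    "\<forall>P\<in>polys_le d. \<forall>x\<in>cball 0 (R + G). \<exists>s\<in>{-1..1}. pnorm P \<le> C0 * \<bar>P (x + power_curve w s)\<bar>"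
    by (elim exE conjE) (rule that)
  from sublevel_integral_bound[OF \<epsilon>, of D] obtain C1 \<delta> where C1: "C1 > 0" "\<delta> > 0"
    "\<forall>p :: real poly. degree p \<le> D \<longrightarrow> (\<forall>t\<in>{-1..1}.
    (LBINT s. indicator {-1..1} s * (1 + \<bar>poly p s\<bar>) powr - \<epsilon>) \<le> C1 * (1 + \<bar>poly p t\<bar>) powr - \<delta>)"
    by (elim exE conjE) (rule that)
  define C0' where "C0' = max C0 1"
  define V where "V = measure lborel (cball (0 :: real ^ 'm) (R + G))"
  define C where "C = (V + 1) * (C1 * C0' powr \<delta>)"
  have V: "V \<ge> 0" by (simp add: V_def)
  have C0': "C0' \<ge> 1" "C0' \<ge> C0" by (auto simp: C0'_def)
  have Cpos: "C > 0" using V C1 C0' by (auto simp: C_def intro!: mult_pos_pos add_nonneg_pos)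
  have le1: "(1 + \<bar>a\<bar>) powr - \<epsilon> \<le> 1" for a :: real
    using \<epsilon> powr_mono2'[of "-\<epsilon>" 1 "1 + \<bar>a\<bar>"] by simp
  show ?thesis
  proof (rule exI[of _ C], rule conjI[OF Cpos], rule exI[of _ \<delta>], rule conjI[OF C1(2)], rule ballI)
    fix Q :: "real ^ 'm \<Rightarrow> real" assume Q: "Q \<in> polys_le d"
    have [measurable]: "borel_fun Q"
      by (rule borel_measurable_continuous_onI[OF polys_le_continuous[OF Q]])
    have [measurable]: "borel_fun (power_curve w)"
      by (rule borel_measurable_continuous_onI[OF continuous_power_curve])
    define g where "g = (\<lambda>x. (1 + \<bar>Q x\<bar>) powr - \<epsilon>)"
    define f where "f = (\<lambda>x. indicator (cball (0 :: real ^ 'm) R) x * g x)"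
    define a where "a = (\<lambda>x. \<integral>s. indicator {-1..1} s *\<^sub>R f (x + power_curve w s) \<partial>lborel)"
    have fm: "borel_fun (\<lambda>x. indicator (cball 0 R) x * (1 + \<bar>Q x\<bar>) powr - \<epsilon>)"
      by (intro borel_measurable_times borel_measurable_indicator) (simp, measurable)
    have f: "bdd_supp 1 R f" unfolding bdd_supp_def f_def g_def
      using le1 fm by (auto split: split_indicator)
    have k: "bdd_supp 1 1 (indicator {-1..1::real} :: real \<Rightarrow> real)" using bdd_supp_indicator[of "-1" 1] by simp
    have avg: "(LBINT x. a x) = 2 * (LBINT x. f x)" "integrable lborel a"
      using bdd_supp_averaging[OF f k, of "power_curve w" G] G by (auto simp: a_def)
    have fb: "f x \<le> g x" "0 \<le> f x" for x by (auto simp: f_def g_def split: split_indicator)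
    have le: "a x \<le> C1 * C0' powr \<delta> * (1 + pnorm Q) powr - \<delta> * indicator (cball 0 (R + G)) x" for x
    proof (cases "norm x \<le> R + G")
      case False
      have "indicator {-1..1} s *\<^sub>R f (x + power_curve w s) = 0" for s
      proof (cases "\<bar>s\<bar> \<le> 1")
        case True
        have "norm x \<le> norm (x + power_curve w s) + norm (power_curve w s)"
          using norm_triangle_ineq4[of "x + power_curve w s" "power_curve w s"] by simp
        then have "R < norm (x + power_curve w s)" using False G[OF True] by simp
        then show ?thesis using bdd_suppD(3)[OF f] by simp
      qed (auto simp: indicator_def abs_le_iff)
      then have "a x = (\<integral>s. 0 \<partial>(lborel :: real measure))" unfolding a_def
        by (intro Bochner_Integration.integral_cong) auto
      then show ?thesis using False by simp
    next
      case True
      from w1 Q obtain p where p: "degree p \<le> D" "\<And>t. Q (x + power_curve w t) = poly p t" by blast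
      have "x \<in> cball 0 (R + G)" using True by simp
      from bspec[OF bspec[OF C0(2) Q] this] obtain t where
        t: "t \<in> {-1..1}" "pnorm Q \<le> C0 * \<bar>Q (x + power_curve w t)\<bar>" by (elim bexE) (rule that)
      have "a x \<le> (LBINT s. indicator {-1..1} s * (1 + \<bar>poly p s\<bar>) powr - \<epsilon>)" unfolding a_def
      proof (rule integral_mono)
        have m: "borel_fun (\<lambda>s. poly p s)"
          by (intro borel_measurable_continuous_onI continuous_intros)
        have "bdd_supp 1 1 (\<lambda>s. indicator {-1..1} s * (1 + \<bar>poly p s\<bar>) powr - \<epsilon>)"
          unfolding bdd_supp_def using m le1 by (auto split: split_indicator)
        then show "integrable lborel (\<lambda>s. indicator {-1..1} s * (1 + \<bar>poly p s\<bar>) powr - \<epsilon>)" by (rule bdd_supp_integrable)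
        have "bdd_supp 1 1 (\<lambda>s. indicator {-1..1} s *\<^sub>R f (x + power_curve w s))"
          unfolding bdd_supp_def
        proof (intro conjI allI impI)
          show "borel_fun (\<lambda>s. indicator {-1..1} s *\<^sub>R f (x + power_curve w s))"
            using bdd_suppD(1)[OF f] by measurable
          show "norm (indicator {-1..1} s *\<^sub>R f (x + power_curve w s)) \<le> 1" for s
            using bdd_suppD(2)[OF f, of "x + power_curve w s"] by (auto split: split_indicator)
        qed (auto split: split_indicator)
        then show "integrable lborel (\<lambda>s. indicator {-1..1} s *\<^sub>R f (x + power_curve w s))" by (rule bdd_supp_integrable)
        show "indicator {-1..1} s *\<^sub>R f (x + power_curve w s) \<le> indicator {-1..1} s * (1 + \<bar>poly p s\<bar>) powr - \<epsilon>" for s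
          using fb(1)[of "x + power_curve w s"] by (auto simp: g_def p(2) split: split_indicator)
      qed
      also have "\<dots> \<le> C1 * (1 + \<bar>poly p t\<bar>) powr - \<delta>" using C1(3) p(1) t(1) by blast
      also have "\<dots> \<le> C1 * (C0' powr \<delta> * (1 + pnorm Q) powr - \<delta>)"
      proof (rule mult_left_mono)
        have pn: "0 \<le> pnorm Q" by (rule pnorm_nonneg[OF Q])
        have "C0 * \<bar>poly p t\<bar> \<le> C0' * \<bar>poly p t\<bar>" using C0' by (intro mult_right_mono) auto
        then have "pnorm Q \<le> C0' * \<bar>poly p t\<bar>" using t(2) p(2) by simp
        then have "(1 + pnorm Q) / C0' \<le> 1 + \<bar>poly p t\<bar>" using C0' by (simp add: field_simps)
        then have "(1 + \<bar>poly p t\<bar>) powr - \<delta> \<le> ((1 + pnorm Q) / C0') powr - \<delta>"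
          using C0' pn C1(2) by (intro powr_mono2') auto
        also have "\<dots> = C0' powr \<delta> * (1 + pnorm Q) powr - \<delta>"
          using C0' pn by (simp add: powr_divide powr_minus field_simps)
        finally show "(1 + \<bar>poly p t\<bar>) powr - \<delta> \<le> C0' powr \<delta> * (1 + pnorm Q) powr - \<delta>" .
      qed (use C1 in auto)
      finally show ?thesis using True by (simp add: mult.assoc)
    qed
    have "2 * (LBINT x. f x) \<le> (LBINT x. C1 * C0' powr \<delta> * (1 + pnorm Q) powr - \<delta> * indicator (cball (0 :: real ^ 'm) (R + G)) x)"
      unfolding avg(1)[symmetric] by (rule integral_mono[OF avg(2) integrable_cball_indicator le])
    also have "\<dots> = C1 * C0' powr \<delta> * (1 + pnorm Q) powr - \<delta> * V" by (simp add: V_def)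
    also have "\<dots> \<le> C1 * C0' powr \<delta> * (1 + pnorm Q) powr - \<delta> * (V + 1)"
      using C1 by (intro mult_left_mono) auto
    also have "\<dots> = C * (1 + pnorm Q) powr - \<delta>" by (simp add: C_def mult_ac)
    finally have "2 * (LBINT x. f x) \<le> C * (1 + pnorm Q) powr - \<delta>" .
    moreover have "0 \<le> (LBINT x. f x)" using fb(2) by (intro integral_nonneg_AE) auto
    ultimately have "(LBINT x. f x) \<le> C * (1 + pnorm Q) powr - \<delta>" by linarith
    then show "(LBINT x. indicator (cball 0 R) x * (1 + \<bar>Q x\<bar>) powr - \<epsilon>) \<le> C * (1 + pnorm Q) powr - \<delta>"
      by (simp add: f_def g_def)
  qed
qed

lemma bdd_supp_mult_left:
  fixes f g :: "'a::euclidean_space \<Rightarrow> complex"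
  assumes "borel_fun f" "\<And>x. norm (f x) \<le> 1" "bdd_supp M R g"
  shows "bdd_supp M R (\<lambda>x. f x * g x)"
  unfolding bdd_supp_def
proof (intro conjI allI impI)
  show "borel_fun (\<lambda>x. f x * g x)" using assms(1) bdd_suppD(1)[OF assms(3)] by measurable
  fix x
  show "norm (f x * g x) \<le> M"
    using mult_mono[OF assms(2)[of x] bdd_suppD(2)[OF assms(3), of x]] by (simp add: norm_mult)
  show "R < norm x \<Longrightarrow> f x * g x = 0" using bdd_suppD(3)[OF assms(3)] by simp
qed

lemma bdd_supp_mono: "bdd_supp M R f \<Longrightarrow> M \<le> M' \<Longrightarrow> R \<le> R' \<Longrightarrow> bdd_supp M' R' f"
  unfolding bdd_supp_def by (auto intro: order_trans)

lemma borel_measurable_cnj [measurable]: "borel_fun cnj"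
  by (intro borel_measurable_continuous_onI continuous_intros)

text \<open>Cauchy-Schwarz against the indicator of the ball, read off from the nonnegative integral
  of the squared deviation of \<open>norm (h x)\<close> from its mean. The mean divides by the
  measure of the ball, so a null ball is treated separately.\<close>

lemma square_integral_le:
  fixes h :: "'a::euclidean_space \<Rightarrow> complex"
  assumes h: "bdd_supp M R h"
  shows "(LBINT x. norm (h x))\<^sup>2 \<le> measure lborel (cball (0 :: 'a) R) * (LBINT x. (norm (h x))\<^sup>2)"
proof -
  define V where "V = measure lborel (cball (0 :: 'a) R)"
  define I where "I = (LBINT x. norm (h x))"
  have i1: "integrable lborel (\<lambda>x. norm (h x))" by (intro integrable_norm bdd_supp_integrable[OF h])
  have "bdd_supp (M\<^sup>2) R (\<lambda>x. (norm (h x))\<^sup>2)"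
    using h unfolding bdd_supp_def by (auto intro!: power_mono)
  then have i2: "integrable lborel (\<lambda>x. (norm (h x))\<^sup>2)" by (rule bdd_supp_integrable)
  show ?thesis
  proof (cases "V = 0")
    case True
    have "I \<le> M * V" using bdd_supp_integral_le[of M R "\<lambda>x. norm (h x)"] h
      by (auto simp: I_def V_def bdd_supp_def)
    moreover have "I \<ge> 0" by (simp add: I_def)
    ultimately have "I = 0" using True by simp
    then show ?thesis unfolding I_def[symmetric] V_def[symmetric] using True by simp
  next
    case False
    then have V: "V > 0" by (simp add: V_def zero_less_measure_iff)
    define c where "c = I / V"
    have "0 \<le> (LBINT x. (norm (h x) - c * indicator (cball 0 R) x)\<^sup>2)"
      by (rule integral_nonneg_AE) simp
    also have "\<dots> = (LBINT x. (norm (h x))\<^sup>2 - 2 * c * norm (h x) + c\<^sup>2 * indicator (cball 0 R) x)"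
      using bdd_suppD(3)[OF h] by (intro Bochner_Integration.integral_cong) (auto simp: power2_diff split: split_indicator)
    also have "\<dots> = (LBINT x. (norm (h x))\<^sup>2) - 2 * c * I + c\<^sup>2 * V"
    proof -
      have "(LBINT x. (norm (h x))\<^sup>2 - 2 * c * norm (h x) + c\<^sup>2 * indicator (cball 0 R) x) =
        (LBINT x. (norm (h x))\<^sup>2 - 2 * c * norm (h x)) + (LBINT x. c\<^sup>2 * indicator (cball (0 :: 'a) R) x)"
        by (intro Bochner_Integration.integral_add Bochner_Integration.integrable_diff i2 integrable_mult_right i1 integrable_cball_indicator)
      also have "(LBINT x. (norm (h x))\<^sup>2 - 2 * c * norm (h x)) = (LBINT x. (norm (h x))\<^sup>2) - 2 * c * I"
        using i1 i2 by (subst Bochner_Integration.integral_diff) (auto simp: I_def)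
      finally show ?thesis by (simp add: V_def)
    qed
    also have "\<dots> = (LBINT x. (norm (h x))\<^sup>2) - I\<^sup>2 / V"
      using V by (simp add: c_def power2_eq_square field_simps)
    finally show ?thesis using V by (simp add: I_def V_def field_simps)
  qed
qed

section \<open>Van der Corput differencing along a direction\<close>

lemma borel_measurable_lborel_integral_fst:
  fixes f :: "'a::euclidean_space \<Rightarrow> 'b::euclidean_space \<Rightarrow> 'c::{banach, second_countable_topology}"
  assumes "case_prod f \<in> borel_measurable (borel \<Otimes>\<^sub>M borel)"
  shows "borel_fun (\<lambda>x. \<integral>y. f x y \<partial>lborel)"
proof -
  have "(\<lambda>x. \<integral>y. f x y \<partial>lborel) \<in> borel_measurable lborel"
    by (rule lborel.borel_measurable_lebesgue_integral) (use assms in simp)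
  then show ?thesis by simp
qed

text \<open>As \<open>F\<close> is constant along \<open>v\<close>, averaging the integrand over a
  unit segment in that direction acts on \<open>G\<close> alone. Cauchy-Schwarz then discards
  \<open>F\<close>, and the square of the average expands into correlations of \<open>G\<close> with
  its translates, which depend only on the difference of two parameters in [0, 1].\<close>

lemma van_der_Corput_inequality:
  fixes F G :: "'a::euclidean_space \<Rightarrow> complex" and v :: 'a
  assumes F: "borel_fun F" "\<And>x. norm (F x) \<le> 1" "\<And>x t. F (x + t *\<^sub>R v) = F x"
    and G: "bdd_supp M R G"
  shows "(norm (LBINT x. F x * G x))\<^sup>2 \<le> measure lborel (cball (0 :: 'a) (R + norm v)) *
    (LBINT t. indicator {-1..1} t * norm (LBINT x. G x * cnj (G (x + t *\<^sub>R v))))"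
proof -
  let ?k = "indicator {0..1::real} :: real \<Rightarrow> real"
  note [measurable] = F(1) bdd_suppD(1)[OF G]
  define a where "a = (\<lambda>x. \<integral>s. ?k s *\<^sub>R G (x + s *\<^sub>R v) \<partial>lborel)"
  define J where "J = (\<lambda>t. \<integral>x. G x * cnj (G (x + t *\<^sub>R v)) \<partial>lborel)"
  have k: "bdd_supp 1 1 ?k" using bdd_supp_indicator[of 0 1] by simp
  have M0: "0 \<le> M" by (rule bdd_suppD(4)[OF G])
  have \<gamma>: "borel_fun (\<lambda>s. s *\<^sub>R v)" by measurable
  have FG: "bdd_supp M R (\<lambda>x. F x * G x)" by (rule bdd_supp_mult_left[OF F(1,2) G])
  have a_sup: "bdd_supp M (R + norm v) a" unfolding bdd_supp_def
  proof (intro conjI allI impI)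
    show "borel_fun a" unfolding a_def
      by (rule borel_measurable_lborel_integral_fst) measurable
    fix x
    have bs: "bdd_supp M 1 (\<lambda>s. ?k s *\<^sub>R G (x + s *\<^sub>R v))" unfolding bdd_supp_def
    proof (intro conjI allI impI)
      show "borel_fun (\<lambda>s. ?k s *\<^sub>R G (x + s *\<^sub>R v))" by measurable
      show "norm (?k s *\<^sub>R G (x + s *\<^sub>R v)) \<le> M" for s
        using bdd_suppD(2)[OF G, of "x + s *\<^sub>R v"] M0 by (auto split: split_indicator)
    qed (auto split: split_indicator)
    have "norm (a x) \<le> (LBINT s. norm (?k s *\<^sub>R G (x + s *\<^sub>R v)))" unfolding a_def by (rule integral_norm_bound)
    also have "\<dots> \<le> (LBINT s. M * ?k s)"
    proof (rule integral_mono)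
      show "integrable lborel (\<lambda>s. norm (?k s *\<^sub>R G (x + s *\<^sub>R v)))"
        by (intro integrable_norm bdd_supp_integrable[OF bs])
      show "integrable lborel (\<lambda>s. M * ?k s)" using bdd_supp_integrable[OF k] by simp
      show "norm (?k s *\<^sub>R G (x + s *\<^sub>R v)) \<le> M * ?k s" for s
        using bdd_suppD(2)[OF G, of "x + s *\<^sub>R v"] M0 by (auto split: split_indicator)
    qed
    finally show "norm (a x) \<le> M" by simp
    assume x: "R + norm v < norm x"
    have "?k s *\<^sub>R G (x + s *\<^sub>R v) = 0" for s
    proof (cases "s \<in> {0..1}")
      case True
      have "norm (s *\<^sub>R v) \<le> norm v" using True by (simp add: mult_left_le_one_le)
      moreover have "norm x \<le> norm (x + s *\<^sub>R v) + norm (s *\<^sub>R v)"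
        using norm_triangle_ineq4[of "x + s *\<^sub>R v" "s *\<^sub>R v"] by simp
      ultimately show ?thesis using bdd_suppD(3)[OF G, of "x + s *\<^sub>R v"] x by simp
    qed simp
    then have "a x = (\<integral>s. 0 \<partial>(lborel :: real measure))" unfolding a_def
      by (intro Bochner_Integration.integral_cong) auto
    then show "a x = 0" by simp
  qed
  have nv: "norm (s *\<^sub>R v) \<le> norm v" if "\<bar>s\<bar> \<le> 1" for s
    using that by (simp add: mult_left_le_one_le)
  have Fa: "(LBINT s. ?k s *\<^sub>R (F x * G (x + s *\<^sub>R v))) = F x * a x" for x
    unfolding a_def by (subst integral_mult_right_zero[symmetric]) simp
  have "(LBINT x. (LBINT s. ?k s *\<^sub>R (F (x + s *\<^sub>R v) * G (x + s *\<^sub>R v)))) = (LBINT s. ?k s) *\<^sub>R (LBINT x. F x * G x)"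
    by (rule bdd_supp_averaging(1)[OF FG k \<gamma> nv])
  then have "(LBINT x. F x * G x) = (LBINT x. F x * a x)"
    unfolding F(3) Fa by simp
  then have 1: "norm (LBINT x. F x * G x) \<le> (LBINT x. norm (a x))"
  proof -
    assume e: "(LBINT x. F x * G x) = (LBINT x. F x * a x)"
    have Fa: "bdd_supp M (R + norm v) (\<lambda>x. F x * a x)" by (rule bdd_supp_mult_left[OF F(1,2) a_sup])
    have "norm (LBINT x. F x * a x) \<le> (LBINT x. norm (F x * a x))" by (rule integral_norm_bound)
    also have "\<dots> \<le> (LBINT x. norm (a x))"
    proof (rule integral_mono)
      show "norm (F x * a x) \<le> norm (a x)" for x
        using mult_right_mono[OF F(2)[of x], of "norm (a x)"] by (simp add: norm_mult)
    qed (intro integrable_norm bdd_supp_integrable[OF Fa] bdd_supp_integrable[OF a_sup])+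
    finally show ?thesis using e by simp
  qed
  have sq: "(LBINT x. norm (a x))\<^sup>2 \<le> measure lborel (cball (0 :: 'a) (R + norm v)) * (LBINT x. (norm (a x))\<^sup>2)"
    by (rule square_integral_le[OF a_sup])
  have Jb: "norm (J t) \<le> M * M * measure lborel (cball (0 :: 'a) R)" for t
  proof -
    have "bdd_supp (M * M) R (\<lambda>x. G x * cnj (G (x + t *\<^sub>R v)))" unfolding bdd_supp_def
    proof (intro conjI allI impI)
      show "borel_fun (\<lambda>x. G x * cnj (G (x + t *\<^sub>R v)))" by measurable
      show "norm (G x * cnj (G (x + t *\<^sub>R v))) \<le> M * M" for x
        unfolding norm_mult complex_mod_cnj by (intro mult_mono bdd_suppD(2)[OF G] M0) auto
      show "R < norm x \<Longrightarrow> G x * cnj (G (x + t *\<^sub>R v)) = 0" for x using bdd_suppD(3)[OF G] by simp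
    qed
    from bdd_supp_integral_le[OF this] show ?thesis by (simp add: J_def)
  qed
  have Jm [measurable]: "borel_fun J" unfolding J_def
    by (rule borel_measurable_lborel_integral_fst) measurable
  have Gcv: "bdd_supp (M * M) (R + norm v) (\<lambda>x. G (x + s *\<^sub>R v) * cnj (a x))" for s
    unfolding bdd_supp_def
  proof (intro conjI allI impI)
    note [measurable] = bdd_suppD(1)[OF a_sup]
    show "borel_fun (\<lambda>x. G (x + s *\<^sub>R v) * cnj (a x))" by measurable
    show "norm (G (x + s *\<^sub>R v) * cnj (a x)) \<le> M * M" for x
      unfolding norm_mult complex_mod_cnj by (intro mult_mono bdd_suppD(2)[OF G] bdd_suppD(2)[OF a_sup] M0) auto
    show "R + norm v < norm x \<Longrightarrow> G (x + s *\<^sub>R v) * cnj (a x) = 0" for x using bdd_suppD(3)[OF a_sup] by simp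
  qed
  have inner: "(LBINT x. G (x + s *\<^sub>R v) * cnj (a x)) = (LBINT s'. ?k s' *\<^sub>R J (s' - s))" for s
  proof -
    have "(LBINT x. (LBINT s'. ?k s' *\<^sub>R (G (x + s *\<^sub>R v) * cnj (G (x + s' *\<^sub>R v))))) =
      (LBINT s'. (LBINT x. ?k s' *\<^sub>R (G (x + s *\<^sub>R v) * cnj (G (x + s' *\<^sub>R v)))))"
    proof -
      let ?g = "\<lambda>p :: 'a \<times> real. ?k (snd p) *\<^sub>R (G (fst p + s *\<^sub>R v) * cnj (G (fst p + snd p *\<^sub>R v)))"
      have "?g \<in> borel_measurable (borel \<Otimes>\<^sub>M borel)" by measurable
      then have gm: "borel_fun ?g" by (simp add: borel_prod)
      have "bdd_supp (M * M) (R + norm v + 1) ?g" unfolding bdd_supp_def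
      proof (intro conjI allI impI gm)
        fix p :: "'a \<times> real"
        have "norm (G (fst p + s *\<^sub>R v) * cnj (G (fst p + snd p *\<^sub>R v))) \<le> M * M"
          unfolding norm_mult complex_mod_cnj by (intro mult_mono bdd_suppD(2)[OF G] M0) auto
        then show "norm (?g p) \<le> M * M" using M0 by (auto split: split_indicator)
        assume p: "R + norm v + 1 < norm p"
        show "?g p = 0"
        proof (rule ccontr)
          assume "?g p \<noteq> 0"
          then have 1: "\<bar>snd p\<bar> \<le> 1" "norm (fst p + snd p *\<^sub>R v) \<le> R"
            using bdd_suppD(3)[OF G, of "fst p + snd p *\<^sub>R v"] by (force split: split_indicator_asm)+
          have "norm p \<le> norm (fst p) + norm (snd p)" using norm_Pair_le[of "fst p" "snd p"] by simp
          moreover have "norm (fst p) \<le> norm (fst p + snd p *\<^sub>R v) + norm (snd p *\<^sub>R v)"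
            using norm_triangle_ineq4[of "fst p + snd p *\<^sub>R v" "snd p *\<^sub>R v"] by simp
          ultimately show False using 1 nv[OF 1(1)] p by simp
        qed
      qed
      from bdd_supp_Fubini(1)[OF this] show ?thesis by simp
    qed
    moreover have "(LBINT s'. ?k s' *\<^sub>R (G (x + s *\<^sub>R v) * cnj (G (x + s' *\<^sub>R v)))) = G (x + s *\<^sub>R v) * cnj (a x)" for x
    proof -
      have "cnj (a x) = (LBINT s'. ?k s' *\<^sub>R cnj (G (x + s' *\<^sub>R v)))" unfolding a_def
        by (simp flip: Bochner_Integration.integral_cnj)
      then show ?thesis by (simp flip: integral_mult_right_zero)
    qed
    moreover have "(LBINT x. G (x + s *\<^sub>R v) * cnj (G (x + s' *\<^sub>R v))) = J (s' - s)" for s'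
    proof -
      have m: "borel_fun (\<lambda>x. G x * cnj (G (x + (s' - s) *\<^sub>R v)))" by measurable
      have "(LBINT x. G (x + s *\<^sub>R v) * cnj (G (x + s' *\<^sub>R v))) = J (s' - s)"
        using lborel_integral_translate[OF m, of "s *\<^sub>R v"] by (simp add: J_def algebra_simps)
      then show ?thesis .
    qed
    ultimately show ?thesis by simp
  qed
  have i2: "bdd_supp (M\<^sup>2) (R + norm v) (\<lambda>x. (norm (a x))\<^sup>2)"
    using a_sup unfolding bdd_supp_def by (auto intro!: power_mono)
  \<comment> \<open>Written as a complex integral, so that the two factors of the square can be
    expanded separately, each with its own parameter.\<close>
  have "complex_of_real (LBINT x. (norm (a x))\<^sup>2) = (LBINT x. a x * cnj (a x))"
    by (simp only: complex_norm_square[symmetric] of_real_power integral_complex_of_real[symmetric])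
  also have "\<dots> = (LBINT x. (LBINT s. ?k s *\<^sub>R (G (x + s *\<^sub>R v) * cnj (a x))))"
  proof -
    have "(LBINT s. ?k s *\<^sub>R (G (x + s *\<^sub>R v) * cnj (a x))) = a x * cnj (a x)" for x
      unfolding a_def by (simp flip: integral_mult_left_zero scaleR_left_commute mult_scaleR_left)
    then show ?thesis by simp
  qed
  also have "\<dots> = (LBINT s. (LBINT x. ?k s *\<^sub>R (G (x + s *\<^sub>R v) * cnj (a x))))"
  proof -
    note [measurable] = bdd_suppD(1)[OF a_sup]
    let ?g = "\<lambda>p :: 'a \<times> real. ?k (snd p) *\<^sub>R (G (fst p + snd p *\<^sub>R v) * cnj (a (fst p)))"
    have "?g \<in> borel_measurable (borel \<Otimes>\<^sub>M borel)" by measurable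
    then have gm: "borel_fun ?g" by (simp add: borel_prod)
    have "bdd_supp (M * M) (R + norm v + 1) ?g" unfolding bdd_supp_def
    proof (intro conjI allI impI gm)
      fix p :: "'a \<times> real"
      show "norm (?g p) \<le> M * M" using bdd_suppD(2)[OF Gcv[of "snd p"], of "fst p"] M0 by (auto split: split_indicator)
      assume p: "R + norm v + 1 < norm p"
      show "?g p = 0"
      proof (rule ccontr)
        assume "?g p \<noteq> 0"
        then have 1: "\<bar>snd p\<bar> \<le> 1" "norm (fst p) \<le> R + norm v"
          using bdd_suppD(3)[OF a_sup, of "fst p"] by (force split: split_indicator_asm)+
        have "norm p \<le> norm (fst p) + norm (snd p)" using norm_Pair_le[of "fst p" "snd p"] by simp
        then show False using 1 p by simp
      qed
    qed
    from bdd_supp_Fubini(1)[OF this] show ?thesis by simp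
  qed
  also have "\<dots> = (LBINT s. ?k s *\<^sub>R (LBINT s'. ?k s' *\<^sub>R J (s' - s)))"
    by (simp add: integral_scaleR_right inner)
  finally have eq: "complex_of_real (LBINT x. (norm (a x))\<^sup>2) = (LBINT s. ?k s *\<^sub>R (LBINT s'. ?k s' *\<^sub>R J (s' - s)))" .
  define T where "T = (LBINT t. indicator {-1..1} t * norm (J t))"
  define B where "B = M * M * measure lborel (cball (0 :: 'a) R)"
  have B0: "0 \<le> B" using M0 by (simp add: B_def)
  have Jsup: "bdd_supp B 1 (\<lambda>t. indicator {-1..1} t * norm (J t))" unfolding bdd_supp_def
  proof (intro conjI allI impI)
    show "borel_fun (\<lambda>t. indicator {-1..1} t * norm (J t))" by measurable
    show "norm (indicator {-1..1} t * norm (J t)) \<le> B" for t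
      using Jb[of t] B0 by (auto simp: B_def split: split_indicator)
  qed (auto split: split_indicator)
  \<comment> \<open>For fixed \<open>s\<close> in [0, 1] the difference \<open>s' - s\<close> stays
    in [-1, 1]; extending its range to the whole interval removes the dependence on
    \<open>s\<close>.\<close>
  have inner_le: "norm (?k s *\<^sub>R (LBINT s'. ?k s' *\<^sub>R J (s' - s))) \<le> T * ?k s" for s
  proof (cases "s \<in> {0..1}")
    case True
    have "norm (LBINT s'. ?k s' *\<^sub>R J (s' - s)) \<le> (LBINT s'. norm (?k s' *\<^sub>R J (s' - s)))"
      by (rule integral_norm_bound)
    also have "\<dots> \<le> (LBINT s'. indicator {-1..1} (s' + (- s)) * norm (J (s' + (- s))))"
    proof (rule integral_mono)
      have "bdd_supp B 1 (\<lambda>s'. ?k s' *\<^sub>R J (s' - s))" unfolding bdd_supp_def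
      proof (intro conjI allI impI)
        show "borel_fun (\<lambda>s'. ?k s' *\<^sub>R J (s' - s))" by measurable
        show "norm (?k s' *\<^sub>R J (s' - s)) \<le> B" for s'
          using Jb[of "s' - s"] B0 by (auto simp: B_def split: split_indicator)
      qed (auto split: split_indicator)
      then show "integrable lborel (\<lambda>s'. norm (?k s' *\<^sub>R J (s' - s)))" by (intro integrable_norm bdd_supp_integrable)
      have "bdd_supp B 2 (\<lambda>s'. indicator {-1..1} (s' + (- s)) * norm (J (s' + (- s))))" unfolding bdd_supp_def
      proof (intro conjI allI impI)
        show "borel_fun (\<lambda>s'. indicator {-1..1} (s' + (- s)) * norm (J (s' + (- s))))" by measurable
        show "norm (indicator {-1..1} (s' + (- s)) * norm (J (s' + (- s)))) \<le> B" for s'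
          by (rule bdd_suppD(2)[OF Jsup])
        show "indicator {-1..1} (s' + (- s)) * norm (J (s' + (- s))) = 0" if "2 < norm s'" for s'
          using that True by (auto split: split_indicator)
      qed
      then show "integrable lborel (\<lambda>s'. indicator {-1..1} (s' + (- s)) * norm (J (s' + (- s))))" by (rule bdd_supp_integrable)
      show "norm (?k s' *\<^sub>R J (s' - s)) \<le> indicator {-1..1} (s' + (- s)) * norm (J (s' + (- s)))" for s'
        using True by (auto split: split_indicator)
    qed
    also have "\<dots> = T" unfolding T_def
      by (rule lborel_integral_translate[OF bdd_suppD(1)[OF Jsup]])
    finally show ?thesis using True by simp
  qed simp
  have "(LBINT x. (norm (a x))\<^sup>2) = norm (complex_of_real (LBINT x. (norm (a x))\<^sup>2))"
  proof -
    have "0 \<le> (LBINT x. (norm (a x))\<^sup>2)" by (rule integral_nonneg_AE) simp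
    then show ?thesis by (simp only: norm_of_real abs_of_nonneg)
  qed
  also have "\<dots> \<le> (LBINT s. norm (?k s *\<^sub>R (LBINT s'. ?k s' *\<^sub>R J (s' - s))))"
    unfolding eq by (rule integral_norm_bound)
  also have "\<dots> \<le> (LBINT s. T * ?k s)"
  proof (rule integral_mono)
    have "bdd_supp T 1 (\<lambda>s. ?k s *\<^sub>R (LBINT s'. ?k s' *\<^sub>R J (s' - s)))" unfolding bdd_supp_def
    proof (intro conjI allI impI)
      have "borel_fun (\<lambda>s. \<integral>s'. ?k s' *\<^sub>R J (s' - s) \<partial>lborel)"
        by (rule borel_measurable_lborel_integral_fst) measurable
      then show "borel_fun (\<lambda>s. ?k s *\<^sub>R (LBINT s'. ?k s' *\<^sub>R J (s' - s)))" by measurable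
      have "0 \<le> T" unfolding T_def by (rule integral_nonneg_AE) simp
      then show "norm (?k s *\<^sub>R (LBINT s'. ?k s' *\<^sub>R J (s' - s))) \<le> T" for s
        using inner_le[of s] by (auto split: split_indicator)
    qed (auto split: split_indicator)
    then show "integrable lborel (\<lambda>s. norm (?k s *\<^sub>R (LBINT s'. ?k s' *\<^sub>R J (s' - s))))"
      by (intro integrable_norm bdd_supp_integrable)
    show "integrable lborel (\<lambda>s. T * ?k s)" using bdd_supp_integrable[OF k] by simp
  qed (rule inner_le)
  also have "\<dots> = T" by simp
  finally have "(LBINT x. (norm (a x))\<^sup>2) \<le> T" .
  then have "measure lborel (cball (0 :: 'a) (R + norm v)) * (LBINT x. (norm (a x))\<^sup>2) \<le> measure lborel (cball (0 :: 'a) (R + norm v)) * T"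
    by (intro mult_left_mono) auto
  moreover have "(norm (LBINT x. F x * G x))\<^sup>2 \<le> (LBINT x. norm (a x))\<^sup>2"
    using 1 by (intro power_mono) auto
  ultimately show ?thesis using sq unfolding T_def J_def by linarith
qed

subsection \<open>Oscillation in a direction\<close>

text \<open>Lipschitz rather than C^1, because amplitudes will be multiplied by piecewise linear
  cutoffs. Bound and Lipschitz constant are separate since absorbing a phase into the amplitude
  enlarges only the latter.\<close>

definition amp :: "real \<Rightarrow> real \<Rightarrow> real \<Rightarrow> ('a::euclidean_space \<Rightarrow> complex) \<Rightarrow> bool" where
  "amp R M L \<eta> \<longleftrightarrow> (\<forall>x. norm (\<eta> x) \<le> M) \<and> (\<forall>x y. norm (\<eta> x - \<eta> y) \<le> L * norm (x - y)) \<and>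
     (\<forall>x. R < norm x \<longrightarrow> \<eta> x = 0)"

lemma ampD:
  assumes "amp R M L \<eta>"
  shows "norm (\<eta> x) \<le> M" "norm (\<eta> x - \<eta> y) \<le> L * norm (x - y)" "R < norm x \<Longrightarrow> \<eta> x = 0" "0 \<le> M"
  using assms order_trans[OF norm_ge_zero[of "\<eta> x"], of M] unfolding amp_def by auto

lemma amp_Lipschitz_nonneg:
  fixes \<eta> :: "'a::euclidean_space \<Rightarrow> complex"
  assumes "amp R M L \<eta>"
  shows "0 \<le> L"
proof -
  obtain b :: 'a where b: "b \<in> Basis" using nonempty_Basis by blast
  have "0 \<le> norm (\<eta> b - \<eta> 0)" by simp
  also have "\<dots> \<le> L * norm (b - 0)" by (rule ampD(2)[OF assms])
  finally show ?thesis using b by simp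
qed

lemma amp_bdd_supp:
  assumes "amp R M L \<eta>"
  shows "bdd_supp M R \<eta>"
proof -
  have "L-lipschitz_on UNIV \<eta>"
    by (rule lipschitz_onI) (auto simp: dist_norm ampD(2)[OF assms] amp_Lipschitz_nonneg[OF assms])
  then have "continuous_on UNIV \<eta>" by (rule lipschitz_on_continuous_on)
  then have "borel_fun \<eta>" by (rule borel_measurable_continuous_onI)
  then show ?thesis using ampD[OF assms] by (auto simp: bdd_supp_def)
qed

lemma norm_cis_diff_le: "norm (cis a - cis b) \<le> \<bar>a - b\<bar>"
proof -
  have "cis a - cis b = cis b * (cis (a - b) - 1)" by (simp add: cis_mult algebra_simps)
  then have "norm (cis a - cis b) = norm (exp (\<i> * of_real (a - b)) - 1)"
    by (simp add: norm_mult cis_conv_exp)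
  also have "\<dots> = 2 * \<bar>sin ((a - b) / 2)\<bar>" by (rule dist_exp_i_1)
  also have "\<dots> \<le> 2 * \<bar>(a - b) / 2\<bar>" by (intro mult_left_mono abs_sin_x_le_abs_x) auto
  finally show ?thesis by simp
qed

lemma continuous_on_cis_compose: "continuous_on S f \<Longrightarrow> continuous_on S (\<lambda>x. cis (f x))"
  unfolding cis_conv_exp by (intro continuous_intros)

lemma borel_measurable_cis [measurable]: "borel_fun cis"
  by (intro borel_measurable_continuous_onI continuous_on_cis_compose continuous_intros)

lemma polys_le_measurable: "P \<in> polys_le d \<Longrightarrow> borel_fun P"
  for P :: "real ^ 'm::finite \<Rightarrow> real"
  by (rule borel_measurable_continuous_onI[OF polys_le_continuous])

lemma linear_phase_integral:
  assumes "q \<noteq> 0" "0 \<le> r"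
  shows "norm (LBINT s. indicator {0..r} s *\<^sub>R cis (p + s * q)) \<le> 2 / \<bar>q\<bar>"
proof -
  let ?F = "\<lambda>s. cis (p + s * q) / (\<i> * of_real q)"
  have "(LBINT s. indicator {0..r} s *\<^sub>R cis (p + s * q)) = ?F r - ?F 0"
  proof (rule integral_FTC_atLeastAtMost[OF assms(2)])
    fix s :: real
    have "((\<lambda>z. exp (\<i> * (of_real p + z * of_real q)) / (\<i> * of_real q)) has_field_derivative cis (p + s * q)) (at (of_real s))"
      using assms(1) by (auto intro!: derivative_eq_intros simp: cis_conv_exp mult.commute[of _ \<i>])
    from has_vector_derivative_real_field[OF this]
    show "(?F has_vector_derivative cis (p + s * q)) (at s within {0..r})" by (simp add: cis_conv_exp)
  qed (intro continuous_on_cis_compose continuous_intros)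
  also have "norm \<dots> \<le> norm (?F r) + norm (?F 0)" by (rule norm_triangle_ineq4)
  also have "\<dots> = 2 / \<bar>q\<bar>" by (simp add: norm_divide norm_mult)
  finally show ?thesis .
qed

lemma ddir_pnorm_bound:
  "\<exists>C\<ge>0. \<forall>Q\<in>polys_le d. \<forall>y\<in>cball (0 :: real ^ 'm::finite) R. \<bar>ddir v Q y\<bar> \<le> C * pnorm Q"
proof -
  obtain c :: "nat \<Rightarrow> real" where c: "\<forall>P\<in>polys_le d. \<forall>(x :: real ^ 'm) v.
    ddir v P x = (\<Sum>k\<le>d. c k * P (x + (real k / real (Suc d)) *\<^sub>R v))"
    using ddir_formula[of d, where 'm='m] by (elim exE conjE) (rule that)
  obtain B where B: "B > 0" "\<forall>P\<in>polys_le d. \<forall>y\<in>cball (0 :: real ^ 'm) (R + norm v). \<bar>P y\<bar> \<le> B * pnorm P"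
    using pnorm_bound[where 'm='m, of d "R + norm v"] by (elim exE conjE) (rule that)
  define C where "C = (\<Sum>k\<le>d. \<bar>c k\<bar>) * B"
  have "C \<ge> 0" using B by (auto simp: C_def intro!: mult_nonneg_nonneg sum_nonneg)
  moreover have "\<bar>ddir v Q y\<bar> \<le> C * pnorm Q" if Q: "Q \<in> polys_le d" and y: "y \<in> cball 0 R" for Q y
  proof -
    have "\<bar>ddir v Q y\<bar> \<le> (\<Sum>k\<le>d. \<bar>c k * Q (y + (real k / real (Suc d)) *\<^sub>R v)\<bar>)"
      unfolding bspec[OF c Q, rule_format] by (rule sum_abs)
    also have "\<dots> \<le> (\<Sum>k\<le>d. \<bar>c k\<bar> * (B * pnorm Q))"
    proof (rule sum_mono)
      fix k assume "k \<in> {..d}"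
      then have "real k / real (Suc d) * norm v \<le> 1 * norm v" by (intro mult_right_mono) auto
      then have "y + (real k / real (Suc d)) *\<^sub>R v \<in> cball 0 (R + norm v)"
        using y norm_triangle_ineq[of y "(real k / real (Suc d)) *\<^sub>R v"] by simp
      then show "\<bar>c k * Q (y + (real k / real (Suc d)) *\<^sub>R v)\<bar> \<le> \<bar>c k\<bar> * (B * pnorm Q)"
        unfolding abs_mult using bspec[OF bspec[OF B(2) Q]] by (intro mult_left_mono) auto
    qed
    also have "\<dots> = C * pnorm Q" by (simp add: C_def sum_distrib_right mult.assoc)
    finally show ?thesis .
  qed
  ultimately show ?thesis by blast
qed

lemma taylor_along_direction:
  fixes P :: "real ^ 'm::finite \<Rightarrow> real"
  assumes P: "P \<in> polys_le d" and s: "0 \<le> s" "s \<le> 1" and x: "norm x \<le> R"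
    and B: "\<And>y. norm y \<le> R + norm v \<Longrightarrow> \<bar>ddir v (ddir v P) y\<bar> \<le> B"
  shows "\<bar>P (x + s *\<^sub>R v) - P x - s * ddir v P x\<bar> \<le> s\<^sup>2 * B"
proof -
  have inb: "norm (x + t *\<^sub>R v) \<le> R + norm v" if "0 \<le> t" "t \<le> 1" for t
    using norm_triangle_ineq[of x "t *\<^sub>R v"] mult_right_mono[OF that(2) norm_ge_zero[of v]] that x by simp
  have "norm x \<le> R + norm v" using x norm_ge_zero[of v] by linarith
  then have B0: "0 \<le> B" using order_trans[OF abs_ge_zero B] by blast
  have 1: "\<bar>ddir v P (x + t *\<^sub>R v) - ddir v P x\<bar> \<le> t * B" if t: "0 \<le> t" "t \<le> s" for t
  proof (cases "t = 0")
    case False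
    then have t0: "0 < t" using t by simp
    obtain z where z: "0 < z" "z < t" "ddir v P (x + t *\<^sub>R v) - ddir v P (x + 0 *\<^sub>R v) = (t - 0) * ddir v (ddir v P) (x + z *\<^sub>R v)"
      using MVT2[OF t0, of "\<lambda>t. ddir v P (x + t *\<^sub>R v)" "\<lambda>t. ddir v (ddir v P) (x + t *\<^sub>R v)"]
        ddir_has_derivative[OF ddir_polys_le'[OF P]] by blast
    have "\<bar>ddir v (ddir v P) (x + z *\<^sub>R v)\<bar> \<le> B" using z t s by (intro B inb) auto
    then show ?thesis using z t0 by (simp add: abs_mult mult_left_mono)
  qed simp
  show ?thesis
  proof (cases "s = 0")
    case False
    then have s0: "0 < s" using s by simp
    have d: "((\<lambda>t. P (x + t *\<^sub>R v) - t * ddir v P x) has_real_derivative ddir v P (x + t *\<^sub>R v) - ddir v P x) (at t)" for t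
      by (auto intro!: derivative_eq_intros ddir_has_derivative[OF P])
    obtain z where z: "0 < z" "z < s" "(P (x + s *\<^sub>R v) - s * ddir v P x) - (P (x + 0 *\<^sub>R v) - 0 * ddir v P x) =
       (s - 0) * (ddir v P (x + z *\<^sub>R v) - ddir v P x)"
      using MVT2[OF s0, of "\<lambda>t. P (x + t *\<^sub>R v) - t * ddir v P x" "\<lambda>t. ddir v P (x + t *\<^sub>R v) - ddir v P x"] d by blast
    have "\<bar>ddir v P (x + z *\<^sub>R v) - ddir v P x\<bar> \<le> s * B"
      using 1[of z] z B0 mult_right_mono[of z s B] by simp
    then have "s * \<bar>ddir v P (x + z *\<^sub>R v) - ddir v P x\<bar> \<le> s * (s * B)" using s by (intro mult_left_mono)
    moreover have "P (x + s *\<^sub>R v) - P x - s * ddir v P x = s * (ddir v P (x + z *\<^sub>R v) - ddir v P x)"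
      using z(3) by simp
    ultimately show ?thesis using s by (simp add: abs_mult power2_eq_square mult.assoc)
  qed simp
qed

text \<open>The factor \<open>F\<close> is constant along \<open>v\<close>, so in this direction
  only \<open>P\<close> oscillates. On segments of length \<open>r\<close> the phase is linear with
  slope \<open>Q x\<close> up to \<open>O(N * r\<^sup>2)\<close>, and the amplitude is constant up
  to \<open>O(r)\<close>. The linear phase gains a factor of order
  \<open>1 / (1 + r * \<bar>Q x\<bar>)\<close>, and the points where \<open>Q\<close> is small are
  handled by \<open>negative_power_integral_bound\<close>.\<close>

lemma directional_decay:
  fixes v :: "real ^ 'm::finite"
  shows "\<exists>C>0. \<exists>\<epsilon>>0. \<forall>M F \<eta>. \<forall>P\<in>polys_le d. borel_fun F \<longrightarrow> (\<forall>x. norm (F x) \<le> 1) \<longrightarrow>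
    (\<forall>x t. F (x + t *\<^sub>R v) = F x) \<longrightarrow> amp R M M \<eta> \<longrightarrow>
    norm (LBINT x. cis (P x) * (F x * \<eta> x)) \<le> C * M * (1 + pnorm (ddir v P)) powr - \<epsilon>"
proof -
  define R' where "R' = R + norm v"
  obtain C1 where C1: "C1 \<ge> 0" "\<forall>Q\<in>polys_le d. \<forall>y\<in>cball (0 :: real ^ 'm) (R' + norm v). \<bar>ddir v Q y\<bar> \<le> C1 * pnorm Q"
    using ddir_pnorm_bound[where 'm='m, of d "R' + norm v" v] by (elim exE conjE) (rule that)
  obtain C2 \<delta> where C2: "C2 > 0" "\<delta> > 0" "\<forall>Q \<in> polys_le d.
    (LBINT x. indicator (cball (0 :: real ^ 'm) R') x * (1 + \<bar>Q x\<bar>) powr - 1) \<le> C2 * (1 + pnorm Q) powr - \<delta>"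
    using negative_power_integral_bound[where 'm='m, OF zero_less_one, of d R'] by (elim exE conjE) (rule that)
  define V where "V = measure lborel (cball (0 :: real ^ 'm) R')"
  define \<epsilon> where "\<epsilon> = min (1/3) (\<delta> / 3)"
  define C where "C = (norm v + C1) * V + 3 * C2"
  have V: "V \<ge> 0" by (simp add: V_def)
  have \<epsilon>: "\<epsilon> > 0" using C2 by (simp add: \<epsilon>_def)
  have Cpos: "C > 0" using V C1 C2 by (auto simp: C_def intro!: add_nonneg_pos)
  show ?thesis
  proof (rule exI[of _ C], rule conjI[OF Cpos], rule exI[of _ \<epsilon>], rule conjI[OF \<epsilon>], intro allI ballI impI)
    fix M and F \<eta> :: "real ^ 'm \<Rightarrow> complex" and P :: "real ^ 'm \<Rightarrow> real"
    assume P: "P \<in> polys_le d" and F: "borel_fun F" "\<forall>x. norm (F x) \<le> 1" "\<forall>x t. F (x + t *\<^sub>R v) = F x"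
      and \<eta>: "amp R M M \<eta>"
    define Q where "Q = ddir v P"
    define N where "N = pnorm Q"
    \<comment> \<open>An exponent strictly between 1/2 and 1: the quadratic error
      \<open>N * r\<^sup>2\<close> tends to 0 while the variation \<open>r * N\<close> of the phase
      over a segment still grows.\<close>
    define r where "r = (1 + N) powr - (2/3)"
    have Q: "Q \<in> polys_le d" unfolding Q_def by (rule ddir_polys_le'[OF P])
    have N: "N \<ge> 0" unfolding N_def by (rule pnorm_nonneg[OF Q])
    have r: "0 < r" "r \<le> 1" using N by (auto simp: r_def intro: powr_le1 simp: powr_minus)
      (metis add_increasing2 inverse_le_1_iff ge_one_powr_ge_zero le_add_same_cancel1 linear zero_le_divide_iff zero_le_numeral)
    have M: "M \<ge> 0" by (rule ampD(4)[OF \<eta>])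
    note \<eta>s = amp_bdd_supp[OF \<eta>]
    note [measurable] = F(1) polys_le_measurable[OF P] polys_le_measurable[OF Q] bdd_suppD(1)[OF \<eta>s]
    define g where "g = (\<lambda>x. cis (P x) * (F x * \<eta> x))"
    have gs: "bdd_supp M R g" unfolding g_def
      by (intro bdd_supp_mult_left \<eta>s) (use F in auto)
    let ?k = "indicator {0..r} :: real \<Rightarrow> real"
    have ks: "bdd_supp 1 1 ?k" using bdd_supp_mono[OF bdd_supp_indicator[of 0 r], of 1 1] r by simp
    have \<gamma>: "borel_fun (\<lambda>s. s *\<^sub>R v)" "\<bar>s\<bar> \<le> 1 \<Longrightarrow> norm (s *\<^sub>R v) \<le> norm v" for s
      by (auto simp: mult_left_le_one_le)
    define a where "a = (\<lambda>x. \<integral>s. ?k s *\<^sub>R g (x + s *\<^sub>R v) \<partial>lborel)"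
    have avg: "(LBINT x. a x) = r *\<^sub>R (LBINT x. g x)" "integrable lborel a"
      using bdd_supp_averaging[OF gs ks \<gamma>] r by (simp_all add: a_def)
    define h where "h = (\<lambda>x. indicator (cball 0 R') x * (r * (M * (norm v * r + C1 * N * r\<^sup>2))) +
       3 * M * r * (indicator (cball 0 R') x * (1 + \<bar>r * Q x\<bar>) powr - 1))"
    have hint: "integrable lborel (\<lambda>x. indicator (cball 0 R') x * (1 + \<bar>r * Q x\<bar>) powr - 1)"
    proof (rule bdd_supp_integrable)
      show "bdd_supp 1 R' (\<lambda>x. indicator (cball 0 R') x * (1 + \<bar>r * Q x\<bar>) powr - 1)" unfolding bdd_supp_def
      proof (intro conjI allI impI)
        show "borel_fun (\<lambda>x. indicator (cball 0 R') x * (1 + \<bar>r * Q x\<bar>) powr - 1)"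
          by (intro borel_measurable_times borel_measurable_indicator) (simp, measurable)
        show "norm (indicator (cball 0 R') x * (1 + \<bar>r * Q x\<bar>) powr - 1) \<le> 1" for x
          by (auto simp: powr_minus inverse_le_1_iff split: split_indicator)
      qed auto
    qed
    have le: "norm (a x) \<le> h x" for x
    proof (cases "norm x \<le> R'")
      case False
      have "?k s *\<^sub>R g (x + s *\<^sub>R v) = 0" for s
      proof (cases "s \<in> {0..r}")
        case True
        then have "norm (s *\<^sub>R v) \<le> norm v" using r by (intro \<gamma>(2)) auto
        moreover have "norm x \<le> norm (x + s *\<^sub>R v) + norm (s *\<^sub>R v)"
          using norm_triangle_ineq4[of "x + s *\<^sub>R v" "s *\<^sub>R v"] by simp
        ultimately have "R < norm (x + s *\<^sub>R v)" using False by (simp add: R'_def)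
        then show ?thesis using bdd_suppD(3)[OF gs] by simp
      qed simp
      then have "a x = (\<integral>s. 0 \<partial>(lborel :: real measure))" unfolding a_def
        by (intro Bochner_Integration.integral_cong) auto
      then show ?thesis using False by (simp add: h_def)
    next
      case True
      define E where "E = (\<lambda>s. ?k s *\<^sub>R (cis (P (x + s *\<^sub>R v)) * \<eta> (x + s *\<^sub>R v)))"
      define E0 where "E0 = (\<lambda>s. ?k s *\<^sub>R (cis (P x + s * Q x) * \<eta> x))"
      have Es: "bdd_supp M 1 E" unfolding bdd_supp_def E_def
      proof (intro conjI allI impI)
        show "borel_fun (\<lambda>s. ?k s *\<^sub>R (cis (P (x + s *\<^sub>R v)) * \<eta> (x + s *\<^sub>R v)))" by measurable
      qed (use ampD(1)[OF \<eta>] M r in \<open>auto simp: norm_mult split: split_indicator\<close>)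
      have E0s: "bdd_supp M 1 E0" unfolding bdd_supp_def E0_def
      proof (intro conjI allI impI)
        show "borel_fun (\<lambda>s. ?k s *\<^sub>R (cis (P x + s * Q x) * \<eta> x))" by measurable
      qed (use ampD(1)[OF \<eta>] M r in \<open>auto simp: norm_mult split: split_indicator\<close>)
      have "a x = F x * (LBINT s. E s)" unfolding a_def g_def E_def
        by (subst integral_mult_right_zero[symmetric]) (simp add: F(3) mult_ac)
      then have aE: "norm (a x) \<le> norm (LBINT s. E s)"
        using mult_right_mono[OF spec[OF F(2), of x], of "norm (LBINT s. E s)"] by (simp add: norm_mult)
      have "norm (LBINT s. E s) \<le> norm (LBINT s. E0 s) + norm ((LBINT s. E s) - (LBINT s. E0 s))"
        using norm_triangle_sub[of "\<integral>s. E s \<partial>lborel" "\<integral>s. E0 s \<partial>lborel"] by simp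
      also have "(LBINT s. E s) - (LBINT s. E0 s) = (LBINT s. E s - E0 s)"
        by (rule Bochner_Integration.integral_diff[symmetric]) (intro bdd_supp_integrable[OF Es] bdd_supp_integrable[OF E0s])+
      also have "norm (LBINT s. E s - E0 s) \<le> (LBINT s. norm (E s - E0 s))" by (rule integral_norm_bound)
      also have "\<dots> \<le> (LBINT s. (M * (norm v * r + C1 * N * r\<^sup>2)) * ?k s)"
      proof (rule integral_mono)
        show "integrable lborel (\<lambda>s. norm (E s - E0 s))"
          by (intro integrable_norm Bochner_Integration.integrable_diff bdd_supp_integrable[OF Es] bdd_supp_integrable[OF E0s])
        show "integrable lborel (\<lambda>s. (M * (norm v * r + C1 * N * r\<^sup>2)) * ?k s)"
          using bdd_supp_integrable[OF ks] by simp
        fix s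
        show "norm (E s - E0 s) \<le> (M * (norm v * r + C1 * N * r\<^sup>2)) * ?k s"
        proof (cases "s \<in> {0..r}")
          case s: True
          have "\<bar>P (x + s *\<^sub>R v) - P x - s * Q x\<bar> \<le> s\<^sup>2 * (C1 * N)" unfolding Q_def
          proof (rule taylor_along_direction[OF P _ _ True])
            fix y :: "real ^ 'm" assume "norm y \<le> R' + norm v"
            then show "\<bar>ddir v (ddir v P) y\<bar> \<le> C1 * N"
              using bspec[OF bspec[OF C1(2) Q], of y] by (simp add: Q_def N_def)
          qed (use s r in auto)
          also have "\<dots> \<le> r\<^sup>2 * (C1 * N)" using s C1 N by (intro mult_right_mono power_mono) auto
          finally have t: "\<bar>P (x + s *\<^sub>R v) - (P x + s * Q x)\<bar> \<le> r\<^sup>2 * (C1 * N)" by (simp add: algebra_simps)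
          have "cis (P (x + s *\<^sub>R v)) * \<eta> (x + s *\<^sub>R v) - cis (P x + s * Q x) * \<eta> x =
            (cis (P (x + s *\<^sub>R v)) - cis (P x + s * Q x)) * \<eta> (x + s *\<^sub>R v) + cis (P x + s * Q x) * (\<eta> (x + s *\<^sub>R v) - \<eta> x)"
            by (simp add: algebra_simps)
          also have "norm \<dots> \<le> norm ((cis (P (x + s *\<^sub>R v)) - cis (P x + s * Q x)) * \<eta> (x + s *\<^sub>R v)) + norm (cis (P x + s * Q x) * (\<eta> (x + s *\<^sub>R v) - \<eta> x))"
            by (rule norm_triangle_ineq)
          also have "\<dots> \<le> r\<^sup>2 * (C1 * N) * M + M * (r * norm v)"
          proof (intro add_mono)
            show "norm ((cis (P (x + s *\<^sub>R v)) - cis (P x + s * Q x)) * \<eta> (x + s *\<^sub>R v)) \<le> r\<^sup>2 * (C1 * N) * M"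
              unfolding norm_mult using C1 N
              by (intro mult_mono order_trans[OF norm_cis_diff_le t] ampD(1)[OF \<eta>]) auto
            have "norm (\<eta> (x + s *\<^sub>R v) - \<eta> x) \<le> M * norm (s *\<^sub>R v)" using ampD(2)[OF \<eta>, of "x + s *\<^sub>R v" x] by simp
            also have "\<dots> \<le> M * (r * norm v)" using s M by (intro mult_left_mono) (auto intro: mult_right_mono)
            finally show "norm (cis (P x + s * Q x) * (\<eta> (x + s *\<^sub>R v) - \<eta> x)) \<le> M * (r * norm v)" by (simp add: norm_mult)
          qed
          also have "\<dots> = M * (norm v * r + C1 * N * r\<^sup>2)" by (simp add: algebra_simps)
          finally show ?thesis using s by (simp add: E_def E0_def)
        qed (simp add: E_def E0_def)
      qed
      also have "\<dots> = r * (M * (norm v * r + C1 * N * r\<^sup>2))" using r by simp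
      also have "norm (LBINT s. E0 s) \<le> 3 * M * r * (1 + \<bar>r * Q x\<bar>) powr - 1"
      proof -
        have "(LBINT s. E0 s) = (LBINT s. ?k s *\<^sub>R cis (P x + s * Q x)) * \<eta> x"
          unfolding E0_def by (simp flip: integral_mult_left_zero)
        then have e: "norm (LBINT s. E0 s) = norm (LBINT s. ?k s *\<^sub>R cis (P x + s * Q x)) * norm (\<eta> x)"
          by (simp add: norm_mult)
        have p: "(1 + \<bar>r * Q x\<bar>) powr - 1 = 1 / (1 + r * \<bar>Q x\<bar>)" using r by (simp add: powr_minus_divide abs_mult)
        have "norm (LBINT s. ?k s *\<^sub>R cis (P x + s * Q x)) \<le> 3 * r * (1 / (1 + r * \<bar>Q x\<bar>))"
        proof (cases "r * \<bar>Q x\<bar> \<le> 2")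
          case True
          have "norm (LBINT s. ?k s *\<^sub>R cis (P x + s * Q x)) \<le> (LBINT s. norm (?k s *\<^sub>R cis (P x + s * Q x)))"
            by (rule integral_norm_bound)
          also have "\<dots> = r" using r by simp
          finally have n: "norm (LBINT s. ?k s *\<^sub>R cis (P x + s * Q x)) \<le> r" .
          have "r * (1 + r * \<bar>Q x\<bar>) \<le> r * 3" using r True by (intro mult_left_mono) auto
          moreover have "0 < 1 + r * \<bar>Q x\<bar>" using r by (intro add_pos_nonneg) auto
          ultimately have "r \<le> 3 * r * (1 / (1 + r * \<bar>Q x\<bar>))" by (simp add: pos_le_divide_eq mult.commute)
          then show ?thesis using n by linarith
        next
          case False
          then have q: "Q x \<noteq> 0" by auto
          have "norm (LBINT s. ?k s *\<^sub>R cis (P x + s * Q x)) \<le> 2 / \<bar>Q x\<bar>"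
            by (rule linear_phase_integral[OF q]) (use r in auto)
          also have "2 / \<bar>Q x\<bar> \<le> 3 * r * (1 / (1 + r * \<bar>Q x\<bar>))"
          proof -
            have "2 * (1 + r * \<bar>Q x\<bar>) \<le> 3 * r * \<bar>Q x\<bar>" using False by (simp add: algebra_simps)
            moreover have "0 < \<bar>Q x\<bar>" "0 < 1 + r * \<bar>Q x\<bar>" using q r by (auto intro: add_pos_nonneg)
            ultimately show ?thesis by (simp add: divide_simps mult_ac)
          qed
          finally show ?thesis .
        qed
        then have "norm (LBINT s. E0 s) \<le> 3 * r * (1 / (1 + r * \<bar>Q x\<bar>)) * M"
          unfolding e using r ampD(1)[OF \<eta>, of x] by (intro mult_mono) auto
        then show ?thesis unfolding p by (simp add: mult_ac)
      qed
      finally show ?thesis using aE True by (simp add: h_def)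
    qed
    have i1: "integrable lborel (\<lambda>x. indicator (cball (0 :: real ^ 'm) R') x * (r * (M * (norm v * r + C1 * N * r\<^sup>2))))"
      using integrable_cball_indicator[of "r * (M * (norm v * r + C1 * N * r\<^sup>2))" R', where 'a = "real ^ 'm"] by (simp add: mult.commute)
    have "r * norm (LBINT x. g x) = norm (LBINT x. a x)" using avg(1) r by simp
    also have "\<dots> \<le> (LBINT x. norm (a x))" by (rule integral_norm_bound)
    also have "\<dots> \<le> (LBINT x. h x)"
      by (rule integral_mono[OF integrable_norm[OF avg(2)] _ le])
        (unfold h_def, intro Bochner_Integration.integrable_add i1 integrable_mult_right hint)
    also have "\<dots> = V * (r * (M * (norm v * r + C1 * N * r\<^sup>2))) + 3 * M * r * (LBINT x. indicator (cball 0 R') x * (1 + \<bar>r * Q x\<bar>) powr - 1)"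
    proof -
      have "(LBINT x. h x) = (LBINT x. indicator (cball (0 :: real ^ 'm) R') x * (r * (M * (norm v * r + C1 * N * r\<^sup>2)))) +
        (LBINT x. 3 * M * r * (indicator (cball 0 R') x * (1 + \<bar>r * Q x\<bar>) powr - 1))"
        unfolding h_def by (intro Bochner_Integration.integral_add i1 integrable_mult_right hint)
      also have "(LBINT x. 3 * M * r * (indicator (cball 0 R') x * (1 + \<bar>r * Q x\<bar>) powr - 1)) =
        3 * M * r * (LBINT x. indicator (cball 0 R') x * (1 + \<bar>r * Q x\<bar>) powr - 1)"
        by (rule integral_mult_right_zero)
      also have "(LBINT x. indicator (cball (0 :: real ^ 'm) R') x * (r * (M * (norm v * r + C1 * N * r\<^sup>2)))) =
        V * (r * (M * (norm v * r + C1 * N * r\<^sup>2)))"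
        unfolding integral_mult_left_zero by (simp add: V_def)
      finally show ?thesis .
    qed
    also have "\<dots> \<le> V * (r * (M * (norm v * r + C1 * N * r\<^sup>2))) + 3 * M * r * (C2 * (1 + pnorm (\<lambda>x. r * Q x)) powr - \<delta>)"
      using bspec[OF C2(3) polys_le_scale[OF Q, of r]] M r by (intro add_left_mono mult_left_mono) auto
    also have "\<dots> = r * (M * (V * (norm v * r + C1 * (N * r\<^sup>2)) + 3 * C2 * (1 + pnorm (\<lambda>x. r * Q x)) powr - \<delta>))"
      by (simp add: algebra_simps)
    finally have main: "norm (LBINT x. g x) \<le> M * (V * (norm v * r + C1 * (N * r\<^sup>2)) + 3 * C2 * (1 + pnorm (\<lambda>x. r * Q x)) powr - \<delta>)"
      using r by (simp only: mult_le_cancel_left_pos)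
    have e1: "r \<le> (1 + N) powr - \<epsilon>" unfolding r_def using N by (intro powr_mono) (auto simp: \<epsilon>_def)
    have e2: "N * r\<^sup>2 \<le> (1 + N) powr - \<epsilon>"
    proof -
      have "r\<^sup>2 = (1 + N) powr - (4/3)" unfolding r_def power2_eq_square by (simp flip: powr_add)
      then have "N * r\<^sup>2 \<le> (1 + N) powr 1 * (1 + N) powr - (4/3)" using N by (intro mult_mono) auto
      also have "\<dots> = (1 + N) powr (1 + - (4/3))" by (rule powr_add[symmetric])
      also have "\<dots> = (1 + N) powr - (1/3)" by simp
      also have "\<dots> \<le> (1 + N) powr - \<epsilon>" using N by (intro powr_mono) (auto simp: \<epsilon>_def)
      finally show ?thesis .
    qed
    \<comment> \<open>The norm of \<open>r * Q\<close> is at least \<open>r * N\<close>, and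
      \<open>1 + r * N\<close> is at least \<open>r * (1 + N)\<close>, which is the positive power
      1/3 of \<open>1 + N\<close>.\<close>
    have e3: "(1 + pnorm (\<lambda>x. r * Q x)) powr - \<delta> \<le> (1 + N) powr - \<epsilon>"
    proof -
      have "r * N \<le> pnorm (\<lambda>x. r * Q x)"
      proof -
        have "N \<le> pnorm (\<lambda>x. r * Q x) / r" unfolding N_def
        proof (rule pnorm_least)
          fix x :: "real ^ 'm" assume "x \<in> unit_cube"
          from pnorm_upper[OF polys_le_scale[OF Q, of r] this]
          show "\<bar>Q x\<bar> \<le> pnorm (\<lambda>x. r * Q x) / r" using r by (simp add: abs_mult field_simps)
        qed
        then show ?thesis using r by (simp add: field_simps)
      qed
      moreover have "(1 + N) powr (1/3) = r * (1 + N)"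
        using N powr_add[of "1 + N" "- (2/3)" 1] by (simp add: r_def)
      ultimately have "(1 + N) powr (1/3) \<le> 1 + pnorm (\<lambda>x. r * Q x)" using r by (simp add: algebra_simps)
      then have "(1 + pnorm (\<lambda>x. r * Q x)) powr - \<delta> \<le> ((1 + N) powr (1/3)) powr - \<delta>"
        using N C2 by (intro powr_mono2') auto
      also have "\<dots> \<le> (1 + N) powr - \<epsilon>" unfolding powr_powr using N by (intro powr_mono) (auto simp: \<epsilon>_def)
      finally show ?thesis .
    qed
    have "V * (norm v * r + C1 * (N * r\<^sup>2)) + 3 * C2 * (1 + pnorm (\<lambda>x. r * Q x)) powr - \<delta> \<le>
      V * (norm v * (1 + N) powr - \<epsilon> + C1 * (1 + N) powr - \<epsilon>) + 3 * C2 * (1 + N) powr - \<epsilon>"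
      using V C1 C2 by (intro add_mono mult_left_mono e1 e2 e3) auto
    also have "\<dots> = C * (1 + N) powr - \<epsilon>" by (simp add: C_def algebra_simps)
    finally have "M * (V * (norm v * r + C1 * (N * r\<^sup>2)) + 3 * C2 * (1 + pnorm (\<lambda>x. r * Q x)) powr - \<delta>) \<le> M * (C * (1 + N) powr - \<epsilon>)"
      using M by (rule mult_left_mono)
    then show "norm (LBINT x. cis (P x) * (F x * \<eta> x)) \<le> C * M * (1 + pnorm (ddir v P)) powr - \<epsilon>"
      using main by (simp add: g_def N_def Q_def mult_ac)
  qed
qed

section \<open>Oscillatory forms and the functionals in which they decay\<close>

definition unit_bdd :: "(nat \<Rightarrow> real \<Rightarrow> complex) \<Rightarrow> nat set \<Rightarrow> bool" where
  "unit_bdd F J \<longleftrightarrow> (\<forall>j\<in>J. borel_fun (F j) \<and> (\<forall>t. norm (F j t) \<le> 1))"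

text \<open>The functions live on the real line and are evaluated at \<open>u j \<bullet> x\<close>.
  No factor \<lambda> appears: the bounds are uniform over phases of bounded degree, so it is part
  of \<open>P\<close>.\<close>

definition osc :: "(nat \<Rightarrow> real ^ 'm::finite) \<Rightarrow> nat set \<Rightarrow> (nat \<Rightarrow> real \<Rightarrow> complex) \<Rightarrow>
    (real ^ 'm \<Rightarrow> real) \<Rightarrow> (real ^ 'm \<Rightarrow> complex) \<Rightarrow> complex" where
  "osc u J F P \<eta> = (LBINT x. cis (P x) * ((\<Prod>j\<in>J. F j (u j \<bullet> x)) * \<eta> x))"

abbreviation osc_bound_at :: "real \<Rightarrow> (nat \<Rightarrow> real ^ 'm::finite) \<Rightarrow> nat set \<Rightarrow> (real ^ 'm \<Rightarrow> real) \<Rightarrow>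
    real \<Rightarrow> real \<Rightarrow> real \<Rightarrow> bool" where
  "osc_bound_at R u J P C \<epsilon> X \<equiv> \<forall>M F \<eta>. unit_bdd F J \<longrightarrow> amp R M M \<eta> \<longrightarrow>
     norm (osc u J F P \<eta>) \<le> C * M * (1 + X) powr - \<epsilon>"

abbreviation osc_bound :: "nat \<Rightarrow> real \<Rightarrow> (nat \<Rightarrow> real ^ 'm::finite) \<Rightarrow> nat set \<Rightarrow> real \<Rightarrow> real \<Rightarrow>
    ((real ^ 'm \<Rightarrow> real) \<Rightarrow> real) \<Rightarrow> bool" where
  "osc_bound d R u J C \<epsilon> X \<equiv> \<forall>M F \<eta>. \<forall>P\<in>polys_le d. unit_bdd F J \<longrightarrow> amp R M M \<eta> \<longrightarrow>
     norm (osc u J F P \<eta>) \<le> C * M * (1 + X P) powr - \<epsilon>"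

text \<open>Decay in single functionals is easier to produce than decay in a norm; bounds for
  several functionals are then combined by \<open>decays_sum\<close>.\<close>

definition decays :: "nat \<Rightarrow> real \<Rightarrow> (nat \<Rightarrow> real ^ 'm::finite) \<Rightarrow> nat set \<Rightarrow> ((real ^ 'm \<Rightarrow> real) \<Rightarrow> real) \<Rightarrow> bool" where
  "decays d R u J \<phi> \<longleftrightarrow> (\<exists>C>0. \<exists>\<epsilon>>0. osc_bound d R u J C \<epsilon> (\<lambda>P. \<bar>\<phi> P\<bar>))"

text \<open>The second condition makes the value of \<open>\<phi>\<close> at the difference of
  \<open>P\<close> and its translate by \<open>t *\<^sub>R v\<close> a polynomial in
  \<open>t\<close>, so that the one-variable sublevel estimate applies to the parameter of the
  differencing.\<close>

definition poly_functional :: "nat \<Rightarrow> ((real ^ 'm::finite \<Rightarrow> real) \<Rightarrow> real) \<Rightarrow> bool" where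
  "poly_functional d \<phi> \<longleftrightarrow> flin (polys_le d) \<phi> \<and>
     (\<forall>P\<in>polys_le d. \<forall>v. \<exists>p. degree p \<le> d \<and> (\<forall>t. \<phi> (\<lambda>x. P (x + t *\<^sub>R v)) = poly p t))"

lemma unit_bddD:
  "unit_bdd F J \<Longrightarrow> j \<in> J \<Longrightarrow> borel_fun (F j)"
  "unit_bdd F J \<Longrightarrow> j \<in> J \<Longrightarrow> norm (F j t) \<le> 1"
  by (auto simp: unit_bdd_def)

lemma borel_measurable_prod_inner:
  fixes u :: "nat \<Rightarrow> 'a::euclidean_space" and F :: "nat \<Rightarrow> real \<Rightarrow> 'b::{real_normed_field, second_countable_topology}"
  assumes "\<And>j. j \<in> J \<Longrightarrow> borel_fun (F j)"
  shows "borel_fun (\<lambda>x. \<Prod>j\<in>J. F j (u j \<bullet> x))"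
proof (rule borel_measurable_prod)
  fix j assume "j \<in> J"
  note [measurable] = assms[OF this]
  show "borel_fun (\<lambda>x. F j (u j \<bullet> x))" by measurable
qed

lemma unit_bdd_prod_measurable:
  fixes u :: "nat \<Rightarrow> 'a::euclidean_space"
  assumes "unit_bdd F J"
  shows "borel_fun (\<lambda>x. \<Prod>j\<in>J. F j (u j \<bullet> x))"
using assms by (intro borel_measurable_prod_inner) (rule unit_bddD(1))

lemma unit_bdd_prod_norm: "unit_bdd F J \<Longrightarrow> norm (\<Prod>j\<in>J. F j (t j)) \<le> 1"
  unfolding prod_norm[symmetric] by (rule prod_le_1) (auto simp: unit_bdd_def)

lemma unit_bdd_prod_invariant:
  assumes "\<And>j. j \<in> J \<Longrightarrow> u j \<bullet> v = 0"
  shows "(\<Prod>j\<in>J. F j (u j \<bullet> (x + t *\<^sub>R v))) = (\<Prod>j\<in>J. F j (u j \<bullet> x))"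
  using assms by (intro prod.cong) (auto simp: inner_add_right)

lemma amp_mult_cnj:
  assumes "amp R M M \<eta>"
  shows "amp R (2 * M\<^sup>2) (2 * M\<^sup>2) (\<lambda>x. \<eta> x * cnj (\<eta> (x + h)))"
  unfolding amp_def
proof (intro conjI allI impI)
  note e = ampD[OF assms]
  fix x y
  have "norm (\<eta> x * cnj (\<eta> (x + h))) \<le> M * M" unfolding norm_mult complex_mod_cnj by (intro mult_mono e) auto
  then show "norm (\<eta> x * cnj (\<eta> (x + h))) \<le> 2 * M\<^sup>2"
    using mult_nonneg_nonneg[OF e(4) e(4)] unfolding power2_eq_square by linarith
  have "\<eta> x * cnj (\<eta> (x + h)) - \<eta> y * cnj (\<eta> (y + h)) =
    (\<eta> x - \<eta> y) * cnj (\<eta> (x + h)) + \<eta> y * cnj (\<eta> (x + h) - \<eta> (y + h))" by (simp add: algebra_simps)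
  also have "norm \<dots> \<le> norm ((\<eta> x - \<eta> y) * cnj (\<eta> (x + h))) + norm (\<eta> y * cnj (\<eta> (x + h) - \<eta> (y + h)))"
    by (rule norm_triangle_ineq)
  also have "\<dots> \<le> (M * norm (x - y)) * M + M * (M * norm (x - y))"
    unfolding norm_mult complex_mod_cnj
  proof (intro add_mono mult_mono e mult_nonneg_nonneg)
    show "norm (\<eta> (x + h) - \<eta> (y + h)) \<le> M * norm (x - y)" using e(2)[of "x + h" "y + h"] by simp
  qed auto
  finally show "norm (\<eta> x * cnj (\<eta> (x + h)) - \<eta> y * cnj (\<eta> (y + h))) \<le> 2 * M\<^sup>2 * norm (x - y)"
    by (simp add: power2_eq_square algebra_simps)
  show "R < norm x \<Longrightarrow> \<eta> x * cnj (\<eta> (x + h)) = 0" using e(3) by simp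
qed

lemma osc_integrand_bdd_supp:
  assumes P: "P \<in> polys_le d" and F: "unit_bdd F J" and \<eta>: "amp R M L \<eta>"
  shows "bdd_supp M R (\<lambda>x. cis (P x) * ((\<Prod>j\<in>J. F j (u j \<bullet> x)) * \<eta> x))"
proof -
  note [measurable] = polys_le_measurable[OF P]
  have "borel_fun (\<lambda>x. cis (P x))" by measurable
  then show ?thesis
    by (intro bdd_supp_mult_left amp_bdd_supp[OF \<eta>] unit_bdd_prod_measurable[OF F] unit_bdd_prod_norm[OF F]) auto
qed

lemma osc_trivial_bound:
  fixes u :: "nat \<Rightarrow> real ^ 'm::finite"
  assumes "P \<in> polys_le d" "unit_bdd F J" "amp R M L \<eta>"
  shows "norm (osc u J F P \<eta>) \<le> M * measure lborel (cball (0 :: real ^ 'm) R)"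
  unfolding osc_def by (rule bdd_supp_integral_le[OF osc_integrand_bdd_supp[OF assms]])

text \<open>Differencing along \<open>v\<close> removes the functions in \<open>A\<close> and leaves
  a form for \<open>B\<close> whose phase is the difference \<open>D t\<close>. It decays in
  \<open>\<phi> (D t)\<close>, a polynomial in \<open>t\<close>, and the sublevel estimate trades
  the integral over \<open>t\<close> for the value at the single point \<open>t0\<close>. The square
  in the van der Corput inequality halves the exponent.\<close>

lemma van_der_Corput_decay:
  fixes u :: "nat \<Rightarrow> real ^ 'm::finite"
  assumes fin: "finite A" "finite B" "A \<inter> B = {}" and inv: "\<And>j. j \<in> A \<Longrightarrow> u j \<bullet> v = 0"
    and \<phi>: "poly_functional d \<phi>" and dec: "decays d R u B \<phi>" and t0: "t0 \<in> {-1..1}"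
  shows "decays d R u (A \<union> B) (\<lambda>P. \<phi> (\<lambda>x. P x - P (x + t0 *\<^sub>R v)))"
proof -
  obtain C \<epsilon> where C: "C > 0" "\<epsilon> > 0" "osc_bound d R u B C \<epsilon> (\<lambda>P. \<bar>\<phi> P\<bar>)"
    using dec unfolding decays_def by (elim exE conjE) (rule that)
  obtain C1 \<delta> where C1: "C1 > 0" "\<delta> > 0" "\<forall>p :: real poly. degree p \<le> d \<longrightarrow> (\<forall>t\<in>{-1..1}.
    (LBINT s. indicator {-1..1} s * (1 + \<bar>poly p s\<bar>) powr - \<epsilon>) \<le> C1 * (1 + \<bar>poly p t\<bar>) powr - \<delta>)"
    using sublevel_integral_bound[OF C(2), of d] by (elim exE conjE) (rule that)
  define V where "V = measure lborel (cball (0 :: real ^ 'm) (R + norm v))"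
  define K where "K = sqrt (V * (C * 2 * C1) + 1)"
  have V: "V \<ge> 0" by (simp add: V_def)
  have "V * (C * 2 * C1) \<ge> 0" using V C C1 by auto
  then have K2: "K\<^sup>2 = V * (C * 2 * C1) + 1" and K: "K > 0"
    unfolding K_def by (simp_all only: real_sqrt_gt_0_iff real_sqrt_pow2_iff)
  show ?thesis unfolding decays_def
  proof (rule exI[of _ K], rule conjI[OF K], rule exI[of _ "\<delta> / 2"], rule conjI, use C1 in simp, intro allI ballI impI)
    fix M F and \<eta> :: "real ^ 'm \<Rightarrow> complex" and P :: "real ^ 'm \<Rightarrow> real"
    assume P: "P \<in> polys_le d" and F: "unit_bdd F (A \<union> B)" and \<eta>: "amp R M M \<eta>"
    have FA: "unit_bdd F A" and FB: "unit_bdd F B" using F by (auto simp: unit_bdd_def)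
    have M: "M \<ge> 0" by (rule ampD(4)[OF \<eta>])
    define G where "G = (\<lambda>x. cis (P x) * ((\<Prod>j\<in>B. F j (u j \<bullet> x)) * \<eta> x))"
    define D where "D = (\<lambda>t x. P x - P (x + t *\<^sub>R v))"
    have G: "bdd_supp M R G" unfolding G_def by (rule osc_integrand_bdd_supp[OF P FB \<eta>])
    have e: "osc u (A \<union> B) F P \<eta> = (LBINT x. (\<Prod>j\<in>A. F j (u j \<bullet> x)) * G x)"
      unfolding osc_def G_def by (simp add: prod.union_disjoint[OF fin] mult_ac)
    have vdc: "(norm (osc u (A \<union> B) F P \<eta>))\<^sup>2 \<le> V *
      (LBINT t. indicator {-1..1} t * norm (LBINT x. G x * cnj (G (x + t *\<^sub>R v))))"
      unfolding e V_def
      by (rule van_der_Corput_inequality[OF unit_bdd_prod_measurable[OF FA] unit_bdd_prod_norm[OF FA] unit_bdd_prod_invariant[OF inv] G])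
    have DP: "D t \<in> polys_le d" for t unfolding D_def by (intro polys_le_diff P polys_le_translate)
    obtain p where p: "degree p \<le> d" "\<And>t. \<phi> (\<lambda>x. P (x + t *\<^sub>R v)) = poly p t"
      using \<phi> P unfolding poly_functional_def by blast
    define q where "q = [:\<phi> P:] - p"
    have q: "degree q \<le> d" "\<phi> (D t) = poly q t" for t
    proof -
      show "degree q \<le> d" using p(1) by (auto simp: q_def intro!: degree_diff_le)
      have "\<phi> (D t) = \<phi> P - 1 * \<phi> (\<lambda>x. P (x + t *\<^sub>R v))"
        using flin_diff[OF fsub_polys_le _ P polys_le_translate[OF P, of "t *\<^sub>R v"], where \<phi> = \<phi> and a = 1] \<phi>
        by (simp add: D_def poly_functional_def)
      then show "\<phi> (D t) = poly q t" by (simp add: p(2) q_def)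
    qed
    have J: "norm (LBINT x. G x * cnj (G (x + t *\<^sub>R v))) \<le> C * (2 * M\<^sup>2) * (1 + \<bar>poly q t\<bar>) powr - \<epsilon>" for t
    proof -
      \<comment> \<open>\<open>F j\<close> times the conjugate of its translate is again a function
        of \<open>u j \<bullet> x\<close>, because moving along \<open>v\<close> only shifts this
        coordinate.\<close>
      define F' where "F' = (\<lambda>j s. F j s * cnj (F j (s + t * (u j \<bullet> v))))"
      have F': "unit_bdd F' B" unfolding unit_bdd_def
      proof (intro ballI conjI allI)
        fix j assume j: "j \<in> B"
        note [measurable] = unit_bddD(1)[OF FB j]
        show "borel_fun (F' j)" unfolding F'_def by measurable
        show "norm (F' j s) \<le> 1" for s unfolding F'_def norm_mult complex_mod_cnj
          by (intro mult_le_one unit_bddD(2)[OF FB j]) auto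
      qed
      have "G x * cnj (G (x + t *\<^sub>R v)) = cis (D t x) * ((\<Prod>j\<in>B. F' j (u j \<bullet> x)) * (\<eta> x * cnj (\<eta> (x + t *\<^sub>R v))))" for x
      proof -
        have c: "cis (D t x) = cis (P x) * cnj (cis (P (x + t *\<^sub>R v)))" by (simp add: D_def cis_cnj cis_mult)
        have f: "(\<Prod>j\<in>B. F' j (u j \<bullet> x)) = (\<Prod>j\<in>B. F j (u j \<bullet> x)) * cnj (\<Prod>j\<in>B. F j (u j \<bullet> (x + t *\<^sub>R v)))"
          by (simp add: F'_def prod.distrib inner_add_right)
        show ?thesis unfolding c f by (simp add: G_def mult_ac)
      qed
      then have e2: "(LBINT x. G x * cnj (G (x + t *\<^sub>R v))) = osc u B F' (D t) (\<lambda>x. \<eta> x * cnj (\<eta> (x + t *\<^sub>R v)))"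
        by (simp add: osc_def)
      show ?thesis unfolding e2 q(2)[symmetric]
        using C(3)[rule_format, OF DP[of t] F' amp_mult_cnj[OF \<eta>, of "t *\<^sub>R v"]] by simp
    qed
    have "(LBINT t. indicator {-1..1} t * norm (LBINT x. G x * cnj (G (x + t *\<^sub>R v)))) \<le>
      (LBINT t. C * (2 * M\<^sup>2) * (indicator {-1..1} t * (1 + \<bar>poly q t\<bar>) powr - \<epsilon>))"
    proof (rule integral_mono')
      have m: "borel_fun (\<lambda>s. poly q s)"
        by (intro borel_measurable_continuous_onI continuous_intros)
      have le1: "(1 + \<bar>a\<bar>) powr - \<epsilon> \<le> 1" for a :: real
        using C(2) powr_mono2'[of "-\<epsilon>" 1 "1 + \<bar>a\<bar>"] by simp
      have "bdd_supp 1 1 (\<lambda>s. indicator {-1..1} s * (1 + \<bar>poly q s\<bar>) powr - \<epsilon>)"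
        unfolding bdd_supp_def using m le1 by (auto split: split_indicator)
      from bdd_supp_integrable[OF this]
      show "integrable lborel (\<lambda>t. C * (2 * M\<^sup>2) * (indicator {-1..1} t * (1 + \<bar>poly q t\<bar>) powr - \<epsilon>))"
        by (rule integrable_mult_right)
      show "indicator {-1..1} t * norm (LBINT x. G x * cnj (G (x + t *\<^sub>R v))) \<le>
        C * (2 * M\<^sup>2) * (indicator {-1..1} t * (1 + \<bar>poly q t\<bar>) powr - \<epsilon>)" for t
        using J[of t] by (auto split: split_indicator)
    qed (use C in auto)
    also have "\<dots> = C * (2 * M\<^sup>2) * (LBINT t. indicator {-1..1} t * (1 + \<bar>poly q t\<bar>) powr - \<epsilon>)"
      by (rule integral_mult_right_zero)
    also have "\<dots> \<le> C * (2 * M\<^sup>2) * (C1 * (1 + \<bar>poly q t0\<bar>) powr - \<delta>)"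
      using C C1(3) q(1) t0 by (intro mult_left_mono) auto
    finally have "(norm (osc u (A \<union> B) F P \<eta>))\<^sup>2 \<le> V * (C * (2 * M\<^sup>2) * (C1 * (1 + \<bar>poly q t0\<bar>) powr - \<delta>))"
      by (intro order_trans[OF vdc] mult_left_mono V)
    also have "\<dots> = V * (C * 2 * C1) * (M\<^sup>2 * (1 + \<bar>poly q t0\<bar>) powr - \<delta>)" by (simp add: mult_ac)
    also have "\<dots> \<le> K\<^sup>2 * (M\<^sup>2 * (1 + \<bar>poly q t0\<bar>) powr - \<delta>)"
      unfolding K2 by (intro mult_right_mono) auto
    also have "\<dots> = (K * M * (1 + \<bar>poly q t0\<bar>) powr - (\<delta> / 2))\<^sup>2"
    proof -
      have "((1 + \<bar>poly q t0\<bar>) powr - (\<delta> / 2))\<^sup>2 = (1 + \<bar>poly q t0\<bar>) powr (- (\<delta> / 2) + - (\<delta> / 2))"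
        unfolding power2_eq_square by (rule powr_add[symmetric])
      then show ?thesis by (simp add: power_mult_distrib)
    qed
    finally have "norm (osc u (A \<union> B) F P \<eta>) \<le> K * M * (1 + \<bar>poly q t0\<bar>) powr - (\<delta> / 2)"
      by (rule power2_le_imp_le) (use K M in auto)
    then show "norm (osc u (A \<union> B) F P \<eta>) \<le> K * M * (1 + \<bar>\<phi> (\<lambda>x. P x - P (x + t0 *\<^sub>R v))\<bar>) powr - (\<delta> / 2)"
      using q(2)[of t0] by (simp add: D_def)
  qed
qed

text \<open>One and the same form obeys the bound of every functional, hence the best of them, and
  the largest value is comparable to the sum. Exponents are lowered to their minimum.\<close>

lemma decays_sum:
  fixes u :: "nat \<Rightarrow> real ^ 'm::finite"
  assumes "finite I" "\<And>i. i \<in> I \<Longrightarrow> decays d R u J (\<phi> i)"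
  shows "\<exists>C>0. \<exists>\<epsilon>>0. osc_bound d R u J C \<epsilon> (\<lambda>P. \<Sum>i\<in>I. \<bar>\<phi> i P\<bar>)"
  using assms
proof (induction I rule: finite_induct)
  case empty
  let ?V = "measure lborel (cball (0 :: real ^ 'm) R)"
  show ?case
  proof (rule exI[of _ "?V + 1"], rule conjI, simp add: add_nonneg_pos, rule exI[of _ 1], rule conjI, simp, intro allI ballI impI)
    fix M F and \<eta> :: "real ^ 'm \<Rightarrow> complex" and P :: "real ^ 'm \<Rightarrow> real"
    assume P: "P \<in> polys_le d" and F: "unit_bdd F J" and \<eta>: "amp R M M \<eta>"
    have "norm (osc u J F P \<eta>) \<le> M * ?V" by (rule osc_trivial_bound[OF P F \<eta>])
    also have "\<dots> \<le> (?V + 1) * M" using ampD(4)[OF \<eta>] by (simp add: algebra_simps)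
    finally show "norm (osc u J F P \<eta>) \<le> (?V + 1) * M * (1 + (\<Sum>i\<in>{}. \<bar>\<phi> i P\<bar>)) powr - 1" by simp
  qed
next
  case (insert k I)
  obtain C \<epsilon> where C: "C > 0" "\<epsilon> > 0" "osc_bound d R u J C \<epsilon> (\<lambda>P. \<Sum>i\<in>I. \<bar>\<phi> i P\<bar>)"
    using insert.IH insert.prems by auto
  obtain C' \<epsilon>' where C': "C' > 0" "\<epsilon>' > 0" "osc_bound d R u J C' \<epsilon>' (\<lambda>P. \<bar>\<phi> k P\<bar>)"
    using insert.prems[of k] unfolding decays_def by auto
  define \<delta> where "\<delta> = min \<epsilon> \<epsilon>'"
  define K where "K = max C C'"
  have \<delta>: "\<delta> > 0" "\<delta> \<le> \<epsilon>" "\<delta> \<le> \<epsilon>'" using C C' by (auto simp: \<delta>_def)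
  have K: "K > 0" "C \<le> K" "C' \<le> K" using C by (auto simp: K_def)
  show ?case
  proof (rule exI[of _ "K * 2 powr \<delta>"], rule conjI, use K in simp, rule exI[of _ \<delta>], rule conjI[OF \<delta>(1)], intro allI ballI impI)
    fix M F and \<eta> :: "real ^ 'm \<Rightarrow> complex" and P :: "real ^ 'm \<Rightarrow> real"
    assume P: "P \<in> polys_le d" and F: "unit_bdd F J" and \<eta>: "amp R M M \<eta>"
    have M: "M \<ge> 0" by (rule ampD(4)[OF \<eta>])
    define a where "a = \<bar>\<phi> k P\<bar>"
    define b where "b = (\<Sum>i\<in>I. \<bar>\<phi> i P\<bar>)"
    have ab: "a \<ge> 0" "b \<ge> 0" by (auto simp: a_def b_def intro: sum_nonneg)
    have 1: "norm (osc u J F P \<eta>) \<le> K * M * (1 + b) powr - \<delta>"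
    proof -
      have "norm (osc u J F P \<eta>) \<le> C * M * (1 + b) powr - \<epsilon>" using C(3) P F \<eta> by (simp add: b_def)
      also have "\<dots> \<le> K * M * (1 + b) powr - \<delta>"
        using M K \<delta> ab by (intro mult_mono powr_mono) auto
      finally show ?thesis .
    qed
    have 2: "norm (osc u J F P \<eta>) \<le> K * M * (1 + a) powr - \<delta>"
    proof -
      have "norm (osc u J F P \<eta>) \<le> C' * M * (1 + a) powr - \<epsilon>'" using C'(3) P F \<eta> by (simp add: a_def)
      also have "\<dots> \<le> K * M * (1 + a) powr - \<delta>"
        using M K \<delta> ab by (intro mult_mono powr_mono) auto
      finally show ?thesis .
    qed
    \<comment> \<open>The larger of the two values controls the sum, since \<open>1 + a + b\<close>
      is at most twice \<open>1 + max a b\<close>.\<close>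
    have "norm (osc u J F P \<eta>) \<le> K * M * (1 + max a b) powr - \<delta>" using 1 2 by (simp add: max_def)
    also have "\<dots> \<le> K * M * ((1 + (a + b)) / 2) powr - \<delta>"
      using K M \<delta> ab by (intro mult_left_mono powr_mono2') auto
    also have "((1 + (a + b)) / 2) powr - \<delta> = 2 powr \<delta> * (1 + (a + b)) powr - \<delta>"
      using ab by (simp add: powr_divide powr_minus field_simps)
    finally show "norm (osc u J F P \<eta>) \<le> K * 2 powr \<delta> * M * (1 + (\<Sum>i\<in>insert k I. \<bar>\<phi> i P\<bar>)) powr - \<delta>"
      using insert.hyps by (simp add: a_def b_def mult_ac)
  qed
qed

text \<open>All functions of the form are constant along a direction orthogonal to every
  \<open>u j\<close>, so \<open>directional_decay\<close> applies; a value at a point of the cube is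
  at most the supremum there.\<close>

lemma directional_functional_decays:
  fixes u :: "nat \<Rightarrow> real ^ 'm::finite"
  assumes inv: "\<And>j. j \<in> J \<Longrightarrow> u j \<bullet> w = 0" and z: "z \<in> unit_cube"
  shows "decays d R u J (\<lambda>P. ddir w P z)"
proof -
  obtain C \<epsilon> where C: "C > 0" "\<epsilon> > 0" "\<forall>M F \<eta>. \<forall>P\<in>polys_le d. borel_fun F \<longrightarrow> (\<forall>x. norm (F x) \<le> 1) \<longrightarrow>
    (\<forall>x t. F (x + t *\<^sub>R w) = F x) \<longrightarrow> amp R M M \<eta> \<longrightarrow>
    norm (LBINT x. cis (P x) * (F x * \<eta> x)) \<le> C * M * (1 + pnorm (ddir w P)) powr - \<epsilon>"
    using directional_decay[of d w R] by (elim exE conjE) (rule that)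
  show ?thesis unfolding decays_def
  proof (rule exI[of _ C], rule conjI[OF C(1)], rule exI[of _ \<epsilon>], rule conjI[OF C(2)], intro allI ballI impI)
    fix M F and \<eta> :: "real ^ 'm \<Rightarrow> complex" and P :: "real ^ 'm \<Rightarrow> real"
    assume P: "P \<in> polys_le d" and F: "unit_bdd F J" and \<eta>: "amp R M M \<eta>"
    have "norm (osc u J F P \<eta>) \<le> C * M * (1 + pnorm (ddir w P)) powr - \<epsilon>"
      unfolding osc_def using C(3)[rule_format, OF P unit_bdd_prod_measurable[OF F] unit_bdd_prod_norm[OF F] unit_bdd_prod_invariant[OF inv] \<eta>]
      by simp
    also have "\<dots> \<le> C * M * (1 + \<bar>ddir w P z\<bar>) powr - \<epsilon>"
      using C ampD(4)[OF \<eta>] pnorm_upper[OF ddir_polys_le[OF P] z, of w] by (intro mult_left_mono powr_mono2') auto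
    finally show "norm (osc u J F P \<eta>) \<le> C * M * (1 + \<bar>ddir w P z\<bar>) powr - \<epsilon>" .
  qed
qed

subsection \<open>Linearly independent directions\<close>

text \<open>Linear independence in the form in which it is used: moving along \<open>v j\<close>
  changes the coordinate \<open>u j \<bullet> x\<close> and no other one with index in
  \<open>J\<close>.\<close>

definition dual_system :: "(nat \<Rightarrow> 'a::real_inner) \<Rightarrow> nat set \<Rightarrow> (nat \<Rightarrow> 'a) \<Rightarrow> bool" where
  "dual_system u J v \<longleftrightarrow> (\<forall>i\<in>J. \<forall>j\<in>J. u i \<bullet> v j = (if i = j then 1 else 0))"

text \<open>The separate constant \<open>a\<close> makes the constants degenerate also when
  \<open>J\<close> is empty, in agreement with the convention for \<open>n = 0\<close> in the
  relative norm.\<close>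

definition degenerate :: "nat \<Rightarrow> (nat \<Rightarrow> real ^ 'm::finite) \<Rightarrow> nat set \<Rightarrow> (real ^ 'm \<Rightarrow> real) set" where
  "degenerate d u J = {w. \<exists>a g. (\<forall>j\<in>J. degree (g j) \<le> d) \<and> w = (\<lambda>x. a + (\<Sum>j\<in>J. poly (g j) (u j \<bullet> x)))}"

lemma subspace_invariant_directions: "subspace {y. \<forall>x t. P (x + t *\<^sub>R y) = P x}"
proof (rule subspaceI)
  fix y z assume y: "y \<in> {y. \<forall>x t. P (x + t *\<^sub>R y) = P x}" and z: "z \<in> {y. \<forall>x t. P (x + t *\<^sub>R y) = P x}"
  have "P (x + t *\<^sub>R (y + z)) = P x" for x t
  proof -
    have "P (x + t *\<^sub>R (y + z)) = P ((x + t *\<^sub>R y) + t *\<^sub>R z)" by (simp add: algebra_simps)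
    also have "\<dots> = P x" using y z by simp
    finally show ?thesis .
  qed
  then show "y + z \<in> {y. \<forall>x t. P (x + t *\<^sub>R y) = P x}" by simp
qed auto

text \<open>Projecting the coordinates of \<open>y\<close> in the standard basis shows that
  \<open>y\<close> is a combination of the given directions: the correction terms add up to the
  vectors \<open>(u k \<bullet> y) *\<^sub>R v k\<close>, which vanish. Directions of invariance
  form a subspace.\<close>

lemma invariant_under_complement:
  fixes P :: "'a::euclidean_space \<Rightarrow> real"
  assumes "finite K" and inv: "\<And>e x t. e \<in> Basis \<Longrightarrow> P (x + t *\<^sub>R (e - (\<Sum>k\<in>K. (u k \<bullet> e) *\<^sub>R v k))) = P x"
    and y: "\<And>k. k \<in> K \<Longrightarrow> u k \<bullet> y = 0"
  shows "P (x + y) = P x"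
proof -
  let ?S = "{y. \<forall>x t. P (x + t *\<^sub>R y) = P x}"
  have "(\<Sum>e\<in>Basis. (y \<bullet> e) *\<^sub>R (e - (\<Sum>k\<in>K. (u k \<bullet> e) *\<^sub>R v k))) \<in> ?S"
    by (intro subspace_sum subspace_scale subspace_invariant_directions) (use inv in auto)
  moreover have "(\<Sum>e\<in>Basis. (y \<bullet> e) *\<^sub>R (e - (\<Sum>k\<in>K. (u k \<bullet> e) *\<^sub>R v k))) = y"
  proof -
    have "(\<Sum>e\<in>Basis. (y \<bullet> e) *\<^sub>R (\<Sum>k\<in>K. (u k \<bullet> e) *\<^sub>R v k)) = (\<Sum>k\<in>K. (\<Sum>e\<in>Basis. (y \<bullet> e) * (u k \<bullet> e)) *\<^sub>R v k)"
      unfolding scaleR_sum_right scaleR_sum_left by (subst sum.swap) simp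
    also have "\<dots> = (\<Sum>k\<in>K. (u k \<bullet> y) *\<^sub>R v k)"
      by (intro sum.cong refl arg_cong2[of _ _ _ _ scaleR]) (subst euclidean_inner, simp add: mult.commute)
    also have "\<dots> = 0" using y by simp
    finally show ?thesis by (simp add: scaleR_diff_right sum_subtractf euclidean_representation)
  qed
  ultimately have "y \<in> ?S" by simp
  then have "P (x + 1 *\<^sub>R y) = P x" by blast
  then show ?thesis by simp
qed

text \<open>By the first condition \<open>P\<close> depends only on the coordinates
  \<open>u k \<bullet> x\<close>; by the second its increment along \<open>v k\<close> depends only
  on the k-th of them. Then \<open>P\<close> is the sum of its increments along the dual vectors,
  and these are one-variable polynomials.\<close>

lemma separated_polynomial_degenerate:
  fixes P :: "real ^ 'm::finite \<Rightarrow> real"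
  assumes J: "finite J" and dual: "dual_system u J v" and P: "P \<in> polys_le d"
    and a: "\<And>e x t. e \<in> Basis \<Longrightarrow> P (x + t *\<^sub>R (e - (\<Sum>k\<in>J. (u k \<bullet> e) *\<^sub>R v k))) = P x"
    and b: "\<And>k e x t s. k \<in> J \<Longrightarrow> e \<in> Basis \<Longrightarrow>
      P (x + t *\<^sub>R (e - (u k \<bullet> e) *\<^sub>R v k) + s *\<^sub>R v k) - P (x + t *\<^sub>R (e - (u k \<bullet> e) *\<^sub>R v k)) =
      P (x + s *\<^sub>R v k) - P x"
  shows "P \<in> degenerate d u J"
proof -
  have b': "P (y + s *\<^sub>R v k) = P y + (P (s *\<^sub>R v k) - P 0)" if k: "k \<in> J" and y: "u k \<bullet> y = 0" for k y s
  proof -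
    have "(\<lambda>x. P (x + s *\<^sub>R v k) - P x) (0 + y) = (\<lambda>x. P (x + s *\<^sub>R v k) - P x) 0"
      by (rule invariant_under_complement[where K = "{k}" and u = u and v = v]) (use b[OF k] y in auto)
    then show ?thesis by simp
  qed
  \<comment> \<open>The partial sum is annihilated by \<open>u k\<close>, so adding the next
    multiple of \<open>v k\<close> changes \<open>P\<close> by the same amount as at the
    origin.\<close>
  have sep: "P (\<Sum>k\<in>K. t k *\<^sub>R v k) = P 0 + (\<Sum>k\<in>K. P (t k *\<^sub>R v k) - P 0)" if "K \<subseteq> J" for K t
    using finite_subset[OF that J] that
  proof (induction K rule: finite_induct)
    case (insert k K)
    have "u k \<bullet> v j = 0" if "j \<in> K" for j
    proof -
      have "k \<in> J" "j \<in> J" "k \<noteq> j" using that insert.hyps insert.prems by auto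
      then show ?thesis using dual by (simp add: dual_system_def)
    qed
    then have "u k \<bullet> (\<Sum>j\<in>K. t j *\<^sub>R v j) = 0"
      unfolding inner_sum_right by (intro sum.neutral) simp
    from b'[OF _ this, of "t k"] insert show ?case by (simp add: add.commute)
  qed simp
  have P': "P x = P 0 + (\<Sum>k\<in>J. P ((u k \<bullet> x) *\<^sub>R v k) - P 0)" for x
  proof -
    let ?s = "\<Sum>k\<in>J. (u k \<bullet> x) *\<^sub>R v k"
    have "u j \<bullet> (x - ?s) = 0" if j: "j \<in> J" for j
    proof -
      have "(\<Sum>k\<in>J. (u k \<bullet> x) * (u j \<bullet> v k)) = (\<Sum>k\<in>J. if k = j then u k \<bullet> x else 0)"
        using dual j unfolding dual_system_def by (intro sum.cong) auto
      then show ?thesis using J j by (simp add: inner_diff_right inner_sum_right)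
    qed
    from invariant_under_complement[OF J a this, of ?s] have "P x = P ?s" by simp
    then show ?thesis using sep[of J "\<lambda>k. u k \<bullet> x"] by simp
  qed
  have "\<forall>k. \<exists>p. degree p \<le> d \<and> (\<forall>t. P (0 + t *\<^sub>R v k) = poly p t)"
    using polys_le_on_line[OF P] by blast
  from choice[OF this] obtain p where p: "\<And>k. degree (p k) \<le> d" "\<And>k t. P (t *\<^sub>R v k) = poly (p k) t" by auto
  show ?thesis unfolding degenerate_def
  proof (intro CollectI exI conjI ballI)
    show "degree (p k - [:P 0:]) \<le> d" for k using p(1)[of k] by (auto intro!: degree_diff_le)
    show "P = (\<lambda>x. P 0 + (\<Sum>k\<in>J. poly (p k - [:P 0:]) (u k \<bullet> x)))"
      by (rule ext, subst P') (simp add: p(2))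
  qed
qed

lemma periodic_poly_const:
  fixes p :: "real poly"
  assumes "\<And>s. poly p (s + 1) = poly p s"
  shows "poly p s = poly p 0"
proof -
  have n: "poly p (real n) = poly p 0" for n
  proof (induction n)
    case (Suc n)
    then show ?case using assms[of "real n"] by (simp add: add.commute)
  qed simp
  have "p - [:poly p 0:] = 0"
  proof (rule ccontr)
    assume "p - [:poly p 0:] \<noteq> 0"
    then have "finite {x. poly (p - [:poly p 0:]) x = 0}" by (rule poly_roots_finite)
    moreover have "range real \<subseteq> {x. poly (p - [:poly p 0:]) x = 0}" using n by auto
    ultimately have "finite (range real)" by (rule rev_finite_subset)
    moreover have "infinite (range real)" by (rule range_inj_infinite) (simp add: inj_on_def)
    ultimately show False by simp
  qed
  then have "p = [:poly p 0:]" by simp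
  then have "poly p s = poly [:poly p 0:] s" by simp
  then show ?thesis by simp
qed

text \<open>On each line in direction \<open>v\<close> the polynomial has period 1, so it takes one
  value at all natural numbers and is constant.\<close>

lemma polys_le_periodic_invariant:
  fixes P :: "real ^ 'm::finite \<Rightarrow> real"
  assumes P: "P \<in> polys_le d" and per: "\<And>x. P (x + v) = P x"
  shows "P (x + s *\<^sub>R v) = P x"
proof -
  obtain p where p: "\<And>t. P (x + t *\<^sub>R v) = poly p t" using polys_le_on_line[OF P] by metis
  have "poly p (s + 1) = poly p s" for s
    using per[of "x + s *\<^sub>R v"] p[of "s + 1"] p[of s] by (simp add: algebra_simps)
  from periodic_poly_const[OF this, of s] show ?thesis using p[of s] p[of 0] by simp
qed

lemma poly_functional_ddir: "poly_functional d (\<lambda>P. ddir w P z)"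
  unfolding poly_functional_def flin_def
proof (intro conjI ballI allI ddir_add ddir_scale)
  fix P :: "real ^ 'a \<Rightarrow> real" and v assume P: "P \<in> polys_le d"
  obtain p where p: "degree p \<le> d" "\<And>t. ddir w P (z + t *\<^sub>R v) = poly p t"
    using polys_le_on_line[OF ddir_polys_le'[OF P]] by metis
  have "ddir w (\<lambda>x. P (x + h)) z = ddir w P (z + h)" for h
    unfolding ddir_def by (simp add: algebra_simps)
  then show "\<exists>p. degree p \<le> d \<and> (\<forall>t. ddir w (\<lambda>x. P (x + t *\<^sub>R v)) z = poly p t)"
    using p by auto
qed auto

lemma poly_functional_difference:
  fixes \<phi> :: "(real ^ 'm::finite \<Rightarrow> real) \<Rightarrow> real"
  assumes \<phi>: "poly_functional d \<phi>"
  shows "poly_functional d (\<lambda>P. \<phi> (\<lambda>x. P x - P (x + h)))"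
proof -
  have fl: "flin (polys_le d) \<phi>" using \<phi> by (simp add: poly_functional_def)
  have D: "(\<lambda>x. P x - P (x + h)) \<in> polys_le d" if "P \<in> polys_le d" for P :: "real ^ 'm \<Rightarrow> real"
    by (intro polys_le_diff that polys_le_translate)
  show ?thesis unfolding poly_functional_def flin_def
  proof (intro conjI ballI allI)
    fix P Q :: "real ^ 'm \<Rightarrow> real" assume "P \<in> polys_le d" "Q \<in> polys_le d"
    from flin_add[OF fl D[OF this(1)] D[OF this(2)]]
    show "\<phi> (\<lambda>x. P x + Q x - (P (x + h) + Q (x + h))) = \<phi> (\<lambda>x. P x - P (x + h)) + \<phi> (\<lambda>x. Q x - Q (x + h))"
      by (simp add: algebra_simps)
  next
    fix P :: "real ^ 'm \<Rightarrow> real" and a assume "P \<in> polys_le d"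
    from flin_scale[OF fl D[OF this]]
    show "\<phi> (\<lambda>x. a * P x - a * P (x + h)) = a * \<phi> (\<lambda>x. P x - P (x + h))"
      by (simp add: algebra_simps)
  next
    fix P :: "real ^ 'm \<Rightarrow> real" and v assume P: "P \<in> polys_le d"
    obtain p where "degree p \<le> d" "\<forall>t. \<phi> (\<lambda>x. (\<lambda>x. P x - P (x + h)) (x + t *\<^sub>R v)) = poly p t"
      using \<phi>[unfolded poly_functional_def, THEN conjunct2, THEN bspec, OF D[OF P], THEN spec, of v]
      by (elim exE conjE) (rule that)
    then show "\<exists>p. degree p \<le> d \<and> (\<forall>t. \<phi> (\<lambda>x. P (x + t *\<^sub>R v) - P (x + h + t *\<^sub>R v)) = poly p t)"
      by (intro exI[of _ p]) (simp add: algebra_simps)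
  qed
qed

lemma exists_unisolvent_set:
  "\<exists>Z. finite Z \<and> Z \<subseteq> unit_cube \<and> (\<forall>P\<in>polys_le d. (\<forall>z\<in>Z. P z = 0) \<longrightarrow> P = (\<lambda>_ :: real ^ 'm::finite. 0))"
proof -
  obtain w :: "'m \<Rightarrow> nat" and N where N: "finite N" "N \<subseteq> {-1..1}"
    and z: "\<forall>P\<in>polys_le d. (\<forall>s\<in>N. P (power_curve w s) = 0) \<longrightarrow> P = (\<lambda>_. 0)"
    using exists_unisolvent_curve[where 'm = 'm, of d] by (elim exE conjE) (rule that)
  have "power_curve w ` N \<subseteq> unit_cube"
  proof (intro image_subsetI power_curve_in_unit_cube)
    fix s assume "s \<in> N"
    then have "s \<in> {-1..1}" using N(2) by (rule subsetD[rotated])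
    then show "\<bar>s\<bar> \<le> 1" by (simp add: abs_le_iff)
  qed
  with N(1) z show ?thesis by (intro exI[of _ "power_curve w ` N"]) auto
qed

text \<open>Two families are needed. Derivatives along \<open>w e\<close> test whether
  \<open>P\<close> depends on the \<open>u j \<bullet> x\<close> alone; all functions are constant
  in these directions. Derivatives along \<open>w' k e\<close> of the unit difference along
  \<open>v k\<close> test whether increments along \<open>v k\<close> depend on
  \<open>u k \<bullet> x\<close> alone; differencing along \<open>v k\<close> first removes all
  functions but the k-th, and this one is constant along \<open>w' k e\<close>. Evaluating at a
  unisolvent set keeps the families finite.\<close>

lemma independent_functionals:
  fixes u :: "nat \<Rightarrow> real ^ 'm::finite"
  assumes J: "finite J" and dual: "dual_system u J v"
  shows "\<exists>\<Phi>. finite \<Phi> \<and> (\<forall>\<phi>\<in>\<Phi>. poly_functional d \<phi>) \<and> (\<forall>R. \<forall>\<phi>\<in>\<Phi>. decays d R u J \<phi>) \<and>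
    (\<forall>P\<in>polys_le d. (\<forall>\<phi>\<in>\<Phi>. \<phi> P = 0) \<longrightarrow> P \<in> degenerate d u J)"
proof -
  obtain Z :: "(real ^ 'm) set" where Z: "finite Z" "Z \<subseteq> unit_cube"
    "\<forall>P\<in>polys_le d. (\<forall>z\<in>Z. P z = 0) \<longrightarrow> P = (\<lambda>_. 0)"
    using exists_unisolvent_set[where 'm='m, of d] by (elim exE conjE) (rule that)
  \<comment> \<open>\<open>w e\<close> removes the part of \<open>e\<close> seen by any
    \<open>u k\<close> with \<open>k\<close> in \<open>J\<close>; the vector \<open>w' k e\<close>
    only has to be orthogonal to the single \<open>u k\<close>.\<close>
  define w where "w = (\<lambda>e. e - (\<Sum>k\<in>J. (u k \<bullet> e) *\<^sub>R v k))"
  define w' where "w' = (\<lambda>k e. e - (u k \<bullet> e) *\<^sub>R v k)"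
  define f where "f = (\<lambda>(e, z) P. ddir (w e) P z)"
  define g where "g = (\<lambda>(k, e, z) P. ddir (w' k e) (\<lambda>x. P x - P (x + 1 *\<^sub>R v k)) z)"
  define \<Phi> where "\<Phi> = f ` (Basis \<times> Z) \<union> g ` (J \<times> Basis \<times> Z)"
  have "finite \<Phi>" using J Z by (auto simp: \<Phi>_def)
  moreover have "poly_functional d \<phi>" if "\<phi> \<in> \<Phi>" for \<phi>
    using that by (auto simp: \<Phi>_def f_def g_def intro: poly_functional_ddir poly_functional_difference[OF poly_functional_ddir])
  moreover have "decays d R u J \<phi>" if \<phi>: "\<phi> \<in> \<Phi>" for \<phi> R
  proof -
    consider e z where "e \<in> Basis" "z \<in> Z" "\<phi> = (\<lambda>P. ddir (w e) P z)"
      | k e z where "k \<in> J" "e \<in> Basis" "z \<in> Z" "\<phi> = (\<lambda>P. ddir (w' k e) (\<lambda>x. P x - P (x + 1 *\<^sub>R v k)) z)"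
      using \<phi> by (auto simp: \<Phi>_def f_def g_def)
    then show ?thesis
    proof cases
      case 1
      show ?thesis unfolding 1(3)
      proof (rule directional_functional_decays)
        fix j assume j: "j \<in> J"
        have "(\<Sum>k\<in>J. (u k \<bullet> e) * (u j \<bullet> v k)) = (\<Sum>k\<in>J. if k = j then u k \<bullet> e else 0)"
          using dual j unfolding dual_system_def by (intro sum.cong) auto
        then show "u j \<bullet> w e = 0" using J j by (simp add: w_def inner_diff_right inner_sum_right)
      qed (use 1 Z in auto)
    next
      case 2
      have "decays d R u ((J - {k}) \<union> {k}) \<phi>" unfolding 2(4)
      proof (rule van_der_Corput_decay)
        show "u j \<bullet> v k = 0" if "j \<in> J - {k}" for j using dual 2 that by (auto simp: dual_system_def)
        show "poly_functional d (\<lambda>P. ddir (w' k e) P z)" by (rule poly_functional_ddir)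
        show "decays d R u {k} (\<lambda>P. ddir (w' k e) P z)"
        proof (rule directional_functional_decays)
          show "u j \<bullet> w' k e = 0" if "j \<in> {k}" for j
            using that dual 2 by (simp add: w'_def inner_diff_right dual_system_def)
        qed (use 2 Z in auto)
      qed (use J in auto)
      then show ?thesis using 2(1) by (simp add: insert_absorb)
    qed
  qed
  moreover have "P \<in> degenerate d u J" if P: "P \<in> polys_le d" and 0: "\<forall>\<phi>\<in>\<Phi>. \<phi> P = 0" for P
  proof (rule separated_polynomial_degenerate[OF J dual P])
    fix e x t assume e: "e \<in> (Basis :: (real ^ 'm) set)"
    have "ddir (w e) P z = 0" if "z \<in> Z" for z
    proof -
      have "f (e, z) \<in> \<Phi>" using e that by (auto simp: \<Phi>_def)
      then show ?thesis using 0 by (auto simp: f_def)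
    qed
    then have "ddir (w e) P = (\<lambda>_. 0)" using Z(3) ddir_polys_le'[OF P] by blast
    then show "P (x + t *\<^sub>R (e - (\<Sum>k\<in>J. (u k \<bullet> e) *\<^sub>R v k))) = P x"
      using ddir_zero_invariant[OF P, of "w e"] by (simp add: w_def)
  next
    fix k e x t s assume k: "k \<in> J" and e: "e \<in> (Basis :: (real ^ 'm) set)"
    define D where "D = (\<lambda>x. P x - P (x + 1 *\<^sub>R v k))"
    have D: "D \<in> polys_le d" unfolding D_def by (intro polys_le_diff P polys_le_translate)
    have "ddir (w' k e) D z = 0" if "z \<in> Z" for z
    proof -
      have "g (k, e, z) \<in> \<Phi>" using k e that by (auto simp: \<Phi>_def)
      then show ?thesis using 0 by (auto simp: g_def D_def)
    qed
    then have "ddir (w' k e) D = (\<lambda>_. 0)" using Z(3) ddir_polys_le'[OF D] by blast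
    then have inv: "D (x + t *\<^sub>R w' k e) = D x" for x t by (intro ddir_zero_invariant[OF D]) simp
    define E where "E = (\<lambda>x. P (x + t *\<^sub>R w' k e) - P x)"
    have E: "E \<in> polys_le d" unfolding E_def by (intro polys_le_diff P polys_le_translate)
    \<comment> \<open>The functionals see only the unit step along \<open>v k\<close>. Since the
      increment \<open>E\<close> is a polynomial with period \<open>v k\<close>, it is constant in
      this direction, which gives every step \<open>s\<close>.\<close>
    have "E (x + s *\<^sub>R v k) = E x"
    proof (rule polys_le_periodic_invariant[OF E])
      fix x show "E (x + v k) = E x" using inv[of x t] by (simp add: E_def D_def algebra_simps)
    qed
    moreover have w': "e - (u k \<bullet> e) *\<^sub>R v k = w' k e" by (simp add: w'_def)
    ultimately show "P (x + t *\<^sub>R (e - (u k \<bullet> e) *\<^sub>R v k) + s *\<^sub>R v k) - P (x + t *\<^sub>R (e - (u k \<bullet> e) *\<^sub>R v k)) =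
      P (x + s *\<^sub>R v k) - P x"
      unfolding w' by (simp add: E_def algebra_simps)
  qed
  ultimately show ?thesis by (intro exI[of _ \<Phi>]) blast
qed

section \<open>The statement of the induction and its independent case\<close>

abbreviation nondegenerate :: "((real ^ 'm::finite \<Rightarrow> real) \<Rightarrow> real) \<Rightarrow> nat \<Rightarrow> (nat \<Rightarrow> real ^ 'm) \<Rightarrow> nat set \<Rightarrow>
    real \<Rightarrow> (real ^ 'm \<Rightarrow> real) \<Rightarrow> bool" where
  "nondegenerate nrm d u J N P \<equiv> \<forall>w\<in>degenerate d u J. N \<le> nrm (\<lambda>x. P x - w x)"

text \<open>\<open>N\<close> is an arbitrary lower bound for the distance of \<open>P\<close> to the
  degenerate polynomials. In this form it passes directly to \<open>P\<close> minus a polynomial in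
  \<open>u n \<bullet> x\<close> when the n-th direction is dropped. The amplitude has
  \<open>M\<close> both as bound and as Lipschitz constant.\<close>

abbreviation osc_claim_with :: "((real ^ 'm::finite \<Rightarrow> real) \<Rightarrow> real) \<Rightarrow> nat \<Rightarrow> real \<Rightarrow> (nat \<Rightarrow> real ^ 'm) \<Rightarrow>
    nat set \<Rightarrow> real \<Rightarrow> real \<Rightarrow> bool" where
  "osc_claim_with nrm d R u J C \<epsilon> \<equiv> \<forall>M F \<eta> N. \<forall>P\<in>polys_le d. unit_bdd F J \<longrightarrow> amp R M M \<eta> \<longrightarrow> 0 \<le> N \<longrightarrow>
     nondegenerate nrm d u J N P \<longrightarrow> norm (osc u J F P \<eta>) \<le> C * M * (1 + N) powr - \<epsilon>"

definition osc_claim :: "((real ^ 'm::finite \<Rightarrow> real) \<Rightarrow> real) \<Rightarrow> nat \<Rightarrow> real \<Rightarrow> (nat \<Rightarrow> real ^ 'm) \<Rightarrow> nat set \<Rightarrow> bool" where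
  "osc_claim nrm d R u J \<longleftrightarrow> (\<exists>C>0. \<exists>\<epsilon>>0. osc_claim_with nrm d R u J C \<epsilon>)"

lemma norm_on_sum_le:
  assumes N: "norm_on S nrm" and S: "fsub S" and e: "\<And>i. i \<in> I \<Longrightarrow> e i \<in> S" and fin: "finite I"
  shows "nrm (\<lambda>x. \<Sum>i\<in>I. a i * e i x) \<le> (\<Sum>i\<in>I. \<bar>a i\<bar> * nrm (e i))"
  using fin e
proof (induction I rule: finite_induct)
  case empty
  have "nrm (\<lambda>_. 0) = 0" using N fsub_zero[OF S] unfolding norm_on_def by blast
  then show ?case by simp
next
  case (insert k I)
  have 1: "(\<lambda>x. a k * e k x) \<in> S" using insert.prems by (intro fsub_scale[OF S]) simp
  have 2: "(\<lambda>x. \<Sum>i\<in>I. a i * e i x) \<in> S" using insert.prems by (intro fsub_sum[OF S]) simp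
  have "nrm (\<lambda>x. a k * e k x + (\<Sum>i\<in>I. a i * e i x)) \<le> nrm (\<lambda>x. a k * e k x) + nrm (\<lambda>x. \<Sum>i\<in>I. a i * e i x)"
    using N 1 2 by (simp add: norm_on_def)
  also have "nrm (\<lambda>x. a k * e k x) = \<bar>a k\<bar> * nrm (e k)" using N insert.prems[of k] by (simp add: norm_on_def)
  finally show ?case using insert by simp
qed

text \<open>By \<open>functional_splitting\<close>, \<open>P\<close> is degenerate up to a
  combination of fixed polynomials with coefficients \<open>\<phi> P\<close>. Hence the distance
  \<open>N\<close> is at most a constant times the sum of the \<open>\<bar>\<phi> P\<bar>\<close>,
  in which the form decays.\<close>

lemma osc_claim_independent:
  fixes u :: "nat \<Rightarrow> real ^ 'm::finite"
  assumes nrm: "norm_on (polys_le d) nrm" and J: "finite J" and dual: "dual_system u J v"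
  shows "osc_claim nrm d R u J"
proof -
  obtain \<Phi> where \<Phi>: "finite \<Phi>" "\<forall>\<phi>\<in>\<Phi>. poly_functional d \<phi>" "\<forall>R. \<forall>\<phi>\<in>\<Phi>. decays d R u J \<phi>"
    "\<forall>P\<in>polys_le d. (\<forall>\<phi>\<in>\<Phi>. \<phi> P = 0) \<longrightarrow> P \<in> degenerate d u J"
    using independent_functionals[OF J dual, of d] by (elim exE conjE) (rule that)
  have "\<exists>e. (\<forall>\<phi>\<in>\<Phi>. e \<phi> \<in> polys_le d) \<and> (\<forall>P\<in>polys_le d. (\<lambda>x. P x - (\<Sum>\<phi>\<in>\<Phi>. \<phi> P * e \<phi> x)) \<in> degenerate d u J)"
    by (rule functional_splitting[where \<phi> = "\<lambda>\<phi>. \<phi>", OF \<Phi>(1) fsub_polys_le]) (use \<Phi> in \<open>auto simp: poly_functional_def\<close>)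
  then obtain e where e: "\<And>\<phi>. \<phi>\<in>\<Phi> \<Longrightarrow> e \<phi> \<in> polys_le d"
    "\<And>P. P\<in>polys_le d \<Longrightarrow> (\<lambda>x. P x - (\<Sum>\<phi>\<in>\<Phi>. \<phi> P * e \<phi> x)) \<in> degenerate d u J" by auto
  obtain C \<epsilon> where C: "C > 0" "\<epsilon> > 0" "osc_bound d R u J C \<epsilon> (\<lambda>P. \<Sum>\<phi>\<in>\<Phi>. \<bar>\<phi> P\<bar>)"
    using decays_sum[where \<phi> = "\<lambda>\<phi>. \<phi>", OF \<Phi>(1), of d R u J] \<Phi>(3) by blast
  define K where "K = 1 + (\<Sum>\<phi>\<in>\<Phi>. nrm (e \<phi>))"
  have ne: "0 \<le> nrm (e \<phi>)" if "\<phi> \<in> \<Phi>" for \<phi> using nrm e(1)[OF that] by (simp add: norm_on_def)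
  have K: "K \<ge> 1" using ne by (simp add: K_def sum_nonneg)
  show ?thesis unfolding osc_claim_def
  proof (rule exI[of _ "C * K powr \<epsilon>"], rule conjI, use C K in simp, rule exI[of _ \<epsilon>], rule conjI[OF C(2)], intro allI ballI impI)
    fix M F and \<eta> :: "real ^ 'm \<Rightarrow> complex" and N and P :: "real ^ 'm \<Rightarrow> real"
    assume P: "P \<in> polys_le d" and F: "unit_bdd F J" and \<eta>: "amp R M M \<eta>" and N0: "0 \<le> N"
      and N: "nondegenerate nrm d u J N P"
    define X where "X = (\<Sum>\<phi>\<in>\<Phi>. \<bar>\<phi> P\<bar>)"
    have X: "X \<ge> 0" by (simp add: X_def sum_nonneg)
    have "N \<le> nrm (\<lambda>x. \<Sum>\<phi>\<in>\<Phi>. \<phi> P * e \<phi> x)" using bspec[OF N e(2)[OF P]] by simp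
    also have "\<dots> \<le> (\<Sum>\<phi>\<in>\<Phi>. \<bar>\<phi> P\<bar> * nrm (e \<phi>))"
      by (rule norm_on_sum_le[OF nrm fsub_polys_le e(1) \<Phi>(1)])
    also have "\<dots> \<le> (\<Sum>\<phi>\<in>\<Phi>. X * nrm (e \<phi>))"
      using \<Phi>(1) ne by (intro sum_mono mult_right_mono) (auto simp: X_def intro: member_le_sum)
    also have "\<dots> = X * (K - 1)" by (simp add: K_def sum_distrib_left)
    finally have "1 + N \<le> K * (1 + X)" using K X by (simp add: algebra_simps)
    then have NX: "(1 + N) / K \<le> 1 + X" using K by (simp add: field_simps)
    have "norm (osc u J F P \<eta>) \<le> C * M * (1 + X) powr - \<epsilon>" using C(3) P F \<eta> by (simp add: X_def)
    also have "\<dots> \<le> C * M * ((1 + N) / K) powr - \<epsilon>"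
      using C ampD(4)[OF \<eta>] NX N0 K by (intro mult_left_mono powr_mono2') auto
    also have "((1 + N) / K) powr - \<epsilon> = K powr \<epsilon> * (1 + N) powr - \<epsilon>"
      using K N0 by (simp add: powr_divide powr_minus field_simps)
    finally show "norm (osc u J F P \<eta>) \<le> C * K powr \<epsilon> * M * (1 + N) powr - \<epsilon>" by (simp add: mult_ac)
  qed
qed

subsection \<open>A Plancherel inequality\<close>

definition fourier :: "(real \<Rightarrow> complex) \<Rightarrow> real \<Rightarrow> complex" where
  "fourier g \<xi> = (LBINT s. g s * cis (- (\<xi> * s)))"

text \<open>Its value at 0 is the square integral of \<open>h\<close>, which is how the square norm
  is recovered in the limit below.\<close>

definition autocorr :: "(real \<Rightarrow> complex) \<Rightarrow> real \<Rightarrow> complex" where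
  "autocorr h t = (LBINT x. h x * cnj (h (x + t)))"

text \<open>The weight will be the Gaussian, which has no bounded support; integrability of the
  double integral comes from that of \<open>\<phi>\<close> together with the bounded support of
  \<open>h\<close>.\<close>

lemma weighted_Fubini:
  fixes \<phi> :: "real \<Rightarrow> real" and h :: "real \<Rightarrow> complex"
  assumes \<phi>: "integrable lborel \<phi>" and h: "bdd_supp M R h"
    and b: "case_prod b \<in> borel_measurable (borel \<Otimes>\<^sub>M borel)" "\<And>t x. norm (b t x) \<le> C"
  shows "(LBINT t. (LBINT x. \<phi> t *\<^sub>R (h x * b t x))) = (LBINT x. (LBINT t. \<phi> t *\<^sub>R (h x * b t x)))"
proof -
  note [measurable] = bdd_suppD(1)[OF h] b(1)
  have [measurable]: "borel_fun \<phi>" using \<phi> by auto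
  have C: "0 \<le> C" using order_trans[OF norm_ge_zero b(2)] .
  have M: "0 \<le> M" by (rule bdd_suppD(4)[OF h])
  have sup: "bdd_supp (\<bar>\<phi> t\<bar> * (M * C)) R (\<lambda>x. \<phi> t *\<^sub>R (h x * b t x))" for t unfolding bdd_supp_def
  proof (intro conjI allI impI)
    show "borel_fun (\<lambda>x. \<phi> t *\<^sub>R (h x * b t x))" by measurable
    show "norm (\<phi> t *\<^sub>R (h x * b t x)) \<le> \<bar>\<phi> t\<bar> * (M * C)" for x
      unfolding norm_scaleR norm_mult by (intro mult_left_mono mult_mono bdd_suppD(2)[OF h] b(2) M) auto
    show "R < norm x \<Longrightarrow> \<phi> t *\<^sub>R (h x * b t x) = 0" for x using bdd_suppD(3)[OF h] by simp
  qed
  have "integrable (lborel \<Otimes>\<^sub>M lborel) (\<lambda>(t, x). \<phi> t *\<^sub>R (h x * b t x))"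
  proof (rule lborel_pair.Fubini_integrable)
    show "(\<lambda>(t, x). \<phi> t *\<^sub>R (h x * b t x)) \<in> borel_measurable (lborel \<Otimes>\<^sub>M lborel)" by measurable
    show "AE t in lborel. integrable lborel (\<lambda>x. (\<lambda>(t, x). \<phi> t *\<^sub>R (h x * b t x)) (t, x))"
      using bdd_supp_integrable[OF sup] by simp
    show "integrable lborel (\<lambda>t. \<integral>x. norm ((\<lambda>(t, x). \<phi> t *\<^sub>R (h x * b t x)) (t, x)) \<partial>lborel)"
    proof (rule Bochner_Integration.integrable_bound)
      show "integrable lborel (\<lambda>t. \<bar>\<phi> t\<bar> * (M * C * measure lborel (cball (0::real) R)))"
        using \<phi> by (intro integrable_mult_left integrable_abs)
      show "(\<lambda>t. \<integral>x. norm ((\<lambda>(t, x). \<phi> t *\<^sub>R (h x * b t x)) (t, x)) \<partial>lborel) \<in> borel_measurable lborel"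
        by measurable
      have "norm (LBINT x. norm (\<phi> t *\<^sub>R (h x * b t x))) \<le> (\<bar>\<phi> t\<bar> * (M * C)) * measure lborel (cball (0::real) R)" for t
        using bdd_supp_integral_le[of "\<bar>\<phi> t\<bar> * (M * C)" R "\<lambda>x. norm (\<phi> t *\<^sub>R (h x * b t x))"] sup[of t]
        unfolding bdd_supp_def by auto
      then show "AE t in lborel. norm (LBINT x. norm ((\<lambda>(t, x). \<phi> t *\<^sub>R (h x * b t x)) (t, x)))
        \<le> norm (\<bar>\<phi> t\<bar> * (M * C * measure lborel (cball (0::real) R)))"
        using M C by (intro AE_I2) (simp add: abs_mult mult_ac)
    qed
  qed
  from lborel_pair.Fubini_integral[OF this] show ?thesis by simp
qed

lemma gaussian_fourier: "(LBINT t. std_normal_density t *\<^sub>R cis (t * y)) = complex_of_real (exp (- y\<^sup>2 / 2))"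
proof -
  have "char std_normal_distribution y = (LBINT t. std_normal_density t *\<^sub>R iexp (y * t))"
    unfolding char_def by (subst integral_density) auto
  then show ?thesis by (simp add: char_std_normal_distribution cis_conv_exp mult.commute)
qed

lemma fourier_measurable:
  assumes "borel_fun h"
  shows "borel_fun (fourier h)"
proof -
  note [measurable] = assms
  show ?thesis unfolding fourier_def[abs_def] by (rule borel_measurable_lborel_integral_fst) measurable
qed

lemma fourier_bound:
  assumes h: "bdd_supp M R h"
  shows "norm (fourier h \<xi>) \<le> M * measure lborel (cball (0::real) R)"
proof -
  note [measurable] = bdd_suppD(1)[OF h]
  have "bdd_supp M R (\<lambda>s. cis (- (\<xi> * s)) * h s)"
  proof (rule bdd_supp_mult_left[OF _ _ h])
    show "borel_fun (\<lambda>s. cis (- (\<xi> * s)))" by measurable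
  qed simp
  from bdd_supp_integral_le[OF this] show ?thesis by (simp add: fourier_def mult.commute)
qed

lemma autocorr_measurable:
  assumes "borel_fun h"
  shows "borel_fun (autocorr h)"
proof -
  note [measurable] = assms
  show ?thesis unfolding autocorr_def[abs_def] by (rule borel_measurable_lborel_integral_fst) measurable
qed

text \<open>A regularised Parseval identity. The Gaussian weight makes everything absolutely
  convergent, so Fubini moves the oscillation onto the Gaussian, whose transform is explicit. For
  large \<open>a\<close> the Gaussian mean of the autocorrelation on the right tends to its value at
  0.\<close>

lemma gaussian_energy:
  assumes h: "bdd_supp M R h" and a: "a \<noteq> 0"
  shows "complex_of_real (LBINT t. std_normal_density t * (norm (fourier h (a * t)))\<^sup>2) =
    of_real (sqrt (2 * pi) / \<bar>a\<bar>) * (LBINT z. std_normal_density z *\<^sub>R autocorr h (z / a))"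
proof -
  let ?\<phi> = std_normal_density
  define B where "B = M * measure lborel (cball (0::real) R)"
  note hm [measurable] = bdd_suppD(1)[OF h]
  note fm [measurable] = fourier_measurable[OF hm]
  have \<phi>: "integrable lborel ?\<phi>" by simp
  have cn: "norm (cis x) \<le> 1" for x by simp
  have h': "bdd_supp M R (\<lambda>y. cnj (h y))" using h by (auto simp: bdd_supp_def)
  have "complex_of_real (LBINT t. ?\<phi> t * (norm (fourier h (a * t)))\<^sup>2) =
    (LBINT t. ?\<phi> t *\<^sub>R (fourier h (a * t) * cnj (fourier h (a * t))))"
    unfolding integral_complex_of_real[symmetric]
    by (intro Bochner_Integration.integral_cong) (simp_all only: complex_norm_square[symmetric] scaleR_conv_of_real of_real_mult)
  also have "\<dots> = (LBINT t. (LBINT x. ?\<phi> t *\<^sub>R (h x * (cis (- (a * t * x)) * cnj (fourier h (a * t))))))"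
  proof (intro Bochner_Integration.integral_cong refl)
    fix t
    have "(LBINT x. ?\<phi> t *\<^sub>R (h x * (cis (- (a * t * x)) * cnj (fourier h (a * t))))) =
      ?\<phi> t *\<^sub>R (LBINT x. (h x * cis (- (a * t * x))) * cnj (fourier h (a * t)))"
      by (simp add: mult.assoc)
    also have "\<dots> = ?\<phi> t *\<^sub>R (fourier h (a * t) * cnj (fourier h (a * t)))"
      by (subst integral_mult_left_zero) (simp add: fourier_def)
    finally show "?\<phi> t *\<^sub>R (fourier h (a * t) * cnj (fourier h (a * t))) =
      (LBINT x. ?\<phi> t *\<^sub>R (h x * (cis (- (a * t * x)) * cnj (fourier h (a * t)))))"
      by (rule sym)
  qed
  also have "\<dots> = (LBINT x. (LBINT t. ?\<phi> t *\<^sub>R (h x * (cis (- (a * t * x)) * cnj (fourier h (a * t))))))"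
  proof (rule weighted_Fubini[OF \<phi> h])
    show "(\<lambda>(t, x). cis (- (a * t * x)) * cnj (fourier h (a * t))) \<in> borel_measurable (borel \<Otimes>\<^sub>M borel)" by measurable
    show "norm (cis (- (a * t * x)) * cnj (fourier h (a * t))) \<le> B" for t x
      using fourier_bound[OF h, of "a * t"] by (simp add: norm_mult B_def)
  qed
  also have "\<dots> = (LBINT x. h x * ((1 / \<bar>a\<bar>) *\<^sub>R (LBINT z. complex_of_real (exp (- z\<^sup>2 / 2)) * cnj (h (x + z / a)))))"
  proof (intro Bochner_Integration.integral_cong refl)
    fix x
    have "(LBINT t. ?\<phi> t *\<^sub>R (h x * (cis (- (a * t * x)) * cnj (fourier h (a * t))))) =
      h x * (LBINT t. ?\<phi> t *\<^sub>R (cis (- (a * t * x)) * cnj (fourier h (a * t))))"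
      by (subst integral_mult_right_zero[symmetric]) simp
    also have "(LBINT t. ?\<phi> t *\<^sub>R (cis (- (a * t * x)) * cnj (fourier h (a * t)))) =
      (LBINT t. (LBINT y. ?\<phi> t *\<^sub>R (cnj (h y) * cis (t * (a * (y - x))))))"
    proof (intro Bochner_Integration.integral_cong refl)
      fix t
      have "cnj (fourier h (a * t)) = (LBINT y. cnj (h y) * cis (a * t * y))"
        unfolding fourier_def Bochner_Integration.integral_cnj[symmetric] by (simp add: cis_cnj)
      then have "cis (- (a * t * x)) * cnj (fourier h (a * t)) = (LBINT y. cis (- (a * t * x)) * (cnj (h y) * cis (a * t * y)))"
        by (simp only: integral_mult_right_zero)
      also have "\<dots> = (LBINT y. cnj (h y) * cis (t * (a * (y - x))))"
      proof (intro Bochner_Integration.integral_cong refl)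
        fix y
        have "cis (- (a * t * x)) * cis (a * t * y) = cis (t * (a * (y - x)))" by (simp add: cis_mult algebra_simps)
        then show "cis (- (a * t * x)) * (cnj (h y) * cis (a * t * y)) = cnj (h y) * cis (t * (a * (y - x)))"
          by (simp add: mult.left_commute)
      qed
      finally show "?\<phi> t *\<^sub>R (cis (- (a * t * x)) * cnj (fourier h (a * t))) =
        (LBINT y. ?\<phi> t *\<^sub>R (cnj (h y) * cis (t * (a * (y - x)))))" by simp
    qed
    also have "\<dots> = (LBINT y. (LBINT t. ?\<phi> t *\<^sub>R (cnj (h y) * cis (t * (a * (y - x))))))"
      by (rule weighted_Fubini[OF \<phi> h' _ cn]) measurable
    also have "\<dots> = (LBINT y. cnj (h y) * complex_of_real (exp (- (a * (y - x))\<^sup>2 / 2)))"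
    proof (intro Bochner_Integration.integral_cong refl)
      fix y
      show "(LBINT t. ?\<phi> t *\<^sub>R (cnj (h y) * cis (t * (a * (y - x))))) = cnj (h y) * complex_of_real (exp (- (a * (y - x))\<^sup>2 / 2))"
        unfolding gaussian_fourier[symmetric] by (subst integral_mult_right_zero[symmetric]) simp
    qed
    \<comment> \<open>The substitution \<open>y = x + z / a\<close> removes \<open>a\<close> from
      the Gaussian and produces the prefactor.\<close>
    also have "\<dots> = \<bar>1 / a\<bar> *\<^sub>R (LBINT z. cnj (h (x + (1 / a) * z)) * complex_of_real (exp (- (a * ((x + (1 / a) * z) - x))\<^sup>2 / 2)))"
      using a by (intro lborel_integral_real_affine) simp
    also have "\<dots> = (1 / \<bar>a\<bar>) *\<^sub>R (LBINT z. complex_of_real (exp (- z\<^sup>2 / 2)) * cnj (h (x + z / a)))"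
      using a by (simp add: mult.commute)
    finally show "(LBINT t. ?\<phi> t *\<^sub>R (h x * (cis (- (a * t * x)) * cnj (fourier h (a * t))))) =
      h x * ((1 / \<bar>a\<bar>) *\<^sub>R (LBINT z. complex_of_real (exp (- z\<^sup>2 / 2)) * cnj (h (x + z / a))))" .
  qed
  also have "\<dots> = (LBINT x. (LBINT z. ?\<phi> z *\<^sub>R (h x * (of_real (sqrt (2 * pi) / \<bar>a\<bar>) * cnj (h (x + z / a))))))"
  proof (intro Bochner_Integration.integral_cong refl)
    fix x
    have e: "complex_of_real (exp (- z\<^sup>2 / 2)) = of_real (sqrt (2 * pi)) * of_real (?\<phi> z)" for z
    proof -
      have "exp (- z\<^sup>2 / 2) = sqrt (2 * pi) * ?\<phi> z" by (simp add: std_normal_density_def)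
      then show ?thesis by (simp only: of_real_mult)
    qed
    have "h x * ((1 / \<bar>a\<bar>) *\<^sub>R (LBINT z. complex_of_real (exp (- z\<^sup>2 / 2)) * cnj (h (x + z / a)))) =
      (LBINT z. h x * ((1 / \<bar>a\<bar>) *\<^sub>R (complex_of_real (exp (- z\<^sup>2 / 2)) * cnj (h (x + z / a)))))"
      by (simp only: integral_mult_right_zero integral_scaleR_right)
    also have "\<dots> = (LBINT z. ?\<phi> z *\<^sub>R (h x * (of_real (sqrt (2 * pi) / \<bar>a\<bar>) * cnj (h (x + z / a)))))"
      unfolding e by (intro Bochner_Integration.integral_cong refl) (simp add: scaleR_conv_of_real mult_ac)
    finally show "h x * ((1 / \<bar>a\<bar>) *\<^sub>R (LBINT z. complex_of_real (exp (- z\<^sup>2 / 2)) * cnj (h (x + z / a)))) =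
      (LBINT z. ?\<phi> z *\<^sub>R (h x * (of_real (sqrt (2 * pi) / \<bar>a\<bar>) * cnj (h (x + z / a)))))" .
  qed
  also have "\<dots> = (LBINT z. (LBINT x. ?\<phi> z *\<^sub>R (h x * (of_real (sqrt (2 * pi) / \<bar>a\<bar>) * cnj (h (x + z / a))))))"
  proof (rule weighted_Fubini[OF \<phi> h, symmetric])
    show "(\<lambda>(z, x). of_real (sqrt (2 * pi) / \<bar>a\<bar>) * cnj (h (x + z / a))) \<in> borel_measurable (borel \<Otimes>\<^sub>M borel)" by measurable
    show "norm (of_real (sqrt (2 * pi) / \<bar>a\<bar>) * cnj (h (x + z / a))) \<le> sqrt (2 * pi) / \<bar>a\<bar> * M" for z x
    proof -
      have "norm (complex_of_real (sqrt (2 * pi) / \<bar>a\<bar>)) = sqrt (2 * pi) / \<bar>a\<bar>" by (simp only: norm_of_real) simp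
      then show ?thesis unfolding norm_mult using bdd_suppD(2)[OF h, of "x + z / a"] by (simp add: divide_right_mono mult_left_mono)
    qed
  qed
  also have "\<dots> = (LBINT z. of_real (sqrt (2 * pi) / \<bar>a\<bar>) * (?\<phi> z *\<^sub>R autocorr h (z / a)))"
  proof (intro Bochner_Integration.integral_cong refl)
    fix z
    have "(LBINT x. ?\<phi> z *\<^sub>R (h x * (of_real (sqrt (2 * pi) / \<bar>a\<bar>) * cnj (h (x + z / a))))) =
      (LBINT x. of_real (sqrt (2 * pi) / \<bar>a\<bar>) * (?\<phi> z *\<^sub>R (h x * cnj (h (x + z / a)))))"
      by (intro Bochner_Integration.integral_cong refl) (simp add: scaleR_conv_of_real mult_ac)
    also have "\<dots> = of_real (sqrt (2 * pi) / \<bar>a\<bar>) * (?\<phi> z *\<^sub>R autocorr h (z / a))"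
      unfolding autocorr_def by (simp only: integral_mult_right_zero integral_scaleR_right)
    finally show "(LBINT x. ?\<phi> z *\<^sub>R (h x * (of_real (sqrt (2 * pi) / \<bar>a\<bar>) * cnj (h (x + z / a))))) =
      of_real (sqrt (2 * pi) / \<bar>a\<bar>) * (?\<phi> z *\<^sub>R autocorr h (z / a))" .
  qed
  also have "\<dots> = of_real (sqrt (2 * pi) / \<bar>a\<bar>) * (LBINT z. ?\<phi> z *\<^sub>R autocorr h (z / a))"
    by (rule integral_mult_right_zero)
  finally show ?thesis .
qed

lemma autocorr_bound:
  assumes h: "bdd_supp M R h"
  shows "norm (autocorr h t) \<le> (LBINT x. (norm (h x))\<^sup>2)"
proof -
  note [measurable] = bdd_suppD(1)[OF h]
  have s: "bdd_supp (M\<^sup>2) R (\<lambda>x. (norm (h x))\<^sup>2)"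
    using h unfolding bdd_supp_def by (auto intro!: power_mono)
  have i: "integrable lborel (\<lambda>x. (norm (h x))\<^sup>2)" by (rule bdd_supp_integrable[OF s])
  have tr: "(LBINT x. (norm (h (x + t)))\<^sup>2) = (LBINT x. (norm (h x))\<^sup>2)"
    by (rule lborel_integral_translate[OF bdd_suppD(1)[OF s]])
  have s': "bdd_supp (M\<^sup>2) (R + \<bar>t\<bar>) (\<lambda>x. (norm (h (x + t)))\<^sup>2)" unfolding bdd_supp_def
  proof (intro conjI allI impI)
    show "borel_fun (\<lambda>x. (norm (h (x + t)))\<^sup>2)" by measurable
    show "norm ((norm (h (x + t)))\<^sup>2) \<le> M\<^sup>2" for x by (rule bdd_suppD(2)[OF s])
    show "R + \<bar>t\<bar> < norm x \<Longrightarrow> (norm (h (x + t)))\<^sup>2 = 0" for x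
      by (rule bdd_suppD(3)[OF s]) (auto simp: abs_if split: if_splits)
  qed
  have i': "integrable lborel (\<lambda>x. (norm (h (x + t)))\<^sup>2)" by (rule bdd_supp_integrable[OF s'])
  have "norm (autocorr h t) \<le> (LBINT x. norm (h x * cnj (h (x + t))))" unfolding autocorr_def by (rule integral_norm_bound)
  also have "\<dots> \<le> (LBINT x. (1/2) * (norm (h x))\<^sup>2 + (1/2) * (norm (h (x + t)))\<^sup>2)"
  proof (rule integral_mono')
    show "integrable lborel (\<lambda>x. (1/2) * (norm (h x))\<^sup>2 + (1/2) * (norm (h (x + t)))\<^sup>2)" using i i' by simp
    show "norm (h x * cnj (h (x + t))) \<le> (1/2) * (norm (h x))\<^sup>2 + (1/2) * (norm (h (x + t)))\<^sup>2" for x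
      using sum_squares_bound[of "norm (h x)" "norm (h (x + t))"] by (simp add: norm_mult)
  qed simp
  also have "\<dots> = (LBINT x. (norm (h x))\<^sup>2)" using i i' tr by simp
  finally show ?thesis .
qed

text \<open>Measurability supplies continuous functions converging almost everywhere. They are
  pulled into the disc of radius \<open>M\<close> and cut off near the ball of radius
  \<open>R\<close>; neither operation moves the limit \<open>h\<close>, and dominated convergence
  becomes available.\<close>

lemma bdd_supp_continuous_approx:
  fixes h :: "real \<Rightarrow> complex"
  assumes h: "bdd_supp M R h"
  shows "\<exists>c. (\<forall>n. bdd_supp M (R + 1) (c n) \<and> continuous_on UNIV (c n)) \<and> (AE x in lborel. (\<lambda>n. c n x) \<longlonglongrightarrow> h x)"
proof (cases "M = 0")
  case True
  then have "h x = 0" for x using bdd_suppD(2)[OF h, of x] by simp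
  then show ?thesis using True by (intro exI[of _ "\<lambda>_ _. 0"]) (auto simp: bdd_supp_def)
next
  case False
  then have M: "M > 0" using bdd_suppD(4)[OF h] by simp
  have "h \<in> borel_measurable lebesgue" using bdd_suppD(1)[OF h] by (simp add: measurable_completion)
  then have "h measurable_on UNIV" by (rule lebesgue_measurable_imp_measurable_on) simp
  then obtain N g where N: "negligible N" and g: "\<And>n. continuous_on UNIV (g n)"
    and lim: "\<And>x. x \<notin> N \<Longrightarrow> (\<lambda>n. g n x) \<longlonglongrightarrow> h x" unfolding measurable_on_def by auto
  define k where "k = (\<lambda>z :: complex. (M / max M (norm z)) *\<^sub>R z)"
  define \<theta> where "\<theta> = (\<lambda>x :: real. max 0 (min 1 (R + 1 - \<bar>x\<bar>)))"
  define c where "c = (\<lambda>n x. \<theta> x *\<^sub>R k (g n x))"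
  have kc: "continuous_on UNIV k" unfolding k_def using M by (intro continuous_intros) (auto simp: max_def)
  have kn: "norm (k z) \<le> M" for z
  proof -
    have "M * norm z \<le> M * max M (norm z)" using M by (intro mult_left_mono) auto
    moreover have "max M (norm z) > 0" using M by auto
    ultimately show ?thesis using M by (simp add: k_def pos_divide_le_eq)
  qed
  have \<theta>: "0 \<le> \<theta> x" "\<theta> x \<le> 1" for x by (auto simp: \<theta>_def)
  have cc: "continuous_on UNIV (c n)" for n unfolding c_def \<theta>_def
    by (intro continuous_intros continuous_on_compose2[OF kc g]) auto
  have "bdd_supp M (R + 1) (c n)" for n unfolding bdd_supp_def
  proof (intro conjI allI impI)
    show "borel_fun (c n)" by (rule borel_measurable_continuous_onI[OF cc])
    show "norm (c n x) \<le> M" for x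
      using mult_mono[OF \<theta>(2)[of x] kn[of "g n x"]] \<theta>(1)[of x] by (simp add: c_def)
  qed (auto simp: c_def \<theta>_def)
  moreover have "(\<lambda>n. c n x) \<longlonglongrightarrow> h x" if "x \<notin> N" for x
  proof -
    have "isCont k (h x)" using kc by (simp add: continuous_on_eq_continuous_at)
    from isCont_tendsto_compose[OF this lim[OF that]] have "(\<lambda>n. k (g n x)) \<longlonglongrightarrow> k (h x)" .
    also have "k (h x) = h x" using bdd_suppD(2)[OF h, of x] M by (simp add: k_def max_def)
    finally have "(\<lambda>n. c n x) \<longlonglongrightarrow> \<theta> x *\<^sub>R h x" unfolding c_def by (intro tendsto_intros)
    also have "\<theta> x *\<^sub>R h x = h x"
      using bdd_suppD(3)[OF h, of x] by (cases "R < \<bar>x\<bar>") (auto simp: \<theta>_def)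
    finally show ?thesis .
  qed
  moreover have "AE x in lborel. x \<notin> N"
    using N by (metis AE_completion_iff AE_not_in negligible_iff_null_sets)
  ultimately show ?thesis using cc by (intro exI[of _ c]) auto
qed

text \<open>For continuous approximants dominated convergence applies. The approximation error
  enters twice, because translating the difference does not change its integral.\<close>

lemma L1_translation_continuity:
  fixes h :: "real \<Rightarrow> complex"
  assumes h: "bdd_supp M R h" and \<tau>: "\<tau> \<longlonglongrightarrow> 0"
  shows "(\<lambda>k. \<integral>x. norm (h (x + \<tau> k) - h x) \<partial>lborel) \<longlonglongrightarrow> 0"
proof -
  obtain c where c: "\<And>n. bdd_supp M (R + 1) (c n)" "\<And>n. continuous_on UNIV (c n)"
    and ae: "AE x in lborel. (\<lambda>n. c n x) \<longlonglongrightarrow> h x"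
    using bdd_supp_continuous_approx[OF h] by auto
  note hm [measurable] = bdd_suppD(1)[OF h]
  note cm [measurable] = bdd_suppD(1)[OF c(1)]
  have h1: "bdd_supp M (R + 1) h" by (rule bdd_supp_mono[OF h]) auto
  have dsup: "bdd_supp (2 * M) (R + 1) (\<lambda>x. norm (c n x - h x))" for n unfolding bdd_supp_def
  proof (intro conjI allI impI)
    show "borel_fun (\<lambda>x. norm (c n x - h x))" by measurable
    show "norm (norm (c n x - h x)) \<le> 2 * M" for x
      using norm_triangle_ineq4[of "c n x" "h x"] bdd_suppD(2)[OF c(1), of n x] bdd_suppD(2)[OF h, of x] by simp
  qed (use bdd_suppD(3)[OF c(1)] bdd_suppD(3)[OF h1] in auto)
  have lim1: "(\<lambda>n. \<integral>x. norm (c n x - h x) \<partial>lborel) \<longlonglongrightarrow> 0"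
  proof -
    have "(\<lambda>n. \<integral>x. norm (c n x - h x) \<partial>lborel) \<longlonglongrightarrow> (\<integral>x. 0 \<partial>(lborel :: real measure))"
    proof (rule integral_dominated_convergence)
      show "integrable lborel (\<lambda>x. 2 * M * indicator (cball (0 :: real) (R + 1)) x :: real)" by (rule integrable_cball_indicator)
      show "AE x in lborel. (\<lambda>n. norm (c n x - h x)) \<longlonglongrightarrow> 0"
        using ae by eventually_elim (auto intro!: tendsto_eq_intros)
      show "AE x in lborel. norm (norm (c n x - h x)) \<le> 2 * M * indicator (cball (0 :: real) (R + 1)) x" for n
        using bdd_supp_le_indicator[OF dsup] by simp
    qed auto
    then show ?thesis by simp
  qed
  have bseq: "\<exists>B\<ge>0. \<forall>k. \<bar>\<tau> k\<bar> \<le> B"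
    using convergent_imp_bounded[OF \<tau>] unfolding bounded_iff by (metis abs_ge_zero order_trans rangeI real_norm_def)
  then obtain B where B: "B \<ge> 0" "\<And>k. \<bar>\<tau> k\<bar> \<le> B" by blast
  have sh: "bdd_supp M' (R' + B) (\<lambda>x. f (x + \<tau> k))" if f: "bdd_supp M' R' f" for f :: "real \<Rightarrow> 'c::{banach, second_countable_topology}" and k M' R'
    unfolding bdd_supp_def
  proof (intro conjI allI impI)
    show "borel_fun (\<lambda>x. f (x + \<tau> k))" using bdd_suppD(1)[OF f] by measurable
    show "norm (f (x + \<tau> k)) \<le> M'" for x by (rule bdd_suppD(2)[OF f])
    show "f (x + \<tau> k) = 0" if "R' + B < norm x" for x
      using that B(2)[of k] by (intro bdd_suppD(3)[OF f]) auto
  qed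
  have lim2: "(\<lambda>k. \<integral>x. norm (c n (x + \<tau> k) - c n x) \<partial>lborel) \<longlonglongrightarrow> 0" for n
  proof -
    have "(\<lambda>k. \<integral>x. norm (c n (x + \<tau> k) - c n x) \<partial>lborel) \<longlonglongrightarrow> (\<integral>x. 0 \<partial>(lborel :: real measure))"
    proof (rule integral_dominated_convergence)
      show "integrable lborel (\<lambda>x. 2 * M * indicator (cball (0 :: real) (R + 1 + B)) x :: real)" by (rule integrable_cball_indicator)
      have "(\<lambda>k. norm (c n (x + \<tau> k) - c n x)) \<longlonglongrightarrow> norm (c n (x + 0) - c n x)" for x
        using c(2)[of n] by (intro tendsto_intros isCont_tendsto_compose[of _ "c n"] \<tau>) (simp add: continuous_on_eq_continuous_at)
      then show "AE x in lborel. (\<lambda>k. norm (c n (x + \<tau> k) - c n x)) \<longlonglongrightarrow> 0" by simp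
      show "AE x in lborel. norm (norm (c n (x + \<tau> k) - c n x)) \<le> 2 * M * indicator (cball (0 :: real) (R + 1 + B)) x" for k
      proof (rule AE_I2)
        fix x
        have "norm (c n (x + \<tau> k)) \<le> M * indicator (cball (0 :: real) (R + 1 + B)) x"
          by (rule bdd_supp_le_indicator[OF sh[OF c(1)]])
        moreover have "norm (c n x) \<le> M * indicator (cball (0 :: real) (R + 1 + B)) x"
          by (rule bdd_supp_le_indicator[OF bdd_supp_mono[OF c(1)]]) (use B in auto)
        ultimately show "norm (norm (c n (x + \<tau> k) - c n x)) \<le> 2 * M * indicator (cball (0 :: real) (R + 1 + B)) x"
          using norm_triangle_ineq4[of "c n (x + \<tau> k)" "c n x"] by simp
      qed
    qed auto
    then show ?thesis by simp
  qed
  have le: "(LBINT x. norm (h (x + \<tau> k) - h x)) \<le> 2 * (LBINT x. norm (c n x - h x)) + (LBINT x. norm (c n (x + \<tau> k) - c n x))" for n k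
  proof -
    have i1: "integrable lborel (\<lambda>x. norm (c n x - h x))" by (rule bdd_supp_integrable[OF dsup])
    have i2: "integrable lborel (\<lambda>x. norm (c n (x + \<tau> k) - h (x + \<tau> k)))"
      by (rule bdd_supp_integrable[OF sh[OF dsup]])
    have i3: "integrable lborel (\<lambda>x. norm (c n (x + \<tau> k) - c n x))"
      by (intro integrable_norm Bochner_Integration.integrable_diff bdd_supp_integrable[OF sh[OF c(1)]] bdd_supp_integrable[OF c(1)])
    have "(LBINT x. norm (h (x + \<tau> k) - h x)) \<le>
      (LBINT x. (norm (c n (x + \<tau> k) - h (x + \<tau> k)) + norm (c n (x + \<tau> k) - c n x)) + norm (c n x - h x))"
    proof (rule integral_mono')
      show "integrable lborel (\<lambda>x. (norm (c n (x + \<tau> k) - h (x + \<tau> k)) + norm (c n (x + \<tau> k) - c n x)) + norm (c n x - h x))"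
        using i1 i2 i3 by simp
      fix x
      have "norm (h (x + \<tau> k) - h x) = norm ((c n (x + \<tau> k) - c n x) + (c n x - h x) - (c n (x + \<tau> k) - h (x + \<tau> k)))" by (rule arg_cong[of _ _ norm]) simp
      then show "norm (h (x + \<tau> k) - h x) \<le> (norm (c n (x + \<tau> k) - h (x + \<tau> k)) + norm (c n (x + \<tau> k) - c n x)) + norm (c n x - h x)"
        using norm_triangle_ineq4[of "(c n (x + \<tau> k) - c n x) + (c n x - h x)" "c n (x + \<tau> k) - h (x + \<tau> k)"]
          norm_triangle_ineq[of "c n (x + \<tau> k) - c n x" "c n x - h x"] by linarith
    qed simp
    also have "\<dots> = (LBINT x. norm (c n (x + \<tau> k) - h (x + \<tau> k))) + (LBINT x. norm (c n (x + \<tau> k) - c n x)) + (LBINT x. norm (c n x - h x))"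
      using i1 i2 i3 by simp
    also have "(LBINT x. norm (c n (x + \<tau> k) - h (x + \<tau> k))) = (LBINT x. norm (c n x - h x))"
      by (rule lborel_integral_translate[OF bdd_suppD(1)[OF dsup]])
    finally show ?thesis by simp
  qed
  show ?thesis
  proof (rule LIMSEQ_I)
    fix r :: real assume r: "r > 0"
    from LIMSEQ_D[OF lim1, of "r / 4"] r obtain n where n: "norm ((LBINT x. norm (c n x - h x)) - 0) < r / 4" by auto
    from LIMSEQ_D[OF lim2[of n], of "r / 2"] r obtain K where
      K: "\<And>k. k \<ge> K \<Longrightarrow> norm ((LBINT x. norm (c n (x + \<tau> k) - c n x)) - 0) < r / 2" by auto
    have "norm ((LBINT x. norm (h (x + \<tau> k) - h x)) - 0) < r" if "k \<ge> K" for k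
    proof -
      have "0 \<le> (LBINT x. norm (h (x + \<tau> k) - h x))" by (rule integral_nonneg_AE) simp
      then show ?thesis using le[of k n] n K[OF that] by simp
    qed
    then show "\<exists>K. \<forall>k\<ge>K. norm ((LBINT x. norm (h (x + \<tau> k) - h x)) - 0) < r" by blast
  qed
qed

lemma autocorr_tendsto:
  assumes h: "bdd_supp M R h" and \<tau>: "\<tau> \<longlonglongrightarrow> 0"
  shows "(\<lambda>k. autocorr h (\<tau> k)) \<longlonglongrightarrow> autocorr h 0"
proof (rule LIM_zero_cancel)
  note [measurable] = bdd_suppD(1)[OF h]
  have M: "0 \<le> M" by (rule bdd_suppD(4)[OF h])
  have sup: "bdd_supp (M * M) R (\<lambda>x. h x * cnj (h (x + t)))" for t unfolding bdd_supp_def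
  proof (intro conjI allI impI)
    show "borel_fun (\<lambda>x. h x * cnj (h (x + t)))" by measurable
    show "norm (h x * cnj (h (x + t))) \<le> M * M" for x
      unfolding norm_mult complex_mod_cnj by (intro mult_mono bdd_suppD(2)[OF h] M) auto
  qed (use bdd_suppD(3)[OF h] in auto)
  have "norm (autocorr h t - autocorr h 0) \<le> M * (LBINT x. norm (h (x + t) - h x))" for t
  proof -
    have "autocorr h t - autocorr h 0 = (LBINT x. h x * cnj (h (x + t)) - h x * cnj (h (x + 0)))"
      unfolding autocorr_def by (rule Bochner_Integration.integral_diff[symmetric]) (rule bdd_supp_integrable[OF sup])+
    also have "norm \<dots> \<le> (LBINT x. norm (h x * cnj (h (x + t)) - h x * cnj (h (x + 0))))" by (rule integral_norm_bound)
    also have "\<dots> \<le> (LBINT x. M * norm (h (x + t) - h x))"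
    proof (rule integral_mono')
      have s: "bdd_supp M (R + \<bar>t\<bar>) (\<lambda>x. h (x + t))" unfolding bdd_supp_def
      proof (intro conjI allI impI)
        show "h (x + t) = 0" if "R + \<bar>t\<bar> < norm x" for x
          using that by (intro bdd_suppD(3)[OF h]) auto
      qed (use bdd_suppD(2)[OF h] in auto)
      show "integrable lborel (\<lambda>x. M * norm (h (x + t) - h x))"
        by (intro integrable_mult_right integrable_norm Bochner_Integration.integrable_diff bdd_supp_integrable[OF s] bdd_supp_integrable[OF h])
      fix x
      have "h x * cnj (h (x + t)) - h x * cnj (h (x + 0)) = h x * cnj (h (x + t) - h x)" by (simp add: algebra_simps)
      then show "norm (h x * cnj (h (x + t)) - h x * cnj (h (x + 0))) \<le> M * norm (h (x + t) - h x)"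
        unfolding norm_mult complex_mod_cnj using bdd_suppD(2)[OF h, of x] by (simp add: norm_mult mult_right_mono del: complex_cnj_diff)
    qed (use M in auto)
    finally show ?thesis by simp
  qed
  then have le: "norm (autocorr h (\<tau> k) - autocorr h 0) \<le> M * (LBINT x. norm (h (x + \<tau> k) - h x))" for k by simp
  have "(\<lambda>k. M * (LBINT x. norm (h (x + \<tau> k) - h x))) \<longlonglongrightarrow> M * 0"
    by (intro tendsto_intros L1_translation_continuity[OF h \<tau>])
  then have "(\<lambda>k. M * (LBINT x. norm (h (x + \<tau> k) - h x))) \<longlonglongrightarrow> 0" by simp
  then show "(\<lambda>k. autocorr h (\<tau> k) - autocorr h 0) \<longlonglongrightarrow> 0"
    by (rule Lim_null_comparison[rotated]) (use le in auto)
qed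

text \<open>The transform of the correlation is a product of the transform of \<open>g1\<close> with
  the conjugate of that of \<open>g2\<close>, both reflected, so its modulus is at most
  \<open>\<kappa>\<close> times that of \<open>g2\<close>. Comparing the Gaussian energies of
  \<open>H\<close> and \<open>g2\<close> at the same scale, where the prefactors cancel, and letting
  the scale grow gives the inequality of square integrals.\<close>

lemma correlation_square_integral:
  assumes g1: "bdd_supp M1 R1 g1" and g2: "bdd_supp M2 R2 g2" and \<kappa>: "\<And>\<xi>. norm (fourier g1 \<xi>) \<le> \<kappa>"
  shows "(LBINT z. (norm (LBINT s. g1 s * cnj (g2 (s + z))))\<^sup>2) \<le> \<kappa>\<^sup>2 * (LBINT s. (norm (g2 s))\<^sup>2)"
    and "bdd_supp (M1 * M2 * measure lborel (cball (0::real) R1)) (R1 + R2) (\<lambda>z. \<integral>s. g1 s * cnj (g2 (s + z)) \<partial>lborel)"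
proof -
  note [measurable] = bdd_suppD(1)[OF g1] bdd_suppD(1)[OF g2]
  have M: "0 \<le> M1" "0 \<le> M2" by (rule bdd_suppD(4)[OF g1], rule bdd_suppD(4)[OF g2])
  define H where "H = (\<lambda>z. \<integral>s. g1 s * cnj (g2 (s + z)) \<partial>lborel)"
  have sup: "bdd_supp (M1 * M2) R1 (\<lambda>s. g1 s * cnj (g2 (s + z)))" for z unfolding bdd_supp_def
  proof (intro conjI allI impI)
    show "borel_fun (\<lambda>s. g1 s * cnj (g2 (s + z)))" by measurable
    show "norm (g1 s * cnj (g2 (s + z))) \<le> M1 * M2" for s
      unfolding norm_mult complex_mod_cnj by (intro mult_mono bdd_suppD(2)[OF g1] bdd_suppD(2)[OF g2] M) auto
  qed (use bdd_suppD(3)[OF g1] in auto)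
  have H: "bdd_supp (M1 * M2 * measure lborel (cball (0::real) R1)) (R1 + R2) H" unfolding bdd_supp_def
  proof (intro conjI allI impI)
    show "borel_fun H" unfolding H_def by (rule borel_measurable_lborel_integral_fst) measurable
    show "norm (H z) \<le> M1 * M2 * measure lborel (cball (0::real) R1)" for z
      unfolding H_def by (rule bdd_supp_integral_le[OF sup])
    fix z :: real assume z: "R1 + R2 < norm z"
    have "g1 s * cnj (g2 (s + z)) = 0" for s
    proof (cases "R1 < norm s")
      case False
      then have "R2 < norm (s + z)" using z by (auto simp: abs_if split: if_splits)
      then show ?thesis using bdd_suppD(3)[OF g2] by simp
    qed (use bdd_suppD(3)[OF g1] in auto)
    then have "H z = (\<integral>s. 0 \<partial>(lborel :: real measure))" unfolding H_def
      by (intro Bochner_Integration.integral_cong) auto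
    then show "H z = 0" by simp
  qed
  then show "bdd_supp (M1 * M2 * measure lborel (cball (0::real) R1)) (R1 + R2) (\<lambda>z. \<integral>s. g1 s * cnj (g2 (s + z)) \<partial>lborel)"
    by (simp add: H_def)
  note Hm [measurable] = bdd_suppD(1)[OF H]
  have ftH: "norm (fourier H \<xi>) \<le> \<kappa> * norm (fourier g2 (- \<xi>))" for \<xi>
  proof -
    have "fourier H \<xi> = (LBINT z. (LBINT s. cis (- (\<xi> * z)) * (g1 s * cnj (g2 (s + z)))))"
      unfolding fourier_def H_def by (simp add: mult.commute flip: integral_mult_right_zero)
    also have "\<dots> = (LBINT s. (LBINT z. cis (- (\<xi> * z)) * (g1 s * cnj (g2 (s + z)))))"
    proof -
      let ?g = "\<lambda>p :: real \<times> real. cis (- (\<xi> * fst p)) * (g1 (snd p) * cnj (g2 (snd p + fst p)))"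
      have "?g \<in> borel_measurable (borel \<Otimes>\<^sub>M borel)" by measurable
      then have gm: "borel_fun ?g" by (simp add: borel_prod)
      have "bdd_supp (M1 * M2) (2 * R1 + R2) ?g" unfolding bdd_supp_def
      proof (intro conjI allI impI gm)
        fix p :: "real \<times> real"
        show "norm (?g p) \<le> M1 * M2" using bdd_suppD(2)[OF sup, of "snd p" "fst p"] by (simp add: norm_mult)
        assume p: "2 * R1 + R2 < norm p"
        show "?g p = 0"
        proof (rule ccontr)
          assume "?g p \<noteq> 0"
          then have "g1 (snd p) \<noteq> 0" "g2 (snd p + fst p) \<noteq> 0" by auto
          then have "\<bar>snd p\<bar> \<le> R1" "\<bar>snd p + fst p\<bar> \<le> R2"
            using bdd_suppD(3)[OF g1, of "snd p"] bdd_suppD(3)[OF g2, of "snd p + fst p"] by force+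
          moreover have "norm p \<le> norm (fst p) + norm (snd p)" using norm_Pair_le[of "fst p" "snd p"] by simp
          ultimately show False using p by simp
        qed
      qed
      from bdd_supp_Fubini(1)[OF this] show ?thesis by simp
    qed
    also have "\<dots> = (LBINT s. (g1 s * cis (- (- \<xi> * s))) * cnj (fourier g2 (- \<xi>)))"
    proof (intro Bochner_Integration.integral_cong refl)
      fix s
      have m: "borel_fun (\<lambda>y. cis (- (\<xi> * (y - s))) * (g1 s * cnj (g2 y)))" by measurable
      have "(LBINT z. cis (- (\<xi> * z)) * (g1 s * cnj (g2 (s + z)))) = (LBINT y. cis (- (\<xi> * (y - s))) * (g1 s * cnj (g2 y)))"
        using lborel_integral_translate[OF m, of s] by (simp add: add.commute)
      also have "\<dots> = (LBINT y. (g1 s * cis (\<xi> * s)) * cnj (g2 y * cis (- (- \<xi> * y))))"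
      proof (intro Bochner_Integration.integral_cong refl)
        fix y
        have "cis (- (\<xi> * (y - s))) = cis (\<xi> * s) * cis (- (\<xi> * y))" by (simp add: cis_mult algebra_simps)
        then show "cis (- (\<xi> * (y - s))) * (g1 s * cnj (g2 y)) = (g1 s * cis (\<xi> * s)) * cnj (g2 y * cis (- (- \<xi> * y)))"
          by (simp add: cis_cnj mult_ac)
      qed
      also have "\<dots> = (g1 s * cis (\<xi> * s)) * cnj (fourier g2 (- \<xi>))"
        unfolding fourier_def by (simp only: integral_mult_right_zero Bochner_Integration.integral_cnj)
      finally show "(LBINT z. cis (- (\<xi> * z)) * (g1 s * cnj (g2 (s + z)))) = (g1 s * cis (- (- \<xi> * s))) * cnj (fourier g2 (- \<xi>))"
        by simp
    qed
    also have "\<dots> = fourier g1 (- \<xi>) * cnj (fourier g2 (- \<xi>))"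
      unfolding fourier_def[of g1] by (rule integral_mult_left_zero)
    finally have "norm (fourier H \<xi>) = norm (fourier g1 (- \<xi>)) * norm (fourier g2 (- \<xi>))" by (simp add: norm_mult)
    then show ?thesis using mult_right_mono[OF \<kappa>[of "- \<xi>"] norm_ge_zero] by simp
  qed
  let ?\<phi> = std_normal_density
  \<comment> \<open>The energy of \<open>g2\<close> is taken at \<open>- a\<close>, because the
    bound on the transform of \<open>H\<close> involves the reflected frequency.\<close>
  have key: "norm (LBINT z. ?\<phi> z *\<^sub>R autocorr H (z / a)) \<le> \<kappa>\<^sup>2 * (LBINT s. (norm (g2 s))\<^sup>2)" if a: "a > 0" for a
  proof -
    define S where "S = sqrt (2 * pi) / \<bar>a\<bar>"
    have S: "S > 0" using a by (simp add: S_def)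
    have fb: "integrable lborel (\<lambda>t. ?\<phi> t * (norm (fourier h (b * t)))\<^sup>2)" if h: "bdd_supp M R h" for h M R b
    proof (rule Bochner_Integration.integrable_bound)
      show "integrable lborel (\<lambda>t. ?\<phi> t * (M * measure lborel (cball (0::real) R))\<^sup>2)" by (intro integrable_mult_left) simp
      show "(\<lambda>t. ?\<phi> t * (norm (fourier h (b * t)))\<^sup>2) \<in> borel_measurable lborel"
        using fourier_measurable[OF bdd_suppD(1)[OF h]] by measurable
      show "AE t in lborel. norm (?\<phi> t * (norm (fourier h (b * t)))\<^sup>2) \<le> norm (?\<phi> t * (M * measure lborel (cball (0::real) R))\<^sup>2)"
        using fourier_bound[OF h] by (intro AE_I2) (auto simp: abs_mult intro!: mult_left_mono power_mono)
    qed
    have "S * norm (LBINT z. ?\<phi> z *\<^sub>R autocorr H (z / a)) = norm (complex_of_real (LBINT t. ?\<phi> t * (norm (fourier H (a * t)))\<^sup>2))"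
      unfolding gaussian_energy[OF H less_imp_neq[OF a, symmetric]] norm_mult S_def[symmetric] using S by simp
    also have "\<dots> = (LBINT t. ?\<phi> t * (norm (fourier H (a * t)))\<^sup>2)"
    proof -
      have "0 \<le> (LBINT t. ?\<phi> t * (norm (fourier H (a * t)))\<^sup>2)" by (rule integral_nonneg_AE) simp
      then show ?thesis by (simp only: norm_of_real abs_of_nonneg)
    qed
    also have "\<dots> \<le> (LBINT t. \<kappa>\<^sup>2 * (?\<phi> t * (norm (fourier g2 ((- a) * t)))\<^sup>2))"
    proof (rule integral_mono)
      show "integrable lborel (\<lambda>t. ?\<phi> t * (norm (fourier H (a * t)))\<^sup>2)" by (rule fb[OF H])
      show "integrable lborel (\<lambda>t. \<kappa>\<^sup>2 * (?\<phi> t * (norm (fourier g2 ((- a) * t)))\<^sup>2))" by (intro integrable_mult_right fb[OF g2])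
      fix t
      have "(norm (fourier H (a * t)))\<^sup>2 \<le> (\<kappa> * norm (fourier g2 (- (a * t))))\<^sup>2" by (intro power_mono ftH) simp
      then have "?\<phi> t * (norm (fourier H (a * t)))\<^sup>2 \<le> ?\<phi> t * (\<kappa> * norm (fourier g2 (- (a * t))))\<^sup>2" by (intro mult_left_mono) auto
      then show "?\<phi> t * (norm (fourier H (a * t)))\<^sup>2 \<le> \<kappa>\<^sup>2 * (?\<phi> t * (norm (fourier g2 ((- a) * t)))\<^sup>2)"
        by (simp add: power_mult_distrib mult_ac)
    qed
    also have "\<dots> = \<kappa>\<^sup>2 * (LBINT t. ?\<phi> t * (norm (fourier g2 ((- a) * t)))\<^sup>2)" by (rule integral_mult_right_zero)
    also have "(LBINT t. ?\<phi> t * (norm (fourier g2 ((- a) * t)))\<^sup>2) \<le> norm (complex_of_real (LBINT t. ?\<phi> t * (norm (fourier g2 ((- a) * t)))\<^sup>2))"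
      by (simp only: norm_of_real abs_ge_self)
    also have "\<dots> = S * norm (LBINT z. ?\<phi> z *\<^sub>R autocorr g2 (z / - a))"
    proof -
      have "- a \<noteq> 0" using a by simp
      moreover have "\<bar>- a\<bar> = \<bar>a\<bar>" by simp
      ultimately show ?thesis unfolding gaussian_energy[OF g2 \<open>- a \<noteq> 0\<close>] norm_mult norm_of_real using S
        by (simp only: S_def[symmetric] abs_of_pos)
    qed
    also have "norm (LBINT z. ?\<phi> z *\<^sub>R autocorr g2 (z / - a)) \<le> (LBINT s. (norm (g2 s))\<^sup>2)"
    proof -
      have "norm (LBINT z. ?\<phi> z *\<^sub>R autocorr g2 (z / - a)) \<le> (LBINT z. norm (?\<phi> z *\<^sub>R autocorr g2 (z / - a)))" by (rule integral_norm_bound)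
      also have "\<dots> \<le> (LBINT z. ?\<phi> z * (LBINT s. (norm (g2 s))\<^sup>2))"
      proof (rule integral_mono')
        show "integrable lborel (\<lambda>z. ?\<phi> z * (LBINT s. (norm (g2 s))\<^sup>2))" by (intro integrable_mult_left) simp
        show "norm (?\<phi> z *\<^sub>R autocorr g2 (z / - a)) \<le> ?\<phi> z * (LBINT s. (norm (g2 s))\<^sup>2)" for z
          using autocorr_bound[OF g2, of "z / - a"] by (simp add: mult_left_mono)
      qed simp
      also have "\<dots> = (LBINT s. (norm (g2 s))\<^sup>2)" by simp
      finally show ?thesis .
    qed
    finally have "S * norm (LBINT z. ?\<phi> z *\<^sub>R autocorr H (z / a)) \<le> \<kappa>\<^sup>2 * (S * (LBINT s. (norm (g2 s))\<^sup>2))"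
      using S by (simp add: mult_left_mono)
    then show ?thesis using S by (simp add: mult.left_commute[of _ S] mult_le_cancel_left_pos)
  qed
  \<comment> \<open>With \<open>a\<close> running through the positive integers, the Gaussian mean
    of the autocorrelation converges to its value at 0, the square integral of
    \<open>H\<close>.\<close>
  have "(\<lambda>n. \<integral>z. ?\<phi> z *\<^sub>R autocorr H (z / real (Suc n)) \<partial>lborel) \<longlonglongrightarrow> (LBINT z. ?\<phi> z *\<^sub>R autocorr H 0)"
  proof (rule integral_dominated_convergence)
    note [measurable] = autocorr_measurable[OF Hm]
    let ?B = "\<integral>s. (norm (H s))\<^sup>2 \<partial>lborel"
    show "integrable lborel (\<lambda>z. ?\<phi> z * ?B)" by (intro integrable_mult_left) simp
    show "AE z in lborel. norm (?\<phi> z *\<^sub>R autocorr H (z / real (Suc n))) \<le> ?\<phi> z * ?B" for n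
      using autocorr_bound[OF H] by (intro AE_I2) (simp add: mult_left_mono)
    have "(\<lambda>n. z / real (Suc n)) \<longlonglongrightarrow> 0" for z :: real
      using LIMSEQ_Suc[OF lim_const_over_n[of z]] by simp
    then show "AE z in lborel. (\<lambda>n. ?\<phi> z *\<^sub>R autocorr H (z / real (Suc n))) \<longlonglongrightarrow> ?\<phi> z *\<^sub>R autocorr H 0"
      by (intro AE_I2 tendsto_intros autocorr_tendsto[OF H])
    show "(\<lambda>z. ?\<phi> z *\<^sub>R autocorr H (z / real (Suc n))) \<in> borel_measurable lborel" for n by measurable
  qed measurable
  also have "(LBINT z. ?\<phi> z *\<^sub>R autocorr H 0) = autocorr H 0" by (subst integral_scaleR_left) auto
  finally have "(\<lambda>n. norm (LBINT z. ?\<phi> z *\<^sub>R autocorr H (z / real (Suc n)))) \<longlonglongrightarrow> norm (autocorr H 0)"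
    by (rule tendsto_norm)
  then have "norm (autocorr H 0) \<le> \<kappa>\<^sup>2 * (LBINT s. (norm (g2 s))\<^sup>2)"
    by (rule LIMSEQ_le_const2) (use key in auto)
  moreover have "norm (autocorr H 0) = (LBINT z. (norm (H z))\<^sup>2)"
  proof -
    have "autocorr H 0 = complex_of_real (LBINT z. (norm (H z))\<^sup>2)"
      unfolding autocorr_def integral_complex_of_real[symmetric] complex_norm_square by simp
    moreover have "0 \<le> (LBINT z. (norm (H z))\<^sup>2)" by (rule integral_nonneg_AE) simp
    ultimately show ?thesis by (simp only: norm_of_real abs_of_nonneg)
  qed
  ultimately show "(LBINT z. (norm (LBINT s. g1 s * cnj (g2 (s + z))))\<^sup>2) \<le> \<kappa>\<^sup>2 * (LBINT s. (norm (g2 s))\<^sup>2)"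
    by (simp add: H_def)
qed

subsection \<open>Functions with small local Fourier coefficients\<close>

abbreviation dual_function :: "'a::euclidean_space \<Rightarrow> ('a \<Rightarrow> complex) \<Rightarrow> (real \<Rightarrow> complex) \<Rightarrow> bool" where
  "dual_function u \<Phi> D \<equiv> \<forall>f B. borel_fun f \<longrightarrow> (\<forall>t. norm (f t) \<le> B) \<longrightarrow>
      (LBINT x. f (u \<bullet> x) * \<Phi> x) = (LBINT t. f t * D t)"

text \<open>\<open>D t\<close> is the integral of \<open>\<Phi>\<close> over the hyperplane where
  \<open>u \<bullet> x = t\<close>. To avoid a change of coordinates, the integrand is averaged over
  a unit segment along \<open>w\<close>; as \<open>u \<bullet> w = 1\<close>, the parameter of the
  segment becomes \<open>t - u \<bullet> x\<close>, and Fubini isolates the variable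
  \<open>t\<close>.\<close>

lemma exists_dual_function:
  fixes u w :: "'a::euclidean_space" and \<Phi> :: "'a \<Rightarrow> complex"
  assumes uw: "u \<bullet> w = 1" and \<Phi>: "bdd_supp M R \<Phi>"
  shows "\<exists>D. bdd_supp (M * measure lborel (cball (0 :: 'a) (R + norm w))) (norm u * R) D \<and>
    dual_function u \<Phi> D"
proof -
  let ?k = "indicator {0..1::real} :: real \<Rightarrow> real"
  note [measurable] = bdd_suppD(1)[OF \<Phi>]
  have M0: "0 \<le> M" by (rule bdd_suppD(4)[OF \<Phi>])
  have k: "bdd_supp 1 1 ?k" using bdd_supp_indicator[of 0 1] by simp
  \<comment> \<open>The argument of \<open>\<Phi>\<close> is the point on the line through
    \<open>x\<close> in direction \<open>w\<close> whose inner product with \<open>u\<close> is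
    \<open>t\<close>; the window restricts \<open>x\<close> to a slab of unit thickness.\<close>
  define h where "h = (\<lambda>x t. ?k (t - u \<bullet> x) *\<^sub>R \<Phi> (x + (t - u \<bullet> x) *\<^sub>R w))"
  define D where "D = (\<lambda>t. \<integral>x. h x t \<partial>lborel)"
  have hsup: "norm x \<le> R + norm w \<and> \<bar>t\<bar> \<le> norm u * R" if "h x t \<noteq> 0" for x t
  proof -
    from that have 1: "t - u \<bullet> x \<in> {0..1}" "\<Phi> (x + (t - u \<bullet> x) *\<^sub>R w) \<noteq> 0"
      by (auto simp: h_def split: split_indicator_asm)
    define y where "y = x + (t - u \<bullet> x) *\<^sub>R w"
    have y: "norm y \<le> R" using 1(2) bdd_suppD(3)[OF \<Phi>, of y] by (force simp: y_def)
    have "u \<bullet> y = t" by (simp add: y_def inner_add_right uw)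
    then have "\<bar>t\<bar> \<le> norm u * norm y" using Cauchy_Schwarz_ineq2[of u y] by simp
    also have "\<dots> \<le> norm u * R" using y by (intro mult_left_mono) auto
    finally have t: "\<bar>t\<bar> \<le> norm u * R" .
    have "norm x \<le> norm y + norm ((t - u \<bullet> x) *\<^sub>R w)"
      using norm_triangle_ineq4[of y "(t - u \<bullet> x) *\<^sub>R w"] by (simp add: y_def)
    also have "norm ((t - u \<bullet> x) *\<^sub>R w) \<le> norm w" using 1(1) by (simp add: mult_left_le_one_le)
    finally show ?thesis using y t by simp
  qed
  have hb: "norm (h x t) \<le> M" for x t
    using bdd_suppD(2)[OF \<Phi>, of "x + (t - u \<bullet> x) *\<^sub>R w"] M0 by (auto simp: h_def split: split_indicator)
  have hm [measurable]: "(\<lambda>(x, t). h x t) \<in> borel_measurable (borel \<Otimes>\<^sub>M borel)"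
    unfolding h_def by measurable
  have D: "bdd_supp (M * measure lborel (cball (0 :: 'a) (R + norm w))) (norm u * R) D" unfolding bdd_supp_def
  proof (intro conjI allI impI)
    show "borel_fun D" unfolding D_def by (rule borel_measurable_lborel_integral_fst) measurable
    show "norm (D t) \<le> M * measure lborel (cball (0 :: 'a) (R + norm w))" for t
      unfolding D_def
    proof (rule bdd_supp_integral_le)
      have "borel_fun (\<lambda>x. h x t)" by measurable
      then show "bdd_supp M (R + norm w) (\<lambda>x. h x t)" unfolding bdd_supp_def using hb hsup by force
    qed
    show "D t = 0" if "norm u * R < norm t" for t
    proof -
      have "h x t = 0" for x using hsup[of x t] that by force
      then have "D t = (\<integral>x. 0 \<partial>(lborel :: 'a measure))" unfolding D_def
        by (intro Bochner_Integration.integral_cong) auto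
      then show ?thesis by simp
    qed
  qed
  moreover have "(LBINT x. f (u \<bullet> x) * \<Phi> x) = (LBINT t. f t * D t)"
    if f [measurable]: "borel_fun f" and B: "\<forall>t. norm (f t) \<le> B" for f B
  proof -
    have B0: "0 \<le> B" using order_trans[OF norm_ge_zero] B by blast
    have fs: "bdd_supp (B * M) R (\<lambda>x. f (u \<bullet> x) * \<Phi> x)" unfolding bdd_supp_def
    proof (intro conjI allI impI)
      show "borel_fun (\<lambda>x. f (u \<bullet> x) * \<Phi> x)" by measurable
      show "norm (f (u \<bullet> x) * \<Phi> x) \<le> B * M" for x
        unfolding norm_mult using B B0 by (intro mult_mono bdd_suppD(2)[OF \<Phi>]) auto
    qed (use bdd_suppD(3)[OF \<Phi>] in auto)
    have "(LBINT x. (LBINT s. ?k s *\<^sub>R (f (u \<bullet> (x + s *\<^sub>R w)) * \<Phi> (x + s *\<^sub>R w)))) = (LBINT s. ?k s) *\<^sub>R (LBINT x. f (u \<bullet> x) * \<Phi> x)"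
      by (rule bdd_supp_averaging(1)[OF fs k, of _ "norm w"]) (auto simp: mult_left_le_one_le)
    then have "(LBINT x. f (u \<bullet> x) * \<Phi> x) = (LBINT x. (LBINT s. ?k s *\<^sub>R (f (u \<bullet> (x + s *\<^sub>R w)) * \<Phi> (x + s *\<^sub>R w))))"
      by simp
    also have "\<dots> = (LBINT x. (LBINT t. f t * h x t))"
    proof (rule Bochner_Integration.integral_cong[OF refl])
      fix x
      have m: "borel_fun (\<lambda>s. ?k s *\<^sub>R (f (u \<bullet> (x + s *\<^sub>R w)) * \<Phi> (x + s *\<^sub>R w)))" by measurable
      have "(LBINT s. ?k s *\<^sub>R (f (u \<bullet> (x + s *\<^sub>R w)) * \<Phi> (x + s *\<^sub>R w))) =
        (LBINT t. ?k (t + - (u \<bullet> x)) *\<^sub>R (f (u \<bullet> (x + (t + - (u \<bullet> x)) *\<^sub>R w)) * \<Phi> (x + (t + - (u \<bullet> x)) *\<^sub>R w)))"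
        by (rule lborel_integral_translate[OF m, symmetric])
      also have "\<dots> = (LBINT t. f t * h x t)"
        by (intro Bochner_Integration.integral_cong refl) (simp add: h_def inner_add_right uw)
      finally show "(LBINT s. ?k s *\<^sub>R (f (u \<bullet> (x + s *\<^sub>R w)) * \<Phi> (x + s *\<^sub>R w))) = (LBINT t. f t * h x t)" .
    qed
    also have "\<dots> = (LBINT t. (LBINT x. f t * h x t))"
    proof -
      let ?g = "\<lambda>p :: 'a \<times> real. f (snd p) * h (fst p) (snd p)"
      have "?g \<in> borel_measurable (borel \<Otimes>\<^sub>M borel)" by measurable
      then have gm: "borel_fun ?g" by (simp add: borel_prod)
      have "bdd_supp (B * M) (R + norm w + norm u * R) ?g" unfolding bdd_supp_def
      proof (intro conjI allI impI gm)
        fix p :: "'a \<times> real"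
        show "norm (?g p) \<le> B * M" unfolding norm_mult using B B0 hb by (intro mult_mono) auto
        assume p: "R + norm w + norm u * R < norm p"
        have "norm p \<le> norm (fst p) + norm (snd p)" using norm_Pair_le[of "fst p" "snd p"] by simp
        then show "?g p = 0" using hsup[of "fst p" "snd p"] p by force
      qed
      from bdd_supp_Fubini(1)[OF this] show ?thesis by simp
    qed
    also have "\<dots> = (LBINT t. f t * D t)"
      unfolding D_def by (simp only: integral_mult_right_zero)
    finally show ?thesis .
  qed
  ultimately show ?thesis by blast
qed

text \<open>The window \<open>{y..y+r}\<close> of \<open>g\<close> has transform bounded by
  \<open>\<kappa>\<close>, so its correlation with a larger window of \<open>g\<close> is small in
  square mean by \<open>correlation_square_integral\<close>. As \<open>c \<noteq> 0\<close>, the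
  shifts \<open>t * c\<close> sweep an interval, and Cauchy-Schwarz in \<open>t\<close> finishes the
  estimate.\<close>

lemma local_correlation_bound:
  fixes g :: "real \<Rightarrow> complex"
  assumes g: "borel_fun g" "\<And>s. norm (g s) \<le> 1" and c: "c \<noteq> 0" and r: "0 < r" "r \<le> 1"
    and \<kappa>: "\<And>a \<xi>. norm (LBINT s. indicator {a..a+r} s *\<^sub>R (g s * cis (\<xi> * s))) \<le> \<kappa>"
  shows "(LBINT t. indicator {-1..1} t * norm (LBINT s. indicator {0..r} s *\<^sub>R (g (y + s) * cnj (g (y + s + t * c)))))
    \<le> \<kappa> * sqrt (4 * (1 + \<bar>c\<bar>) / \<bar>c\<bar>)"
proof -
  note [measurable] = g(1)
  define g1 where "g1 = (\<lambda>s. indicator {0..r} s *\<^sub>R g (y + s))"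
  \<comment> \<open>The radius \<open>1 + \<bar>c\<bar>\<close> covers every
    \<open>s + t * c\<close> with \<open>s\<close> in \<open>{0..r}\<close> and
    \<open>\<bar>t\<bar> \<le> 1\<close>, so truncating \<open>g\<close> does not change the
    correlations in question.\<close>
  define g2 where "g2 = (\<lambda>s. indicator {-(1 + \<bar>c\<bar>)..1 + \<bar>c\<bar>} s *\<^sub>R g (y + s))"
  define H where "H = (\<lambda>z. \<integral>s. g1 s * cnj (g2 (s + z)) \<partial>lborel)"
  have \<kappa>0: "0 \<le> \<kappa>" using order_trans[OF norm_ge_zero \<kappa>] .
  have g1s: "bdd_supp 1 1 g1" unfolding bdd_supp_def g1_def
  proof (intro conjI allI impI)
    show "borel_fun (\<lambda>s. indicator {0..r} s *\<^sub>R g (y + s))" by measurable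
  qed (use g(2) r in \<open>auto split: split_indicator\<close>)
  have g2s: "bdd_supp 1 (1 + \<bar>c\<bar>) g2" unfolding bdd_supp_def g2_def
  proof (intro conjI allI impI)
    show "borel_fun (\<lambda>s. indicator {-(1 + \<bar>c\<bar>)..1 + \<bar>c\<bar>} s *\<^sub>R g (y + s))" by measurable
  qed (use g(2) in \<open>auto split: split_indicator\<close>)
  have ft: "norm (fourier g1 \<xi>) \<le> \<kappa>" for \<xi>
  proof -
    have m: "borel_fun (\<lambda>x. indicator {y..y+r} x *\<^sub>R (g x * cis (- \<xi> * x)))" by measurable
    have "fourier g1 \<xi> = (LBINT s. cis (\<xi> * y) * (indicator {y..y+r} (s + y) *\<^sub>R (g (s + y) * cis (- \<xi> * (s + y)))))"
      unfolding fourier_def g1_def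
    proof (intro Bochner_Integration.integral_cong refl)
      fix s
      have "cis (- (\<xi> * s)) = cis (\<xi> * y) * cis (- \<xi> * (s + y))" by (simp add: cis_mult algebra_simps)
      then show "indicator {0..r} s *\<^sub>R g (y + s) * cis (- (\<xi> * s)) =
        cis (\<xi> * y) * (indicator {y..y+r} (s + y) *\<^sub>R (g (s + y) * cis (- \<xi> * (s + y))))"
        by (auto simp: add.commute mult_ac split: split_indicator)
    qed
    also have "\<dots> = cis (\<xi> * y) * (LBINT s. indicator {y..y+r} (s + y) *\<^sub>R (g (s + y) * cis (- \<xi> * (s + y))))"
      by (rule integral_mult_right_zero)
    also have "(LBINT s. indicator {y..y+r} (s + y) *\<^sub>R (g (s + y) * cis (- \<xi> * (s + y)))) =
      (LBINT x. indicator {y..y+r} x *\<^sub>R (g x * cis (- \<xi> * x)))"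
      by (rule lborel_integral_translate[OF m])
    finally show ?thesis using \<kappa>[of y "- \<xi>"] by (simp add: norm_mult)
  qed
  note C = correlation_square_integral[OF g1s g2s ft]
  have Hs: "bdd_supp (1 * 1 * measure lborel (cball (0::real) 1)) (1 + (1 + \<bar>c\<bar>)) H" using C(2) by (simp add: H_def)
  note [measurable] = bdd_suppD(1)[OF Hs]
  define h where "h = (\<lambda>t. indicator {-1..1} t *\<^sub>R H (t * c))"
  have hs: "bdd_supp (1 * 1 * measure lborel (cball (0::real) 1)) 1 h" unfolding bdd_supp_def h_def
  proof (intro conjI allI impI)
    show "borel_fun (\<lambda>t. indicator {-1..1} t *\<^sub>R H (t * c))" by measurable
    show "norm (indicator {-1..1} t *\<^sub>R H (t * c)) \<le> 1 * 1 * measure lborel (cball (0::real) 1)" for t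
      using bdd_suppD(2)[OF Hs, of "t * c"] bdd_suppD(4)[OF Hs] by (auto split: split_indicator)
  qed (auto split: split_indicator)
  have g2i: "(LBINT s. (norm (g2 s))\<^sup>2) \<le> 2 * (1 + \<bar>c\<bar>)"
  proof -
    have "(LBINT s. (norm (g2 s))\<^sup>2) \<le> (LBINT s. indicator {-(1 + \<bar>c\<bar>)..1 + \<bar>c\<bar>} s)"
    proof (rule integral_mono')
      show "integrable lborel (indicator {-(1 + \<bar>c\<bar>)..1 + \<bar>c\<bar>} :: real \<Rightarrow> real)"
        by (rule bdd_supp_integrable[OF bdd_supp_indicator])
      show "(norm (g2 s))\<^sup>2 \<le> indicator {-(1 + \<bar>c\<bar>)..1 + \<bar>c\<bar>} s" for s
        using g(2)[of "y + s"] by (auto simp: g2_def power_le_one split: split_indicator)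
    qed auto
    also have "\<dots> = 2 * (1 + \<bar>c\<bar>)" by simp
    finally show ?thesis .
  qed
  have "(LBINT t. indicator {-1..1} t * norm (LBINT s. indicator {0..r} s *\<^sub>R (g (y + s) * cnj (g (y + s + t * c))))) = (LBINT t. norm (h t))"
  proof (intro Bochner_Integration.integral_cong refl)
    fix t :: real
    show "indicator {-1..1} t * norm (LBINT s. indicator {0..r} s *\<^sub>R (g (y + s) * cnj (g (y + s + t * c)))) = norm (h t)"
    proof (cases "t \<in> {-1..1}")
      case True
      have "H (t * c) = (LBINT s. indicator {0..r} s *\<^sub>R (g (y + s) * cnj (g (y + s + t * c))))"
        unfolding H_def
      proof (intro Bochner_Integration.integral_cong refl)
        fix s
        have "s + t * c \<in> {-(1 + \<bar>c\<bar>)..1 + \<bar>c\<bar>}" if "s \<in> {0..r}"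
        proof -
          have "\<bar>t * c\<bar> \<le> 1 * \<bar>c\<bar>" unfolding abs_mult using True by (intro mult_right_mono) auto
          then show ?thesis using that r by (auto simp: abs_le_iff)
        qed
        then show "g1 s * cnj (g2 (s + t * c)) = indicator {0..r} s *\<^sub>R (g (y + s) * cnj (g (y + s + t * c)))"
          by (auto simp: g1_def g2_def add.assoc split: split_indicator)
      qed
      then show ?thesis using True by (simp add: h_def)
    qed (simp add: h_def)
  qed
  also have "\<dots> \<le> sqrt (2 * (LBINT t. (norm (h t))\<^sup>2))"
  proof (rule real_le_rsqrt)
    have "measure lborel (cball (0::real) 1) = 2" by (simp add: cball_eq_atLeastAtMost)
    then show "(LBINT t. norm (h t))\<^sup>2 \<le> 2 * (LBINT t. (norm (h t))\<^sup>2)"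
      using square_integral_le[OF hs] by simp
  qed
  \<comment> \<open>The constant is the product of 2 for the length of [-1, 1],
    \<open>1 / \<bar>c\<bar>\<close> from the substitution \<open>z = c * t\<close>, and
    \<open>2 * (1 + \<bar>c\<bar>)\<close> for the length of the window of
    \<open>g2\<close>.\<close>
  also have "\<dots> \<le> sqrt (\<kappa>\<^sup>2 * (4 * (1 + \<bar>c\<bar>) / \<bar>c\<bar>))"
  proof (rule real_sqrt_le_mono)
    have H2: "bdd_supp ((1 * 1 * measure lborel (cball (0::real) 1))\<^sup>2) (1 + (1 + \<bar>c\<bar>)) (\<lambda>z. (norm (H z))\<^sup>2)"
      using Hs unfolding bdd_supp_def by (auto intro!: power_mono)
    have aff: "(LBINT z. (norm (H z))\<^sup>2) = \<bar>c\<bar> *\<^sub>R (LBINT t. (norm (H (0 + c * t)))\<^sup>2)"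
      by (rule lborel_integral_real_affine[OF c])
    have "integrable lborel (\<lambda>t. (norm (H (0 + c * t)))\<^sup>2)"
      by (rule lborel_integrable_real_affine[OF bdd_supp_integrable[OF H2] c])
    then have "(LBINT t. (norm (h t))\<^sup>2) \<le> (LBINT t. (norm (H (0 + c * t)))\<^sup>2)"
      by (rule integral_mono') (auto simp: h_def mult.commute split: split_indicator)
    also have "\<dots> = (1 / \<bar>c\<bar>) * (LBINT z. (norm (H z))\<^sup>2)" using aff c by simp
    also have "\<dots> \<le> (1 / \<bar>c\<bar>) * (\<kappa>\<^sup>2 * (2 * (1 + \<bar>c\<bar>)))"
    proof (rule mult_left_mono)
      have "(LBINT z. (norm (H z))\<^sup>2) \<le> \<kappa>\<^sup>2 * (LBINT s. (norm (g2 s))\<^sup>2)" unfolding H_def by (rule C(1))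
      also have "\<dots> \<le> \<kappa>\<^sup>2 * (2 * (1 + \<bar>c\<bar>))" by (intro mult_left_mono g2i) simp
      finally show "(LBINT z. (norm (H z))\<^sup>2) \<le> \<kappa>\<^sup>2 * (2 * (1 + \<bar>c\<bar>))" .
    qed simp
    finally have "2 * (LBINT t. (norm (h t))\<^sup>2) \<le> 2 * ((1 / \<bar>c\<bar>) * (\<kappa>\<^sup>2 * (2 * (1 + \<bar>c\<bar>))))" by simp
    also have "\<dots> = \<kappa>\<^sup>2 * (4 * (1 + \<bar>c\<bar>) / \<bar>c\<bar>)" by simp
    finally show "2 * (LBINT t. (norm (h t))\<^sup>2) \<le> \<kappa>\<^sup>2 * (4 * (1 + \<bar>c\<bar>) / \<bar>c\<bar>)" .
  qed
  also have "\<dots> = \<kappa> * sqrt (4 * (1 + \<bar>c\<bar>) / \<bar>c\<bar>)"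
    by (simp only: real_sqrt_mult real_sqrt_abs abs_of_nonneg[OF \<kappa>0])
  finally show ?thesis .
qed

abbreviation uniform_estimate :: "real \<Rightarrow> 'a::euclidean_space \<Rightarrow> 'a \<Rightarrow> 'a \<Rightarrow> real \<Rightarrow> bool" where
  "uniform_estimate R u v w K \<equiv> \<forall>M L FA FB g \<eta> \<kappa> r. borel_fun FA \<longrightarrow> (\<forall>x. norm (FA x) \<le> 1) \<longrightarrow>
    line_invariant v FA \<longrightarrow> borel_fun FB \<longrightarrow> (\<forall>x. norm (FB x) \<le> 1) \<longrightarrow>
    line_invariant w FB \<longrightarrow> g \<in> borel_measurable borel \<longrightarrow> (\<forall>s. norm (g s) \<le> 1) \<longrightarrow>
    amp R M L \<eta> \<longrightarrow> 0 < r \<longrightarrow> r \<le> 1 \<longrightarrow>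
    (\<forall>a \<xi>. norm (LBINT s. indicator {a..a+r} s *\<^sub>R (g s * cis (\<xi> * s))) \<le> \<kappa>) \<longrightarrow>
    (norm (LBINT x. FA x * (FB x * (g (u \<bullet> x) * \<eta> x))))\<^sup>2 \<le> K * (M\<^sup>2 * \<kappa> / r + M * L * r)"

text \<open>Two averages, one for each unknown factor. Differencing along \<open>v\<close> removes
  \<open>FA\<close>. In the remaining correlation a segment of length \<open>r\<close> along
  \<open>w\<close> leaves \<open>FB\<close> unchanged, while \<open>u \<bullet> x\<close> moves
  through a window of \<open>g\<close>, where the local correlation bound applies. The term
  \<open>M * L * r\<close> is the variation of the amplitude, and \<open>1 / r\<close> comes from
  normalising the average.\<close>

lemma uniform_function_estimate:
  fixes u v w :: "'a::euclidean_space"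
  assumes uw: "u \<bullet> w = 1" and c: "u \<bullet> v \<noteq> 0"
  shows "\<exists>K>0. uniform_estimate R u v w K"
proof -
  define V where "V = measure lborel (cball (0 :: 'a) (R + norm v))"
  define V' where "V' = measure lborel (cball (0 :: 'a) (R + norm w))"
  define K1 where "K1 = sqrt (4 * (1 + \<bar>u \<bullet> v\<bar>) / \<bar>u \<bullet> v\<bar>)"
  define K where "K = V * V' * (K1 + 4 * norm w) + 1"
  have V: "V \<ge> 0" "V' \<ge> 0" by (auto simp: V_def V'_def)
  have K1: "K1 \<ge> 0" by (simp add: K1_def)
  have K: "K > 0" using V K1 by (auto simp: K_def intro!: add_nonneg_pos mult_nonneg_nonneg)
  show ?thesis
  proof (rule exI[of _ K], rule conjI[OF K], intro allI impI)
    fix M L \<kappa> r :: real and FA FB \<eta> :: "'a \<Rightarrow> complex" and g :: "real \<Rightarrow> complex"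
    assume FA: "borel_fun FA" "\<forall>x. norm (FA x) \<le> 1" "line_invariant v FA"
      and FB: "borel_fun FB" "\<forall>x. norm (FB x) \<le> 1" "line_invariant w FB"
      and g: "borel_fun g" "\<forall>s. norm (g s) \<le> 1" and \<eta>: "amp R M L \<eta>" and r: "0 < r" "r \<le> 1"
      and \<kappa>: "\<forall>a \<xi>. norm (LBINT s. indicator {a..a+r} s *\<^sub>R (g s * cis (\<xi> * s))) \<le> \<kappa>"
    note e = ampD[OF \<eta>]
    have M: "M \<ge> 0" and L: "L \<ge> 0" by (rule e(4), rule amp_Lipschitz_nonneg[OF \<eta>])
    note [measurable] = FA(1) FB(1) g(1) bdd_suppD(1)[OF amp_bdd_supp[OF \<eta>]]
    have gu: "borel_fun (\<lambda>x. g (u \<bullet> x))" by measurable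
    define G where "G = (\<lambda>x. FB x * (g (u \<bullet> x) * \<eta> x))"
    have G: "bdd_supp M R G" unfolding G_def
      using FB(2) g(2) by (intro bdd_supp_mult_left[OF FB(1)] bdd_supp_mult_left[OF gu] amp_bdd_supp[OF \<eta>]) auto
    \<comment> \<open>The shift \<open>t * (u \<bullet> v)\<close> is the displacement of
      \<open>u \<bullet> x\<close> along \<open>t *\<^sub>R v\<close>; because
      \<open>u \<bullet> v \<noteq> 0\<close> it varies with \<open>t\<close>, as
      \<open>local_correlation_bound\<close> requires.\<close>
    define W where "W = (\<lambda>y t. \<integral>s. indicator {0..r} s *\<^sub>R (g (y + s) * cnj (g (y + s + t * (u \<bullet> v)))) \<partial>lborel)"
    define J where "J = (\<lambda>t. \<integral>x. G x * cnj (G (x + t *\<^sub>R v)) \<partial>lborel)"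
    let ?k = "indicator {0..r} :: real \<Rightarrow> real"
    let ?I = "indicator (cball 0 (R + norm w)) :: 'a \<Rightarrow> real"
    have ks: "bdd_supp 1 1 ?k" using bdd_supp_mono[OF bdd_supp_indicator[of 0 r], of 1 1] r by simp
    have vdc: "(norm (LBINT x. FA x * G x))\<^sup>2 \<le> V * (LBINT t. indicator {-1..1} t * norm (J t))"
      unfolding V_def J_def by (rule van_der_Corput_inequality[OF FA(1) spec[OF FA(2)] _ G]) (use FA(3) in auto)
    have Wb: "norm (W y t) \<le> r" for y t
    proof -
      have "norm (W y t) \<le> (LBINT s. norm (?k s *\<^sub>R (g (y + s) * cnj (g (y + s + t * (u \<bullet> v))))))"
        unfolding W_def by (rule integral_norm_bound)
      also have "\<dots> \<le> (LBINT s. ?k s)"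
      proof (rule integral_mono'[OF bdd_supp_integrable[OF ks]])
        fix s
        have "norm (g (y + s) * cnj (g (y + s + t * (u \<bullet> v)))) \<le> 1"
          unfolding norm_mult complex_mod_cnj using g(2) by (intro mult_le_one) auto
        then show "norm (?k s *\<^sub>R (g (y + s) * cnj (g (y + s + t * (u \<bullet> v))))) \<le> ?k s"
          by (auto split: split_indicator)
      qed auto
      also have "\<dots> = r" using r by simp
      finally show ?thesis .
    qed
    have Wm [measurable]: "(\<lambda>(y, t). W y t) \<in> borel_measurable (borel \<Otimes>\<^sub>M borel)"
    proof -
      have "(\<lambda>p. \<integral>s. ?k s *\<^sub>R (g (fst p + s) * cnj (g (fst p + s + snd p * (u \<bullet> v)))) \<partial>lborel) \<in> borel_measurable (borel :: (real \<times> real) measure)"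
        by (rule borel_measurable_lborel_integral_fst) (simp only: borel_prod[symmetric], measurable)
      then show ?thesis by (simp add: W_def case_prod_beta borel_prod)
    qed
    \<comment> \<open>Over the segment along \<open>w\<close> the factor \<open>Bt\<close> is
      constant and the amplitude product \<open>\<theta>\<close> changes by at most
      \<open>2 * M * L * r * norm w\<close>. Freezing it at \<open>x\<close> leaves
      \<open>W (u \<bullet> x) t\<close>.\<close>
    have Jle: "r * norm (J t) \<le> M\<^sup>2 * (LBINT x. ?I x * norm (W (u \<bullet> x) t)) + r * (2 * M * L * r * norm w * V')" for t
    proof -
      define \<theta> where "\<theta> = (\<lambda>x. \<eta> x * cnj (\<eta> (x + t *\<^sub>R v)))"
      define Bt where "Bt = (\<lambda>x. FB x * cnj (FB (x + t *\<^sub>R v)))"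
      define h where "h = (\<lambda>x. G x * cnj (G (x + t *\<^sub>R v)))"
      have \<theta>b: "norm (\<theta> x) \<le> M\<^sup>2" for x
        unfolding \<theta>_def norm_mult complex_mod_cnj power2_eq_square by (intro mult_mono e) auto
      have \<theta>l: "norm (\<theta> x - \<theta> y) \<le> 2 * M * L * norm (x - y)" for x y
      proof -
        have "\<theta> x - \<theta> y = (\<eta> x - \<eta> y) * cnj (\<eta> (x + t *\<^sub>R v)) + \<eta> y * cnj (\<eta> (x + t *\<^sub>R v) - \<eta> (y + t *\<^sub>R v))"
          by (simp add: \<theta>_def algebra_simps)
        also have "norm \<dots> \<le> norm ((\<eta> x - \<eta> y) * cnj (\<eta> (x + t *\<^sub>R v))) + norm (\<eta> y * cnj (\<eta> (x + t *\<^sub>R v) - \<eta> (y + t *\<^sub>R v)))"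
          by (rule norm_triangle_ineq)
        also have "\<dots> \<le> (L * norm (x - y)) * M + M * (L * norm (x - y))"
          unfolding norm_mult complex_mod_cnj
        proof (intro add_mono mult_mono e mult_nonneg_nonneg L M)
          show "norm (\<eta> (x + t *\<^sub>R v) - \<eta> (y + t *\<^sub>R v)) \<le> L * norm (x - y)" using e(2)[of "x + t *\<^sub>R v" "y + t *\<^sub>R v"] by simp
        qed auto
        finally show ?thesis by (simp add: algebra_simps)
      qed
      have Btb: "norm (Bt x) \<le> 1" for x
        unfolding Bt_def norm_mult complex_mod_cnj using FB(2) by (intro mult_le_one) auto
      have hs: "bdd_supp (M * M) R h" unfolding bdd_supp_def h_def
      proof (intro conjI allI impI)
        note [measurable] = bdd_suppD(1)[OF G]
        show "borel_fun (\<lambda>x. G x * cnj (G (x + t *\<^sub>R v)))" by measurable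
        show "norm (G x * cnj (G (x + t *\<^sub>R v))) \<le> M * M" for x
          unfolding norm_mult complex_mod_cnj by (intro mult_mono bdd_suppD(2)[OF G] M) auto
      qed (use bdd_suppD(3)[OF G] in auto)
      note [measurable] = bdd_suppD(1)[OF hs]
      have hx: "h (x + s *\<^sub>R w) = Bt x * ((g (u \<bullet> x + s) * cnj (g (u \<bullet> x + s + t * (u \<bullet> v)))) * \<theta> (x + s *\<^sub>R w))" for x s
      proof -
        have "FB (x + s *\<^sub>R w + t *\<^sub>R v) = FB (x + t *\<^sub>R v)"
          using FB(3)[rule_format, of "x + t *\<^sub>R v" s] by (simp add: algebra_simps)
        then show ?thesis using FB(3) by (simp add: h_def G_def Bt_def \<theta>_def inner_add_right uw mult_ac)
      qed
      define a where "a = (\<lambda>x. \<integral>s. ?k s *\<^sub>R h (x + s *\<^sub>R w) \<partial>lborel)"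
      have avg: "(LBINT x. a x) = r *\<^sub>R (LBINT x. h x)" "integrable lborel a"
        using bdd_supp_averaging[OF hs ks, of "\<lambda>s. s *\<^sub>R w" "norm w"] r by (simp_all add: a_def mult_left_le_one_le)
      define b where "b = (\<lambda>x. M\<^sup>2 * (?I x * norm (W (u \<bullet> x) t)) + (r * (2 * M * L * r * norm w)) * ?I x)"
      have le: "norm (a x) \<le> b x" for x
      proof (cases "norm x \<le> R + norm w")
        case False
        have "?k s *\<^sub>R h (x + s *\<^sub>R w) = 0" for s
        proof (cases "s \<in> {0..r}")
          case True
          then have "norm (s *\<^sub>R w) \<le> norm w" using r by (simp add: mult_left_le_one_le)
          moreover have "norm x \<le> norm (x + s *\<^sub>R w) + norm (s *\<^sub>R w)"
            using norm_triangle_ineq4[of "x + s *\<^sub>R w" "s *\<^sub>R w"] by simp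
          ultimately have "R < norm (x + s *\<^sub>R w)" using False by simp
          then show ?thesis using bdd_suppD(3)[OF hs] by simp
        qed simp
        then have "a x = (\<integral>s. 0 \<partial>(lborel :: real measure))" unfolding a_def
          by (intro Bochner_Integration.integral_cong) auto
        then show ?thesis using False by (simp add: b_def)
      next
        case True
        define E where "E = (\<lambda>s. g (u \<bullet> x + s) * cnj (g (u \<bullet> x + s + t * (u \<bullet> v))))"
        have Em [measurable]: "borel_fun E" unfolding E_def by measurable
        have Eb: "norm (E s) \<le> 1" for s
          unfolding E_def norm_mult complex_mod_cnj using g(2) by (intro mult_le_one) auto
        have \<theta>m [measurable]: "borel_fun \<theta>" unfolding \<theta>_def by measurable
        have s1: "bdd_supp (M\<^sup>2) 1 (\<lambda>s. ?k s *\<^sub>R (E s * \<theta> (x + s *\<^sub>R w)))" unfolding bdd_supp_def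
        proof (intro conjI allI impI)
          show "borel_fun (\<lambda>s. ?k s *\<^sub>R (E s * \<theta> (x + s *\<^sub>R w)))" by measurable
          fix s
          have "norm (E s * \<theta> (x + s *\<^sub>R w)) \<le> 1 * M\<^sup>2" unfolding norm_mult by (intro mult_mono Eb \<theta>b) auto
          then show "norm (?k s *\<^sub>R (E s * \<theta> (x + s *\<^sub>R w))) \<le> M\<^sup>2" by (auto split: split_indicator)
        qed (use r in \<open>auto split: split_indicator\<close>)
        have s2: "bdd_supp (M\<^sup>2) 1 (\<lambda>s. ?k s *\<^sub>R (E s * \<theta> x))" unfolding bdd_supp_def
        proof (intro conjI allI impI)
          show "borel_fun (\<lambda>s. ?k s *\<^sub>R (E s * \<theta> x))" by measurable
          fix s
          have "norm (E s * \<theta> x) \<le> 1 * M\<^sup>2" unfolding norm_mult by (intro mult_mono Eb \<theta>b) auto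
          then show "norm (?k s *\<^sub>R (E s * \<theta> x)) \<le> M\<^sup>2" by (auto split: split_indicator)
        qed (use r in \<open>auto split: split_indicator\<close>)
        have "a x = (LBINT s. Bt x * (?k s *\<^sub>R (E s * \<theta> (x + s *\<^sub>R w))))"
          unfolding a_def hx E_def by (intro Bochner_Integration.integral_cong refl) simp
        also have "\<dots> = Bt x * (LBINT s. ?k s *\<^sub>R (E s * \<theta> (x + s *\<^sub>R w)))" by (rule integral_mult_right_zero)
        finally have "norm (a x) \<le> 1 * norm (LBINT s. ?k s *\<^sub>R (E s * \<theta> (x + s *\<^sub>R w)))"
          unfolding norm_mult by (simp only: norm_mult) (intro mult_right_mono Btb, simp)
        also have "\<dots> \<le> norm (LBINT s. ?k s *\<^sub>R (E s * \<theta> x)) + norm ((LBINT s. ?k s *\<^sub>R (E s * \<theta> (x + s *\<^sub>R w))) - (LBINT s. ?k s *\<^sub>R (E s * \<theta> x)))"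
          using norm_triangle_sub[of "\<integral>s. ?k s *\<^sub>R (E s * \<theta> (x + s *\<^sub>R w)) \<partial>lborel" "\<integral>s. ?k s *\<^sub>R (E s * \<theta> x) \<partial>lborel"] by simp
        also have "(LBINT s. ?k s *\<^sub>R (E s * \<theta> (x + s *\<^sub>R w))) - (LBINT s. ?k s *\<^sub>R (E s * \<theta> x)) =
          (LBINT s. ?k s *\<^sub>R (E s * \<theta> (x + s *\<^sub>R w)) - ?k s *\<^sub>R (E s * \<theta> x))"
          by (rule Bochner_Integration.integral_diff[symmetric]) (rule bdd_supp_integrable[OF s1], rule bdd_supp_integrable[OF s2])
        also have "norm \<dots> \<le> (LBINT s. norm (?k s *\<^sub>R (E s * \<theta> (x + s *\<^sub>R w)) - ?k s *\<^sub>R (E s * \<theta> x)))" by (rule integral_norm_bound)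
        also have "\<dots> \<le> (LBINT s. (2 * M * L * r * norm w) * ?k s)"
        proof (rule integral_mono')
          show "integrable lborel (\<lambda>s. (2 * M * L * r * norm w) * ?k s)" by (intro integrable_mult_right bdd_supp_integrable[OF ks])
          show "0 \<le> (2 * M * L * r * norm w) * ?k s" for s using M L r by simp
          fix s
          show "norm (?k s *\<^sub>R (E s * \<theta> (x + s *\<^sub>R w)) - ?k s *\<^sub>R (E s * \<theta> x)) \<le> (2 * M * L * r * norm w) * ?k s"
          proof (cases "s \<in> {0..r}")
            case s: True
            have "norm (\<theta> (x + s *\<^sub>R w) - \<theta> x) \<le> 2 * M * L * norm (s *\<^sub>R w)" using \<theta>l[of "x + s *\<^sub>R w" x] by simp
            also have "\<dots> \<le> 2 * M * L * (r * norm w)" using s M L by (intro mult_left_mono) (auto intro: mult_right_mono)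
            finally have "norm (E s) * norm (\<theta> (x + s *\<^sub>R w) - \<theta> x) \<le> 1 * (2 * M * L * (r * norm w))"
              by (intro mult_mono Eb) auto
            then show ?thesis using s by (simp add: right_diff_distrib[symmetric] norm_mult mult_ac)
          qed simp
        qed
        also have "\<dots> = r * (2 * M * L * r * norm w)" using r by simp
        also have "(LBINT s. ?k s *\<^sub>R (E s * \<theta> x)) = W (u \<bullet> x) t * \<theta> x"
          unfolding W_def by (subst integral_mult_left_zero[symmetric]) (simp add: E_def)
        also have "norm (W (u \<bullet> x) t * \<theta> x) \<le> M\<^sup>2 * norm (W (u \<bullet> x) t)"
          unfolding norm_mult using \<theta>b[of x] by (simp add: mult.commute mult_right_mono)
        finally show ?thesis using True by (simp add: b_def)
      qed
      have iW: "integrable lborel (\<lambda>x. ?I x * norm (W (u \<bullet> x) t))"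
      proof (rule bdd_supp_integrable)
        show "bdd_supp r (R + norm w) (\<lambda>x. ?I x * norm (W (u \<bullet> x) t))" unfolding bdd_supp_def
        proof (intro conjI allI impI)
          have "borel_fun (\<lambda>x. norm (W (u \<bullet> x) t))" by measurable
          then show "borel_fun (\<lambda>x. ?I x * norm (W (u \<bullet> x) t))" by (intro borel_measurable_times borel_measurable_indicator) auto
        qed (use Wb r in \<open>auto split: split_indicator\<close>)
      qed
      have i2: "integrable lborel (\<lambda>x. (r * (2 * M * L * r * norm w)) * ?I x)" by (rule integrable_cball_indicator)
      have "r * norm (J t) = norm (LBINT x. a x)" using avg(1) r by (simp add: J_def h_def)
      also have "\<dots> \<le> (LBINT x. norm (a x))" by (rule integral_norm_bound)
      also have "\<dots> \<le> (LBINT x. b x)"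
        by (rule integral_mono[OF integrable_norm[OF avg(2)] _ le])
          (unfold b_def, intro Bochner_Integration.integrable_add integrable_mult_right iW i2)
      also have "\<dots> = (LBINT x. M\<^sup>2 * (?I x * norm (W (u \<bullet> x) t))) + (LBINT x. (r * (2 * M * L * r * norm w)) * ?I x)"
        unfolding b_def by (intro Bochner_Integration.integral_add integrable_mult_right iW i2)
      also have "(LBINT x. M\<^sup>2 * (?I x * norm (W (u \<bullet> x) t))) = M\<^sup>2 * (LBINT x. ?I x * norm (W (u \<bullet> x) t))"
        by (rule integral_mult_right_zero)
      also have "(LBINT x. (r * (2 * M * L * r * norm w)) * ?I x) = r * (2 * M * L * r * norm w * V')"
        by (simp add: V'_def)
      finally show ?thesis .
    qed
    define S where "S = (\<lambda>t. \<integral>x. ?I x * norm (W (u \<bullet> x) t) \<partial>lborel)"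
    let ?g = "\<lambda>p :: 'a \<times> real. indicator {-1..1} (snd p) * (?I (fst p) * norm (W (u \<bullet> fst p) (snd p)))"
    have gs: "bdd_supp r (R + norm w + 1) ?g" unfolding bdd_supp_def
    proof (intro conjI allI impI)
      have "?g \<in> borel_measurable (borel \<Otimes>\<^sub>M borel)"
      proof (intro borel_measurable_times)
        show "(\<lambda>p :: 'a \<times> real. indicator {-1..1} (snd p) :: real) \<in> borel_measurable (borel \<Otimes>\<^sub>M borel)" by measurable
        show "(\<lambda>p :: 'a \<times> real. ?I (fst p)) \<in> borel_measurable (borel \<Otimes>\<^sub>M borel)"
          by (rule measurable_compose[OF measurable_fst], rule borel_measurable_indicator) simp
        show "(\<lambda>p :: 'a \<times> real. norm (W (u \<bullet> fst p) (snd p))) \<in> borel_measurable (borel \<Otimes>\<^sub>M borel)" by measurable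
      qed
      then show "borel_fun ?g" by (simp add: borel_prod)
      show "norm (?g p) \<le> r" for p using Wb[of "u \<bullet> fst p" "snd p"] r by (auto split: split_indicator)
      fix p :: "'a \<times> real" assume p: "R + norm w + 1 < norm p"
      have "norm p \<le> norm (fst p) + norm (snd p)" using norm_Pair_le[of "fst p" "snd p"] by simp
      then show "?g p = 0" using p by (auto split: split_indicator)
    qed
    note Fub = bdd_supp_Fubini[OF gs]
    have Si: "integrable lborel (\<lambda>t. indicator {-1..1} t * S t)"
      using Fub(3) by (simp add: S_def)
    have "(LBINT t. indicator {-1..1} t * S t) = (LBINT x. ?I x * (LBINT t. indicator {-1..1} t * norm (W (u \<bullet> x) t)))"
    proof -
      have "(LBINT t. indicator {-1..1} t * S t) = (LBINT t. (LBINT x. indicator {-1..1} t * (?I x * norm (W (u \<bullet> x) t))))"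
        unfolding S_def by (simp only: integral_mult_right_zero)
      also have "\<dots> = (LBINT x. (LBINT t. indicator {-1..1} t * (?I x * norm (W (u \<bullet> x) t))))"
        using Fub(1) by simp
      also have "\<dots> = (LBINT x. ?I x * (LBINT t. indicator {-1..1} t * norm (W (u \<bullet> x) t)))"
        unfolding mult.left_commute[of "indicator {-1..1} _"] by (simp only: integral_mult_right_zero)
      finally show ?thesis .
    qed
    also have "\<dots> \<le> (LBINT x. (\<kappa> * K1) * ?I x)"
    proof (rule integral_mono')
      show "integrable lborel (\<lambda>x. (\<kappa> * K1) * ?I x)" by (rule integrable_cball_indicator)
      have \<kappa>0: "0 \<le> \<kappa>" using order_trans[OF norm_ge_zero \<kappa>[rule_format]] .
      show "0 \<le> (\<kappa> * K1) * ?I x" for x using \<kappa>0 K1 by simp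
      have "(LBINT t. indicator {-1..1} t * norm (W y t)) \<le> \<kappa> * K1" for y
        unfolding W_def K1_def by (rule local_correlation_bound[OF g(1) _ c r]) (use g(2) \<kappa> in auto)
      then show "?I x * (LBINT t. indicator {-1..1} t * norm (W (u \<bullet> x) t)) \<le> (\<kappa> * K1) * ?I x" for x
        by (auto split: split_indicator)
    qed
    also have "\<dots> = \<kappa> * K1 * V'" by (simp add: V'_def)
    finally have Sint: "(LBINT t. indicator {-1..1} t * S t) \<le> \<kappa> * K1 * V'" .
    have i3: "integrable lborel (\<lambda>t. (2 * M * L * r * norm w * V') * indicator {-1..1::real} t)"
      using bdd_supp_integrable[OF bdd_supp_indicator[of "-1" 1]] by (intro integrable_mult_right)
    have "(LBINT t. indicator {-1..1} t * norm (J t)) \<le>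
      (LBINT t. (M\<^sup>2 / r) * (indicator {-1..1} t * S t) + (2 * M * L * r * norm w * V') * indicator {-1..1} t)"
    proof (rule integral_mono')
      show "integrable lborel (\<lambda>t. (M\<^sup>2 / r) * (indicator {-1..1} t * S t) + (2 * M * L * r * norm w * V') * indicator {-1..1} t)"
        by (intro Bochner_Integration.integrable_add integrable_mult_right Si i3)
      have "norm (J t) \<le> (M\<^sup>2 / r) * S t + 2 * M * L * r * norm w * V'" for t
        using Jle[of t] r by (simp add: S_def field_simps)
      then show "indicator {-1..1} t * norm (J t) \<le> (M\<^sup>2 / r) * (indicator {-1..1} t * S t) + (2 * M * L * r * norm w * V') * indicator {-1..1} t" for t
        by (auto split: split_indicator)
      then show "0 \<le> (M\<^sup>2 / r) * (indicator {-1..1} t * S t) + (2 * M * L * r * norm w * V') * indicator {-1..1} t" for t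
        by (rule order_trans[rotated]) simp
    qed
    also have "\<dots> = (LBINT t. (M\<^sup>2 / r) * (indicator {-1..1} t * S t)) + (LBINT t. (2 * M * L * r * norm w * V') * indicator {-1..1::real} t)"
      by (intro Bochner_Integration.integral_add integrable_mult_right Si i3)
    also have "\<dots> = (M\<^sup>2 / r) * (LBINT t. indicator {-1..1} t * S t) + 2 * (2 * M * L * r * norm w * V')"
      by (subst integral_mult_right_zero) simp
    also have "\<dots> \<le> (M\<^sup>2 / r) * (\<kappa> * K1 * V') + 2 * (2 * M * L * r * norm w * V')"
      using Sint r by (intro add_right_mono mult_left_mono) auto
    also have "\<dots> = V' * K1 * (M\<^sup>2 * \<kappa> / r) + 4 * norm w * V' * (M * L * r)"
      using r by (simp add: field_simps)
    finally have Jint: "(LBINT t. indicator {-1..1} t * norm (J t)) \<le> V' * K1 * (M\<^sup>2 * \<kappa> / r) + 4 * norm w * V' * (M * L * r)" .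
    have \<kappa>0: "0 \<le> \<kappa>" using order_trans[OF norm_ge_zero \<kappa>[rule_format]] .
    have nn: "0 \<le> M\<^sup>2 * \<kappa> / r" "0 \<le> M * L * r" using \<kappa>0 r M L by auto
    have "(norm (LBINT x. FA x * G x))\<^sup>2 \<le> V * (V' * K1 * (M\<^sup>2 * \<kappa> / r) + 4 * norm w * V' * (M * L * r))"
      using vdc mult_left_mono[OF Jint V(1)] by linarith
    also have "\<dots> = (V * V' * K1) * (M\<^sup>2 * \<kappa> / r) + (V * V' * (4 * norm w)) * (M * L * r)" by (simp add: algebra_simps)
    also have "\<dots> \<le> K * (M\<^sup>2 * \<kappa> / r) + K * (M * L * r)"
    proof (intro add_mono mult_right_mono nn)
      have "0 \<le> V * V' * K1" "0 \<le> V * V' * (4 * norm w)" using V K1 by auto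
      then show "V * V' * K1 \<le> K" "V * V' * (4 * norm w) \<le> K" unfolding K_def by (simp_all add: distrib_left)
    qed
    finally show "(norm (LBINT x. FA x * (FB x * (g (u \<bullet> x) * \<eta> x))))\<^sup>2 \<le> K * (M\<^sup>2 * \<kappa> / r + M * L * r)"
      by (simp add: G_def distrib_left)
  qed
qed

subsection \<open>The induction on the number of directions\<close>

lemma flin_sum:
  assumes S: "fsub S" and \<phi>: "flin S \<phi>" and fin: "finite I" and p: "\<And>i. i \<in> I \<Longrightarrow> p i \<in> S"
  shows "\<phi> (\<lambda>x. \<Sum>i\<in>I. a i * p i x) = (\<Sum>i\<in>I. a i * \<phi> (p i))"
  using fin p
proof (induction I rule: finite_induct)
  case empty
  from flin_scale[OF \<phi> fsub_zero[OF S], of 0] show ?case by simp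
next
  case (insert k I)
  have 1: "(\<lambda>x. a k * p k x) \<in> S" using insert.prems by (intro fsub_scale[OF S]) simp
  have 2: "(\<lambda>x. \<Sum>i\<in>I. a i * p i x) \<in> S" using insert.prems by (intro fsub_sum[OF S]) simp
  have "p k \<in> S" using insert.prems by simp
  from flin_add[OF \<phi> 1 2] flin_scale[OF \<phi> this, of "a k"] insert show ?case by simp
qed

text \<open>Since the coefficients in \<open>ddir_formula\<close> sum to zero, the derivative is a
  combination of differences along \<open>v\<close>. Decay in each difference, which van der Corput
  provides, therefore implies decay in the functional of the derivative.\<close>

lemma ddir_functional_bound:
  fixes v :: "real ^ 'm::finite"
  assumes \<phi>: "flin (polys_le d) \<phi>"
  shows "\<exists>K\<ge>0. \<forall>P\<in>polys_le d. \<bar>\<phi> (ddir v P)\<bar> \<le>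
    K * (\<Sum>k\<le>d. \<bar>\<phi> (\<lambda>x. P x - P (x + (real k / real (Suc d)) *\<^sub>R v))\<bar>)"
proof -
  obtain c :: "nat \<Rightarrow> real" where c0: "(\<Sum>k\<le>d. c k) = 0" and c: "\<forall>P\<in>polys_le d. \<forall>(x :: real ^ 'm) v.
    ddir v P x = (\<Sum>k\<le>d. c k * P (x + (real k / real (Suc d)) *\<^sub>R v))"
    using ddir_formula[of d, where 'm='m] by (elim exE conjE) (rule that)
  define K where "K = (\<Sum>k\<le>d. \<bar>c k\<bar>)"
  have K: "K \<ge> 0" "\<And>k. k \<le> d \<Longrightarrow> \<bar>c k\<bar> \<le> K"
    unfolding K_def by (auto intro: sum_nonneg member_le_sum)
  show ?thesis
  proof (rule exI[of _ K], rule conjI[OF K(1)], rule ballI)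
    fix P :: "real ^ 'm \<Rightarrow> real" assume P: "P \<in> polys_le d"
    let ?D = "\<lambda>k x. P x - P (x + (real k / real (Suc d)) *\<^sub>R v)"
    have D: "?D k \<in> polys_le d" for k by (intro polys_le_diff P polys_le_translate)
    have "ddir v P = (\<lambda>x. \<Sum>k\<le>d. (- c k) * ?D k x)"
    proof
      fix x
      have "(\<Sum>k\<le>d. (- c k) * ?D k x) = (\<Sum>k\<le>d. c k * P (x + (real k / real (Suc d)) *\<^sub>R v)) - (\<Sum>k\<le>d. c k) * P x"
        by (simp add: right_diff_distrib sum_subtractf sum_distrib_right sum_negf)
      then show "ddir v P x = (\<Sum>k\<le>d. (- c k) * ?D k x)" using c0 bspec[OF c P, rule_format, of v x] by simp
    qed
    then have "\<phi> (ddir v P) = (\<Sum>k\<le>d. (- c k) * \<phi> (?D k))"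
      using flin_sum[OF fsub_polys_le \<phi>, of "{..d}" ?D "\<lambda>k. - c k"] D by simp
    then have "\<bar>\<phi> (ddir v P)\<bar> \<le> (\<Sum>k\<le>d. \<bar>(- c k) * \<phi> (?D k)\<bar>)" by (simp only: sum_abs)
    also have "\<dots> \<le> (\<Sum>k\<le>d. K * \<bar>\<phi> (?D k)\<bar>)"
      by (intro sum_mono) (auto simp: abs_mult intro!: mult_right_mono K(2))
    also have "\<dots> = K * (\<Sum>k\<le>d. \<bar>\<phi> (?D k)\<bar>)" by (rule sum_distrib_left[symmetric])
    finally show "\<bar>\<phi> (ddir v P)\<bar> \<le> K * (\<Sum>k\<le>d. \<bar>\<phi> (?D k)\<bar>)" .
  qed
qed

lemma decays_dominated:
  fixes u :: "nat \<Rightarrow> real ^ 'm::finite"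
  assumes I: "finite I" "\<And>i. i \<in> I \<Longrightarrow> decays d R u J (\<psi> i)" and K: "K \<ge> 0"
    and dom: "\<And>P. P \<in> polys_le d \<Longrightarrow> \<bar>\<phi> P\<bar> \<le> K * (\<Sum>i\<in>I. \<bar>\<psi> i P\<bar>)"
  shows "decays d R u J \<phi>"
proof -
  have "\<exists>C>0. \<exists>\<epsilon>>0. osc_bound d R u J C \<epsilon> (\<lambda>P. \<Sum>i\<in>I. \<bar>\<psi> i P\<bar>)"
    by (rule decays_sum[OF I(1)]) (rule I(2))
  then obtain C \<epsilon> where C: "C > 0" "\<epsilon> > 0" "osc_bound d R u J C \<epsilon> (\<lambda>P. \<Sum>i\<in>I. \<bar>\<psi> i P\<bar>)"
    by (elim exE conjE) (rule that)
  show ?thesis unfolding decays_def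
  proof (rule exI[of _ "C * (K + 1) powr \<epsilon>"], rule conjI, use C K in simp, rule exI[of _ \<epsilon>], rule conjI[OF C(2)], intro allI ballI impI)
    fix M F and \<eta> :: "real ^ 'm \<Rightarrow> complex" and P :: "real ^ 'm \<Rightarrow> real"
    assume P: "P \<in> polys_le d" and F: "unit_bdd F J" and \<eta>: "amp R M M \<eta>"
    define X where "X = (\<Sum>i\<in>I. \<bar>\<psi> i P\<bar>)"
    have X: "X \<ge> 0" by (simp add: X_def sum_nonneg)
    have "1 + \<bar>\<phi> P\<bar> \<le> (K + 1) * (1 + X)" using dom[OF P] X K by (simp add: X_def[symmetric] algebra_simps)
    then have le: "(1 + \<bar>\<phi> P\<bar>) / (K + 1) \<le> 1 + X" using K by (simp add: pos_divide_le_eq mult.commute)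
    have "norm (osc u J F P \<eta>) \<le> C * M * (1 + X) powr - \<epsilon>" using C(3) P F \<eta> by (simp add: X_def)
    also have "\<dots> \<le> C * M * ((1 + \<bar>\<phi> P\<bar>) / (K + 1)) powr - \<epsilon>"
      using C ampD(4)[OF \<eta>] le K by (intro mult_left_mono powr_mono2') auto
    also have "((1 + \<bar>\<phi> P\<bar>) / (K + 1)) powr - \<epsilon> = (K + 1) powr \<epsilon> * (1 + \<bar>\<phi> P\<bar>) powr - \<epsilon>"
      using K by (simp add: powr_divide powr_minus field_simps)
    finally show "norm (osc u J F P \<eta>) \<le> C * (K + 1) powr \<epsilon> * M * (1 + \<bar>\<phi> P\<bar>) powr - \<epsilon>" by (simp add: mult_ac)
  qed
qed

lemma polys_le_Lipschitz:
  fixes P :: "real ^ 'm::finite \<Rightarrow> real"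
  shows "P \<in> polys_le d \<Longrightarrow> \<exists>L\<ge>0. lipschitz_on_ball R L P"
proof (induction d arbitrary: P)
  case 0
  then obtain c where "P = (\<lambda>_. c)" using polys_le_0[of P] by auto
  then show ?case by (intro exI[of _ 0]) simp
next
  case (Suc d)
  from polys_le_Suc_cases[OF Suc.prems] obtain c Q where
    Q: "\<And>i. Q i \<in> polys_le d" and P: "P = (\<lambda>x. c + (\<Sum>i\<in>UNIV. x $ i * Q i x))" by blast
  have "\<forall>i. \<exists>L\<ge>0. lipschitz_on_ball R L (Q i)" using Suc.IH[OF Q] by blast
  from choice[OF this] obtain L where L: "\<And>i. L i \<ge> 0"
    "\<And>i x y. x \<in> cball 0 R \<Longrightarrow> y \<in> cball 0 R \<Longrightarrow> \<bar>Q i x - Q i y\<bar> \<le> L i * norm (x - y)" by blast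
  have "\<forall>i. \<exists>B\<ge>0. \<forall>x\<in>cball (0 :: real ^ 'm) R. \<bar>Q i x\<bar> \<le> B" using polys_le_bounded_on[OF Q] by blast
  from choice[OF this] obtain B where B: "\<And>i. B i \<ge> 0" "\<And>i x. x \<in> cball 0 R \<Longrightarrow> \<bar>Q i x\<bar> \<le> B i" by blast
  define K where "K = (\<Sum>i\<in>UNIV. B i + \<bar>R\<bar> * L i)"
  have "K \<ge> 0" unfolding K_def using L B by (intro sum_nonneg add_nonneg_nonneg mult_nonneg_nonneg) auto
  moreover have "\<bar>P x - P y\<bar> \<le> K * norm (x - y)" if x: "x \<in> cball 0 R" and y: "y \<in> cball 0 R" for x y
  proof -
    have "\<bar>P x - P y\<bar> \<le> (\<Sum>i\<in>UNIV. \<bar>x $ i * Q i x - y $ i * Q i y\<bar>)"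
      unfolding P by (simp add: sum_subtractf[symmetric])
    also have "\<dots> \<le> (\<Sum>i\<in>UNIV. (B i + \<bar>R\<bar> * L i) * norm (x - y))"
    proof (rule sum_mono)
      fix i
      have "x $ i * Q i x - y $ i * Q i y = (x - y) $ i * Q i x + y $ i * (Q i x - Q i y)" by (simp add: algebra_simps)
      then have "\<bar>x $ i * Q i x - y $ i * Q i y\<bar> \<le> \<bar>(x - y) $ i\<bar> * \<bar>Q i x\<bar> + \<bar>y $ i\<bar> * \<bar>Q i x - Q i y\<bar>"
        using abs_triangle_ineq[of "(x - y) $ i * Q i x" "y $ i * (Q i x - Q i y)"] by (simp add: abs_mult)
      also have "\<dots> \<le> norm (x - y) * B i + \<bar>R\<bar> * (L i * norm (x - y))"
      proof (intro add_mono mult_mono component_le_norm_cart B(2)[OF x] L(2)[OF x y])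
        show "\<bar>y $ i\<bar> \<le> \<bar>R\<bar>" using component_le_norm_cart[of y i] y by simp
      qed auto
      finally show "\<bar>x $ i * Q i x - y $ i * Q i y\<bar> \<le> (B i + \<bar>R\<bar> * L i) * norm (x - y)" by (simp add: algebra_simps)
    qed
    finally show ?thesis by (simp add: K_def sum_distrib_right)
  qed
  ultimately show ?case by blast
qed

text \<open>A Lipschitz phase can be absorbed into the amplitude at the cost of its Lipschitz
  constant. The bound for \<open>E\<close> is known on the ball only, so pairs with a point outside,
  where \<open>\<eta>\<close> vanishes, are treated separately.\<close>

lemma amp_mult_cis:
  fixes \<eta> :: "'a::euclidean_space \<Rightarrow> complex" and E :: "'a \<Rightarrow> real"
  assumes \<eta>: "amp R M M \<eta>" and L: "L \<ge> 0" "\<And>x y. norm x \<le> R \<Longrightarrow> norm y \<le> R \<Longrightarrow> \<bar>E x - E y\<bar> \<le> L * norm (x - y)"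
  shows "amp R M (M * (1 + L)) (\<lambda>x. cis (E x) * \<eta> x)"
  unfolding amp_def
proof (intro conjI allI impI)
  note e = ampD[OF \<eta>]
  show "norm (cis (E x) * \<eta> x) \<le> M" for x using e(1) by (simp add: norm_mult)
  show "R < norm x \<Longrightarrow> cis (E x) * \<eta> x = 0" for x using e(3) by simp
  fix x y :: 'a
  have MM: "M * norm (x - y) \<le> M * (1 + L) * norm (x - y)"
    using e(4) L(1) by (intro mult_right_mono) (auto simp: mult_le_cancel_left1)
  consider "R < norm x" | "R < norm y" | "norm x \<le> R" "norm y \<le> R" by linarith
  then show "norm (cis (E x) * \<eta> x - cis (E y) * \<eta> y) \<le> M * (1 + L) * norm (x - y)"
  proof cases
    case 1
    then have "norm (cis (E x) * \<eta> x - cis (E y) * \<eta> y) = norm (\<eta> x - \<eta> y)" using e(3) by (simp add: norm_mult)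
    then show ?thesis using e(2)[of x y] MM by linarith
  next
    case 2
    then have "norm (cis (E x) * \<eta> x - cis (E y) * \<eta> y) = norm (\<eta> x - \<eta> y)" using e(3) by (simp add: norm_mult)
    then show ?thesis using e(2)[of x y] MM by linarith
  next
    case 3
    have "cis (E x) * \<eta> x - cis (E y) * \<eta> y = (cis (E x) - cis (E y)) * \<eta> x + cis (E y) * (\<eta> x - \<eta> y)" by (simp add: algebra_simps)
    then have "norm (cis (E x) * \<eta> x - cis (E y) * \<eta> y) \<le> norm (cis (E x) - cis (E y)) * norm (\<eta> x) + norm (\<eta> x - \<eta> y)"
      using norm_triangle_ineq[of "(cis (E x) - cis (E y)) * \<eta> x" "cis (E y) * (\<eta> x - \<eta> y)"] by (simp add: norm_mult)
    also have "\<dots> \<le> (L * norm (x - y)) * M + M * norm (x - y)"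
      using L(1) by (intro add_mono mult_mono e order_trans[OF norm_cis_diff_le L(2)[OF 3]]) auto
    finally show ?thesis by (simp add: algebra_simps)
  qed
qed

lemma exists_poly_antiderivative:
  fixes q :: "real poly"
  shows "\<exists>p. pderiv p = q \<and> degree p \<le> Suc (degree q)"
proof (intro exI conjI)
  let ?p = "\<Sum>i\<le>degree q. monom (coeff q i / real (Suc i)) (Suc i)"
  have "pderiv ?p = (\<Sum>i\<le>degree q. monom (coeff q i) i)"
    unfolding pderiv_sum by (intro sum.cong refl) (simp add: pderiv_monom)
  then show "pderiv ?p = q" by (simp add: poly_as_sum_of_monoms)
  show "degree ?p \<le> Suc (degree q)"
    by (intro degree_sum_le) (auto intro: order_trans[OF degree_monom_le])
qed

lemma dual_system_independent_sum:
  assumes "finite J" "dual_system u J v" "j \<in> J"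
  shows "(\<Sum>i\<in>J. f i (u i \<bullet> (t *\<^sub>R v j))) = f j t + (\<Sum>i\<in>J - {j}. f i 0)"
proof -
  have "(\<Sum>i\<in>J - {j}. f i (u i \<bullet> (t *\<^sub>R v j))) = (\<Sum>i\<in>J - {j}. f i 0)"
    using assms by (intro sum.cong) (auto simp: dual_system_def)
  then show ?thesis using assms by (simp add: sum.remove[OF assms(1,3)] dual_system_def)
qed

text \<open>Along \<open>v\<close> each summand integrates to an antiderivative divided by
  \<open>u j \<bullet> v\<close>. The difficulty is the degree: the summands of a degenerate
  polynomial may have degree \<open>d\<close>, and integration would give \<open>d + 1\<close>.
  Restricting the derivative to the lines spanned by the dual vectors recovers each summand, up to a
  constant, from a polynomial of degree at most \<open>d - 1\<close>.\<close>

lemma integrate_degenerate_derivative: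
  fixes u :: "nat \<Rightarrow> real ^ 'm::finite"
  assumes d: "d \<ge> 1" and P: "P \<in> polys_le d" and J: "finite J" "n \<in> J" and dual: "dual_system u J vv"
    and c: "\<And>j. j \<in> J \<Longrightarrow> u j \<bullet> v \<noteq> 0" and deg: "ddir v P \<in> degenerate d u J"
  shows "\<exists>p. (\<forall>j\<in>J. degree (p j) \<le> d) \<and>
    (\<forall>x t. P (x + t *\<^sub>R v) - (\<Sum>j\<in>J. poly (p j) (u j \<bullet> (x + t *\<^sub>R v))) = P x - (\<Sum>j\<in>J. poly (p j) (u j \<bullet> x)))"
proof -
  define Q where "Q = ddir v P"
  obtain a g where Qg: "Q = (\<lambda>x. a + (\<Sum>j\<in>J. poly (g j) (u j \<bullet> x)))"
    using deg unfolding degenerate_def Q_def by blast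
  have "\<forall>j. \<exists>q. degree q \<le> d - 1 \<and> (\<forall>t. Q (0 + t *\<^sub>R vv j) = poly q t)"
    using polys_le_on_line[OF ddir_polys_le[OF P]] unfolding Q_def by blast
  from choice[OF this] obtain q where q: "\<And>j. degree (q j) \<le> d - 1" "\<And>j t. Q (t *\<^sub>R vv j) = poly (q j) t" by auto
  \<comment> \<open>Every restriction is normalised to vanish at 0, and the remaining constant
    \<open>Q 0\<close> is assigned to the index \<open>n\<close>.\<close>
  define q' where "q' = (\<lambda>j. q j - [:Q 0:] + (if j = n then [:Q 0:] else 0))"
  have q': "degree (q' j) \<le> d - 1" for j
    unfolding q'_def using q(1)[of j] by (auto intro!: degree_add_le degree_diff_le)
  have gj: "poly (g j) t = poly (g j) 0 + poly (q j - [:Q 0:]) t" if j: "j \<in> J" for j t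
  proof -
    have "Q (t *\<^sub>R vv j) - Q (0 *\<^sub>R vv j) = poly (g j) t - poly (g j) 0"
      unfolding Qg using dual_system_independent_sum[OF J(1) dual j, of "\<lambda>i. poly (g i)" t]
        dual_system_independent_sum[OF J(1) dual j, of "\<lambda>i. poly (g i)" 0] by simp
    then show ?thesis by (simp add: q(2)[symmetric])
  qed
  have Qsum: "Q x = (\<Sum>j\<in>J. poly (q' j) (u j \<bullet> x))" for x
  proof -
    have "(\<Sum>j\<in>J. poly (q' j) (u j \<bullet> x)) = (\<Sum>j\<in>J. poly (q j - [:Q 0:]) (u j \<bullet> x) + (if j = n then Q 0 else 0))"
      unfolding q'_def by (intro sum.cong) auto
    also have "\<dots> = (\<Sum>j\<in>J. poly (q j - [:Q 0:]) (u j \<bullet> x)) + Q 0"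
      using J by (simp add: sum.distrib)
    also have "(\<Sum>j\<in>J. poly (q j - [:Q 0:]) (u j \<bullet> x)) = (\<Sum>j\<in>J. poly (g j) (u j \<bullet> x) - poly (g j) 0)"
      by (intro sum.cong refl) (use gj in \<open>simp add: algebra_simps\<close>)
    also have "\<dots> + Q 0 = Q x" unfolding Qg by (simp add: sum_subtractf)
    finally show ?thesis by simp
  qed
  have "\<forall>j. \<exists>p. pderiv p = q' j \<and> degree p \<le> Suc (degree (q' j))" using exists_poly_antiderivative by blast
  from choice[OF this] obtain r where r: "\<And>j. pderiv (r j) = q' j" "\<And>j. degree (r j) \<le> Suc (degree (q' j))" by blast
  define p where "p = (\<lambda>j. smult (1 / (u j \<bullet> v)) (r j))"
  have dp: "degree (p j) \<le> d" for j
    using r(2)[of j] q'[of j] d order_trans[OF degree_smult_le[of "1 / (u j \<bullet> v)" "r j"], of d] unfolding p_def by simp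
  have "P (x + t *\<^sub>R v) - (\<Sum>j\<in>J. poly (p j) (u j \<bullet> (x + t *\<^sub>R v))) = P x - (\<Sum>j\<in>J. poly (p j) (u j \<bullet> x))" for x t
  proof -
    have D: "((\<lambda>t. P (x + t *\<^sub>R v) - (\<Sum>j\<in>J. poly (p j) (u j \<bullet> (x + t *\<^sub>R v)))) has_real_derivative 0) (at s)" for s
    proof -
      have A: "((\<lambda>t. poly (p j) (u j \<bullet> x + t * (u j \<bullet> v))) has_real_derivative poly (pderiv (p j)) (u j \<bullet> x + s * (u j \<bullet> v)) * (u j \<bullet> v)) (at s)" for j
        by (rule DERIV_chain2[OF poly_DERIV]) (auto intro!: derivative_eq_intros)
      have B: "poly (pderiv (p j)) (u j \<bullet> x + s * (u j \<bullet> v)) * (u j \<bullet> v) = poly (q' j) (u j \<bullet> (x + s *\<^sub>R v))" if "j \<in> J" for j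
        using c[OF that] by (simp add: p_def pderiv_smult r(1) inner_add_right)
      have "((\<lambda>t. poly (p j) (u j \<bullet> (x + t *\<^sub>R v))) has_real_derivative poly (q' j) (u j \<bullet> (x + s *\<^sub>R v))) (at s)" if "j \<in> J" for j
      proof -
        have "(\<lambda>t. poly (p j) (u j \<bullet> (x + t *\<^sub>R v))) = (\<lambda>t. poly (p j) (u j \<bullet> x + t * (u j \<bullet> v)))"
          by (simp add: inner_add_right)
        then show ?thesis using A[of j] B[OF that] by (simp only:)
      qed
      then have "((\<lambda>t. \<Sum>j\<in>J. poly (p j) (u j \<bullet> (x + t *\<^sub>R v))) has_real_derivative (\<Sum>j\<in>J. poly (q' j) (u j \<bullet> (x + s *\<^sub>R v)))) (at s)"
        by (rule DERIV_sum)
      from DERIV_diff[OF ddir_has_derivative[OF P, of x v s] this]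
      show ?thesis unfolding Qsum[symmetric] Q_def by simp
    qed
    from DERIV_isconst_all[of "\<lambda>t. P (x + t *\<^sub>R v) - (\<Sum>j\<in>J. poly (p j) (u j \<bullet> (x + t *\<^sub>R v)))" t 0] D show ?thesis by simp
  qed
  with dp show ?thesis by blast
qed

text \<open>\<open>\<delta>\<close> is the distance to the interval, and \<open>\<tau>\<close> falls
  linearly from 1 to 0 over the width \<open>\<theta>\<close>. Unlike the indicator, the cutoff can
  be made part of a Lipschitz amplitude.\<close>

lemma trapezoid_exists:
  fixes a b \<theta> :: real
  assumes "a \<le> b" "\<theta> > 0"
  shows "\<exists>\<tau>. (\<forall>s. 0 \<le> \<tau> s \<and> \<tau> s \<le> 1) \<and> (\<forall>s s'. \<bar>\<tau> s - \<tau> s'\<bar> \<le> \<bar>s - s'\<bar> / \<theta>) \<and>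
    (\<forall>s. \<bar>indicator {a..b} s - \<tau> s\<bar> \<le> indicator {a - \<theta>..a} s + indicator {b..b + \<theta>} s)"
proof -
  define \<delta> where "\<delta> = (\<lambda>s. max 0 (max (a - s) (s - b)))"
  define \<tau> where "\<tau> = (\<lambda>s. max 0 (1 - \<delta> s / \<theta>))"
  have \<delta>l: "\<bar>\<delta> s - \<delta> s'\<bar> \<le> \<bar>s - s'\<bar>" for s s' by (auto simp: \<delta>_def max_def abs_if)
  have "\<bar>\<tau> s - \<tau> s'\<bar> \<le> \<bar>s - s'\<bar> / \<theta>" for s s'
  proof -
    have "\<bar>\<tau> s - \<tau> s'\<bar> \<le> \<bar>\<delta> s / \<theta> - \<delta> s' / \<theta>\<bar>" by (auto simp: \<tau>_def max_def abs_if)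
    also have "\<dots> = \<bar>\<delta> s - \<delta> s'\<bar> / \<theta>" using assms by (simp add: diff_divide_distrib[symmetric])
    also have "\<dots> \<le> \<bar>s - s'\<bar> / \<theta>" using \<delta>l assms by (intro divide_right_mono) auto
    finally show ?thesis .
  qed
  moreover have \<tau>1: "0 \<le> \<tau> s \<and> \<tau> s \<le> 1" for s using assms by (auto simp: \<tau>_def \<delta>_def)
  moreover have "\<bar>indicator {a..b} s - \<tau> s\<bar> \<le> indicator {a - \<theta>..a} s + indicator {b..b + \<theta>} s" for s
  proof -
    consider "s \<in> {a..b}" | "s \<notin> {a..b}" "s \<in> {a - \<theta>..a} \<union> {b..b + \<theta>}" | "s < a - \<theta> \<or> s > b + \<theta>" by force
    then show ?thesis
    proof cases
      case 1
      then have "\<tau> s = 1" by (simp add: \<tau>_def \<delta>_def)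
      then show ?thesis using 1 by simp
    next
      case 2
      then have "1 \<le> indicator {a - \<theta>..a} s + (indicator {b..b + \<theta>} s :: real)" by (auto split: split_indicator)
      moreover have "\<bar>indicator {a..b} s - \<tau> s\<bar> \<le> 1" using \<tau>1[of s] 2(1) by simp
      ultimately show ?thesis by linarith
    next
      case 3
      then have "\<delta> s \<ge> \<theta>" using assms by (auto simp: \<delta>_def)
      then have "\<tau> s = 0" using assms by (simp add: \<tau>_def)
      moreover have "s \<notin> {a..b}" using 3 assms by auto
      ultimately show ?thesis by simp
    qed
  qed
  ultimately show ?thesis by (intro exI[of _ \<tau>]) blast
qed

section \<open>Structured functions, extremal functions and the induction step\<close>

lemma osc_fun_upd:
  fixes u :: "nat \<Rightarrow> real ^ 'm::finite"
  assumes "finite J" "n \<notin> J"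
  shows "osc u (insert n J) (F(n := f)) P \<eta> =
    (LBINT x. f (u n \<bullet> x) * (cis (P x) * ((\<Prod>j\<in>J. F j (u j \<bullet> x)) * \<eta> x)))"
proof -
  have "(\<Prod>j\<in>J. (F(n := f)) j (u j \<bullet> x)) = (\<Prod>j\<in>J. F j (u j \<bullet> x))" for x
    using assms by (intro prod.cong) auto
  then show ?thesis using assms by (simp add: osc_def mult_ac)
qed

lemma degenerate_insert:
  fixes u :: "nat \<Rightarrow> real ^ 'm::finite"
  assumes "finite J" "n \<notin> J" "w \<in> degenerate d u J" "degree q \<le> d"
  shows "(\<lambda>x. poly q (u n \<bullet> x) + w x) \<in> degenerate d u (insert n J)"
proof -
  obtain a g where g: "\<forall>j\<in>J. degree (g j) \<le> d" "w = (\<lambda>x. a + (\<Sum>j\<in>J. poly (g j) (u j \<bullet> x)))"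
    using assms(3) unfolding degenerate_def by blast
  have "(\<Sum>j\<in>J. poly ((g(n := q)) j) (u j \<bullet> x)) = (\<Sum>j\<in>J. poly (g j) (u j \<bullet> x))" for x
    using assms(2) by (intro sum.cong) auto
  then show ?thesis unfolding degenerate_def using assms g
    by (intro CollectI exI[of _ a] exI[of _ "g(n := q)"]) auto
qed

text \<open>When the n-th function is a polynomial phase on an interval, the phase is moved into
  \<open>P\<close>, which stays at distance \<open>N\<close> from the degenerate polynomials for the
  smaller set \<open>J\<close>, and the interval is moved into the amplitude after smoothing. The
  form then has one direction fewer, so the hypothesis for \<open>J\<close> applies.\<close>

lemma structured_function_decay:
  fixes u :: "nat \<Rightarrow> real ^ 'm::finite"
  assumes J: "finite J" "n \<notin> J" and un: "u n \<bullet> w = 1" and claim: "osc_claim nrm d R u J"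
  shows "\<exists>K>0. \<exists>\<epsilon>>0. \<forall>M F \<eta> N q a r. \<forall>P\<in>polys_le d. unit_bdd F J \<longrightarrow> amp R M M \<eta> \<longrightarrow> 0 \<le> N \<longrightarrow>
    nondegenerate nrm d u (insert n J) N P \<longrightarrow> degree q \<le> d \<longrightarrow> 0 \<le> r \<longrightarrow>
    norm (osc u (insert n J) (F(n := \<lambda>s. indicator {a..a+r} s *\<^sub>R cis (- poly q s))) P \<eta>) \<le> K * M * (1 + N) powr - \<epsilon>"
proof -
  obtain C \<epsilon> where C: "C > 0" "\<epsilon> > 0" "osc_claim_with nrm d R u J C \<epsilon>"
    using claim unfolding osc_claim_def by (elim exE conjE) (rule that)
  define V where "V = measure lborel (cball (0 :: real ^ 'm) (R + norm w))"
  define K where "K = C * (1 + norm (u n)) + 2 * V"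
  have V: "V \<ge> 0" by (simp add: V_def)
  have K: "K > 0" using C V by (auto simp: K_def intro!: add_pos_nonneg mult_pos_pos)
  have \<epsilon>2: "\<epsilon> / 2 > 0" using C by simp
  show ?thesis
  proof (rule exI[of _ K], rule conjI[OF K], rule exI[of _ "\<epsilon> / 2"], rule conjI[OF \<epsilon>2], intro allI ballI impI)
    fix M N a r :: real and F and \<eta> :: "real ^ 'm \<Rightarrow> complex" and q :: "real poly" and P :: "real ^ 'm \<Rightarrow> real"
    assume P: "P \<in> polys_le d" and F: "unit_bdd F J" and \<eta>: "amp R M M \<eta>" and N0: "0 \<le> N"
      and N: "nondegenerate nrm d u (insert n J) N P" and q: "degree q \<le> d" and r: "0 \<le> r"
    have M: "M \<ge> 0" by (rule ampD(4)[OF \<eta>])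
    \<comment> \<open>Smoothing at width \<open>\<theta>\<close> multiplies the Lipschitz constant
      by a factor of order \<open>1 / \<theta>\<close> and costs an error of order
      \<open>\<theta>\<close>; half of the available exponent balances the two.\<close>
    define \<theta> where "\<theta> = (1 + N) powr - (\<epsilon> / 2)"
    have \<theta>: "\<theta> > 0" "\<theta> \<le> 1" using N0 C powr_mono2'[of "- (\<epsilon> / 2)" 1 "1 + N"] by (auto simp: \<theta>_def)
    have ar: "a \<le> a + r" using r by simp
    obtain \<tau> where \<tau>: "\<forall>s. 0 \<le> \<tau> s \<and> \<tau> s \<le> 1" "\<forall>s s'. \<bar>\<tau> s - \<tau> s'\<bar> \<le> \<bar>s - s'\<bar> / \<theta>"
      "\<forall>s. \<bar>indicator {a..a+r} s - \<tau> s\<bar> \<le> indicator {a - \<theta>..a} s + indicator {a+r..a+r + \<theta>} s"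
      using trapezoid_exists[OF ar \<theta>(1)] by (elim exE conjE) (rule that)
    have "(1 / \<theta>)-lipschitz_on UNIV \<tau>"
      using \<tau>(2) \<theta> by (intro lipschitz_onI) (auto simp: dist_real_def)
    then have "continuous_on UNIV \<tau>" by (rule lipschitz_on_continuous_on)
    then have [measurable]: "borel_fun \<tau>" by (rule borel_measurable_continuous_onI)
    have [measurable]: "borel_fun (\<lambda>s. poly q s)"
      by (intro borel_measurable_continuous_onI continuous_intros)
    define \<Phi> where "\<Phi> = (\<lambda>x. cis (P x) * ((\<Prod>j\<in>J. F j (u j \<bullet> x)) * \<eta> x))"
    have \<Phi>: "bdd_supp M R \<Phi>" unfolding \<Phi>_def by (rule osc_integrand_bdd_supp[OF P F \<eta>])
    obtain D where D: "bdd_supp (M * V) (norm (u n) * R) D"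
      "dual_function (u n) \<Phi> D"
      using exists_dual_function[OF un \<Phi>] unfolding V_def[symmetric] by (elim exE conjE) (rule that)
    note [measurable] = bdd_suppD(1)[OF D(1)]
    define f1 where "f1 = (\<lambda>s. indicator {a..a+r} s *\<^sub>R cis (- poly q s))"
    define f2 where "f2 = (\<lambda>s. \<tau> s *\<^sub>R cis (- poly q s))"
    have f1: "borel_fun f1" "\<forall>t. norm (f1 t) \<le> 1"
    proof -
      have "borel_fun (\<lambda>s. cis (- poly q s))" by measurable
      then show "borel_fun f1" unfolding f1_def
        by (rule borel_measurable_scaleR[OF borel_measurable_indicator[OF atLeastAtMost_borel]])
    qed (auto simp: f1_def split: split_indicator)
    have f2: "borel_fun f2" "\<forall>t. norm (f2 t) \<le> 1" unfolding f2_def using \<tau>(1) by (measurable, auto)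
    have e1: "osc u (insert n J) (F(n := f1)) P \<eta> = (LBINT t. f1 t * D t)"
      unfolding osc_fun_upd[OF J] using D(2)[rule_format, OF f1(1) f1(2)[rule_format]] by (simp add: \<Phi>_def)
    have "osc u J F (\<lambda>x. P x - poly q (u n \<bullet> x)) (\<lambda>x. complex_of_real (\<tau> (u n \<bullet> x)) * \<eta> x) = (LBINT x. f2 (u n \<bullet> x) * \<Phi> x)"
      unfolding osc_def
    proof (rule Bochner_Integration.integral_cong[OF refl])
      fix x
      have "cis (P x - poly q (u n \<bullet> x)) = cis (P x) * cis (- poly q (u n \<bullet> x))" by (simp add: cis_mult)
      then show "cis (P x - poly q (u n \<bullet> x)) * ((\<Prod>j\<in>J. F j (u j \<bullet> x)) * (complex_of_real (\<tau> (u n \<bullet> x)) * \<eta> x)) = f2 (u n \<bullet> x) * \<Phi> x"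
        by (simp add: f2_def \<Phi>_def scaleR_conv_of_real mult_ac)
    qed
    also have "\<dots> = (LBINT t. f2 t * D t)" using D(2)[rule_format, OF f2(1) f2(2)[rule_format]] .
    finally have e2: "osc u J F (\<lambda>x. P x - poly q (u n \<bullet> x)) (\<lambda>x. complex_of_real (\<tau> (u n \<bullet> x)) * \<eta> x) = (LBINT t. f2 t * D t)" .
    define M' where "M' = M * ((1 + norm (u n)) / \<theta>)"
    have "amp R M' M' (\<lambda>x. complex_of_real (\<tau> (u n \<bullet> x)) * \<eta> x)" unfolding amp_def
    proof (intro conjI allI impI)
      note e = ampD[OF \<eta>]
      have \<theta>1: "1 \<le> 1 / \<theta>" using \<theta> by simp
      have MM: "M \<le> M'"
      proof -
        have "1 * 1 \<le> (1 + norm (u n)) * (1 / \<theta>)" using \<theta>1 by (intro mult_mono) auto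
        from mult_left_mono[OF this M] show ?thesis by (simp add: M'_def)
      qed
      have "norm (complex_of_real (\<tau> (u n \<bullet> x)) * \<eta> x) \<le> 1 * M" for x
        unfolding norm_mult using \<tau>(1) e by (intro mult_mono) auto
      then show "norm (complex_of_real (\<tau> (u n \<bullet> x)) * \<eta> x) \<le> M'" for x using MM by (auto intro: order_trans)
      show "R < norm x \<Longrightarrow> complex_of_real (\<tau> (u n \<bullet> x)) * \<eta> x = 0" for x using e(3) by simp
      fix x y
      have "complex_of_real (\<tau> (u n \<bullet> x)) * \<eta> x - complex_of_real (\<tau> (u n \<bullet> y)) * \<eta> y =
        complex_of_real (\<tau> (u n \<bullet> x) - \<tau> (u n \<bullet> y)) * \<eta> x + complex_of_real (\<tau> (u n \<bullet> y)) * (\<eta> x - \<eta> y)"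
        by (simp add: algebra_simps)
      also have "norm \<dots> \<le> norm (complex_of_real (\<tau> (u n \<bullet> x) - \<tau> (u n \<bullet> y)) * \<eta> x) + norm (complex_of_real (\<tau> (u n \<bullet> y)) * (\<eta> x - \<eta> y))"
        by (rule norm_triangle_ineq)
      also have "\<dots> \<le> (norm (u n) * norm (x - y) / \<theta>) * M + 1 * (M * norm (x - y))"
        unfolding norm_mult norm_of_real
      proof (intro add_mono mult_mono e)
        have "\<bar>\<tau> (u n \<bullet> x) - \<tau> (u n \<bullet> y)\<bar> \<le> \<bar>u n \<bullet> x - u n \<bullet> y\<bar> / \<theta>" using \<tau>(2) by blast
        also have "u n \<bullet> x - u n \<bullet> y = u n \<bullet> (x - y)" by (simp add: inner_diff_right)
        also have "\<bar>u n \<bullet> (x - y)\<bar> / \<theta> \<le> norm (u n) * norm (x - y) / \<theta>"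
          using Cauchy_Schwarz_ineq2 \<theta> by (intro divide_right_mono) auto
        finally show "\<bar>\<tau> (u n \<bullet> x) - \<tau> (u n \<bullet> y)\<bar> \<le> norm (u n) * norm (x - y) / \<theta>" .
      qed (use \<tau>(1) \<theta> in auto)
      also have "\<dots> \<le> (norm (u n) * norm (x - y) / \<theta>) * M + (1 / \<theta>) * (M * norm (x - y))"
        using \<theta>1 M by (intro add_left_mono mult_right_mono) auto
      also have "\<dots> = M' * norm (x - y)" by (simp add: M'_def ring_distribs add_divide_distrib mult_ac)
      finally show "norm (complex_of_real (\<tau> (u n \<bullet> x)) * \<eta> x - complex_of_real (\<tau> (u n \<bullet> y)) * \<eta> y) \<le> M' * norm (x - y)" .
    qed
    moreover have "(\<lambda>x. P x - poly q (u n \<bullet> x)) \<in> polys_le d" by (intro polys_le_diff P polys_le_poly_inner q)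
    moreover have "N \<le> nrm (\<lambda>x. (P x - poly q (u n \<bullet> x)) - w x)" if "w \<in> degenerate d u J" for w
      using bspec[OF N degenerate_insert[OF J that q]] by (simp add: diff_diff_eq)
    ultimately have "norm (osc u J F (\<lambda>x. P x - poly q (u n \<bullet> x)) (\<lambda>x. complex_of_real (\<tau> (u n \<bullet> x)) * \<eta> x)) \<le> C * M' * (1 + N) powr - \<epsilon>"
      using F N0 by (intro C(3)[rule_format]) auto
    also have "\<dots> = C * (1 + norm (u n)) * M * (1 + N) powr - (\<epsilon> / 2)"
    proof -
      have "(1 + N) powr - \<epsilon> = (1 + N) powr (- (\<epsilon> / 2) + - (\<epsilon> / 2))" by simp
      also have "\<dots> = \<theta> * \<theta>" unfolding \<theta>_def by (rule powr_add)
      finally have "(1 + N) powr - \<epsilon> = \<theta> * \<theta>" .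
      then show ?thesis using \<theta>(1) by (simp add: M'_def \<theta>_def[symmetric])
    qed
    finally have b2: "norm (LBINT t. f2 t * D t) \<le> C * (1 + norm (u n)) * M * (1 + N) powr - (\<epsilon> / 2)" unfolding e2 .
    have s: "bdd_supp (M * V) (norm (u n) * R) (\<lambda>t. f t * D t)" if "borel_fun f" "\<forall>t. norm (f t) \<le> 1" for f
      by (rule bdd_supp_mult_left[OF that(1) _ D(1)]) (use that in auto)
    have i: "integrable lborel (\<lambda>s. (M * V) * (indicator {a - \<theta>..a} s + indicator {a+r..a+r + \<theta>} s))"
      by (intro integrable_mult_right Bochner_Integration.integrable_add bdd_supp_integrable[OF bdd_supp_indicator])
    have "(LBINT t. f1 t * D t) - (LBINT t. f2 t * D t) = (LBINT t. f1 t * D t - f2 t * D t)"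
      by (rule Bochner_Integration.integral_diff[symmetric]) (rule bdd_supp_integrable[OF s[OF f1]], rule bdd_supp_integrable[OF s[OF f2]])
    then have "norm ((LBINT t. f1 t * D t) - (LBINT t. f2 t * D t)) \<le> (LBINT t. norm (f1 t * D t - f2 t * D t))"
      by (simp only: integral_norm_bound)
    also have "\<dots> \<le> (LBINT s. (M * V) * (indicator {a - \<theta>..a} s + indicator {a+r..a+r + \<theta>} s))"
    proof (rule integral_mono'[OF i])
      fix t
      have "f1 t * D t - f2 t * D t = ((indicator {a..a+r} t - \<tau> t) *\<^sub>R cis (- poly q t)) * D t"
        by (simp add: f1_def f2_def scaleR_diff_left left_diff_distrib)
      then have "norm (f1 t * D t - f2 t * D t) = \<bar>indicator {a..a+r} t - \<tau> t\<bar> * norm (D t)" by (simp add: norm_mult)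
      also have "\<dots> \<le> (indicator {a - \<theta>..a} t + indicator {a+r..a+r + \<theta>} t) * (M * V)"
        using \<tau>(3) by (intro mult_mono bdd_suppD(2)[OF D(1)]) auto
      finally show "norm (f1 t * D t - f2 t * D t) \<le> (M * V) * (indicator {a - \<theta>..a} t + indicator {a+r..a+r + \<theta>} t)"
        by (simp add: mult.commute)
      show "0 \<le> (M * V) * (indicator {a - \<theta>..a} t + indicator {a+r..a+r + \<theta>} t)" using M V by simp
    qed
    also have "\<dots> = (M * V) * (2 * \<theta>)"
    proof -
      have "(LBINT s. (indicator {a - \<theta>..a} s + indicator {a+r..a+r + \<theta>} s :: real)) = \<theta> + \<theta>"
        using \<theta> by (subst Bochner_Integration.integral_add) (auto intro: bdd_supp_integrable[OF bdd_supp_indicator])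
      then show ?thesis by (subst integral_mult_right_zero) simp
    qed
    finally have b3: "norm ((LBINT t. f1 t * D t) - (LBINT t. f2 t * D t)) \<le> 2 * V * M * (1 + N) powr - (\<epsilon> / 2)"
      by (simp add: \<theta>_def mult_ac)
    have "norm (LBINT t. f1 t * D t) \<le> norm (LBINT t. f2 t * D t) + norm ((LBINT t. f1 t * D t) - (LBINT t. f2 t * D t))"
      by (rule norm_triangle_sub)
    also have "\<dots> \<le> C * (1 + norm (u n)) * M * (1 + N) powr - (\<epsilon> / 2) + 2 * V * M * (1 + N) powr - (\<epsilon> / 2)"
      by (intro add_mono b2 b3)
    also have "\<dots> = K * M * (1 + N) powr - (\<epsilon> / 2)" by (simp add: K_def algebra_simps)
    finally show "norm (osc u (insert n J) (F(n := \<lambda>s. indicator {a..a+r} s *\<^sub>R cis (- poly q s))) P \<eta>) \<le> K * M * (1 + N) powr - (\<epsilon> / 2)"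
      using e1 by (simp add: f1_def)
  qed
qed

text \<open>If \<open>1 + X\<close> is at least \<open>(1 + N) powr (\<delta> / 2)\<close>, the
  first bound already decays in \<open>N\<close>. Otherwise the loss \<open>1 + X\<close> in the
  second bound uses up half of its gain, and the fourth root of what remains has exponent
  \<open>\<delta> / 8\<close>.\<close>

lemma min_decay_combination:
  fixes b X N :: real
  assumes b: "0 \<le> b" and X: "0 \<le> X" and N: "0 \<le> N" and C: "0 < C" "0 < K" and \<epsilon>: "0 < \<epsilon>" "\<epsilon> \<le> 1" "0 < \<delta>"
    and b1: "b \<le> C * (1 + X) powr - \<epsilon>" and b4: "b ^ 4 \<le> K * (1 + X) * (1 + N) powr - \<delta>"
  shows "b \<le> (C + K + 1) * (1 + N) powr - (\<epsilon> * \<delta> / 8)"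
proof (cases "(1 + N) powr (\<delta> / 2) \<le> 1 + X")
  case True
  have "b \<le> C * ((1 + N) powr (\<delta> / 2)) powr - \<epsilon>"
    using True N \<epsilon> C by (intro order_trans[OF b1] mult_left_mono powr_mono2') auto
  also have "\<dots> = C * (1 + N) powr - (\<epsilon> * \<delta> / 2)" by (simp add: powr_powr mult.commute)
  also have "\<dots> \<le> (C + K + 1) * (1 + N) powr - (\<epsilon> * \<delta> / 8)"
    using C N \<epsilon> by (intro mult_mono powr_mono) auto
  finally show ?thesis .
next
  case False
  have "b ^ 4 \<le> K * (1 + N) powr (\<delta> / 2) * (1 + N) powr - \<delta>"
    using False C by (intro order_trans[OF b4] mult_right_mono mult_left_mono) auto
  also have "\<dots> = K * ((1 + N) powr (\<delta> / 2 + - \<delta>))" by (simp only: powr_add mult.assoc)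
  also have "\<dots> = K * ((1 + N) powr - (\<delta> / 8)) ^ 4"
    using N by (simp add: powr_realpow[symmetric] powr_powr)
  also have "\<dots> \<le> (C + K + 1) ^ 4 * ((1 + N) powr - (\<delta> / 8)) ^ 4"
  proof (rule mult_right_mono)
    have "K \<le> (C + K + 1) ^ 1" using C by simp
    also have "\<dots> \<le> (C + K + 1) ^ 4" using C by (intro power_increasing) auto
    finally show "K \<le> (C + K + 1) ^ 4" .
  qed simp
  also have "\<dots> = ((C + K + 1) * (1 + N) powr - (\<delta> / 8)) ^ 4" by (simp add: power_mult_distrib)
  finally have "b \<le> (C + K + 1) * (1 + N) powr - (\<delta> / 8)"
    using power_mono_iff[of b "(C + K + 1) * (1 + N) powr - (\<delta> / 8)" 4] b C by simp
  also have "\<dots> \<le> (C + K + 1) * (1 + N) powr - (\<epsilon> * \<delta> / 8)"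
    using C N \<epsilon> mult_right_mono[of \<epsilon> 1 \<delta>] by (intro mult_left_mono powr_mono) auto
  finally show ?thesis .
qed

lemma cis_sum: "finite B \<Longrightarrow> cis (\<Sum>j\<in>B. f j) = (\<Prod>j\<in>B. cis (f j))"
  by (induction B rule: finite_induct) (auto simp: cis_mult[symmetric])

text \<open>Here \<open>B\<close> includes the distinguished index \<open>n\<close>. The functionals
  belonging to \<open>B\<close> are applied to the derivative of \<open>P\<close> along
  \<open>v\<close>; since this derivative is a combination of differences along \<open>v\<close>,
  the full form decays in them. If they all vanish, the derivative is degenerate and integrates to a
  sum of one-variable polynomials up to a term constant along \<open>v\<close>.
  \<open>functional_splitting\<close> turns this into a decomposition with remainder
  \<open>E\<close>.\<close>

lemma phase_decomposition:
  fixes u :: "nat \<Rightarrow> real ^ 'm::finite"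
  assumes d: "d \<ge> 1" and fin: "finite A" "finite B" "A \<inter> B = {}" and n: "n \<in> B"
    and inv_all: "\<forall>j\<in>A. u j \<bullet> v = 0" and c_all: "\<forall>j\<in>B. u j \<bullet> v \<noteq> 0" and dual: "dual_system u B vv"
  shows "\<exists>C>0. \<exists>\<epsilon>>0. \<exists>L\<ge>0. \<forall>P\<in>polys_le d. \<exists>X\<ge>0.
    osc_bound_at R u (A \<union> B) P C \<epsilon> X \<and>
    (\<exists>E p. E \<in> polys_le d \<and> (\<forall>j\<in>B. degree (p j) \<le> d) \<and>
      lipschitz_on_ball R (L * X) E \<and>
      (line_invariant v (\<lambda>x. P x - E x - (\<Sum>j\<in>B. poly (p j) (u j \<bullet> x)))))"
proof -
  have inv: "\<And>j. j \<in> A \<Longrightarrow> u j \<bullet> v = 0" using inv_all by blast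
  have c: "\<And>j. j \<in> B \<Longrightarrow> u j \<bullet> v \<noteq> 0" using c_all by blast
  obtain \<Phi> where \<Phi>: "finite \<Phi>" "\<forall>\<phi>\<in>\<Phi>. poly_functional d \<phi>" "\<forall>R. \<forall>\<phi>\<in>\<Phi>. decays d R u B \<phi>"
    "\<forall>P\<in>polys_le d. (\<forall>\<phi>\<in>\<Phi>. \<phi> P = 0) \<longrightarrow> P \<in> degenerate d u B"
    using independent_functionals[OF fin(2) dual, of d] by (elim exE conjE) (rule that)
  define \<psi> where "\<psi> = (\<lambda>\<phi> P. \<phi> (ddir v P) :: real)"
  have lin: "flin (polys_le d) \<phi>" if "\<phi> \<in> \<Phi>" for \<phi> using \<Phi>(2) that by (simp add: poly_functional_def)
  have dec: "decays d R u (A \<union> B) (\<psi> \<phi>)" if \<phi>: "\<phi> \<in> \<Phi>" for \<phi>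
  proof -
    obtain K where K: "K \<ge> 0" "\<forall>P\<in>polys_le d. \<bar>\<phi> (ddir v P)\<bar> \<le>
      K * (\<Sum>k\<le>d. \<bar>\<phi> (\<lambda>x. P x - P (x + (real k / real (Suc d)) *\<^sub>R v))\<bar>)"
      using ddir_functional_bound[OF lin[OF \<phi>], of v] by (elim exE conjE) (rule that)
    show ?thesis
    proof (rule decays_dominated[of "{..d}" d R u "A \<union> B" "\<lambda>k P. \<phi> (\<lambda>x. P x - P (x + (real k / real (Suc d)) *\<^sub>R v))" K])
      fix k assume k: "k \<in> {..d}"
      have t: "real k / real (Suc d) \<in> {-1..1}"
      proof -
        have "real k / real (Suc d) \<ge> 0" by simp
        moreover have "real k / real (Suc d) \<le> 1" using k by (simp add: divide_le_eq)
        ultimately show ?thesis unfolding atLeastAtMost_iff by linarith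
      qed
      have p\<phi>: "poly_functional d \<phi>" and d\<phi>: "decays d R u B \<phi>" using \<Phi>(2,3) \<phi> by auto
      show "decays d R u (A \<union> B) (\<lambda>P. \<phi> (\<lambda>x. P x - P (x + (real k / real (Suc d)) *\<^sub>R v)))"
        by (rule van_der_Corput_decay[OF fin inv p\<phi> d\<phi> t])
    qed (use K in \<open>auto simp: \<psi>_def\<close>)
  qed
  have "\<exists>C>0. \<exists>\<epsilon>>0. osc_bound d R u (A \<union> B) C \<epsilon> (\<lambda>P. \<Sum>\<phi>\<in>\<Phi>. \<bar>\<psi> \<phi> P\<bar>)"
    by (rule decays_sum[OF \<Phi>(1)]) (rule dec)
  then obtain C \<epsilon> where C: "C > 0" "\<epsilon> > 0" "osc_bound d R u (A \<union> B) C \<epsilon> (\<lambda>P. \<Sum>\<phi>\<in>\<Phi>. \<bar>\<psi> \<phi> P\<bar>)"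
    by (elim exE conjE) (rule that)
  define W where "W = {h. \<exists>p. (\<forall>j\<in>B. degree (p j) \<le> d) \<and>
    (\<forall>x t. h (x + t *\<^sub>R v) - (\<Sum>j\<in>B. poly (p j) (u j \<bullet> (x + t *\<^sub>R v))) = h x - (\<Sum>j\<in>B. poly (p j) (u j \<bullet> x)))}"
  have "\<exists>e. (\<forall>\<phi>\<in>\<Phi>. e \<phi> \<in> polys_le d) \<and> (\<forall>P\<in>polys_le d. (\<lambda>x. P x - (\<Sum>\<phi>\<in>\<Phi>. \<psi> \<phi> P * e \<phi> x)) \<in> W)"
  proof (rule functional_splitting[OF \<Phi>(1) fsub_polys_le])
    fix \<phi> assume \<phi>: "\<phi> \<in> \<Phi>"
    show "flin (polys_le d) (\<psi> \<phi>)"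
      unfolding flin_def \<psi>_def
    proof (intro conjI ballI allI)
      fix P Q :: "real ^ 'm \<Rightarrow> real" and a assume P: "P \<in> polys_le d" and Q: "Q \<in> polys_le d"
      have "ddir v (\<lambda>x. P x + Q x) = (\<lambda>x. ddir v P x + ddir v Q x)" using ddir_add[OF P Q] by (intro ext)
      then show "\<phi> (ddir v (\<lambda>x. P x + Q x)) = \<phi> (ddir v P) + \<phi> (ddir v Q)"
        using flin_add[OF lin[OF \<phi>] ddir_polys_le'[OF P] ddir_polys_le'[OF Q]] by simp
    next
      fix P :: "real ^ 'm \<Rightarrow> real" and a assume P: "P \<in> polys_le d"
      have "ddir v (\<lambda>x. a * P x) = (\<lambda>x. a * ddir v P x)" using ddir_scale[OF P] by (intro ext)
      then show "\<phi> (ddir v (\<lambda>x. a * P x)) = a * \<phi> (ddir v P)"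
        using flin_scale[OF lin[OF \<phi>] ddir_polys_le'[OF P]] by simp
    qed
  next
    fix P assume P: "P \<in> polys_le d" and z: "\<And>\<phi>. \<phi> \<in> \<Phi> \<Longrightarrow> \<psi> \<phi> P = 0"
    have "ddir v P \<in> degenerate d u B" using \<Phi>(4) ddir_polys_le'[OF P] z by (simp add: \<psi>_def)
    from integrate_degenerate_derivative[OF d P fin(2) n dual c this]
    show "P \<in> W" unfolding W_def by simp
  qed
  then obtain e where e: "\<forall>\<phi>\<in>\<Phi>. e \<phi> \<in> polys_le d" "\<forall>P\<in>polys_le d. (\<lambda>x. P x - (\<Sum>\<phi>\<in>\<Phi>. \<psi> \<phi> P * e \<phi> x)) \<in> W"
    by (elim exE conjE) (rule that)
  have "\<forall>\<phi>\<in>\<Phi>. \<exists>L\<ge>0. lipschitz_on_ball R L (e \<phi>)"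
    using e(1) polys_le_Lipschitz[of _ d R] by blast
  from bchoice[OF this] obtain l where l: "\<forall>\<phi>\<in>\<Phi>. 0 \<le> l \<phi> \<and> (lipschitz_on_ball R (l \<phi>) (e \<phi>))"
    by (elim exE) (rule that)
  define L where "L = (\<Sum>\<phi>\<in>\<Phi>. l \<phi>)"
  have L: "L \<ge> 0" "\<And>\<phi>. \<phi> \<in> \<Phi> \<Longrightarrow> l \<phi> \<le> L"
    unfolding L_def using l \<Phi>(1) by (auto intro!: sum_nonneg member_le_sum)
  show ?thesis
  proof (rule exI[of _ C], rule conjI[OF C(1)], rule exI[of _ \<epsilon>], rule conjI[OF C(2)], rule exI[of _ L], rule conjI[OF L(1)], rule ballI)
    fix P :: "real ^ 'm \<Rightarrow> real" assume P: "P \<in> polys_le d"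
    define X where "X = (\<Sum>\<phi>\<in>\<Phi>. \<bar>\<psi> \<phi> P\<bar>)"
    have X: "X \<ge> 0" by (simp add: X_def sum_nonneg)
    \<comment> \<open>The polynomials \<open>e \<phi>\<close> are fixed and the moduli of the
      coefficients sum to \<open>X\<close>, so the Lipschitz constant of \<open>E\<close> on the
      ball is at most a constant times \<open>X\<close>.\<close>
    define E where "E = (\<lambda>x. \<Sum>\<phi>\<in>\<Phi>. \<psi> \<phi> P * e \<phi> x)"
    have E: "E \<in> polys_le d" unfolding E_def using e(1) by (intro polys_le_sum) auto
    have "(\<lambda>x. P x - E x) \<in> W" using e(2) P unfolding E_def by blast
    then obtain p where p: "\<forall>j\<in>B. degree (p j) \<le> d"
      "line_invariant v (\<lambda>x. P x - E x - (\<Sum>j\<in>B. poly (p j) (u j \<bullet> x)))"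
      unfolding W_def mem_Collect_eq by (elim exE conjE) (rule that)
    have EL: "lipschitz_on_ball R (L * X) E"
    proof (intro ballI)
      fix x y :: "real ^ 'm" assume xy: "x \<in> cball 0 R" "y \<in> cball 0 R"
      have "E x - E y = (\<Sum>\<phi>\<in>\<Phi>. \<psi> \<phi> P * (e \<phi> x - e \<phi> y))"
        by (simp add: E_def sum_subtractf right_diff_distrib)
      then have "\<bar>E x - E y\<bar> \<le> (\<Sum>\<phi>\<in>\<Phi>. \<bar>\<psi> \<phi> P * (e \<phi> x - e \<phi> y)\<bar>)" by (simp only: sum_abs)
      also have "\<dots> \<le> (\<Sum>\<phi>\<in>\<Phi>. \<bar>\<psi> \<phi> P\<bar> * (L * norm (x - y)))"
      proof (rule sum_mono)
        fix \<phi> assume \<phi>: "\<phi> \<in> \<Phi>"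
        have "\<bar>e \<phi> x - e \<phi> y\<bar> \<le> l \<phi> * norm (x - y)" using l \<phi> xy by blast
        also have "\<dots> \<le> L * norm (x - y)" by (intro mult_right_mono L(2)[OF \<phi>]) simp
        finally show "\<bar>\<psi> \<phi> P * (e \<phi> x - e \<phi> y)\<bar> \<le> \<bar>\<psi> \<phi> P\<bar> * (L * norm (x - y))"
          by (simp add: abs_mult mult_left_mono)
      qed
      also have "\<dots> = L * X * norm (x - y)" by (simp add: X_def sum_distrib_right sum_distrib_left mult_ac)
      finally show "\<bar>E x - E y\<bar> \<le> L * X * norm (x - y)" .
    qed
    have dX: "osc_bound_at R u (A \<union> B) P C \<epsilon> X"
      using C(3) P unfolding X_def by blast
    show "\<exists>X\<ge>0. (osc_bound_at R u (A \<union> B) P C \<epsilon> X) \<and>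
      (\<exists>E p. E \<in> polys_le d \<and> (\<forall>j\<in>B. degree (p j) \<le> d) \<and>
        lipschitz_on_ball R (L * X) E \<and>
        (line_invariant v (\<lambda>x. P x - E x - (\<Sum>j\<in>B. poly (p j) (u j \<bullet> x)))))"
      by (rule exI[of _ X], rule conjI[OF X], rule conjI[OF dX], rule exI[of _ E], rule exI[of _ p],
          intro conjI E p EL)
  qed
qed

abbreviation extremal_estimate :: "nat \<Rightarrow> real \<Rightarrow> (nat \<Rightarrow> real ^ 'm::finite) \<Rightarrow> nat set \<Rightarrow> nat set \<Rightarrow> nat \<Rightarrow>
    real ^ 'm \<Rightarrow> real \<Rightarrow> real \<Rightarrow> bool" where
  "extremal_estimate d R u A B n v K K0 \<equiv> \<forall>M F \<eta> P L E p \<kappa> r. P \<in> polys_le d \<longrightarrow> E \<in> polys_le d \<longrightarrow> unit_bdd F (insert n (A \<union> B)) \<longrightarrow>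
    amp R M M \<eta> \<longrightarrow> 0 < M \<longrightarrow> 0 \<le> L \<longrightarrow> lipschitz_on_ball R L E \<longrightarrow>
    (\<forall>j\<in>insert n B. degree (p j) \<le> d) \<longrightarrow>
    (line_invariant v (\<lambda>x. P x - E x - (\<Sum>j\<in>insert n B. poly (p j) (u j \<bullet> x)))) \<longrightarrow> 0 < r \<longrightarrow> r \<le> 1 \<longrightarrow>
    (\<forall>a \<xi>. norm (osc u (insert n (A \<union> B)) (F(n := \<lambda>s. indicator {a..a+r} s *\<^sub>R cis (- (poly (p n) s + \<xi> * s)))) P \<eta>) \<le> M * \<kappa>) \<longrightarrow>
    (norm (osc u (insert n (A \<union> B)) F P \<eta>) / M) ^ 4 \<le> K * (\<kappa> / (K0 * r) + (1 + L) * r)"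

text \<open>The form is the integral of \<open>F n\<close> against \<open>D\<close>. Replacing
  \<open>F n\<close> by the normalised conjugate of \<open>D\<close> gives a form equal to the
  square integral of \<open>D\<close> up to scaling, and this controls the original by
  Cauchy-Schwarz. For the replaced form the local Fourier coefficients of the n-th function are
  conjugates of the quantities assumed small, so the uniform estimate applies.\<close>

lemma extremal_function_estimate:
  fixes u :: "nat \<Rightarrow> real ^ 'm::finite"
  assumes fin: "finite A" "finite B" "n \<notin> A \<union> B" "A \<inter> B = {}"
    and inv: "\<forall>j\<in>A. u j \<bullet> v = 0" and c: "u n \<bullet> v \<noteq> 0" and un: "u n \<bullet> w = 1" and ub: "\<forall>j\<in>B. u j \<bullet> w = 0"
  shows "\<exists>K>0. \<exists>K0>0. extremal_estimate d R u A B n v K K0"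
proof -
  obtain K1 where K1: "K1 > 0" "uniform_estimate R (u n) v w K1"
    using uniform_function_estimate[OF un c, of R] by (elim exE conjE) (rule that)
  define V where "V = measure lborel (cball (0 :: real ^ 'm) (R + norm w))"
  define V1 where "V1 = measure lborel (cball (0 :: real) (norm (u n) * R))"
  \<comment> \<open>\<open>D\<close> is bounded by \<open>M * V\<close>; adding 1 keeps the divisor
    positive also when \<open>V = 0\<close>.\<close>
  define K0 where "K0 = V + 1"
  have V: "V \<ge> 0" "V1 \<ge> 0" by (auto simp: V_def V1_def)
  have K0: "K0 > 0" using V by (simp add: K0_def)
  define K where "K = (V1 * K0)\<^sup>2 * K1 + 1"
  have K: "K > 0" using K1 by (simp add: K_def add_nonneg_pos)
  show ?thesis
  proof (rule exI[of _ K], rule conjI[OF K], rule exI[of _ K0], rule conjI[OF K0], intro allI impI)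
    fix M L \<kappa> r :: real and F and \<eta> :: "real ^ 'm \<Rightarrow> complex" and P E :: "real ^ 'm \<Rightarrow> real" and p :: "nat \<Rightarrow> real poly"
    assume P: "P \<in> polys_le d" and E: "E \<in> polys_le d" and F: "unit_bdd F (insert n (A \<union> B))"
      and \<eta>: "amp R M M \<eta>" and M: "0 < M" and L: "0 \<le> L"
      and EL: "lipschitz_on_ball R L E"
      and p: "\<forall>j\<in>insert n B. degree (p j) \<le> d"
      and pinv: "line_invariant v (\<lambda>x. P x - E x - (\<Sum>j\<in>insert n B. poly (p j) (u j \<bullet> x)))"
      and r: "0 < r" "r \<le> 1"
      and small: "\<forall>a \<xi>. norm (osc u (insert n (A \<union> B)) (F(n := \<lambda>s. indicator {a..a+r} s *\<^sub>R cis (- (poly (p n) s + \<xi> * s)))) P \<eta>) \<le> M * \<kappa>"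
    have finJ: "finite (A \<union> B)" using fin by simp
    have FJ: "unit_bdd F (A \<union> B)" and FA: "unit_bdd F A" and FB: "unit_bdd F B" and Fn: "borel_fun (F n)" "\<And>t. norm (F n t) \<le> 1"
      using F by (auto simp: unit_bdd_def)
    define \<Phi> where "\<Phi> = (\<lambda>x. cis (P x) * ((\<Prod>j\<in>A \<union> B. F j (u j \<bullet> x)) * \<eta> x))"
    have \<Phi>: "bdd_supp M R \<Phi>" unfolding \<Phi>_def by (rule osc_integrand_bdd_supp[OF P FJ \<eta>])
    obtain D where D: "bdd_supp (M * V) (norm (u n) * R) D"
      "dual_function (u n) \<Phi> D"
      using exists_dual_function[OF un \<Phi>] unfolding V_def[symmetric] by (elim exE conjE) (rule that)
    note Dm[measurable] = bdd_suppD(1)[OF D(1)]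
    have [measurable]: "borel_fun (\<lambda>s. poly (p n) s)"
      by (intro borel_measurable_continuous_onI continuous_intros)
    define f where "f = (\<lambda>s. cnj (D s) / complex_of_real (M * K0))"
    have fm: "borel_fun f" unfolding f_def by measurable
    have fle: "norm (f s) \<le> 1" for s
    proof -
      have "norm (D s) \<le> M * V" by (rule bdd_suppD(2)[OF D(1)])
      also have "\<dots> \<le> M * K0" using M by (simp add: K0_def)
      finally show ?thesis using M K0 by (simp add: f_def norm_divide norm_mult)
    qed
    define b2 where "b2 = (LBINT t. (norm (D t))\<^sup>2)"
    have b2: "b2 \<ge> 0" by (simp add: b2_def)
    have I1: "(LBINT x. f (u n \<bullet> x) * \<Phi> x) = complex_of_real (b2 / (M * K0))"
    proof -
      have "(LBINT x. f (u n \<bullet> x) * \<Phi> x) = (LBINT t. f t * D t)"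
        using D(2)[rule_format, OF fm fle] .
      also have "\<dots> = (LBINT t. complex_of_real ((norm (D t))\<^sup>2 / (M * K0)))"
      proof (rule Bochner_Integration.integral_cong[OF refl])
        fix t
        have "cnj (D t) * D t = complex_of_real ((norm (D t))\<^sup>2)" by (metis complex_norm_square mult.commute)
        then show "f t * D t = complex_of_real ((norm (D t))\<^sup>2 / (M * K0))" by (simp add: f_def)
      qed
      also have "\<dots> = complex_of_real (b2 / (M * K0))" by (simp only: integral_complex_of_real b2_def integral_divide_zero)
      finally show ?thesis .
    qed
    define h where "h = (\<lambda>x. P x - E x - (\<Sum>j\<in>insert n B. poly (p j) (u j \<bullet> x)))"
    have hm: "borel_fun h" unfolding h_def
      by (rule polys_le_measurable[of _ d], intro polys_le_diff polys_le_sum1 P E polys_le_poly_inner) (use p in auto)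
    \<comment> \<open>The phase is distributed over the factors: \<open>h\<close> joins the
      functions of \<open>A\<close>, all constant along \<open>v\<close>; the polynomials
      \<open>p j\<close> with \<open>j\<close> in \<open>B\<close> join their functions, all
      constant along \<open>w\<close>; \<open>p n\<close> joins the extremal function; and
      \<open>E\<close> joins the amplitude.\<close>
    define GA where "GA = (\<lambda>x. cis (h x) * (\<Prod>j\<in>A. F j (u j \<bullet> x)))"
    define GB where "GB = (\<lambda>x. \<Prod>j\<in>B. F j (u j \<bullet> x) * cis (poly (p j) (u j \<bullet> x)))"
    define g where "g = (\<lambda>s. f s * cis (poly (p n) s))"
    define \<eta>' where "\<eta>' = (\<lambda>x. cis (E x) * \<eta> x)"
    have GAm: "borel_fun GA"
    proof -
      note [measurable] = hm unit_bdd_prod_measurable[OF FA, of u]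
      show ?thesis unfolding GA_def by measurable
    qed
    have GA1: "norm (GA x) \<le> 1" for x
      unfolding GA_def norm_mult norm_cis mult_1 by (rule unit_bdd_prod_norm[OF FA])
    have GAinv: "GA (x + t *\<^sub>R v) = GA x" for x t
    proof -
      have "h (x + t *\<^sub>R v) = h x" using pinv by (simp only: h_def)
      moreover have "(\<Prod>j\<in>A. F j (u j \<bullet> (x + t *\<^sub>R v))) = (\<Prod>j\<in>A. F j (u j \<bullet> x))"
        by (intro prod.cong refl) (simp add: inner_add_right inv)
      ultimately show ?thesis by (simp only: GA_def)
    qed
    have GBm: "borel_fun GB" unfolding GB_def
    proof (rule borel_measurable_prod)
      fix j assume j: "j \<in> B"
      have [measurable]: "borel_fun (\<lambda>x. poly (p j) x)" "borel_fun (F j)"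
        using FB j by (auto intro!: borel_measurable_continuous_onI continuous_intros simp: unit_bdd_def)
      show "borel_fun (\<lambda>x. F j (u j \<bullet> x) * cis (poly (p j) (u j \<bullet> x)))" by measurable
    qed
    have GB1: "norm (GB x) \<le> 1" for x
      unfolding GB_def prod_norm[symmetric] using FB by (intro prod_le_1) (auto simp: norm_mult unit_bdd_def)
    have GBinv: "GB (x + t *\<^sub>R w) = GB x" for x t
      unfolding GB_def by (intro prod.cong refl) (simp add: inner_add_right ub)
    have gm: "borel_fun g" unfolding g_def using fm by measurable
    have g1: "norm (g s) \<le> 1" for s using fle by (simp add: g_def norm_mult)
    have \<eta>'a: "amp R M (M * (1 + L)) \<eta>'"
      unfolding \<eta>'_def by (rule amp_mult_cis[OF \<eta> L]) (use EL in auto)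
    have fac: "GA x * (GB x * (g (u n \<bullet> x) * \<eta>' x)) = f (u n \<bullet> x) * \<Phi> x" for x
    proof -
      have "P x = h x + ((\<Sum>j\<in>B. poly (p j) (u j \<bullet> x)) + (poly (p n) (u n \<bullet> x) + E x))"
        using fin by (simp add: h_def)
      then have "cis (P x) = cis (h x) * ((\<Prod>j\<in>B. cis (poly (p j) (u j \<bullet> x))) * (cis (poly (p n) (u n \<bullet> x)) * cis (E x)))"
        by (simp only: cis_mult[symmetric] cis_sum[OF fin(2)])
      moreover have "(\<Prod>j\<in>A \<union> B. F j (u j \<bullet> x)) = (\<Prod>j\<in>A. F j (u j \<bullet> x)) * (\<Prod>j\<in>B. F j (u j \<bullet> x))"
        using fin by (intro prod.union_disjoint) auto
      ultimately show ?thesis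
        unfolding GA_def GB_def g_def \<eta>'_def \<Phi>_def prod.distrib by (simp only: mult_ac)
    qed
    \<comment> \<open>Unfolding \<open>f\<close> turns a local Fourier coefficient of
      \<open>g\<close> into the conjugate of an integral of \<open>D\<close> against a polynomial
      phase on an interval, that is, a form with this phase as its n-th function.\<close>
    have \<kappa>: "norm (LBINT s. indicator {a..a+r} s *\<^sub>R (g s * cis (\<xi> * s))) \<le> \<kappa> / K0" for a \<xi>
    proof -
      define q where "q = (\<lambda>s :: real. indicator {a..a+r} s *\<^sub>R cis (- (poly (p n) s + \<xi> * s)))"
      have qm: "borel_fun q"
      proof -
        have "borel_fun (\<lambda>s. cis (- (poly (p n) s + \<xi> * s)))" by measurable
        then show ?thesis unfolding q_def
          by (rule borel_measurable_scaleR[OF borel_measurable_indicator[OF atLeastAtMost_borel]])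
      qed
      have q1: "norm (q s) \<le> 1" for s by (auto simp: q_def split: split_indicator)
      have "(LBINT s. indicator {a..a+r} s *\<^sub>R (g s * cis (\<xi> * s))) = (LBINT s. cnj (q s * D s) / complex_of_real (M * K0))"
      proof (rule Bochner_Integration.integral_cong[OF refl])
        fix s
        have "cnj (cis (- (poly (p n) s + \<xi> * s))) = cis (poly (p n) s) * cis (\<xi> * s)" by (simp add: cis_cnj cis_mult add.commute)
        then show "indicator {a..a+r} s *\<^sub>R (g s * cis (\<xi> * s)) = cnj (q s * D s) / complex_of_real (M * K0)"
          unfolding q_def g_def f_def scaleR_conv_of_real complex_cnj_mult complex_cnj_complex_of_real
          by (simp only: times_divide_eq_right times_divide_eq_left mult_ac)
      qed
      also have "\<dots> = cnj (LBINT s. q s * D s) / complex_of_real (M * K0)"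
        by (simp only: integral_divide_zero Bochner_Integration.integral_cnj)
      also have "(LBINT s. q s * D s) = osc u (insert n (A \<union> B)) (F(n := q)) P \<eta>"
        unfolding osc_fun_upd[OF finJ fin(3)] using D(2)[rule_format, OF qm q1] by (simp add: \<Phi>_def)
      also have "norm (cnj (osc u (insert n (A \<union> B)) (F(n := q)) P \<eta>) / complex_of_real (M * K0)) =
          norm (osc u (insert n (A \<union> B)) (F(n := q)) P \<eta>) / (M * K0)"
        using M K0 by (simp add: norm_divide norm_mult)
      also have "\<dots> \<le> (M * \<kappa>) / (M * K0)"
        using small M K0 unfolding q_def by (intro divide_right_mono) auto
      finally show ?thesis using M by simp
    qed
    have est: "(norm (LBINT x. GA x * (GB x * (g (u n \<bullet> x) * \<eta>' x))))\<^sup>2 \<le> K1 * (M\<^sup>2 * (\<kappa> / K0) / r + M * (M * (1 + L)) * r)"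
      using K1(2)[rule_format, OF GAm GA1 GAinv GBm GB1 GBinv gm g1 \<eta>'a r \<kappa>] .
    then have est2: "(b2 / (M * K0))\<^sup>2 \<le> K1 * M\<^sup>2 * (\<kappa> / (K0 * r) + (1 + L) * r)"
      unfolding fac I1 norm_of_real by (simp add: power2_eq_square algebra_simps)
    have I: "osc u (insert n (A \<union> B)) F P \<eta> = (LBINT t. F n t * D t)"
      using osc_fun_upd[OF finJ fin(3), of u F "F n" P \<eta>] D(2)[rule_format, OF Fn] by (simp add: \<Phi>_def)
    have le2: "(norm (osc u (insert n (A \<union> B)) F P \<eta>))\<^sup>2 \<le> V1 * b2"
    proof -
      have FD: "bdd_supp (M * V) (norm (u n) * R) (\<lambda>t. F n t * D t)" by (rule bdd_supp_mult_left[OF Fn D(1)])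
      have "norm (osc u (insert n (A \<union> B)) F P \<eta>) \<le> (LBINT t. norm (F n t * D t))" unfolding I by (rule integral_norm_bound)
      also have "\<dots> \<le> (LBINT t. norm (D t))"
        using Fn(2) by (intro integral_mono' integrable_norm bdd_supp_integrable[OF D(1)]) (auto simp: norm_mult intro: mult_left_le_one_le)
      finally have "(norm (osc u (insert n (A \<union> B)) F P \<eta>))\<^sup>2 \<le> (LBINT t. norm (D t))\<^sup>2" by (rule power_mono) simp
      also have "\<dots> \<le> V1 * b2" unfolding V1_def b2_def by (rule square_integral_le[OF D(1)])
      finally show ?thesis .
    qed
    have pos: "\<kappa> / (K0 * r) + (1 + L) * r \<ge> 0"
    proof -
      have "0 \<le> norm (osc u (insert n (A \<union> B)) (F(n := \<lambda>s. indicator {0..0+r} s *\<^sub>R cis (- (poly (p n) s + 0 * s)))) P \<eta>)" by simp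
      also have "\<dots> \<le> M * \<kappa>" using small by blast
      finally have "0 \<le> \<kappa>" using M by (simp add: zero_le_mult_iff)
      then show ?thesis using K0 r L by simp
    qed
    \<comment> \<open>The fourth power arises from two squarings: Cauchy-Schwarz against
      \<open>D\<close>, and the squared norm on the left of the uniform estimate.\<close>
    have "(norm (osc u (insert n (A \<union> B)) F P \<eta>) / M) ^ 4 = ((norm (osc u (insert n (A \<union> B)) F P \<eta>))\<^sup>2)\<^sup>2 / M ^ 4"
      by (simp add: power_divide)
    also have "\<dots> \<le> (V1 * b2)\<^sup>2 / M ^ 4" using M by (intro divide_right_mono power_mono le2) auto
    also have "\<dots> = (V1 * K0)\<^sup>2 * (b2 / (M * K0))\<^sup>2 / M\<^sup>2"
      using M K0 by (simp add: power2_eq_square power4_eq_xxxx mult_ac)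
    also have "\<dots> \<le> (V1 * K0)\<^sup>2 * (K1 * M\<^sup>2 * (\<kappa> / (K0 * r) + (1 + L) * r)) / M\<^sup>2"
      by (intro divide_right_mono mult_left_mono est2) auto
    also have "\<dots> = ((V1 * K0)\<^sup>2 * K1) * (\<kappa> / (K0 * r) + (1 + L) * r)" using M by simp
    also have "\<dots> \<le> K * (\<kappa> / (K0 * r) + (1 + L) * r)" by (intro mult_right_mono pos) (simp add: K_def)
    finally show "(norm (osc u (insert n (A \<union> B)) F P \<eta>) / M) ^ 4 \<le> K * (\<kappa> / (K0 * r) + (1 + L) * r)" .
  qed
qed

text \<open>The hypothesis for \<open>A \<union> B\<close> enters only through the structured
  functions, where it makes the local Fourier coefficients small. The parameter \<open>X\<close> of
  the phase decomposition appears both as a source of decay and, through the Lipschitz constant of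
  \<open>E\<close>, as a loss; \<open>min_decay_combination\<close> resolves the
  competition.\<close>

lemma osc_claim_step:
  fixes u :: "nat \<Rightarrow> real ^ 'm::finite"
  assumes d: "d \<ge> 1" and fin: "finite A" "finite B" "n \<notin> A \<union> B" "A \<inter> B = {}"
    and inv: "\<forall>j\<in>A. u j \<bullet> v = 0" and c: "\<forall>j\<in>insert n B. u j \<bullet> v \<noteq> 0"
    and dual: "dual_system u (insert n B) vv" and claim: "osc_claim nrm d R u (A \<union> B)"
  shows "osc_claim nrm d R u (insert n (A \<union> B))"
proof -
  let ?J = "insert n (A \<union> B)"
  have finJ: "finite (A \<union> B)" using fin by simp
  have B1: "finite (insert n B)" "A \<inter> insert n B = {}" "n \<in> insert n B" using fin by auto
  have J: "A \<union> insert n B = ?J" by simp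
  have un: "u n \<bullet> vv n = 1" and ub: "\<forall>j\<in>B. u j \<bullet> vv n = 0"
    using dual fin(3) by (auto simp: dual_system_def)
  have cn: "u n \<bullet> v \<noteq> 0" using c by simp
  obtain C1 \<epsilon>1 L where C1: "C1 > 0" "\<epsilon>1 > 0" "L \<ge> 0" "\<forall>P\<in>polys_le d. \<exists>X\<ge>0.
    osc_bound_at R u ?J P C1 \<epsilon>1 X \<and>
    (\<exists>E p. E \<in> polys_le d \<and> (\<forall>j\<in>insert n B. degree (p j) \<le> d) \<and>
      lipschitz_on_ball R (L * X) E \<and>
      (line_invariant v (\<lambda>x. P x - E x - (\<Sum>j\<in>insert n B. poly (p j) (u j \<bullet> x)))))"
    using phase_decomposition[where R = R, OF d fin(1) B1 inv c dual, unfolded J] by (elim exE conjE) (rule that)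
  obtain K2 \<epsilon>2 where K2: "K2 > 0" "\<epsilon>2 > 0" "\<forall>M F \<eta> N q a r. \<forall>P\<in>polys_le d. unit_bdd F (A \<union> B) \<longrightarrow> amp R M M \<eta> \<longrightarrow> 0 \<le> N \<longrightarrow>
    nondegenerate nrm d u ?J N P \<longrightarrow> degree q \<le> d \<longrightarrow> 0 \<le> r \<longrightarrow>
    norm (osc u ?J (F(n := \<lambda>s. indicator {a..a+r} s *\<^sub>R cis (- poly q s))) P \<eta>) \<le> K2 * M * (1 + N) powr - \<epsilon>2"
    using structured_function_decay[OF finJ fin(3) un claim] by (elim exE conjE) (rule that)
  obtain K K0 where K: "K > 0" "K0 > 0" "extremal_estimate d R u A B n v K K0"
    using extremal_function_estimate[where R = R and d = d, OF fin inv cn un ub] by (elim exE conjE) (rule that)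
  define \<epsilon> where "\<epsilon> = min \<epsilon>1 1"
  define \<delta> where "\<delta> = \<epsilon>2 / 2"
  define K' where "K' = K * (K2 / K0 + (1 + L))"
  have \<epsilon>: "\<epsilon> > 0" "\<epsilon> \<le> 1" "\<epsilon> \<le> \<epsilon>1" "\<delta> > 0" using C1 K2 by (auto simp: \<epsilon>_def \<delta>_def)
  have K': "K' > 0" unfolding K'_def using K K2 C1 by (intro mult_pos_pos add_pos_nonneg divide_pos_pos) auto
  have pos: "C1 + K' + 1 > 0" "\<epsilon> * \<delta> / 8 > 0" using C1 K' \<epsilon> by auto
  show ?thesis unfolding osc_claim_def
  proof (rule exI[of _ "C1 + K' + 1"], rule conjI[OF pos(1)], rule exI[of _ "\<epsilon> * \<delta> / 8"], rule conjI[OF pos(2)], intro allI ballI impI)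
    fix M N :: real and F and \<eta> :: "real ^ 'm \<Rightarrow> complex" and P :: "real ^ 'm \<Rightarrow> real"
    assume P: "P \<in> polys_le d" and F: "unit_bdd F ?J" and \<eta>: "amp R M M \<eta>" and N0: "0 \<le> N"
      and N: "nondegenerate nrm d u ?J N P"
    have FAB: "unit_bdd F (A \<union> B)" using F by (simp add: unit_bdd_def)
    show "norm (osc u ?J F P \<eta>) \<le> (C1 + K' + 1) * M * (1 + N) powr - (\<epsilon> * \<delta> / 8)"
    proof (cases "M = 0")
      case True
      then show ?thesis using osc_trivial_bound[OF P F \<eta>] by simp
    next
      case False
      with ampD(4)[OF \<eta>] have M: "M > 0" by simp
      obtain X E p where X: "X \<ge> 0" "osc_bound_at R u ?J P C1 \<epsilon>1 X"
        and E: "E \<in> polys_le d" and p: "\<forall>j\<in>insert n B. degree (p j) \<le> d"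
        and EL: "lipschitz_on_ball R (L * X) E"
        and pinv: "line_invariant v (\<lambda>x. P x - E x - (\<Sum>j\<in>insert n B. poly (p j) (u j \<bullet> x)))"
        using bspec[OF C1(4) P] by (elim exE conjE) (rule that)
      define b where "b = norm (osc u ?J F P \<eta>) / M"
      have b0: "b \<ge> 0" using M by (simp add: b_def)
      have "norm (osc u ?J F P \<eta>) \<le> C1 * M * (1 + X) powr - \<epsilon>1" using X(2) F \<eta> by blast
      also have "\<dots> \<le> C1 * M * (1 + X) powr - \<epsilon>"
        using C1 M X \<epsilon> by (intro mult_left_mono powr_mono) auto
      finally have b1: "b \<le> C1 * (1 + X) powr - \<epsilon>" using M by (simp add: b_def divide_le_eq mult_ac)
      \<comment> \<open>As \<open>\<delta>\<close> is half of \<open>\<epsilon>2\<close>, the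
        coefficient bound is of order \<open>r * r\<close>. Divided by the window length it is of
        order \<open>r\<close>, like the error from the variation of the amplitude.\<close>
      define r where "r = (1 + N) powr - \<delta>"
      have r: "0 < r" "r \<le> 1" using N0 \<epsilon> powr_mono2'[of "- \<delta>" 1 "1 + N"] by (auto simp: r_def)
      have small: "\<forall>a \<xi>. norm (osc u ?J (F(n := \<lambda>s. indicator {a..a+r} s *\<^sub>R cis (- (poly (p n) s + \<xi> * s)))) P \<eta>) \<le> M * (K2 * (1 + N) powr - \<epsilon>2)"
      proof (intro allI)
        fix a \<xi>
        \<comment> \<open>The frequency adds a linear term to the polynomial phase; this is where
          \<open>d \<ge> 1\<close> is used.\<close>
        have q: "degree (p n + [:0, \<xi>:]) \<le> d" using p d by (intro degree_add_le) auto
        have r0: "0 \<le> r" using r by simp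
        have eq: "(\<lambda>s. indicator {a..a+r} s *\<^sub>R cis (- poly (p n + [:0, \<xi>:]) s)) =
          (\<lambda>s. indicator {a..a+r} s *\<^sub>R cis (- (poly (p n) s + \<xi> * s)))" by (simp add: mult.commute)
        show "norm (osc u ?J (F(n := \<lambda>s. indicator {a..a+r} s *\<^sub>R cis (- (poly (p n) s + \<xi> * s)))) P \<eta>) \<le> M * (K2 * (1 + N) powr - \<epsilon>2)"
          using K2(3)[rule_format, OF P FAB \<eta> N0 N[rule_format] q r0, of a] unfolding eq by (simp add: mult_ac)
      qed
      have LX: "0 \<le> L * X" using C1 X by simp
      have b4: "b ^ 4 \<le> K * ((K2 * (1 + N) powr - \<epsilon>2) / (K0 * r) + (1 + L * X) * r)"
        unfolding b_def
        by (rule K(3)[THEN spec, THEN spec, THEN spec, THEN spec, THEN spec, THEN spec, THEN spec, THEN spec, THEN spec,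
            THEN mp, THEN mp, THEN mp, THEN mp, THEN mp, THEN mp, THEN mp, THEN mp, THEN mp, THEN mp, THEN mp, THEN mp,
            OF P E F \<eta> M LX EL p pinv r small])
      have "(1 + N) powr - \<epsilon>2 = (1 + N) powr (- \<delta> + - \<delta>)" by (simp add: \<delta>_def)
      also have "\<dots> = r * r" unfolding r_def by (rule powr_add)
      finally have rr: "(1 + N) powr - \<epsilon>2 = r * r" .
      have "(K2 * (1 + N) powr - \<epsilon>2) / (K0 * r) + (1 + L * X) * r = (K2 / K0 + (1 + L * X)) * r"
        using r K unfolding rr by (simp add: field_simps)
      also have "\<dots> \<le> ((K2 / K0 + (1 + L)) * (1 + X)) * r"
      proof (rule mult_right_mono)
        have "0 \<le> K2 / K0 * X" "0 \<le> L" "0 \<le> X" using K K2 C1 X by auto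
        then show "K2 / K0 + (1 + L * X) \<le> (K2 / K0 + (1 + L)) * (1 + X)" by (simp add: ring_distribs)
      qed (use r in simp)
      finally have "(K2 * (1 + N) powr - \<epsilon>2) / (K0 * r) + (1 + L * X) * r \<le> ((K2 / K0 + (1 + L)) * (1 + X)) * r" .
      then have "b ^ 4 \<le> K * (((K2 / K0 + (1 + L)) * (1 + X)) * r)"
        using K(1) by (intro order_trans[OF b4] mult_left_mono) auto
      then have "b ^ 4 \<le> K' * (1 + X) * (1 + N) powr - \<delta>" by (simp add: K'_def r_def mult_ac)
      from min_decay_combination[OF b0 X(1) N0 C1(1) K' \<epsilon>(1,2,4) b1 this]
      show ?thesis using M by (simp add: b_def divide_le_eq mult_ac)
    qed
  qed
qed

text \<open>A constant phase is degenerate, which forces \<open>N = 0\<close>, and the trivial bound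
  suffices.\<close>

lemma osc_claim_constant:
  fixes u :: "nat \<Rightarrow> real ^ 'm::finite"
  assumes nrm: "norm_on (polys_le 0) nrm"
  shows "osc_claim nrm 0 R u J"
proof -
  let ?V = "measure lborel (cball (0 :: real ^ 'm) R)"
  have V: "?V + 1 > 0" by (simp add: add_nonneg_pos)
  show ?thesis unfolding osc_claim_def
  proof (rule exI[of _ "?V + 1"], rule conjI[OF V], rule exI[of _ 1], rule conjI[OF zero_less_one], intro allI ballI impI)
    fix M N :: real and F and \<eta> :: "real ^ 'm \<Rightarrow> complex" and P :: "real ^ 'm \<Rightarrow> real"
    assume P: "P \<in> polys_le 0" and F: "unit_bdd F J" and \<eta>: "amp R M M \<eta>" and N0: "0 \<le> N"
      and N: "\<forall>w\<in>degenerate 0 u J. N \<le> nrm (\<lambda>x. P x - w x)"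
    obtain c where c: "P = (\<lambda>_. c)" using polys_le_0[OF P] by blast
    have "P \<in> degenerate 0 u J" unfolding degenerate_def c by (intro CollectI exI[of _ c] exI[of _ "\<lambda>_. 0"]) simp
    from bspec[OF N this] have "N \<le> nrm (\<lambda>_. 0)" by simp
    also have "nrm (\<lambda>_. 0) = 0" using nrm fsub_zero[OF fsub_polys_le[of 0]] unfolding norm_on_def by blast
    finally have "N = 0" using N0 by simp
    then show "norm (osc u J F P \<eta>) \<le> (?V + 1) * M * (1 + N) powr - 1"
      using osc_trivial_bound[OF P F \<eta>, of u] ampD(4)[OF \<eta>] by (simp add: ring_distribs mult.commute)
  qed
qed

section \<open>Dual systems and the choice of directions\<close>

lemma dual_system_independent:
  fixes u :: "nat \<Rightarrow> 'a::euclidean_space"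
  assumes fin: "finite S" and dual: "dual_system u S v"
  shows "inj_on u S" "independent (u ` S)"
proof -
  show inj: "inj_on u S"
  proof (rule inj_onI)
    fix i j assume "i \<in> S" "j \<in> S" "u i = u j"
    then show "i = j" using dual unfolding dual_system_def by (metis zero_neq_one)
  qed
  show "independent (u ` S)"
  proof (rule independent_if_scalars_zero)
    show "finite (u ` S)" using fin by simp
    fix f x assume s: "(\<Sum>x\<in>u ` S. f x *\<^sub>R x) = 0" and "x \<in> u ` S"
    then obtain j where j: "j \<in> S" "x = u j" by blast
    have "0 = (\<Sum>x\<in>u ` S. f x *\<^sub>R x) \<bullet> v j" using s by simp
    also have "\<dots> = (\<Sum>i\<in>S. f (u i) * (u i \<bullet> v j))" by (simp add: sum.reindex[OF inj] inner_sum_left)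
    also have "\<dots> = (\<Sum>i\<in>S. if i = j then f (u i) else 0)"
      using dual j by (intro sum.cong refl) (auto simp: dual_system_def)
    also have "\<dots> = f x" using j fin by simp
    finally show "f x = 0" by simp
  qed
qed

lemma dual_system_annihilator:
  fixes u :: "nat \<Rightarrow> 'a::euclidean_space"
  assumes fin: "finite S" and dual: "dual_system u S v" and card: "card S = DIM('a)"
    and x: "\<And>i. i \<in> S \<Longrightarrow> u i \<bullet> x = 0"
  shows "x = 0"
proof -
  note i = dual_system_independent[OF fin dual]
  have "dim (u ` S) = DIM('a)" using dim_eq_card_independent[OF i(2)] card_image[OF i(1)] card by simp
  then have "span (u ` S) = UNIV" by (simp only: dim_eq_full)
  then have "x \<in> span (u ` S)" by simp
  moreover have "orthogonal x y" if "y \<in> u ` S" for y using that x by (auto simp: orthogonal_def inner_commute)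
  ultimately have "orthogonal x x" by (intro orthogonal_to_span[of x "u ` S" x]) auto
  then show ?thesis by (simp add: orthogonal_self)
qed

text \<open>The dual vector of \<open>u j\<close> is its component orthogonal to the span of the
  others, which is nonzero by independence, divided by its squared length.\<close>

lemma exists_dual_system:
  fixes u :: "nat \<Rightarrow> 'a::euclidean_space"
  assumes inj: "inj_on u S" and ind: "independent (u ` S)"
  shows "\<exists>v. dual_system u S v"
proof -
  have "\<forall>j\<in>S. \<exists>z. u j \<bullet> z = 1 \<and> (\<forall>i\<in>S. i \<noteq> j \<longrightarrow> u i \<bullet> z = 0)"
  proof
    fix j assume j: "j \<in> S"
    have im: "u ` S - {u j} = u ` (S - {j})" using inj j by (auto simp: inj_on_def)
    have ns: "u j \<notin> span (u ` (S - {j}))" using ind j im unfolding dependent_def by (metis imageI)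
    obtain y z where yz: "y \<in> span (u ` (S - {j}))" "\<And>w. w \<in> span (u ` (S - {j})) \<Longrightarrow> orthogonal z w" "u j = y + z"
      using orthogonal_subspace_decomp_exists[of "u ` (S - {j})" "u j"] by blast
    have z: "z \<noteq> 0" using ns yz by auto
    have "y \<bullet> z = 0" using yz(2)[OF yz(1)] by (simp add: orthogonal_def inner_commute)
    then have uz: "u j \<bullet> z = z \<bullet> z" by (simp add: yz(3) inner_add_left)
    have "u i \<bullet> z = 0" if "i \<in> S" "i \<noteq> j" for i
      using yz(2)[of "u i"] that span_base[of "u i" "u ` (S - {j})"] by (auto simp: orthogonal_def inner_commute)
    with uz z show "\<exists>z. u j \<bullet> z = 1 \<and> (\<forall>i\<in>S. i \<noteq> j \<longrightarrow> u i \<bullet> z = 0)"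
      by (intro exI[of _ "(1 / (z \<bullet> z)) *\<^sub>R z"]) auto
  qed
  from bchoice[OF this] obtain v where v: "\<forall>j\<in>S. u j \<bullet> v j = 1 \<and> (\<forall>i\<in>S. i \<noteq> j \<longrightarrow> u i \<bullet> v j = 0)" by blast
  then show ?thesis unfolding dual_system_def by (intro exI[of _ v]) auto
qed

text \<open>Induction over proper subsets. Up to m directions are independent and need no step;
  degree 0 is separated because the step absorbs a linear phase.\<close>

lemma osc_claim_general_position:
  fixes u :: "nat \<Rightarrow> real ^ 'm::finite"
  assumes nrm: "norm_on (polys_le d) nrm" and fin: "finite J" and card: "card J < 2 * CARD('m)"
    and gp: "\<And>S. S \<subseteq> J \<Longrightarrow> card S \<le> CARD('m) \<Longrightarrow> \<exists>v. dual_system u S v"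
  shows "osc_claim nrm d R u J"
  using fin card gp
proof (induction J rule: finite_psubset_induct)
  case (psubset J)
  let ?m = "CARD('m)"
  show ?case
  proof (cases "card J \<le> ?m \<or> d = 0")
    case True
    then show ?thesis
    proof
      assume "card J \<le> ?m"
      then obtain v where "dual_system u J v" using psubset.prems(2)[of J] by blast
      then show ?thesis by (rule osc_claim_independent[OF nrm psubset.hyps])
    next
      assume "d = 0"
      then show ?thesis using osc_claim_constant nrm by blast
    qed
  next
    case False
    then have big: "?m < card J" and d: "d \<ge> 1" by auto
    have m: "?m \<ge> 1" by simp
    obtain n where n: "n \<in> J" using big by (metis card.empty ex_in_conv not_less0)
    have "?m - 1 \<le> card (J - {n})" using big n psubset.hyps by simp
    then obtain A where A: "A \<subseteq> J - {n}" "card A = ?m - 1" "finite A"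
      by (rule obtain_subset_with_card_n)
    define B where "B = J - {n} - A"
    have finB: "finite B" using psubset.hyps by (simp add: B_def)
    \<comment> \<open>Of at most \<open>2 * ?m - 1\<close> directions, \<open>?m - 1\<close> are in
      \<open>A\<close>, so at most \<open>?m\<close> remain for \<open>insert n B\<close>. This is
      the place where the number of directions is limited.\<close>
    have cB: "card (insert n B) \<le> ?m"
    proof -
      have "card B = card (J - {n}) - card A" unfolding B_def using A by (intro card_Diff_subset) auto
      then have "card B = card J - 1 - (?m - 1)" using n psubset.hyps A by simp
      moreover have "card (insert n B) = Suc (card B)" using finB by (simp add: B_def)
      ultimately show ?thesis using psubset.prems(1) big m by linarith
    qed
    have J: "J = insert n (A \<union> B)" using A n by (auto simp: B_def)
    have nAB: "n \<notin> A \<union> B" "A \<inter> B = {}" using A by (auto simp: B_def)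
    have "card (insert n A) = ?m" using A m nAB by simp
    then obtain w where w: "dual_system u (insert n A) w" using psubset.prems(2)[of "insert n A"] J by auto
    \<comment> \<open>The dual vector of \<open>u n\<close> within \<open>insert n A\<close> is
      orthogonal to all directions in \<open>A\<close> but not to \<open>u n\<close>.\<close>
    define v where "v = w n"
    have vA: "u j \<bullet> v = 0" if "j \<in> A" for j using w that nAB by (auto simp: dual_system_def v_def)
    have vn: "u n \<bullet> v = 1" using w by (simp add: dual_system_def v_def)
    have vB: "u j \<bullet> v \<noteq> 0" if j: "j \<in> insert n B" for j
    proof (cases "j = n")
      case False
      then have jB: "j \<in> B" using j by simp
      show ?thesis
      proof
        assume z: "u j \<bullet> v = 0"
        \<comment> \<open>If \<open>u j\<close> were orthogonal to \<open>v\<close> as well, then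
          \<open>v\<close> would be orthogonal to the \<open>?m\<close> independent vectors indexed
          by \<open>insert j A\<close> and hence be zero.\<close>
        have "j \<notin> A" using nAB jB by blast
        then have cj: "card (insert j A) = ?m" using A m by simp
        then obtain w' where w': "dual_system u (insert j A) w'" using psubset.prems(2)[of "insert j A"] J jB by auto
        have "v = 0" by (rule dual_system_annihilator[OF _ w']) (use A cj z vA in auto)
        then show False using vn by simp
      qed
    qed (use vn in simp)
    obtain vv where vv: "dual_system u (insert n B) vv" using psubset.prems(2)[of "insert n B"] cB J by auto
    have claim: "osc_claim nrm d R u (A \<union> B)"
    proof (rule psubset.IH)
      show "A \<union> B \<subset> J" using J nAB by auto
      then show "card (A \<union> B) < 2 * ?m" using psubset.prems(1) psubset_card_mono[OF psubset.hyps] by (meson less_trans)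
      show "\<exists>v. dual_system u S v" if "S \<subseteq> A \<union> B" "card S \<le> ?m" for S using psubset.prems(2)[of S] that J by blast
    qed
    have "\<forall>j\<in>A. u j \<bullet> v = 0" "\<forall>j\<in>insert n B. u j \<bullet> v \<noteq> 0" using vA vB by blast+
    from osc_claim_step[OF d A(3) finB nAB this vv claim] show ?thesis unfolding J .
  qed
qed

subsection \<open>Lebesgue measure on lines\<close>

lemma nn_integral_lborel_translate:
  fixes f :: "'a::euclidean_space \<Rightarrow> ennreal"
  assumes "borel_fun f"
  shows "(\<integral>\<^sup>+x. f (x + a) \<partial>lborel) = (\<integral>\<^sup>+x. f x \<partial>lborel)"
proof -
  have "(\<integral>\<^sup>+x. f x \<partial>lborel) = (\<integral>\<^sup>+x. f x \<partial>distr lborel borel ((+) a))" by (simp only: lborel_distr_plus)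
  also have "\<dots> = (\<integral>\<^sup>+x. f (a + x) \<partial>lborel)" using assms by (subst nn_integral_distr) auto
  finally show ?thesis by (simp add: add.commute)
qed

text \<open>Averaging over a unit segment along \<open>v k\<close> affects only the factor
  \<open>g k\<close>, which contributes its full integral, while the ball grows by
  \<open>norm (v k)\<close>. Induction over \<open>S\<close> replaces a linear change of variables
  with its determinant.\<close>

lemma local_product_estimate:
  fixes u :: "nat \<Rightarrow> 'a::euclidean_space" and g :: "nat \<Rightarrow> real \<Rightarrow> ennreal"
  assumes "finite S" "dual_system u S v" "\<And>j. j \<in> S \<Longrightarrow> borel_fun (g j)"
  shows "(\<integral>\<^sup>+x. indicator (cball 0 R) x * (\<Prod>j\<in>S. g j (u j \<bullet> x)) \<partial>lborel) \<le>
    emeasure lborel (cball (0 :: 'a) (R + (\<Sum>j\<in>S. norm (v j)))) * (\<Prod>j\<in>S. \<integral>\<^sup>+t. g j t \<partial>lborel)"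
  using assms
proof (induction S arbitrary: R rule: finite_induct)
  case empty
  then show ?case by simp
next
  case (insert k S)
  have dS: "dual_system u S v" using insert.prems(1) by (simp add: dual_system_def)
  have gS: "\<And>j. j \<in> S \<Longrightarrow> borel_fun (g j)" using insert.prems(2) by simp
  have [measurable]: "borel_fun (g k)" using insert.prems(2) by simp
  have uk: "u k \<bullet> v k = 1" and uj: "\<And>j. j \<in> S \<Longrightarrow> u j \<bullet> v k = 0"
    using insert.prems(1) insert.hyps by (auto simp: dual_system_def)
  define H where "H = (\<lambda>x. \<Prod>j\<in>S. g j (u j \<bullet> x))"
  have Hm[measurable]: "borel_fun H" unfolding H_def
  proof (rule borel_measurable_prod_ennreal)
    fix j assume "j \<in> S"
    then have [measurable]: "borel_fun (g j)" using gS by simp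
    show "borel_fun (\<lambda>x. g j (u j \<bullet> x))" by measurable
  qed
  have Hinv: "H (x + t *\<^sub>R v k) = H x" for x t
    unfolding H_def by (intro prod.cong refl) (simp add: inner_add_right uj)
  have cm[measurable]: "indicator (cball (0 :: 'a) R) \<in> borel_measurable borel" for R
    by (intro borel_measurable_indicator) simp
  define \<Psi> where "\<Psi> = (\<lambda>x :: 'a. indicator (cball 0 R) x * (H x * g k (u k \<bullet> x)) :: ennreal)"
  have \<Psi>m[measurable]: "borel_fun \<Psi>" unfolding \<Psi>_def by measurable
  have le: "\<Psi> (x + t *\<^sub>R v k) \<le> (indicator (cball 0 (R + norm (v k))) x * H x) * g k (t + u k \<bullet> x)" if t: "t \<in> {0..1}" for x t
  proof -
    have "norm x \<le> norm (x + t *\<^sub>R v k) + norm (t *\<^sub>R v k)" by (metis norm_triangle_sub add_diff_cancel_left' norm_minus_commute add.commute norm_triangle_ineq4 add_diff_cancel_right')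
    moreover have "norm (t *\<^sub>R v k) \<le> norm (v k)" using t mult_right_mono[of t 1 "norm (v k)"] by simp
    ultimately have "(indicator (cball 0 R) (x + t *\<^sub>R v k) :: ennreal) \<le> indicator (cball 0 (R + norm (v k))) x"
      by (auto split: split_indicator)
    then show ?thesis
      by (simp add: \<Psi>_def Hinv inner_add_right uk add.commute mult.assoc mult_right_mono)
  qed
  have i1: "(\<integral>\<^sup>+t. indicator {0..1::real} t \<partial>lborel) = (1 :: ennreal)" by simp
  have pm: "(\<lambda>(t, x). indicator {0..1::real} t * \<Psi> (x + t *\<^sub>R v k)) \<in> borel_measurable (lborel \<Otimes>\<^sub>M lborel)"
    by measurable
  have "(\<integral>\<^sup>+x. \<Psi> x \<partial>lborel) = (\<integral>\<^sup>+t. indicator {0..1::real} t * (\<integral>\<^sup>+x. \<Psi> x \<partial>lborel) \<partial>lborel)"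
    by (subst nn_integral_multc) (auto simp: i1)
  also have "\<dots> = (\<integral>\<^sup>+t. (\<integral>\<^sup>+x. indicator {0..1::real} t * \<Psi> (x + t *\<^sub>R v k) \<partial>lborel) \<partial>lborel)"
    by (subst nn_integral_cmult) (auto simp: nn_integral_lborel_translate[OF \<Psi>m])
  also have "\<dots> = (\<integral>\<^sup>+x. (\<integral>\<^sup>+t. indicator {0..1::real} t * \<Psi> (x + t *\<^sub>R v k) \<partial>lborel) \<partial>lborel)"
    using lborel_pair.Fubini'[OF pm] by simp
  also have "\<dots> \<le> (\<integral>\<^sup>+x. (indicator (cball 0 (R + norm (v k))) x * H x) * (\<integral>\<^sup>+t. g k t \<partial>lborel) \<partial>lborel)"
  proof (rule nn_integral_mono)
    fix x
    have "(\<integral>\<^sup>+t. indicator {0..1::real} t * \<Psi> (x + t *\<^sub>R v k) \<partial>lborel) \<le>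
      (\<integral>\<^sup>+t. (indicator (cball 0 (R + norm (v k))) x * H x) * g k (t + u k \<bullet> x) \<partial>lborel)"
      using le by (intro nn_integral_mono) (auto split: split_indicator)
    also have "\<dots> = (indicator (cball 0 (R + norm (v k))) x * H x) * (\<integral>\<^sup>+t. g k t \<partial>lborel)"
      by (subst nn_integral_cmult) (auto simp: nn_integral_lborel_translate)
    finally show "(\<integral>\<^sup>+t. indicator {0..1::real} t * \<Psi> (x + t *\<^sub>R v k) \<partial>lborel) \<le>
      (indicator (cball 0 (R + norm (v k))) x * H x) * (\<integral>\<^sup>+t. g k t \<partial>lborel)" .
  qed
  also have "\<dots> = (\<integral>\<^sup>+x. indicator (cball 0 (R + norm (v k))) x * H x \<partial>lborel) * (\<integral>\<^sup>+t. g k t \<partial>lborel)"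
    by (subst nn_integral_multc) auto
  also have "\<dots> \<le> (emeasure lborel (cball (0 :: 'a) ((R + norm (v k)) + (\<Sum>j\<in>S. norm (v j)))) *
      (\<Prod>j\<in>S. \<integral>\<^sup>+t. g j t \<partial>lborel)) * (\<integral>\<^sup>+t. g k t \<partial>lborel)"
    unfolding H_def by (intro mult_right_mono insert.IH dS gS) auto
  also have "\<dots> = emeasure lborel (cball (0 :: 'a) (R + (\<Sum>j\<in>insert k S. norm (v j)))) * (\<Prod>j\<in>insert k S. \<integral>\<^sup>+t. g j t \<partial>lborel)"
    using insert.hyps by (simp add: mult_ac add.assoc)
  finally show ?case using insert.hyps by (simp add: \<Psi>_def H_def mult_ac)
qed

text \<open>Null sets of the line pull back to null sets: apply the product estimate to the
  indicator of a Borel null set with a single direction, on balls of every integer radius.\<close>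

lemma AE_inner:
  fixes u :: "'a::euclidean_space"
  assumes u: "u \<noteq> 0" and ae: "AE t in lborel. Q t"
  shows "AE x in lborel. Q (u \<bullet> x)"
proof -
  obtain N where N: "{t. \<not> Q t} \<subseteq> N" "N \<in> sets borel" "emeasure lborel N = 0"
    using AE_E[OF ae] by auto
  have dual: "dual_system (\<lambda>_. u) {0} (\<lambda>_. (1 / (u \<bullet> u)) *\<^sub>R u)" using u by (simp add: dual_system_def)
  have Nm: "borel_fun (\<lambda>x. indicator N (u \<bullet> x) :: ennreal)" using N(2) by measurable
  have "AE x in lborel. \<forall>k::nat. indicator (cball 0 (real k)) x * (indicator N (u \<bullet> x) :: ennreal) = 0"
  proof (subst AE_all_countable, rule allI)
    fix k :: nat
    have im: "borel_fun (indicator N :: real \<Rightarrow> ennreal)" using N(2) by simp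
    have z: "(\<integral>\<^sup>+t. (indicator N t :: ennreal) \<partial>lborel) = 0" using N(2,3) by simp
    have "(\<integral>\<^sup>+x. indicator (cball 0 (real k)) x * (indicator N (u \<bullet> x) :: ennreal) \<partial>lborel) = 0"
      using local_product_estimate[OF _ dual, of "\<lambda>_. indicator N" "real k"] im z by simp
    moreover have "borel_fun (\<lambda>x. indicator (cball 0 (real k)) x * (indicator N (u \<bullet> x) :: ennreal))"
      by (intro borel_measurable_times_ennreal borel_measurable_indicator Nm) simp
    ultimately show "AE x in lborel. indicator (cball 0 (real k)) x * (indicator N (u \<bullet> x) :: ennreal) = 0"
      using nn_integral_0_iff_AE[of "\<lambda>x. indicator (cball 0 (real k)) x * (indicator N (u \<bullet> x) :: ennreal)" lborel] by simp
  qed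
  then show ?thesis
  proof (rule AE_mp, intro AE_I2 impI)
    fix x assume z: "\<forall>k::nat. indicator (cball 0 (real k)) x * (indicator N (u \<bullet> x) :: ennreal) = 0"
    obtain k :: nat where "norm x \<le> real k" using real_arch_simple by blast
    then have "u \<bullet> x \<notin> N" using z[rule_format, of k] by (auto split: split_indicator_asm)
    then show "Q (u \<bullet> x)" using N(1) by blast
  qed
qed

text \<open>For a line the chosen orthonormal basis consists of one unit vector, whichever it is,
  and the product measure over one index is \<open>lborel\<close>.\<close>

lemma line_measure:
  fixes V :: "'a::euclidean_space set"
  assumes V: "subspace V" "dim V = 1"
  shows "\<exists>b. norm b = 1 \<and> V = span {b} \<and> subspace_lebesgue V = completion (distr lborel borel (\<lambda>t. t *\<^sub>R b))"
proof -
  have "\<exists>B. orthonormal_basis V B"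
    using orthonormal_basis_subspace[OF V(1)] unfolding orthonormal_basis_def by (metis (no_types, lifting))
  then have B: "orthonormal_basis V (SOME B. orthonormal_basis V B)" by (rule someI_ex)
  define B where "B = (SOME B. orthonormal_basis V B)"
  have B: "pairwise orthogonal B" "\<forall>b\<in>B. norm b = 1" "span B = V" using B by (auto simp: orthonormal_basis_def B_def)
  have "0 \<notin> B" using B(2) by fastforce
  then have ind: "independent B" using pairwise_orthogonal_independent[OF B(1)] by blast
  have "card B = 1" using dim_span_eq_card_independent[OF ind] V(2) B(3) by simp
  then obtain b where b: "B = {b}" by (auto simp: card_1_singleton_iff)
  interpret product_sigma_finite "\<lambda>_ :: 'a. lborel :: real measure" ..
  have "distr (\<Pi>\<^sub>M b\<in>{b}. lborel) borel (\<lambda>c. c b *\<^sub>R b) = distr (distr (\<Pi>\<^sub>M b\<in>{b}. lborel) lborel (\<lambda>c. c b)) borel (\<lambda>t. t *\<^sub>R b)"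
    by (subst distr_distr) (auto simp: comp_def)
  also have "distr (\<Pi>\<^sub>M b\<in>{b}. lborel) lborel (\<lambda>c. c b) = (lborel :: real measure)" by (rule distr_singleton)
  finally have "distr (\<Pi>\<^sub>M b\<in>{b}. lborel) borel (\<lambda>c. c b *\<^sub>R b) = distr lborel borel (\<lambda>t. t *\<^sub>R b)" .
  then have "subspace_lebesgue V = completion (distr lborel borel (\<lambda>t. t *\<^sub>R b))"
    unfolding subspace_lebesgue_def B_def[symmetric] b Let_def by simp
  then show ?thesis using B b by (intro exI[of _ b]) auto
qed

lemma orth_proj_line:
  fixes b :: "'a::euclidean_space"
  assumes b: "norm b = 1"
  shows "orth_proj (span {b}) x = (b \<bullet> x) *\<^sub>R b"
  unfolding orth_proj_def
proof (rule the_equality)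
  have bb: "b \<bullet> b = 1" using b by (simp add: norm_eq_1)
  show "(b \<bullet> x) *\<^sub>R b \<in> span {b} \<and> (\<forall>v\<in>span {b}. orthogonal (x - (b \<bullet> x) *\<^sub>R b) v)"
    by (auto simp: span_singleton orthogonal_def inner_diff_left inner_diff_right bb inner_commute)
  fix y assume y: "y \<in> span {b} \<and> (\<forall>v\<in>span {b}. orthogonal (x - y) v)"
  then obtain t where t: "y = t *\<^sub>R b" by (auto simp: span_singleton)
  have "orthogonal (x - y) b" using y by (auto intro: span_base)
  then show "y = (b \<bullet> x) *\<^sub>R b" by (simp add: t orthogonal_def inner_diff_left inner_diff_right bb inner_commute)
qed

lemma line_Borel_version:
  fixes b :: "'a::euclidean_space" and f :: "'a \<Rightarrow> complex"
  assumes f: "f \<in> borel_measurable (completion (distr lborel borel (\<lambda>t. t *\<^sub>R b)))"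
  shows "\<exists>G. borel_fun G \<and> (AE t in lborel. f (t *\<^sub>R b) = G t)"
proof -
  let ?M = "distr lborel borel (\<lambda>t. t *\<^sub>R b)"
  have "(\<lambda>x. Re (f x)) \<in> borel_measurable (completion ?M)" "(\<lambda>x. Im (f x)) \<in> borel_measurable (completion ?M)"
    using f by measurable
  note c = this[THEN completion_ex_borel_measurable_real]
  obtain g where g: "g \<in> borel_measurable ?M" "AE x in ?M. Re (f x) = g x" using c(1) by (elim bexE) (rule that)
  obtain h where h: "h \<in> borel_measurable ?M" "AE x in ?M. Im (f x) = h x" using c(2) by (elim bexE) (rule that)
  have m: "(\<lambda>t. t *\<^sub>R b) \<in> lborel \<rightarrow>\<^sub>M borel" by measurable
  have [measurable]: "borel_fun g" "borel_fun h" using g(1) h(1) by simp_all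
  have "borel_fun (\<lambda>t. Complex (g (t *\<^sub>R b)) (h (t *\<^sub>R b)))"
    unfolding Complex_eq by measurable
  moreover have "AE t in lborel. f (t *\<^sub>R b) = Complex (g (t *\<^sub>R b)) (h (t *\<^sub>R b))"
    using AE_distrD[OF m g(2)] AE_distrD[OF m h(2)] by eventually_elim (simp add: complex_eq_iff)
  ultimately show ?thesis by blast
qed

text \<open>Compact support makes both suprema in \<open>C1_norm\<close> genuine bounds: the
  function and, since the complement of \<open>K\<close> is open, also its derivative vanish outside
  \<open>K\<close>. The Lipschitz bound is the mean value inequality.\<close>

lemma C1_norm_amp:
  fixes \<eta> :: "'a::euclidean_space \<Rightarrow> complex"
  assumes \<eta>: "is_C1 \<eta>" and K: "supp \<eta> \<subseteq> K" "compact K" and R: "K \<subseteq> cball 0 R"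
  shows "amp R (C1_norm \<eta>) (C1_norm \<eta>) \<eta>"
proof -
  obtain D where D: "\<And>x. (\<eta> has_derivative blinfun_apply (D x)) (at x)" "continuous_on UNIV D"
    using \<eta> unfolding is_C1_def by blast
  have cont: "continuous_on UNIV \<eta>"
    using D(1) by (intro continuous_at_imp_continuous_on) (blast intro: has_derivative_continuous)
  have z: "\<eta> x = 0" if "x \<notin> K" for x using that K(1) closure_subset[of "{x. \<eta> x \<noteq> 0}"] by (auto simp: supp_def)
  have Dz: "D x = 0" if x: "x \<notin> K" for x
  proof -
    have op: "open (- K)" using compact_imp_closed[OF K(2)] by (simp add: open_Compl)
    have "((\<lambda>_. 0) has_derivative blinfun_apply (D x)) (at x)"
      by (rule has_derivative_transform_within_open[OF D(1) op]) (use x z in auto)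
    moreover have "((\<lambda>_. 0 :: complex) has_derivative (\<lambda>_. 0)) (at x)" by (rule has_derivative_const)
    ultimately have "blinfun_apply (D x) = (\<lambda>_. 0)" by (rule has_derivative_unique)
    then show ?thesis by (intro blinfun_eqI) simp
  qed
  have bdd: "bdd_above (range (\<lambda>x. norm (f x)))" if "continuous_on UNIV f" "\<And>x. x \<notin> K \<Longrightarrow> f x = 0" for f :: "'a \<Rightarrow> 'c::real_normed_vector"
  proof -
    have "bounded (f ` K)" using that(1) K(2) by (meson compact_continuous_image compact_imp_bounded continuous_on_subset subset_UNIV)
    then obtain B where B: "\<And>x. x \<in> K \<Longrightarrow> norm (f x) \<le> B" by (auto simp: bounded_iff)
    have "norm (f x) \<le> max B 0" for x using B[of x] that(2)[of x] by (cases "x \<in> K") auto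
    then show ?thesis by (intro bdd_aboveI[of _ "max B 0"]) auto
  qed
  have fr: "frechet_derivative \<eta> (at x) = blinfun_apply (D x)" for x using frechet_derivative_at[OF D(1)] by simp
  define a where "a = (SUP x. norm (\<eta> x))"
  define b where "b = (SUP x. norm (D x))"
  have C: "C1_norm \<eta> = a + b" by (simp add: C1_norm_def a_def b_def fr norm_blinfun.rep_eq)
  have a: "norm (\<eta> x) \<le> a" for x unfolding a_def by (rule cSUP_upper[OF UNIV_I bdd[OF cont z]])
  have b: "norm (D x) \<le> b" for x unfolding b_def by (rule cSUP_upper[OF UNIV_I bdd[OF D(2) Dz]])
  have ab: "0 \<le> a" "0 \<le> b" using order_trans[OF norm_ge_zero a] order_trans[OF norm_ge_zero b] by auto
  show ?thesis unfolding amp_def C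
  proof (intro conjI allI impI)
    show "norm (\<eta> x) \<le> a + b" for x using a[of x] ab by simp
    show "\<eta> x = 0" if "R < norm x" for x
    proof (rule z)
      show "x \<notin> K" using that R by force
    qed
    fix x y
    have "norm (\<eta> x - \<eta> y) \<le> b * norm (x - y)"
      by (rule differentiable_bound[of UNIV \<eta> "\<lambda>x. blinfun_apply (D x)"])
        (use D(1) b in \<open>auto simp: norm_blinfun.rep_eq[symmetric]\<close>)
    then show "norm (\<eta> x - \<eta> y) \<le> (a + b) * norm (x - y)" using ab mult_right_mono[of b "a + b" "norm (x - y)"] by simp
  qed
qed

section \<open>Products of fewer than 2m factors\<close>

lemma top_subset_exists:
  fixes a :: "nat \<Rightarrow> real"
  assumes "finite J" "k \<le> card J"
  shows "\<exists>S\<subseteq>J. card S = k \<and> (\<forall>i\<in>S. \<forall>j\<in>J - S. a j \<le> a i)"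
  using assms(2)
proof (induction k)
  case 0
  then show ?case by (intro exI[of _ "{}"]) auto
next
  case (Suc k)
  then obtain S where S: "S \<subseteq> J" "card S = k" "\<forall>i\<in>S. \<forall>j\<in>J - S. a j \<le> a i" by auto
  have finS: "finite S" using S(1) assms(1) finite_subset by blast
  have "J - S \<noteq> {}" using S Suc.prems card_mono[OF finS, of J] by auto
  then have "Max (a ` (J - S)) \<in> a ` (J - S)" using assms(1) by (intro Max_in) auto
  then obtain i where i: "i \<in> J - S" "a i = Max (a ` (J - S))" by auto
  have "a j \<le> a i" if "j \<in> J - S" for j using that i(2) assms(1) by (simp add: Max_ge)
  then show ?case using S i finS by (intro exI[of _ "insert i S"]) auto
qed

text \<open>Let \<open>S\<close> hold the largest values, m of them if possible. Because
  \<open>card J < 2 * m\<close>, at most \<open>card S - 1\<close> factors remain outside if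
  \<open>J\<close> is nonempty, each at most the smallest value in \<open>S\<close>, so they are
  dominated by the product over \<open>S\<close> without any one chosen element. The spared element
  pays for the repeated factor \<open>a j0\<close>.\<close>

lemma product_by_top_squares:
  fixes a :: "nat \<Rightarrow> real"
  assumes J: "finite J" and m: "0 < m" and card: "card J < 2 * m" and a: "\<And>j. j \<in> J \<Longrightarrow> 1 \<le> a j"
  shows "\<exists>S\<subseteq>J. card S \<le> m \<and> (\<Prod>j\<in>J. a j) \<le> (\<Prod>j\<in>S. (a j)\<^sup>2) \<and> (\<forall>j0\<in>J. a j0 * (\<Prod>j\<in>J. a j) \<le> (\<Prod>j\<in>S. (a j)\<^sup>2))"
proof -
  define k where "k = min m (card J)"
  obtain S where S: "S \<subseteq> J" "card S = k" "\<forall>i\<in>S. \<forall>j\<in>J - S. a j \<le> a i"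
    using top_subset_exists[OF J, of k a] by (auto simp: k_def)
  have finS: "finite S" using S(1) J finite_subset by blast
  have aS: "\<And>j. j \<in> S \<Longrightarrow> 1 \<le> a j" using a S(1) by blast
  have main: "a j0 * (\<Prod>j\<in>J. a j) \<le> (\<Prod>j\<in>S. (a j)\<^sup>2)" if j0: "j0 \<in> J" for j0
  proof -
    have k0: "k > 0" using j0 J m by (auto simp: k_def card_gt_0_iff)
    then have Sne: "S \<noteq> {}" using S(2) by auto
    obtain i0 where i0: "i0 \<in> S" "a j0 \<le> a i0"
    proof (cases "j0 \<in> S")
      case False
      obtain i where "i \<in> S" using Sne by blast
      then show ?thesis using that[of i] S(3) j0 False by blast
    qed (use that in blast)
    define \<theta> where "\<theta> = Min (a ` S)"
    have \<theta>in: "\<theta> \<in> a ` S" unfolding \<theta>_def using finS Sne by (intro Min_in) auto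
    have \<theta>le: "\<theta> \<le> a i" if "i \<in> S" for i unfolding \<theta>_def using that finS by (intro Min_le) auto
    have \<theta>1: "1 \<le> \<theta>" using \<theta>in aS by auto
    have upper: "a j \<le> \<theta>" if "j \<in> J - S" for j using \<theta>in S(3) that by auto
    have "card (J - S) = card J - k" using S finS by (simp add: card_Diff_subset)
    also have "\<dots> \<le> k - 1" using card k0 by (auto simp: k_def min_def)
    finally have cd: "card (J - S) \<le> k - 1" .
    have "(\<Prod>j\<in>J - S. a j) \<le> (\<Prod>j\<in>J - S. \<theta>)" using upper a by (intro prod_mono) (force)
    also have "\<dots> = \<theta> ^ card (J - S)" by simp
    also have "\<dots> \<le> \<theta> ^ (k - 1)" by (rule power_increasing[OF cd \<theta>1])
    also have "\<dots> = (\<Prod>j\<in>S - {i0}. \<theta>)" using S(2) i0 finS by simp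
    also have "\<dots> \<le> (\<Prod>j\<in>S - {i0}. a j)" using \<theta>le \<theta>1 by (intro prod_mono) auto
    finally have rest: "(\<Prod>j\<in>J - S. a j) \<le> (\<Prod>j\<in>S - {i0}. a j)" .
    have nn: "0 \<le> (\<Prod>j\<in>S. a j)" "0 \<le> (\<Prod>j\<in>J - S. a j)" using a S(1) by (auto intro!: prod_nonneg) (force)+
    have "a j0 * (\<Prod>j\<in>J. a j) = (\<Prod>j\<in>S. a j) * (a j0 * (\<Prod>j\<in>J - S. a j))"
      using prod.subset_diff[OF S(1) J, of a] by simp
    also have "\<dots> \<le> (\<Prod>j\<in>S. a j) * (a i0 * (\<Prod>j\<in>S - {i0}. a j))"
      using aS[OF i0(1)] by (intro mult_left_mono mult_mono i0 rest nn) auto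
    also have "a i0 * (\<Prod>j\<in>S - {i0}. a j) = (\<Prod>j\<in>S. a j)" using prod.remove[OF finS i0(1), of a] by simp
    also have "(\<Prod>j\<in>S. a j) * (\<Prod>j\<in>S. a j) = (\<Prod>j\<in>S. (a j)\<^sup>2)" by (simp add: power2_eq_square prod.distrib)
    finally show ?thesis .
  qed
  have "(\<Prod>j\<in>J. a j) \<le> (\<Prod>j\<in>S. (a j)\<^sup>2)"
  proof (cases "J = {}")
    case True
    then show ?thesis using S(1) by simp
  next
    case False
    then obtain j0 where j0: "j0 \<in> J" by blast
    have "0 \<le> (\<Prod>j\<in>J. a j)" using a by (intro prod_nonneg) force
    then have "(\<Prod>j\<in>J. a j) \<le> a j0 * (\<Prod>j\<in>J. a j)" using a[OF j0] by (simp add: mult_le_cancel_right1)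
    then show ?thesis using main[OF j0] by linarith
  qed
  then show ?thesis using S main by (intro exI[of _ S]) (auto simp: k_def)
qed

section \<open>The hypotheses of the statement in terms of direction vectors\<close>

lemma general_position_dual_system:
  fixes u :: "nat \<Rightarrow> 'a::euclidean_space"
  assumes gp: "general_position 1 n V" and u: "\<And>j. j \<in> {1..n} \<Longrightarrow> V j = span {u j}"
    and S: "S \<subseteq> {1..n}" "card S \<le> DIM('a)"
  shows "\<exists>v. dual_system u S v"
proof (cases "S = {}")
  case True
  then show ?thesis by (simp add: dual_system_def)
next
  case False
  have fin: "finite S" using S(1) finite_subset by blast
  have "(\<Union>j\<in>S. V j) \<subseteq> span (u ` S)"
  proof
    fix x assume "x \<in> (\<Union>j\<in>S. V j)"
    then obtain j where j: "j \<in> S" "x \<in> span {u j}" using u S(1) by auto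
    have "span {u j} \<subseteq> span (u ` S)" using j(1) by (intro span_mono) auto
    then show "x \<in> span (u ` S)" using j(2) by blast
  qed
  \<comment> \<open>Dimension count: the vectors \<open>u j\<close> with \<open>j\<close> in
    \<open>S\<close> generate a space of dimension \<open>card S\<close>, so they are distinct and
    independent.\<close>
  then have "dim (span (\<Union>j\<in>S. V j)) \<le> dim (span (u ` S))" by (intro dim_subset span_minimal subspace_span)
  moreover have "dim (span (\<Union>j\<in>S. V j)) = card S" using gp S False unfolding general_position_def by auto
  moreover have "dim (u ` S) \<le> card (u ` S)" using fin by (intro dim_le_card') auto
  moreover have "card (u ` S) \<le> card S" using fin by (rule card_image_le)
  ultimately have eq: "card (u ` S) = card S" "dim (u ` S) = card (u ` S)" by auto
  have inj: "inj_on u S" using eq(1) fin by (intro eq_card_imp_inj_on)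
  have "independent (u ` S)"
    by (rule card_le_dim_spanning[of "u ` S" "u ` S"]) (use eq fin in \<open>auto intro: span_base\<close>)
  then show ?thesis by (rule exists_dual_system[OF inj])
qed

text \<open>A degenerate polynomial divided by \<open>l\<close> is one of the candidates in the
  infimum that defines the relative norm, and homogeneity of the norm restores the factor
  \<open>\<bar>l\<bar>\<close>.\<close>

lemma relative_norm_degenerate:
  fixes u :: "nat \<Rightarrow> real ^ 'm::finite"
  assumes nrm: "norm_on (polys_le d) (nrm d)" and P: "P \<in> polys_le d"
    and u: "\<And>j. j \<in> {1..n} \<Longrightarrow> norm (u j) = 1 \<and> V j = span {u j}"
    and c: "c \<le> relative_norm nrm d n V P" and w: "w \<in> degenerate d u {1..n}"
  shows "\<bar>l\<bar> * c \<le> nrm d (\<lambda>x. l * P x - w x)"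
proof -
  obtain a g where g: "\<forall>j\<in>{1..n}. degree (g j) \<le> d" "w = (\<lambda>x. a + (\<Sum>j=1..n. poly (g j) (u j \<bullet> x)))"
    using w unfolding degenerate_def by blast
  have wp: "w \<in> polys_le d" unfolding g(2) using g(1)
    by (intro polys_le_add polys_le_const polys_le_sum1 polys_le_poly_inner) auto
  have nn: "\<And>p. p \<in> polys_le d \<Longrightarrow> 0 \<le> nrm d p" and sc: "\<And>p a. p \<in> polys_le d \<Longrightarrow> nrm d (\<lambda>x. a * p x) = \<bar>a\<bar> * nrm d p"
    using nrm by (auto simp: norm_on_def)
  show ?thesis
  proof (cases "l = 0")
    case True
    have "(\<lambda>x. l * P x - w x) \<in> polys_le d" by (intro polys_le_diff polys_le_scale P wp)
    from nn[OF this] show ?thesis using True by simp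
  next
    case l: False
    have pp: "(\<lambda>x. P x - w x / l) \<in> polys_le d" using polys_le_scale[OF wp, of "1 / l"] by (intro polys_le_diff P) simp
    have eq: "nrm d (\<lambda>x. l * P x - w x) = \<bar>l\<bar> * nrm d (\<lambda>x. P x - w x / l)"
      using sc[OF pp, of l] l by (simp add: right_diff_distrib)
    have "relative_norm nrm d n V P \<le> nrm d (\<lambda>x. P x - w x / l)"
    proof (cases "n = 0")
      case True
      have "(INF a. nrm d (\<lambda>x. P x - a)) \<le> nrm d (\<lambda>x. P x - a / l)"
        by (rule cINF_lower[OF bdd_belowI[of _ 0] UNIV_I]) (auto intro!: nn polys_le_diff P polys_le_const)
      then show ?thesis using True by (simp add: relative_norm_def g(2))
    next
      case n: False
      \<comment> \<open>The relative norm provides no separate constant when \<open>n > 0\<close>,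
        so \<open>a / l\<close> is put into the polynomial with index 1.\<close>
      define p where "p = (\<lambda>j y. poly (smult (1 / l) (g j) + (if j = 1 then [:a / l:] else 0)) (u j \<bullet> y))"
      have pm: "\<forall>j\<in>{1..n}. p j \<in> polys_le d" unfolding p_def
        using g(1) by (intro ballI polys_le_poly_inner degree_add_le order_trans[OF degree_smult_le]) auto
      have proj: "orth_proj (V j) x = (u j \<bullet> x) *\<^sub>R u j" if "j \<in> {1..n}" for j x
        using u[OF that] orth_proj_line[of "u j" x] by (elim conjE) (simp only:)
      have sm: "(\<Sum>j=1..n. p j (orth_proj (V j) x)) = w x / l" for x
      proof -
        have "p j (orth_proj (V j) x) = poly (g j) (u j \<bullet> x) / l + (if j = 1 then a / l else 0)" if j: "j \<in> {1..n}" for j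
        proof -
          have "u j \<bullet> u j = 1" using u[OF j] by (simp add: norm_eq_1)
          then show ?thesis by (simp add: p_def proj[OF j])
        qed
        then have "(\<Sum>j=1..n. p j (orth_proj (V j) x)) = (\<Sum>j=1..n. poly (g j) (u j \<bullet> x) / l) + (\<Sum>j=1..n. if j = 1 then a / l else 0)"
          by (simp add: sum.distrib)
        also have "(\<Sum>j=1..n. if j = 1 then a / l else 0) = a / l" using n by simp
        finally show ?thesis by (simp add: g(2) sum_divide_distrib add_divide_distrib)
      qed
      \<comment> \<open>Every candidate lies in \<open>polys_le d\<close>, because a polynomial
        restricted to the line is a one-variable polynomial in \<open>u j \<bullet> x\<close>. Hence
        all norms are nonnegative and the infimum is a lower bound.\<close>
      have mem: "(\<lambda>x. P x - (\<Sum>j=1..n. q j (orth_proj (V j) x))) \<in> polys_le d" if q: "\<forall>j\<in>{1..n}. q j \<in> polys_le d" for q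
      proof (intro polys_le_diff P polys_le_sum1)
        fix j assume j: "j \<in> {1..n}"
        obtain r where r: "degree r \<le> d" "\<And>t. q j (0 + t *\<^sub>R u j) = poly r t"
          using polys_le_on_line[of "q j" d 0 "u j"] q j by blast
        have "(\<lambda>x. q j (orth_proj (V j) x)) = (\<lambda>x. poly r (u j \<bullet> x))" using r(2) by (simp add: proj[OF j])
        then show "(\<lambda>x. q j (orth_proj (V j) x)) \<in> polys_le d" using polys_le_poly_inner[OF r(1)] by simp
      qed
      have "(INF p \<in> {p. \<forall>j\<in>{1..n}. p j \<in> polys_le d}. nrm d (\<lambda>x. P x - (\<Sum>j=1..n. p j (orth_proj (V j) x)))) \<le>
          nrm d (\<lambda>x. P x - (\<Sum>j=1..n. p j (orth_proj (V j) x)))"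
        by (rule cINF_lower[OF bdd_belowI[of _ 0]]) (use pm in \<open>auto simp del: One_nat_def intro!: nn mem\<close>)
      from this[unfolded sm] show ?thesis unfolding relative_norm_def if_not_P[OF n] .
    qed
    then show ?thesis unfolding eq using c by (intro mult_left_mono) auto
  qed
qed

subsection \<open>Square integrable functions\<close>

abbreviation unit_L2 :: "(real \<Rightarrow> complex) \<Rightarrow> bool" where
  "unit_L2 F \<equiv> borel_fun F \<and> (\<integral>\<^sup>+t. ennreal ((norm (F t))\<^sup>2) \<partial>lborel) \<le> 1"

lemma prod_mono_ennreal:
  fixes f g :: "'b \<Rightarrow> ennreal"
  shows "(\<And>i. i \<in> A \<Longrightarrow> f i \<le> g i) \<Longrightarrow> (\<Prod>i\<in>A. f i) \<le> (\<Prod>i\<in>A. g i)"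
  by (induction A rule: infinite_finite_induct) (auto intro: mult_mono)

text \<open>The second part, with one factor repeated, serves the truncation: where a value exceeds
  \<open>T\<close>, the repeated factor yields a gain \<open>1 / T\<close>.\<close>

abbreviation product_bound :: "real \<Rightarrow> (nat \<Rightarrow> 'a::euclidean_space) \<Rightarrow> nat set \<Rightarrow> (nat \<Rightarrow> real \<Rightarrow> complex) \<Rightarrow> real \<Rightarrow> bool" where
  "product_bound R u J H C \<equiv>
    (\<integral>\<^sup>+x. indicator (cball 0 R) x * ennreal (\<Prod>j\<in>J. max 1 (norm (H j (u j \<bullet> x)))) \<partial>lborel) \<le> ennreal C \<and>
    (\<forall>k\<in>J. (\<integral>\<^sup>+x. indicator (cball 0 R) x *
      ennreal (max 1 (norm (H k (u k \<bullet> x))) * (\<Prod>j\<in>J. max 1 (norm (H j (u j \<bullet> x))))) \<partial>lborel) \<le> ennreal C)"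

text \<open>At every point the product is dominated by a product of squares over some set of at most
  m indices. This set depends on the point; summing over all such sets gives one dominating
  function, and every summand is integrable by independence of at most m directions.\<close>

lemma large_values_estimate:
  fixes u :: "nat \<Rightarrow> real ^ 'm::finite"
  assumes J: "finite J" "card J < 2 * CARD('m)" and un: "\<And>j. j \<in> J \<Longrightarrow> norm (u j) = 1"
    and gp: "\<And>S. S \<subseteq> J \<Longrightarrow> card S \<le> CARD('m) \<Longrightarrow> \<exists>v. dual_system u S v"
  shows "\<exists>C\<ge>0. \<forall>H. (\<forall>j\<in>J. unit_L2 (H j)) \<longrightarrow>
    product_bound R u J H C"
proof -
  define \<S> where "\<S> = {S. S \<subseteq> J \<and> card S \<le> CARD('m)}"
  have fin\<S>: "finite \<S>" using J by (simp add: \<S>_def)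
  have "\<forall>S\<in>\<S>. \<exists>v. dual_system u S v" using gp by (auto simp: \<S>_def)
  from bchoice[OF this] obtain v where v: "\<And>S. S \<in> \<S> \<Longrightarrow> dual_system u S (v S)" by blast
  define c where "c = (\<lambda>S. measure lborel (cball (0 :: real ^ 'm) (R + (\<Sum>j\<in>S. norm (v S j)))) * (2 * \<bar>R\<bar> + 1) ^ card S)"
  have c0: "c S \<ge> 0" for S by (simp add: c_def)
  define C where "C = (\<Sum>S\<in>\<S>. c S)"
  have C: "C \<ge> 0" unfolding C_def using c0 by (intro sum_nonneg) auto
  show ?thesis
  proof (rule exI[of _ C], rule conjI[OF C], intro allI impI)
    fix H :: "nat \<Rightarrow> real \<Rightarrow> complex"
    assume H: "\<forall>j\<in>J. unit_L2 (H j)"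
    define a where "a = (\<lambda>j t. max 1 (norm (H j t)))"
    \<comment> \<open>\<open>(max 1 (norm z))\<^sup>2\<close> is at most
      \<open>1 + (norm z)\<^sup>2\<close>. The 1 is restricted to the interval that contains every
      \<open>u j \<bullet> x\<close> with \<open>x\<close> in the ball, so that the integral over
      the line stays finite.\<close>
    define g where "g = (\<lambda>j t. indicator {-\<bar>R\<bar>..\<bar>R\<bar>} t + ennreal ((norm (H j t))\<^sup>2))"
    have gm: "borel_fun (g j)" if "j \<in> J" for j
    proof -
      have [measurable]: "borel_fun (H j)" using H that by simp
      show ?thesis unfolding g_def by measurable
    qed
    have gi: "(\<integral>\<^sup>+t. g j t \<partial>lborel) \<le> ennreal (2 * \<bar>R\<bar> + 1)" if j: "j \<in> J" for j
    proof -
      have [measurable]: "borel_fun (H j)" using H j by simp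
      have "(\<integral>\<^sup>+t. g j t \<partial>lborel) = ennreal (2 * \<bar>R\<bar>) + (\<integral>\<^sup>+t. ennreal ((norm (H j t))\<^sup>2) \<partial>lborel)"
        unfolding g_def by (subst nn_integral_add) auto
      also have "\<dots> \<le> ennreal (2 * \<bar>R\<bar>) + 1" using H j by (intro add_left_mono) auto
      also have "\<dots> = ennreal (2 * \<bar>R\<bar> + 1)" by (simp add: ennreal_plus)
      finally show ?thesis .
    qed
    define Z where "Z = (\<lambda>x :: real ^ 'm. \<Sum>S\<in>\<S>. indicator (cball 0 R) x * (\<Prod>j\<in>S. g j (u j \<bullet> x)))"
    have Zi: "(\<integral>\<^sup>+x. Z x \<partial>lborel) \<le> ennreal C"
    proof -
      have "(\<integral>\<^sup>+x. Z x \<partial>lborel) = (\<Sum>S\<in>\<S>. \<integral>\<^sup>+x. indicator (cball 0 R) x * (\<Prod>j\<in>S. g j (u j \<bullet> x)) \<partial>lborel)"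
        unfolding Z_def
      proof (rule nn_integral_sum)
        fix S assume S: "S \<in> \<S>"
        have "borel_fun (\<lambda>x. \<Prod>j\<in>S. g j (u j \<bullet> x))"
        proof (rule borel_measurable_prod_ennreal)
          fix j assume "j \<in> S"
          then have [measurable]: "borel_fun (g j)" using gm S by (auto simp: \<S>_def)
          show "borel_fun (\<lambda>x. g j (u j \<bullet> x))" by measurable
        qed
        then have "borel_fun (\<lambda>x. indicator (cball 0 R) x * (\<Prod>j\<in>S. g j (u j \<bullet> x)))"
          by (intro borel_measurable_times_ennreal borel_measurable_indicator) auto
        then show "(\<lambda>x. indicator (cball 0 R) x * (\<Prod>j\<in>S. g j (u j \<bullet> x))) \<in> borel_measurable lborel" by simp
      qed
      also have "\<dots> \<le> (\<Sum>S\<in>\<S>. ennreal (c S))"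
      proof (rule sum_mono)
        fix S assume S: "S \<in> \<S>"
        then have SJ: "S \<subseteq> J" by (simp add: \<S>_def)
        have "(\<integral>\<^sup>+x. indicator (cball 0 R) x * (\<Prod>j\<in>S. g j (u j \<bullet> x)) \<partial>lborel) \<le>
          emeasure lborel (cball (0 :: real ^ 'm) (R + (\<Sum>j\<in>S. norm (v S j)))) * (\<Prod>j\<in>S. \<integral>\<^sup>+t. g j t \<partial>lborel)"
          by (rule local_product_estimate[OF finite_subset[OF SJ J(1)] v[OF S] gm]) (use SJ in auto)
        also have "\<dots> \<le> emeasure lborel (cball (0 :: real ^ 'm) (R + (\<Sum>j\<in>S. norm (v S j)))) * (\<Prod>j\<in>S. ennreal (2 * \<bar>R\<bar> + 1))"
          using SJ by (intro mult_left_mono prod_mono_ennreal gi) auto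
        also have "\<dots> = ennreal (c S)"
        proof -
          have pw: "(\<Prod>j\<in>S. ennreal (2 * \<bar>R\<bar> + 1)) = ennreal ((2 * \<bar>R\<bar> + 1) ^ card S)"
            unfolding prod_constant by (rule ennreal_power) simp
          have em: "emeasure lborel (cball (0 :: real ^ 'm) r) = ennreal (measure lborel (cball (0 :: real ^ 'm) r))" for r
            by (rule emeasure_eq_ennreal_measure) (use emeasure_lborel_cball_finite[of "0 :: real ^ 'm" r] in auto)
          show ?thesis unfolding em pw c_def by (rule ennreal_mult[symmetric]) auto
        qed
        finally show "(\<integral>\<^sup>+x. indicator (cball 0 R) x * (\<Prod>j\<in>S. g j (u j \<bullet> x)) \<partial>lborel) \<le> ennreal (c S)" .
      qed
      also have "\<dots> = ennreal C" unfolding C_def using c0 by (intro sum_ennreal) auto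
      finally show ?thesis .
    qed
    have point: "indicator (cball 0 R) x * ennreal (\<Prod>j\<in>J. a j (u j \<bullet> x)) \<le> Z x \<and>
      (\<forall>k\<in>J. indicator (cball 0 R) x * ennreal (a k (u k \<bullet> x) * (\<Prod>j\<in>J. a j (u j \<bullet> x))) \<le> Z x)" for x
    proof (cases "x \<in> cball 0 R")
      case True
      then have xR: "norm x \<le> R" by simp
      have "\<exists>S\<subseteq>J. card S \<le> CARD('m) \<and> (\<Prod>j\<in>J. a j (u j \<bullet> x)) \<le> (\<Prod>j\<in>S. (a j (u j \<bullet> x))\<^sup>2) \<and>
        (\<forall>k\<in>J. a k (u k \<bullet> x) * (\<Prod>j\<in>J. a j (u j \<bullet> x)) \<le> (\<Prod>j\<in>S. (a j (u j \<bullet> x))\<^sup>2))"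
        by (rule product_by_top_squares[OF J(1) _ J(2)]) (auto simp: a_def)
      then obtain S where S: "S \<subseteq> J" "card S \<le> CARD('m)" "(\<Prod>j\<in>J. a j (u j \<bullet> x)) \<le> (\<Prod>j\<in>S. (a j (u j \<bullet> x))\<^sup>2)"
        "\<forall>k\<in>J. a k (u k \<bullet> x) * (\<Prod>j\<in>J. a j (u j \<bullet> x)) \<le> (\<Prod>j\<in>S. (a j (u j \<bullet> x))\<^sup>2)"
        by (elim exE conjE) (rule that)
      have ag: "ennreal ((a j (u j \<bullet> x))\<^sup>2) \<le> g j (u j \<bullet> x)" if j: "j \<in> S" for j
      proof -
        have "\<bar>u j \<bullet> x\<bar> \<le> norm (u j) * norm x" by (rule Cauchy_Schwarz_ineq2)
        then have "\<bar>u j \<bullet> x\<bar> \<le> \<bar>R\<bar>" using un[of j] j S(1) xR by auto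
        then have ind: "indicator {-\<bar>R\<bar>..\<bar>R\<bar>} (u j \<bullet> x) = (1 :: ennreal)" by (auto split: split_indicator)
        have "(a j (u j \<bullet> x))\<^sup>2 \<le> 1 + (norm (H j (u j \<bullet> x)))\<^sup>2" by (auto simp: a_def max_def)
        then have "ennreal ((a j (u j \<bullet> x))\<^sup>2) \<le> ennreal (1 + (norm (H j (u j \<bullet> x)))\<^sup>2)" by (rule ennreal_leI)
        also have "\<dots> = g j (u j \<bullet> x)" by (simp add: g_def ind ennreal_plus)
        finally show ?thesis .
      qed
      have "ennreal (\<Prod>j\<in>S. (a j (u j \<bullet> x))\<^sup>2) = (\<Prod>j\<in>S. ennreal ((a j (u j \<bullet> x))\<^sup>2))" by (simp add: prod_ennreal)
      also have "\<dots> \<le> (\<Prod>j\<in>S. g j (u j \<bullet> x))" by (rule prod_mono_ennreal[OF ag])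
      also have "\<dots> = indicator (cball 0 R) x * (\<Prod>j\<in>S. g j (u j \<bullet> x))" using True by simp
      also have "\<dots> \<le> Z x" unfolding Z_def using S(1,2) by (intro member_le_sum fin\<S>) (auto simp: \<S>_def)
      finally have le: "ennreal (\<Prod>j\<in>S. (a j (u j \<bullet> x))\<^sup>2) \<le> Z x" .
      have "ennreal (\<Prod>j\<in>J. a j (u j \<bullet> x)) \<le> Z x" by (rule order_trans[OF ennreal_leI[OF S(3)] le])
      moreover have "ennreal (a k (u k \<bullet> x) * (\<Prod>j\<in>J. a j (u j \<bullet> x))) \<le> Z x" if "k \<in> J" for k
        by (rule order_trans[OF ennreal_leI[OF bspec[OF S(4) that]] le])
      ultimately show ?thesis using True by simp
    qed simp
    have b1: "(\<integral>\<^sup>+x. indicator (cball 0 R) x * ennreal (\<Prod>j\<in>J. max 1 (norm (H j (u j \<bullet> x)))) \<partial>lborel) \<le> ennreal C"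
      by (rule order_trans[OF nn_integral_mono Zi]) (use point in \<open>simp add: a_def\<close>)
    have b2: "(\<integral>\<^sup>+x. indicator (cball 0 R) x * ennreal (max 1 (norm (H k (u k \<bullet> x))) * (\<Prod>j\<in>J. max 1 (norm (H j (u j \<bullet> x))))) \<partial>lborel) \<le> ennreal C"
      if "k \<in> J" for k
      by (rule order_trans[OF nn_integral_mono Zi]) (use point that in \<open>simp add: a_def\<close>)
    show "product_bound R u J H C"
      using b1 b2 by blast
  qed
qed

lemma powr_rescale:
  fixes c l \<epsilon> :: real
  assumes "0 < c" "0 \<le> l" "0 < \<epsilon>"
  shows "(1 + l * c) powr - \<epsilon> \<le> min 1 c powr - \<epsilon> * (1 + l) powr - \<epsilon>"
proof -
  have "min 1 c * (1 + l) = min 1 c + l * min 1 c" by (simp add: ring_distribs mult.commute)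
  also have "\<dots> \<le> 1 + l * c" using assms by (intro add_mono mult_left_mono) auto
  finally have "(1 + l * c) powr - \<epsilon> \<le> (min 1 c * (1 + l)) powr - \<epsilon>"
    using assms by (intro powr_mono2') auto
  also have "\<dots> = min 1 c powr - \<epsilon> * (1 + l) powr - \<epsilon>" by (rule powr_mult)
  finally show ?thesis .
qed

abbreviation L2_decay :: "((real ^ 'm::finite \<Rightarrow> real) \<Rightarrow> real) \<Rightarrow> nat \<Rightarrow> real \<Rightarrow> (nat \<Rightarrow> real ^ 'm) \<Rightarrow> nat set \<Rightarrow>
    (real ^ 'm \<Rightarrow> complex) \<Rightarrow> real \<Rightarrow> real \<Rightarrow> bool" where
  "L2_decay nrm d c u J \<eta> K \<epsilon> \<equiv> \<forall>l H. \<forall>P\<in>polys_le d. (\<forall>j\<in>J. unit_L2 (H j)) \<longrightarrow>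
    nondegenerate nrm d u J (\<bar>l\<bar> * c) (\<lambda>x. l * P x) \<longrightarrow>
    integrable lborel (\<lambda>x. cis (l * P x) * ((\<Prod>j\<in>J. H j (u j \<bullet> x)) * \<eta> x)) \<and>
    norm (osc u J H (\<lambda>x. l * P x) \<eta>) \<le> K * (1 + \<bar>l\<bar>) powr - \<epsilon>"

text \<open>Functions truncated at height \<open>T\<close> and divided by it are admissible for the
  bounded estimate, which then loses \<open>T ^ n\<close>. Where the truncation acts, some function
  exceeds \<open>T\<close>, and the bound with a repeated factor gains \<open>1 / T\<close>.\<close>

lemma square_integrable_decay:
  fixes u :: "nat \<Rightarrow> real ^ 'm::finite"
  assumes J: "finite J" "card J < 2 * CARD('m)" and un: "\<And>j. j \<in> J \<Longrightarrow> norm (u j) = 1"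
    and gp: "\<And>S. S \<subseteq> J \<Longrightarrow> card S \<le> CARD('m) \<Longrightarrow> \<exists>v. dual_system u S v"
    and claim: "osc_claim nrm d R u J" and c: "0 < c" and \<eta>: "amp R M M \<eta>"
  shows "\<exists>K. \<exists>\<epsilon>>0. L2_decay nrm d c u J \<eta> K \<epsilon>"
proof -
  obtain C1 \<epsilon>1 where C1: "C1 > 0" "\<epsilon>1 > 0" "osc_claim_with nrm d R u J C1 \<epsilon>1"
    using claim unfolding osc_claim_def by (elim exE conjE) (rule that)
  have "\<exists>C\<ge>0. \<forall>H. (\<forall>j\<in>J. unit_L2 (H j)) \<longrightarrow>
    product_bound R u J H C"
    by (rule large_values_estimate[OF J]) (rule un, assumption, rule gp)
  then obtain C where C: "C \<ge> 0" "\<forall>H. (\<forall>j\<in>J. unit_L2 (H j)) \<longrightarrow>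
    product_bound R u J H C"
    by (elim exE conjE) (rule that)
  define n where "n = card J"
  \<comment> \<open>Dividing by \<open>n + 1\<close> equalises the two errors: \<open>T ^ n\<close>
    times the bounded decay with exponent \<open>\<epsilon>1\<close> is exactly
    \<open>1 / T\<close>.\<close>
  define \<epsilon> where "\<epsilon> = \<epsilon>1 / (real n + 1)"
  have \<epsilon>: "\<epsilon> > 0" using C1 by (simp add: \<epsilon>_def)
  have M: "M \<ge> 0" by (rule ampD(4)[OF \<eta>])
  define K where "K = C1 * M * min 1 c powr - \<epsilon>1 + real n * (M * C)"
  show ?thesis
  proof (rule exI[of _ K], rule exI[of _ \<epsilon>], rule conjI[OF \<epsilon>], intro allI ballI impI)
    fix l :: real and H :: "nat \<Rightarrow> real \<Rightarrow> complex" and P :: "real ^ 'm \<Rightarrow> real"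
    assume P: "P \<in> polys_le d" and H: "\<forall>j\<in>J. unit_L2 (H j)"
      and N: "nondegenerate nrm d u J (\<bar>l\<bar> * c) (\<lambda>x. l * P x)"
    note CH = C(2)[THEN spec, THEN mp, OF H]
    have lP: "(\<lambda>x. l * P x) \<in> polys_le d" by (rule polys_le_scale[OF P])
    define T where "T = (1 + \<bar>l\<bar>) powr \<epsilon>"
    have T1: "T \<ge> 1" unfolding T_def using \<epsilon> by (intro ge_one_powr_ge_zero) auto
    define F where "F = (\<lambda>j t. if norm (H j t) \<le> T then H j t / complex_of_real T else 0)"
    have Fu: "unit_bdd F J" unfolding unit_bdd_def
    proof (intro ballI conjI allI)
      fix j t assume "j \<in> J"
      then have [measurable]: "borel_fun (H j)" using H by simp
      show "borel_fun (F j)" unfolding F_def by measurable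
      show "norm (F j t) \<le> 1" using T1 by (simp add: F_def norm_divide)
    qed
    define G where "G = (\<lambda>x. \<Prod>j\<in>J. max 1 (norm (H j (u j \<bullet> x))))"
    define I where "I = (\<lambda>x. cis (l * P x) * ((\<Prod>j\<in>J. H j (u j \<bullet> x)) * \<eta> x))"
    define I' where "I' = (\<lambda>x. cis (l * P x) * ((\<Prod>j\<in>J. F j (u j \<bullet> x)) * \<eta> x))"
    have prodm: "borel_fun (\<lambda>x. \<Prod>j\<in>J. H j (u j \<bullet> x))"
    by (rule borel_measurable_prod_inner) (use H in simp)
    have Im: "borel_fun I"
    proof -
      note [measurable] = prodm polys_le_measurable[OF lP] bdd_suppD(1)[OF amp_bdd_supp[OF \<eta>]]
      show ?thesis unfolding I_def by measurable
    qed
    have Gm0: "borel_fun G" unfolding G_def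
    proof (rule borel_measurable_prod_inner[where F = "\<lambda>j t. max 1 (norm (H j t))"])
      fix j assume "j \<in> J"
      then have [measurable]: "borel_fun (H j)" using H by simp
      show "borel_fun (\<lambda>t. max 1 (norm (H j t)))" by measurable
    qed
    have Hle: "norm (\<Prod>j\<in>J. H j (u j \<bullet> x)) \<le> G x" for x
      unfolding G_def prod_norm[symmetric] by (intro prod_mono) auto
    have G1: "G x \<ge> 0" for x unfolding G_def by (intro prod_nonneg) auto
    have \<eta>b: "norm (\<eta> x) \<le> M * indicator (cball 0 R) x" for x
      using ampD(1,3)[OF \<eta>, of x] by (auto split: split_indicator)
    have Ib: "norm (I x) \<le> G x * (M * indicator (cball 0 R) x)" for x
      unfolding I_def norm_mult norm_cis mult_1 by (intro mult_mono Hle \<eta>b G1) auto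
    have Iint: "integrable lborel I"
    proof (rule integrableI_bounded)
      show "I \<in> borel_measurable lborel" using Im by simp
      have "(\<integral>\<^sup>+x. ennreal (norm (I x)) \<partial>lborel) \<le> (\<integral>\<^sup>+x. ennreal M * (indicator (cball 0 R) x * ennreal (G x)) \<partial>lborel)"
      proof (rule nn_integral_mono)
        fix x
        have "ennreal (norm (I x)) \<le> ennreal (G x * (M * indicator (cball 0 R) x))" by (rule ennreal_leI[OF Ib])
        also have "\<dots> = ennreal M * (indicator (cball 0 R) x * ennreal (G x))"
          using M G1 by (auto simp: ennreal_mult mult.commute split: split_indicator)
        finally show "ennreal (norm (I x)) \<le> ennreal M * (indicator (cball 0 R) x * ennreal (G x))" .
      qed
      also have "\<dots> = ennreal M * (\<integral>\<^sup>+x. indicator (cball 0 R) x * ennreal (G x) \<partial>lborel)"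
      proof (rule nn_integral_cmult)
        from Gm0 have "borel_fun (\<lambda>x. indicator (cball 0 R) x * ennreal (G x))"
          by (intro borel_measurable_times_ennreal borel_measurable_indicator measurable_compose[OF _ measurable_ennreal]) auto
        then show "(\<lambda>x. indicator (cball 0 R) x * ennreal (G x)) \<in> borel_measurable lborel" by simp
      qed
      also have "\<dots> \<le> ennreal M * ennreal C" using CH unfolding G_def by (intro mult_left_mono) auto
      also have "\<dots> < \<infinity>" by (simp add: ennreal_mult_less_top)
      finally show "(\<integral>\<^sup>+x. ennreal (norm (I x)) \<partial>lborel) < \<infinity>" .
    qed
    have I'i: "integrable lborel I'"
      unfolding I'_def by (rule bdd_supp_integrable[OF osc_integrand_bdd_supp[OF lP Fu \<eta>]])
    have TI: "integrable lborel (\<lambda>x. complex_of_real (T ^ n) * I' x)" using I'i by simp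
    \<comment> \<open>Either no function is truncated at \<open>x\<close> and the two integrands
      agree after rescaling, or the truncated product is zero and some factor larger than
      \<open>T\<close> permits multiplication by
      \<open>max 1 (norm (H k (u k \<bullet> x))) / T\<close>, which exceeds 1.\<close>
    have diff: "norm (I x - complex_of_real (T ^ n) * I' x) \<le>
      (\<Sum>k\<in>J. (M / T) * (indicator (cball 0 R) x * (max 1 (norm (H k (u k \<bullet> x))) * G x)))" for x
    proof -
      have term0: "0 \<le> (M / T) * (indicator (cball 0 R) x * (max 1 (norm (H k (u k \<bullet> x))) * G x))" for k
        using M T1 G1[of x] by (intro mult_nonneg_nonneg) auto
      show ?thesis
      proof (cases "\<forall>j\<in>J. norm (H j (u j \<bullet> x)) \<le> T")
        case True
        have "(\<Prod>j\<in>J. H j (u j \<bullet> x)) = (\<Prod>j\<in>J. complex_of_real T * F j (u j \<bullet> x))"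
          using True T1 by (intro prod.cong refl) (auto simp: F_def)
        then have "I x = complex_of_real (T ^ n) * I' x" by (simp add: I_def I'_def prod.distrib n_def mult_ac)
        then show ?thesis using term0 by (simp add: sum_nonneg)
      next
        case False
        then obtain k where k: "k \<in> J" "T < norm (H k (u k \<bullet> x))" by force
        then have "F k (u k \<bullet> x) = 0" by (simp add: F_def)
        then have "(\<Prod>j\<in>J. F j (u j \<bullet> x)) = 0" using J k(1) by (auto simp: prod_zero_iff)
        then have "norm (I x - complex_of_real (T ^ n) * I' x) = norm (I x)" by (simp add: I'_def)
        also have "\<dots> \<le> 1 * (G x * (M * indicator (cball 0 R) x))" using Ib by simp
        also have "\<dots> \<le> (max 1 (norm (H k (u k \<bullet> x))) / T) * (G x * (M * indicator (cball 0 R) x))"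
          using k T1 M G1[of x] by (intro mult_right_mono) auto
        also have "\<dots> = (M / T) * (indicator (cball 0 R) x * (max 1 (norm (H k (u k \<bullet> x))) * G x))" by simp
        also have "\<dots> \<le> (\<Sum>k\<in>J. (M / T) * (indicator (cball 0 R) x * (max 1 (norm (H k (u k \<bullet> x))) * G x)))"
          by (rule member_le_sum[OF k(1) _ J(1)]) (rule term0)
        finally show ?thesis .
      qed
    qed
    have dint: "ennreal (norm (LBINT x. I x - complex_of_real (T ^ n) * I' x)) \<le> ennreal (real n * (M / T * C))"
    proof -
      have Gm: "(\<lambda>x. indicator (cball 0 R) x * ennreal (max 1 (norm (H k (u k \<bullet> x))) * G x)) \<in> borel_measurable lborel" if k: "k \<in> J" for k
      proof -
        note Gm0
        moreover have "borel_fun (\<lambda>x. max 1 (norm (H k (u k \<bullet> x))))"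
        proof -
          have [measurable]: "borel_fun (H k)" using H k by simp
          show ?thesis by measurable
        qed
        ultimately have "borel_fun (\<lambda>x. indicator (cball 0 R) x * ennreal (max 1 (norm (H k (u k \<bullet> x))) * G x))"
          by (intro borel_measurable_times_ennreal borel_measurable_indicator measurable_compose[OF _ measurable_ennreal] borel_measurable_times) auto
        then show ?thesis by simp
      qed
      have "ennreal (norm (LBINT x. I x - complex_of_real (T ^ n) * I' x)) \<le>
        (\<integral>\<^sup>+x. ennreal (norm (I x - complex_of_real (T ^ n) * I' x)) \<partial>lborel)"
        by (rule integral_norm_bound_ennreal[OF Bochner_Integration.integrable_diff[OF Iint TI]])
      also have "\<dots> \<le> (\<integral>\<^sup>+x. (\<Sum>k\<in>J. ennreal (M / T) * (indicator (cball 0 R) x * ennreal (max 1 (norm (H k (u k \<bullet> x))) * G x))) \<partial>lborel)"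
      proof (rule nn_integral_mono)
        fix x
        have "ennreal (norm (I x - complex_of_real (T ^ n) * I' x)) \<le>
          ennreal (\<Sum>k\<in>J. (M / T) * (indicator (cball 0 R) x * (max 1 (norm (H k (u k \<bullet> x))) * G x)))"
          by (rule ennreal_leI[OF diff])
        also have "\<dots> = (\<Sum>k\<in>J. ennreal ((M / T) * (indicator (cball 0 R) x * (max 1 (norm (H k (u k \<bullet> x))) * G x))))"
          using M T1 G1[of x] by (intro sum_ennreal[symmetric] mult_nonneg_nonneg) auto
        also have "\<dots> = (\<Sum>k\<in>J. ennreal (M / T) * (indicator (cball 0 R) x * ennreal (max 1 (norm (H k (u k \<bullet> x))) * G x)))"
          using M T1 G1[of x] by (intro sum.cong refl) (auto simp: ennreal_mult[symmetric] split: split_indicator)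
        finally show "ennreal (norm (I x - complex_of_real (T ^ n) * I' x)) \<le>
          (\<Sum>k\<in>J. ennreal (M / T) * (indicator (cball 0 R) x * ennreal (max 1 (norm (H k (u k \<bullet> x))) * G x)))" .
      qed
      also have "\<dots> = (\<Sum>k\<in>J. \<integral>\<^sup>+x. ennreal (M / T) * (indicator (cball 0 R) x * ennreal (max 1 (norm (H k (u k \<bullet> x))) * G x)) \<partial>lborel)"
        by (rule nn_integral_sum) (rule borel_measurable_times_ennreal[OF borel_measurable_const Gm])
      also have "\<dots> \<le> (\<Sum>k\<in>J. ennreal (M / T * C))"
      proof (rule sum_mono)
        fix k assume k: "k \<in> J"
        have "(\<integral>\<^sup>+x. ennreal (M / T) * (indicator (cball 0 R) x * ennreal (max 1 (norm (H k (u k \<bullet> x))) * G x)) \<partial>lborel) =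
          ennreal (M / T) * (\<integral>\<^sup>+x. indicator (cball 0 R) x * ennreal (max 1 (norm (H k (u k \<bullet> x))) * G x) \<partial>lborel)"
          by (rule nn_integral_cmult[OF Gm[OF k]])
        also have "\<dots> \<le> ennreal (M / T) * ennreal C" using CH k unfolding G_def by (intro mult_left_mono) auto
        also have "\<dots> = ennreal (M / T * C)" using M T1 C(1) by (intro ennreal_mult[symmetric]) auto
        finally show "(\<integral>\<^sup>+x. ennreal (M / T) * (indicator (cball 0 R) x * ennreal (max 1 (norm (H k (u k \<bullet> x))) * G x)) \<partial>lborel) \<le> ennreal (M / T * C)" .
      qed
      also have "\<dots> = ennreal (\<Sum>k\<in>J. M / T * C)" using M T1 C(1) by (intro sum_ennreal) auto
      finally show ?thesis by (simp add: n_def)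
    qed
    have d2: "norm (LBINT x. I x - complex_of_real (T ^ n) * I' x) \<le> real n * (M / T * C)"
      using dint M T1 C(1) by (subst (asm) ennreal_le_iff) auto
    have b1: "norm (LBINT x. I' x) \<le> C1 * M * (min 1 c powr - \<epsilon>1 * (1 + \<bar>l\<bar>) powr - \<epsilon>1)"
    proof -
      have lc: "0 \<le> \<bar>l\<bar> * c" using c by simp
      have "norm (osc u J F (\<lambda>x. l * P x) \<eta>) \<le> C1 * M * (1 + \<bar>l\<bar> * c) powr - \<epsilon>1"
        using C1(3)[rule_format, OF lP Fu \<eta> lc] N by blast
      also have "\<dots> \<le> C1 * M * (min 1 c powr - \<epsilon>1 * (1 + \<bar>l\<bar>) powr - \<epsilon>1)"
        using C1 M c by (intro mult_left_mono powr_rescale) auto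
      finally show ?thesis by (simp add: osc_def I'_def)
    qed
    have "(LBINT x. I x) = complex_of_real (T ^ n) * (LBINT x. I' x) + (LBINT x. I x - complex_of_real (T ^ n) * I' x)"
      by (subst Bochner_Integration.integral_diff[OF Iint TI]) simp
    then have "norm (LBINT x. I x) \<le> norm (complex_of_real (T ^ n) * (LBINT x. I' x)) + norm (LBINT x. I x - complex_of_real (T ^ n) * I' x)"
      using norm_triangle_ineq by metis
    also have "\<dots> \<le> T ^ n * (C1 * M * (min 1 c powr - \<epsilon>1 * (1 + \<bar>l\<bar>) powr - \<epsilon>1)) + real n * (M / T * C)"
      using T1 unfolding norm_mult norm_of_real by (intro add_mono d2 mult_mono b1) auto
    also have "\<dots> = K * (1 + \<bar>l\<bar>) powr - \<epsilon>"
    proof -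
      have Ti: "1 / T = (1 + \<bar>l\<bar>) powr - \<epsilon>" by (simp add: T_def powr_minus divide_inverse)
      have "T ^ n * (1 + \<bar>l\<bar>) powr - \<epsilon>1 = (1 + \<bar>l\<bar>) powr (\<epsilon> * real n) * (1 + \<bar>l\<bar>) powr - \<epsilon>1"
        using T1 by (simp add: T_def powr_realpow[symmetric] powr_powr)
      also have "\<dots> = (1 + \<bar>l\<bar>) powr (\<epsilon> * real n + - \<epsilon>1)" by (rule powr_add[symmetric])
      also have "\<epsilon> * real n + - \<epsilon>1 = - \<epsilon>" by (simp add: \<epsilon>_def field_simps)
      finally have T2: "T ^ n * (1 + \<bar>l\<bar>) powr - \<epsilon>1 = (1 + \<bar>l\<bar>) powr - \<epsilon>" .
      have "T ^ n * (C1 * M * (min 1 c powr - \<epsilon>1 * (1 + \<bar>l\<bar>) powr - \<epsilon>1)) + real n * (M / T * C) =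
        C1 * M * min 1 c powr - \<epsilon>1 * (T ^ n * (1 + \<bar>l\<bar>) powr - \<epsilon>1) + real n * (M * C) * (1 / T)" by simp
      also have "\<dots> = K * (1 + \<bar>l\<bar>) powr - \<epsilon>" unfolding T2 Ti K_def by (simp add: ring_distribs)
      finally show ?thesis .
    qed
    finally have "norm (LBINT x. I x) \<le> K * (1 + \<bar>l\<bar>) powr - \<epsilon>" .
    then show "integrable lborel (\<lambda>x. cis (l * P x) * ((\<Prod>j\<in>J. H j (u j \<bullet> x)) * \<eta> x)) \<and>
        norm (osc u J H (\<lambda>x. l * P x) \<eta>) \<le> K * (1 + \<bar>l\<bar>) powr - \<epsilon>"
      using Iint by (simp add: osc_def I_def)
  qed
qed

section \<open>Return to functions on the lines and to the forms of the statement\<close>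

lemma Lambda_eq_osc:
  fixes u :: "nat \<Rightarrow> real ^ 'm::finite" and a :: "nat \<Rightarrow> real"
  assumes V: "\<And>j. j \<in> {1..n} \<Longrightarrow> norm (u j) = 1 \<and> V j = span {u j}"
    and F: "\<And>j. j \<in> {1..n} \<Longrightarrow> borel_fun (F j)"
    and f: "\<And>j. j \<in> {1..n} \<Longrightarrow> AE t in lborel. f j (t *\<^sub>R u j) = complex_of_real (a j) * F j t"
    and P: "P \<in> polys_le d" and \<eta>: "borel_fun \<eta>"
  shows "Lambda n V P \<eta> l f = (\<Prod>j=1..n. complex_of_real (a j)) * osc u {1..n} F (\<lambda>x. l * P x) \<eta>" (is ?eq)
    and "integrable lborel (\<lambda>x. cis (l * P x) * ((\<Prod>j=1..n. F j (u j \<bullet> x)) * \<eta> x)) \<Longrightarrow>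
      integrable lebesgue (Lambda_integrand n V P \<eta> l f)" (is "?i \<Longrightarrow> ?i'")
proof -
  define B where "B = (\<lambda>x. (\<Prod>j=1..n. complex_of_real (a j)) * (cis (l * P x) * ((\<Prod>j=1..n. F j (u j \<bullet> x)) * \<eta> x)))"
  have Bm: "borel_fun B"
  proof -
    have "borel_fun (\<lambda>x. \<Prod>j=1..n. F j (u j \<bullet> x))"
    by (rule borel_measurable_prod_inner[OF F])
    note [measurable] = this \<eta> polys_le_measurable[OF P]
    show ?thesis unfolding B_def by measurable
  qed
  \<comment> \<open>Each \<open>f j\<close> agrees with its Borel representative only almost
    everywhere on its line; \<open>AE_inner\<close> carries the agreement to almost every point of
    the space.\<close>
  have "AE x in lborel. \<forall>j\<in>{1..n}. f j ((u j \<bullet> x) *\<^sub>R u j) = complex_of_real (a j) * F j (u j \<bullet> x)"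
  proof (rule AE_finite_allI)
    fix j assume j: "j \<in> {1..n}"
    have "u j \<noteq> 0" using V[OF j] by auto
    from AE_inner[OF this f[OF j]] show "AE x in lborel. f j ((u j \<bullet> x) *\<^sub>R u j) = complex_of_real (a j) * F j (u j \<bullet> x)" .
  qed simp
  then have "AE x in lborel. B x = Lambda_integrand n V P \<eta> l f x"
  proof (rule AE_mp, intro AE_I2 impI)
    fix x assume x: "\<forall>j\<in>{1..n}. f j ((u j \<bullet> x) *\<^sub>R u j) = complex_of_real (a j) * F j (u j \<bullet> x)"
    have "f j (orth_proj (V j) x) = complex_of_real (a j) * F j (u j \<bullet> x)" if j: "j \<in> {1..n}" for j
    proof -
      have "norm (u j) = 1" "V j = span {u j}" using V[OF j] by auto
      then show ?thesis using x j orth_proj_line[of "u j" x] by simp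
    qed
    then have "(\<Prod>j=1..n. f j (orth_proj (V j) x)) = (\<Prod>j=1..n. complex_of_real (a j) * F j (u j \<bullet> x))"
      by (intro prod.cong) auto
    then show "B x = Lambda_integrand n V P \<eta> l f x"
      by (simp add: B_def Lambda_integrand_def cis_conv_exp prod.distrib mult_ac)
  qed
  then have ae: "AE x in lebesgue. B x = Lambda_integrand n V P \<eta> l f x" by (rule AE_completion)
  have Bl: "B \<in> borel_measurable lebesgue" using Bm by (intro measurable_completion) simp
  have Ll: "Lambda_integrand n V P \<eta> l f \<in> borel_measurable lebesgue" by (rule borel_measurable_AE[OF Bl ae])
  have "Lambda n V P \<eta> l f = (LINT x|lebesgue. B x)" unfolding Lambda_def
    by (rule integral_cong_AE[OF Ll Bl]) (use ae in \<open>eventually_elim, simp\<close>)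
  also have "\<dots> = (LBINT x. B x)" using Bm by (intro integral_completion) simp
  also have "\<dots> = (\<Prod>j=1..n. complex_of_real (a j)) * osc u {1..n} F (\<lambda>x. l * P x) \<eta>"
    by (simp only: B_def osc_def integral_mult_right_zero)
  finally show ?eq .
  show ?i' if ?i
  proof -
    have "integrable lborel B" unfolding B_def using that by (rule integrable_mult_right)
    then have "integrable lebesgue B" using Bm by (subst integrable_completion) auto
    then show ?thesis using integrable_cong_AE[OF Bl Ll ae] by simp
  qed
qed

text \<open>The essential supremum is a nonnegative real number, because norms are nonnegative and
  the line has positive measure. It can therefore be taken out as a factor.\<close>

lemma Linf_representative:
  fixes b :: "'a::euclidean_space"
  assumes V: "subspace_lebesgue V = completion (distr lborel borel (\<lambda>t. t *\<^sub>R b))" and f: "f \<in> Linf_on V"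
  shows "0 \<le> Linf_norm V f \<and> (\<exists>F. borel_fun F \<and> (\<forall>t. norm (F t) \<le> 1) \<and>
    (AE t in lborel. f (t *\<^sub>R b) = complex_of_real (Linf_norm V f) * F t))"
proof -
  let ?M = "distr lborel borel (\<lambda>t. t *\<^sub>R b)"
  define s where "s = esssup (subspace_lebesgue V) (\<lambda>x. ereal (norm (f x)))"
  have fm: "f \<in> borel_measurable (completion ?M)" and sfin: "s < \<infinity>" using f V by (auto simp: Linf_on_def s_def)
  obtain G where G: "borel_fun G" "AE t in lborel. f (t *\<^sub>R b) = G t"
    using line_Borel_version[OF fm] by (elim exE conjE) (rule that)
  have "AE x in completion ?M. ereal (norm (f x)) \<le> s"
    unfolding s_def V by (rule esssup_AE)
  then have "AE x in ?M. ereal (norm (f x)) \<le> s" by (simp only: AE_completion_iff)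
  then have bd: "AE t in lborel. ereal (norm (f (t *\<^sub>R b))) \<le> s" by (rule AE_distrD[rotated]) simp
  have s0: "0 \<le> s"
  proof (rule ccontr)
    assume "\<not> 0 \<le> s"
    then have "\<not> ereal (norm z) \<le> s" for z :: complex using order_trans[of 0 "ereal (norm z)" s] by auto
    then have "AE t in (lborel :: real measure). False" using bd by simp
    then show False by (simp add: eventually_False ae_filter_eq_bot_iff)
  qed
  define L where "L = Linf_norm V f"
  have sL: "s = ereal L" unfolding L_def Linf_norm_def s_def[symmetric] using s0 sfin by (cases s) auto
  have L0: "0 \<le> L" using s0 by (simp add: sL)
  \<comment> \<open>Cutting off where the norm exceeds \<open>L\<close> makes the bound hold
    everywhere and not just almost everywhere. For \<open>L = 0\<close> division by zero gives 0, in
    agreement with \<open>G t = 0\<close> where the first branch applies.\<close>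
  define F where "F = (\<lambda>t. if norm (G t) \<le> L then G t / complex_of_real L else 0)"
  have "borel_fun F"
  proof -
    note [measurable] = G(1)
    show ?thesis unfolding F_def by measurable
  qed
  moreover have "norm (F t) \<le> 1" for t using L0 by (auto simp: F_def norm_divide divide_le_eq)
  moreover have "AE t in lborel. f (t *\<^sub>R b) = complex_of_real L * F t"
    using bd G(2)
  proof eventually_elim
    case (elim t)
    then have "norm (G t) \<le> L" by (simp add: sL)
    then show ?case using elim(2) by (auto simp: F_def)
  qed
  ultimately show ?thesis using L0 unfolding L_def by blast
qed

text \<open>The square integral over the completed measure on the line is transported to a Borel
  integral over the parameter, after replacing the integrand by an almost everywhere equal Borel
  function.\<close>

lemma L2_representative:
  fixes b :: "'a::euclidean_space"
  assumes V: "subspace_lebesgue V = completion (distr lborel borel (\<lambda>t. t *\<^sub>R b))" and f: "f \<in> L2_on V"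
  shows "0 \<le> L2_norm_on V f \<and> (\<exists>F. unit_L2 F \<and>
    (AE t in lborel. f (t *\<^sub>R b) = complex_of_real (L2_norm_on V f) * F t))"
proof -
  let ?M = "distr lborel borel (\<lambda>t. t *\<^sub>R b)"
  have fm: "f \<in> borel_measurable (completion ?M)" and fi: "integrable (completion ?M) (\<lambda>x. (norm (f x))\<^sup>2)"
    using f V by (auto simp: L2_on_def)
  obtain G where G: "borel_fun G" "AE t in lborel. f (t *\<^sub>R b) = G t"
    using line_Borel_version[OF fm] by (elim exE conjE) (rule that)
  note [measurable] = G(1)
  define L where "L = L2_norm_on V f"
  define q where "q = (LINT x|completion ?M. (norm (f x))\<^sup>2)"
  have q0: "q \<ge> 0" by (simp add: q_def)
  have L: "L = sqrt q" by (simp add: L_def L2_norm_on_def V q_def)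
  have L0: "0 \<le> L" by (simp add: L q0)
  have "(\<integral>\<^sup>+x. ennreal ((norm (f x))\<^sup>2) \<partial>completion ?M) = ennreal q"
    unfolding q_def by (rule nn_integral_eq_integral[OF fi]) simp
  moreover obtain g where g: "g \<in> borel_measurable ?M" "AE x in ?M. ennreal ((norm (f x))\<^sup>2) = g x"
  proof -
    have "(\<lambda>x. ennreal ((norm (f x))\<^sup>2)) \<in> borel_measurable (completion ?M)" using fm by measurable
    from completion_ex_borel_measurable[OF this] show ?thesis by (elim bexE) (rule that)
  qed
  moreover have "(\<integral>\<^sup>+x. ennreal ((norm (f x))\<^sup>2) \<partial>completion ?M) = (\<integral>\<^sup>+x. g x \<partial>completion ?M)"
    by (rule nn_integral_cong_AE[OF AE_completion[OF g(2)]])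
  moreover have "(\<integral>\<^sup>+x. g x \<partial>completion ?M) = (\<integral>\<^sup>+x. g x \<partial>?M)" by (rule nn_integral_completion)
  moreover have "(\<integral>\<^sup>+x. g x \<partial>?M) = (\<integral>\<^sup>+t. g (t *\<^sub>R b) \<partial>lborel)" using g(1) by (intro nn_integral_distr) auto
  moreover have "(\<integral>\<^sup>+t. g (t *\<^sub>R b) \<partial>lborel) = (\<integral>\<^sup>+t. ennreal ((norm (G t))\<^sup>2) \<partial>lborel)"
  proof (rule nn_integral_cong_AE)
    have "AE t in lborel. ennreal ((norm (f (t *\<^sub>R b)))\<^sup>2) = g (t *\<^sub>R b)"
      by (rule AE_distrD[OF _ g(2)]) simp
    with G(2) show "AE t in lborel. g (t *\<^sub>R b) = ennreal ((norm (G t))\<^sup>2)" by eventually_elim simp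
  qed
  ultimately have Gq: "(\<integral>\<^sup>+t. ennreal ((norm (G t))\<^sup>2) \<partial>lborel) = ennreal q" by simp
  define F where "F = (\<lambda>t. G t / complex_of_real L)"
  have Fm: "borel_fun F" unfolding F_def by measurable
  have "(\<integral>\<^sup>+t. ennreal ((norm (F t))\<^sup>2) \<partial>lborel) \<le> 1 \<and> (AE t in lborel. f (t *\<^sub>R b) = complex_of_real L * F t)"
  proof (cases "L = 0")
    \<comment> \<open>With norm zero, \<open>F\<close> is the zero function by the convention for
      division, and the factorisation holds because \<open>G\<close> vanishes almost
      everywhere.\<close>
    case True
    then have "q = 0" using L by simp
    then have "(\<integral>\<^sup>+t. ennreal ((norm (G t))\<^sup>2) \<partial>lborel) = 0" using Gq by simp
    then have "AE t in lborel. ennreal ((norm (G t))\<^sup>2) = 0"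
      using nn_integral_0_iff_AE[of "\<lambda>t. ennreal ((norm (G t))\<^sup>2)" lborel] by simp
    with G(2) have "AE t in lborel. f (t *\<^sub>R b) = complex_of_real L * F t" by eventually_elim (simp add: F_def)
    then show ?thesis by (simp add: F_def True)
  next
    case False
    then have Lp: "L > 0" using L0 by simp
    have qL: "q = L\<^sup>2" using q0 by (simp add: L)
    have "(\<integral>\<^sup>+t. ennreal ((norm (F t))\<^sup>2) \<partial>lborel) = (\<integral>\<^sup>+t. ennreal (1 / L\<^sup>2) * ennreal ((norm (G t))\<^sup>2) \<partial>lborel)"
      using Lp by (intro nn_integral_cong) (simp add: F_def norm_divide power_divide ennreal_mult[symmetric])
    also have "\<dots> = ennreal (1 / L\<^sup>2) * ennreal q" by (subst nn_integral_cmult) (auto simp: Gq)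
    also have "\<dots> = ennreal (1 / L\<^sup>2 * q)" using q0 by (intro ennreal_mult[symmetric]) auto
    also have "\<dots> = 1" using Lp by (simp add: qL)
    finally have 1: "(\<integral>\<^sup>+t. ennreal ((norm (F t))\<^sup>2) \<partial>lborel) \<le> 1" by simp
    have "AE t in lborel. f (t *\<^sub>R b) = complex_of_real L * F t" using G(2) by eventually_elim (use Lp in \<open>simp add: F_def\<close>)
    with 1 show ?thesis by blast
  qed
  then show ?thesis using Fm L0 unfolding L_def by blast
qed

theorem theorem2p1:
  fixes V :: "nat \<Rightarrow> (real ^ 'm) set"
    and n :: nat
    and nrm :: "nat \<Rightarrow> (real ^ 'm \<Rightarrow> real) \<Rightarrow> real"
  assumes "CARD('m) \<ge> 2"
    and "n < 2 * CARD('m)"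
    and "\<And>d. norm_on (polys_le d) (nrm d)"
    and "general_position 1 n V"
  shows "uniform_power_decay nrm n V \<and>
    (\<forall>d c \<eta>. 0 < c \<and> is_C1 \<eta> \<and> compact (supp \<eta>) \<longrightarrow>
      (\<exists>C. \<exists>\<epsilon>>0. \<forall>l f P.
         (\<forall>j\<in>{1..n}. f j \<in> L2_on (V j)) \<and>
         P \<in> polys_le d \<and> c \<le> relative_norm nrm d n V P \<longrightarrow>
         integrable lebesgue (Lambda_integrand n V P \<eta> l f) \<and>
         norm (Lambda n V P \<eta> l f)
           \<le> C * (1 + \<bar>l\<bar>) powr (- \<epsilon>) * (\<Prod>j=1..n. L2_norm_on (V j) (f j))))"
proof -
  have "\<forall>j\<in>{1..n}. \<exists>b. norm b = 1 \<and> V j = span {b} \<and> subspace_lebesgue (V j) = completion (distr lborel borel (\<lambda>t. t *\<^sub>R b))"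
    using line_measure assms(4) unfolding general_position_def by auto
  from bchoice[OF this] obtain u where
    u_all: "\<forall>j\<in>{1..n}. norm (u j) = 1 \<and> V j = span {u j} \<and> subspace_lebesgue (V j) = completion (distr lborel borel (\<lambda>t. t *\<^sub>R u j))"
    by (elim exE) (rule that)
  have u: "norm (u j) = 1 \<and> V j = span {u j}" and uV: "V j = span {u j}" and un: "norm (u j) = 1"
    and leb: "subspace_lebesgue (V j) = completion (distr lborel borel (\<lambda>t. t *\<^sub>R u j))" if "j \<in> {1..n}" for j
    using u_all that by blast+
  let ?J = "{1..n}"
  have fJ: "finite ?J" by simp
  have cJ: "card ?J < 2 * CARD('m)" using assms(2) by simp
  have gp: "\<exists>v. dual_system u S v" if "S \<subseteq> ?J" "card S \<le> CARD('m)" for S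
    by (rule general_position_dual_system[OF assms(4) uV]) (use that in auto)
  have claim: "osc_claim (nrm d) d R u ?J" for d R
    by (rule osc_claim_general_position[OF assms(3) fJ cJ gp])
  \<comment> \<open>The factor \<open>l\<close> in the phase scales the distance to the degenerate
    polynomials, so the estimates are used with \<open>N = \<bar>l\<bar> * c\<close>;
    \<open>powr_rescale\<close> converts the result into decay in
    \<open>1 + \<bar>l\<bar>\<close>.\<close>
  have rel: "nondegenerate (nrm d) d u ?J (\<bar>l\<bar> * c) (\<lambda>x. l * P x)"
    if "P \<in> polys_le d" "c \<le> relative_norm nrm d n V P" for d c l P
    using relative_norm_degenerate[OF assms(3) that(1) u that(2)] by blast
  have unif: "\<exists>\<epsilon>>0. \<exists>C. \<forall>l f \<eta> P.
          (\<forall>j\<in>{1..n}. f j \<in> Linf_on (V j)) \<and> is_C1 \<eta> \<and> supp \<eta> \<subseteq> K \<and>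
          P \<in> polys_le d \<and> c \<le> relative_norm nrm d n V P \<longrightarrow>
          norm (Lambda n V P \<eta> l f)
            \<le> C * C1_norm \<eta> * (1 + \<bar>l\<bar>) powr (- \<epsilon>) * (\<Prod>j=1..n. Linf_norm (V j) (f j))"
    if c: "0 < c" and K: "compact K" for d c K
  proof -
    \<comment> \<open>The set \<open>K\<close> enters the estimates through this radius only, which
      makes them uniform over all amplitudes supported in \<open>K\<close>.\<close>
    obtain R where R: "K \<subseteq> cball 0 R" using compact_imp_bounded[OF K] by (auto simp: bounded_iff subset_iff)
    obtain C \<epsilon> where C: "C > 0" "\<epsilon> > 0" "osc_claim_with (nrm d) d R u ?J C \<epsilon>"
      using claim[of d R] unfolding osc_claim_def by (elim exE conjE) (rule that)
    show ?thesis
    proof (rule exI[of _ \<epsilon>], rule conjI[OF C(2)], rule exI[of _ "C * min 1 c powr - \<epsilon>"], intro allI impI, elim conjE)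
      fix l f and \<eta> :: "real ^ 'm \<Rightarrow> complex" and P
      assume f: "\<forall>j\<in>?J. f j \<in> Linf_on (V j)" and \<eta>: "is_C1 \<eta>" "supp \<eta> \<subseteq> K" and P: "P \<in> polys_le d"
        and rc: "c \<le> relative_norm nrm d n V P"
      define a where "a = (\<lambda>j. Linf_norm (V j) (f j))"
      have "\<forall>j\<in>?J. \<exists>F. borel_fun F \<and> (\<forall>t. norm (F t) \<le> 1) \<and>
          (AE t in lborel. f j (t *\<^sub>R u j) = complex_of_real (a j) * F t)"
        using Linf_representative[OF leb] f unfolding a_def by blast
      from bchoice[OF this] obtain F where F: "\<forall>j\<in>?J. borel_fun (F j) \<and> (\<forall>t. norm (F j t) \<le> 1) \<and>
          (AE t in lborel. f j (t *\<^sub>R u j) = complex_of_real (a j) * F j t)" by (elim exE) (rule that)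
      have a0: "0 \<le> a j" if "j \<in> ?J" for j using Linf_representative[OF leb[OF that]] f that unfolding a_def by blast
      have np: "norm (\<Prod>j=1..n. complex_of_real (a j)) = (\<Prod>j=1..n. a j)"
        unfolding prod_norm[symmetric] using a0 by (intro prod.cong) auto
      have amp: "amp R (C1_norm \<eta>) (C1_norm \<eta>) \<eta>" by (rule C1_norm_amp[OF \<eta> K R])
      have Fu: "unit_bdd F ?J" using F unfolding unit_bdd_def by blast
      have lP: "(\<lambda>x. l * P x) \<in> polys_le d" by (rule polys_le_scale[OF P])
      have lc: "0 \<le> \<bar>l\<bar> * c" using c by simp
      have "norm (osc u ?J F (\<lambda>x. l * P x) \<eta>) \<le> C * C1_norm \<eta> * (1 + \<bar>l\<bar> * c) powr - \<epsilon>"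
        using C(3)[rule_format, OF lP Fu amp lc] rel[OF P rc, of l] by blast
      also have "\<dots> \<le> C * C1_norm \<eta> * (min 1 c powr - \<epsilon> * (1 + \<bar>l\<bar>) powr - \<epsilon>)"
        using C ampD(4)[OF amp] c by (intro mult_left_mono powr_rescale) auto
      finally have osc: "norm (osc u ?J F (\<lambda>x. l * P x) \<eta>) \<le> C * min 1 c powr - \<epsilon> * C1_norm \<eta> * (1 + \<bar>l\<bar>) powr - \<epsilon>"
        by (simp add: mult_ac)
      have "Lambda n V P \<eta> l f = (\<Prod>j=1..n. complex_of_real (a j)) * osc u ?J F (\<lambda>x. l * P x) \<eta>"
        by (rule Lambda_eq_osc(1)[OF u _ _ P bdd_suppD(1)[OF amp_bdd_supp[OF amp]]]) (use F in auto)
      then have "norm (Lambda n V P \<eta> l f) = (\<Prod>j=1..n. a j) * norm (osc u ?J F (\<lambda>x. l * P x) \<eta>)"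
        by (simp only: norm_mult np)
      also have "\<dots> \<le> (\<Prod>j=1..n. a j) * (C * min 1 c powr - \<epsilon> * C1_norm \<eta> * (1 + \<bar>l\<bar>) powr - \<epsilon>)"
        using a0 by (intro mult_left_mono osc prod_nonneg) auto
      finally show "norm (Lambda n V P \<eta> l f) \<le> C * min 1 c powr - \<epsilon> * C1_norm \<eta> * (1 + \<bar>l\<bar>) powr (- \<epsilon>) * (\<Prod>j=1..n. Linf_norm (V j) (f j))"
        by (simp add: a_def mult_ac)
    qed
  qed
  have L2: "\<exists>C. \<exists>\<epsilon>>0. \<forall>l f P.
         (\<forall>j\<in>{1..n}. f j \<in> L2_on (V j)) \<and>
         P \<in> polys_le d \<and> c \<le> relative_norm nrm d n V P \<longrightarrow>
         integrable lebesgue (Lambda_integrand n V P \<eta> l f) \<and>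
         norm (Lambda n V P \<eta> l f)
           \<le> C * (1 + \<bar>l\<bar>) powr (- \<epsilon>) * (\<Prod>j=1..n. L2_norm_on (V j) (f j))"
    if c: "0 < c" and \<eta>: "is_C1 \<eta>" "compact (supp \<eta>)" for d c and \<eta> :: "real ^ 'm \<Rightarrow> complex"
  proof -
    obtain R where R: "supp \<eta> \<subseteq> cball 0 R" using compact_imp_bounded[OF \<eta>(2)] by (auto simp: bounded_iff subset_iff)
    have amp: "amp R (C1_norm \<eta>) (C1_norm \<eta>) \<eta>" by (rule C1_norm_amp[OF \<eta>(1) order_refl \<eta>(2) R])
    have "\<exists>K. \<exists>\<epsilon>>0. L2_decay (nrm d) d c u ?J \<eta> K \<epsilon>"
      by (rule square_integrable_decay[OF fJ cJ un gp claim c amp])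
    then obtain K \<epsilon> where K: "\<epsilon> > 0" "L2_decay (nrm d) d c u ?J \<eta> K \<epsilon>"
      by (elim exE conjE) (rule that)
    show ?thesis
    proof (rule exI[of _ K], rule exI[of _ \<epsilon>], rule conjI[OF K(1)], intro allI impI, elim conjE)
      fix l f P
      assume f: "\<forall>j\<in>?J. f j \<in> L2_on (V j)" and P: "P \<in> polys_le d" and rc: "c \<le> relative_norm nrm d n V P"
      define a where "a = (\<lambda>j. L2_norm_on (V j) (f j))"
      have "\<forall>j\<in>?J. \<exists>F. unit_L2 F \<and>
          (AE t in lborel. f j (t *\<^sub>R u j) = complex_of_real (a j) * F t)"
        using L2_representative[OF leb] f unfolding a_def by blast
      from bchoice[OF this] obtain F where F: "\<forall>j\<in>?J. unit_L2 (F j) \<and>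
          (AE t in lborel. f j (t *\<^sub>R u j) = complex_of_real (a j) * F j t)" by (elim exE) (rule that)
      have a0: "0 \<le> a j" if "j \<in> ?J" for j using L2_representative[OF leb[OF that]] f that unfolding a_def by blast
      have np: "norm (\<Prod>j=1..n. complex_of_real (a j)) = (\<Prod>j=1..n. a j)"
        unfolding prod_norm[symmetric] using a0 by (intro prod.cong) auto
      have F1: "\<forall>j\<in>?J. unit_L2 (F j)" using F by blast
      have o: "integrable lborel (\<lambda>x. cis (l * P x) * ((\<Prod>j\<in>?J. F j (u j \<bullet> x)) * \<eta> x)) \<and>
        norm (osc u ?J F (\<lambda>x. l * P x) \<eta>) \<le> K * (1 + \<bar>l\<bar>) powr - \<epsilon>"
        using bspec[OF K(2)[THEN spec, THEN spec] P, THEN mp, OF F1, THEN mp, OF rel[OF P rc, of l]] .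
      have \<eta>m: "borel_fun \<eta>" by (rule bdd_suppD(1)[OF amp_bdd_supp[OF amp]])
      have "integrable lebesgue (Lambda_integrand n V P \<eta> l f)"
        by (rule Lambda_eq_osc(2)[where F = F and a = a, OF u _ _ P \<eta>m]) (use F o in auto)
      moreover have "norm (Lambda n V P \<eta> l f) \<le> K * (1 + \<bar>l\<bar>) powr (- \<epsilon>) * (\<Prod>j=1..n. L2_norm_on (V j) (f j))"
      proof -
        have "Lambda n V P \<eta> l f = (\<Prod>j=1..n. complex_of_real (a j)) * osc u ?J F (\<lambda>x. l * P x) \<eta>"
          by (rule Lambda_eq_osc(1)[OF u _ _ P \<eta>m]) (use F in auto)
        then have "norm (Lambda n V P \<eta> l f) = (\<Prod>j=1..n. a j) * norm (osc u ?J F (\<lambda>x. l * P x) \<eta>)"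
          by (simp only: norm_mult np)
        also have "\<dots> \<le> (\<Prod>j=1..n. a j) * (K * (1 + \<bar>l\<bar>) powr - \<epsilon>)"
          using a0 o by (intro mult_left_mono prod_nonneg) auto
        finally show ?thesis by (simp add: a_def mult_ac)
      qed
      ultimately show "integrable lebesgue (Lambda_integrand n V P \<eta> l f) \<and>
        norm (Lambda n V P \<eta> l f) \<le> K * (1 + \<bar>l\<bar>) powr (- \<epsilon>) * (\<Prod>j=1..n. L2_norm_on (V j) (f j))" by blast
    qed
  qed
  show ?thesis
  proof (rule conjI)
    show "uniform_power_decay nrm n V" unfolding uniform_power_decay_def
    proof (intro allI impI, elim conjE)
      fix d and c :: real and K :: "(real ^ 'm) set"
      assume "0 < c" "compact K"
      then show "\<exists>\<epsilon>>0. \<exists>C. \<forall>l f \<eta> P.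
          (\<forall>j\<in>{1..n}. f j \<in> Linf_on (V j)) \<and> is_C1 \<eta> \<and> supp \<eta> \<subseteq> K \<and>
          P \<in> polys_le d \<and> c \<le> relative_norm nrm d n V P \<longrightarrow>
          norm (Lambda n V P \<eta> l f)
            \<le> C * C1_norm \<eta> * (1 + \<bar>l\<bar>) powr (- \<epsilon>) * (\<Prod>j=1..n. Linf_norm (V j) (f j))"
        by (rule unif)
    qed
  qed (intro allI impI, elim conjE, rule L2)
qed

end
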